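(* Let $d\ge 3$, let $b\in\mathbf F_{\delta,g}$ and let $\{b_n\}\in[b]^r$. Assume that $q>d$ and $\delta>0$ satisfy the following constraints: - if $d\in\{3,4\}$: $q=d+\varepsilon$ with $0<\varepsilon\le 2(\sqrt2-1)$ and $$\sqrt{\delta}<\Big(\sqrt{q-1}-\frac{q-2}{2}\Big)\frac{2}{q};$$ - if $d\ge 5$: $q=d+\varepsilon$ with $0<\varepsilon\le 1$ and $$\sqrt{\delta}<(1-\mu)\,\frac{q-1}{q-2}\,\frac1q$$ for some $0<\mu<1$ satisfying $16\mu>(1-\mu)^4\frac{(q-1)^2}{(q-2)^4}$. For every $n=1,2,\dots$ let $U_n^{t,s}\in\mathcal B(C_\infty)$, $0\le s\le t<\infty$, be the operators determined by $U_n^{t,s}f:=u_n(t)$, where $u_n$ is the classical solution to the Cauchy problem $$(\partial_\tau-\Delta+b_n\cdot\nabla_x)u_n(\tau)=0,\quad s<\tau<\infty,\ x\in\mathbb R^d,\qquad u_n(s)=f.$$ Then the limit $$U^{t,s}:=s\text{-}C_\infty(\mathbb R^d)\text{-}\lim_nU_n^{t,s}\qquad(\text{uniformly in }0\le s<t\le1)$$ exists and determines a Feller evolution family on $\{(t,s)\in\mathbb R_+^2\mid 0\le t-s<\infty\}\times C_\infty(\mathbb R^d)$.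
   Context: Throughout $d\ge3$. $\|\cdot\|_p$ is the norm of $L^p(\mathbb R^d)$ in the spatial variable; $\nabla=\nabla_x$ and $\Delta=\Delta_x$ act in the spatial variable; $\mathcal S(\mathbb R^{1+d})$ is the Schwartz space. $C_\infty=C_\infty(\mathbb R^d)$ is the space of continuous functions on $\mathbb R^d$ vanishing at infinity, with the sup-norm; $\mathcal B(C_\infty)$ is the space of bounded linear operators on it. $T=s\text{-}C_\infty\text{-}\lim_nT_n$ means $\lim_n\|Tf-T_nf\|_{C_\infty}=0$ for every $f\in C_\infty$. Form-bounded vector fields. A Borel measurable vector field $b:\mathbb R^{1+d}\to\mathbb R^d$ belongs to $\mathbf F_{\delta,g}$ (is form-bounded with form-bound $\delta>0$) if $|b|\in L^2_{\rm loc}(\mathbb R^{1+d})$ and, for the function $0\le g=g_\delta\in L^1_{\rm loc}(\mathbb R)$, for all $t>0$ and all $f\in\mathcal S(\mathbb R^{1+d})$, $$\int_0^t\|b(\tau)f(\tau)\|_2^2\,d\tau\le\delta\int_0^t\|\nabla f(\tau)\|_2^2\,d\tau+\int_0^tg(\tau)\|f(\tau)\|_2^2\,d\tau.$$ Regularizing sequences. For $b\in\mathbf F_{\delta,g}$, $[b]^r$ is the collection of all sequences $\{b_n\}\subset[L^\infty(\mathbb R^{1+d})\cap C^\infty(\mathbb R^{1+d})]^d$ such that, for any $0<t<\infty$: (i) $\lim_{n}\|b_n-b\|_{L^2([0,t]\times K)}=0$ for every compact $K\subset\mathbb R^d$; (ii) there is a sequence of functions $0\le g_n\in L^1_{\rm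 loc}(\mathbb R)$ with $\sup_n\int_0^tg_n(\tau)\,d\tau=c_\delta(t)<\infty$; (iii) for all $n\ge1$ and $f\in\mathcal S(\mathbb R^{1+d})$, $\int_0^t\|b_n(\tau)f(\tau)\|_2^2\,d\tau\le\delta\int_0^t\|\nabla f(\tau)\|_2^2\,d\tau+\int_0^tg_n(\tau)\|f(\tau)\|_2^2\,d\tau$. "The classical solution" is understood as the bounded classical solution. The operators $U_n^{t,s}$ are defined by $U_n^{t,s}f=u_n(t)$ for $f\in C_c^1(\mathbb R^d)$ and extended to $C_\infty$ by continuity. A Feller evolution family is a family of operators $U^{t,s}\in\mathcal B(C_\infty)$, $0\le s\le t<\infty$, such that $U^{s,s}=\mathrm{Id}$ and $U^{t,s}=U^{t,r}U^{r,s}$ for $s\le r\le t$; $(t,s)\mapsto U^{t,s}f$ is continuous with values in $C_\infty$ for every $f\in C_\infty$; and each $U^{t,s}$ is positivity preserving ($f\ge0\Rightarrow U^{t,s}f\ge0$) and contractive ($\|U^{t,s}f\|_\infty\le\|f\|_\infty$). *)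

theory Defs
  imports "HOL-Analysis.Analysis"
begin

text \<open>Space is a Euclidean space \<open>'a\<close> with \<open>d = DIM('a)\<close>, and space-time is \<open>real \<times> 'a\<close>.
  Scalar functions are real-valued.\<close>

subsection \<open>The Banach space of continuous functions vanishing at infinity\<close>

typedef (overloaded) 'a C_infty =
  "{f :: 'a::euclidean_space \<Rightarrow>\<^sub>C real. (apply_bcontfun f \<longlongrightarrow> 0) at_infinity}"
  morphisms bcontfun_of Abs_C_infty
proof
  show "0 \<in> {f :: 'a \<Rightarrow>\<^sub>C real. (apply_bcontfun f \<longlongrightarrow> 0) at_infinity}"
    by (simp add: zero_bcontfun.rep_eq)
qed

definition ev :: "'a::euclidean_space C_infty \<Rightarrow> 'a \<Rightarrow> real"
  where "ev f = apply_bcontfun (bcontfun_of f)"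

lemma ev_tendsto_0: "(ev f \<longlongrightarrow> 0) at_infinity"
  using bcontfun_of[of f] by (simp add: ev_def)

lemma bcontfun_of_Abs:
  "(apply_bcontfun f \<longlongrightarrow> 0) at_infinity \<Longrightarrow> bcontfun_of (Abs_C_infty f) = f"
  by (rule Abs_C_infty_inverse) simp

instantiation C_infty :: (euclidean_space) real_vector
begin

definition "0 = Abs_C_infty 0"
definition "f + g = Abs_C_infty (bcontfun_of f + bcontfun_of g)"
definition "f - g = Abs_C_infty (bcontfun_of f - bcontfun_of g)"
definition "- f = Abs_C_infty (- bcontfun_of f)"
definition "c *\<^sub>R f = Abs_C_infty (c *\<^sub>R bcontfun_of f)"

lemma bcontfun_of_simps:
  fixes f g :: "'a C_infty"
  shows "bcontfun_of (0 :: 'a C_infty) = 0"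
    and "bcontfun_of (f + g) = bcontfun_of f + bcontfun_of g"
    and "bcontfun_of (f - g) = bcontfun_of f - bcontfun_of g"
    and "bcontfun_of (- f) = - bcontfun_of f"
    and "bcontfun_of (c *\<^sub>R f) = c *\<^sub>R bcontfun_of f"
proof -
  note lim = ev_tendsto_0[unfolded ev_def]
  show "bcontfun_of (0 :: 'a C_infty) = 0"
    unfolding zero_C_infty_def by (rule bcontfun_of_Abs) (simp add: zero_bcontfun.rep_eq)
  show "bcontfun_of (f + g) = bcontfun_of f + bcontfun_of g"
    unfolding plus_C_infty_def
    by (rule bcontfun_of_Abs) (use tendsto_add[OF lim[of f] lim[of g]] in \<open>simp add: plus_bcontfun.rep_eq\<close>)
  show "bcontfun_of (f - g) = bcontfun_of f - bcontfun_of g"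
    unfolding minus_C_infty_def
    by (rule bcontfun_of_Abs) (use tendsto_diff[OF lim[of f] lim[of g]] in \<open>simp add: minus_bcontfun.rep_eq\<close>)
  show "bcontfun_of (- f) = - bcontfun_of f"
    unfolding uminus_C_infty_def
    by (rule bcontfun_of_Abs) (use tendsto_minus[OF lim[of f]] in \<open>simp add: uminus_bcontfun.rep_eq\<close>)
  show "bcontfun_of (c *\<^sub>R f) = c *\<^sub>R bcontfun_of f"
    unfolding scaleR_C_infty_def
    by (rule bcontfun_of_Abs)
      (use tendsto_scaleR[OF tendsto_const[of c] lim[of f]] in \<open>simp add: scaleR_bcontfun.rep_eq\<close>)
qed

instance
  by standard
    (simp_all add: bcontfun_of_simps bcontfun_of_inject[symmetric] scaleR_add_left scaleR_add_right)

end

instantiation C_infty :: (euclidean_space) real_normed_vector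
begin

definition "norm f = norm (bcontfun_of f)" for f :: "'a C_infty"
definition "dist f g = dist (bcontfun_of f) (bcontfun_of g)" for f g :: "'a C_infty"
definition "sgn f = f /\<^sub>R norm f" for f :: "'a C_infty"
definition uniformity_C_infty :: "('a C_infty \<times> 'a C_infty) filter"
  where "uniformity_C_infty = (INF e\<in>{0 <..}. principal {(x, y). dist x y < e})"
definition open_C_infty :: "'a C_infty set \<Rightarrow> bool"
  where "open_C_infty S = (\<forall>x\<in>S. \<forall>\<^sub>F (x', y) in uniformity. x' = x \<longrightarrow> y \<in> S)"

instance
  by standard
    (simp_all add: bcontfun_of_simps bcontfun_of_inject[symmetric] norm_C_infty_def dist_C_infty_def
      sgn_C_infty_def uniformity_C_infty_def open_C_infty_def dist_norm norm_triangle_ineq)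

end

lemma ev_simps [simp]:
  "ev 0 x = 0" "ev (f + g) x = ev f x + ev g x" "ev (f - g) x = ev f x - ev g x"
  "ev (- f) x = - ev f x" "ev (c *\<^sub>R f) x = c * ev f x"
  by (simp_all add: ev_def bcontfun_of_simps zero_bcontfun.rep_eq plus_bcontfun.rep_eq
      minus_bcontfun.rep_eq uminus_bcontfun.rep_eq scaleR_bcontfun.rep_eq)

lemma norm_C_infty_eq_SUP: "norm f = (SUP x. \<bar>ev f x\<bar>)"
  by (simp add: norm_C_infty_def ev_def norm_bcontfun_def dist_bcontfun.rep_eq zero_bcontfun.rep_eq)

lemma ex_C_infty:
  assumes "continuous_on UNIV f" "(f \<longlongrightarrow> 0) at_infinity"
  shows "\<exists>F. ev F = f"
proof -
  obtain B where B: "\<And>x. B \<le> norm x \<Longrightarrow> norm (f x) < 1"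
    using tendstoD[OF assms(2), of 1] by (auto simp: eventually_at_infinity)
  have "bounded (f ` cball 0 B)"
    by (intro compact_imp_bounded compact_continuous_image continuous_on_subset[OF assms(1)]) auto
  then obtain C where C: "\<And>x. x \<in> cball 0 B \<Longrightarrow> norm (f x) \<le> C"
    unfolding bounded_iff by blast
  have "norm (f x) \<le> max C 1" for x
    using B[of x] C[of x] by (cases "norm x \<le> B") (auto simp: le_max_iff_disj)
  then have "f \<in> bcontfun"
    using bcontfun_normI[OF assms(1)] by blast
  then obtain h where "f = apply_bcontfun h"
    by (rule bcontfunE)
  then show ?thesis
    using assms(2) by (auto simp: ev_def bcontfun_of_Abs intro!: exI[of _ "Abs_C_infty h"])
qed


subsection \<open>Derivatives, smooth functions, Schwartz functions\<close>

text \<open>\<open>dderiv v f\<close> is the derivative of \<open>f\<close> in direction \<open>v\<close>; it is used only where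
  differentiability of \<open>f\<close> is required separately.\<close>

definition dderiv ::
    "'a::real_normed_vector \<Rightarrow> ('a \<Rightarrow> 'b::real_normed_vector) \<Rightarrow> 'a \<Rightarrow> 'b"
  where "dderiv v f x = frechet_derivative f (at x) v"

definition gradient :: "('a::euclidean_space \<Rightarrow> real) \<Rightarrow> 'a \<Rightarrow> 'a"
  where "gradient f x = (\<Sum>i\<in>Basis. dderiv i f x *\<^sub>R i)"

definition laplacian :: "('a::euclidean_space \<Rightarrow> real) \<Rightarrow> 'a \<Rightarrow> real"
  where "laplacian f x = (\<Sum>i\<in>Basis. dderiv i (dderiv i f) x)"

text \<open>\<open>foldr dderiv vs f\<close> is an iterated partial derivative. If all of them are differentiable,
  they are all continuous, so this is the class of infinitely differentiable functions.\<close>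

definition smooth :: "('a::euclidean_space \<Rightarrow> 'b::real_normed_vector) \<Rightarrow> bool"
  where "smooth f \<longleftrightarrow> (\<forall>vs. set vs \<subseteq> Basis \<longrightarrow> (\<forall>x. foldr dderiv vs f differentiable (at x)))"

definition schwartz_space :: "('a::euclidean_space \<Rightarrow> real) set"
  where "schwartz_space = {f. smooth f \<and>
    (\<forall>(k::nat) vs. set vs \<subseteq> Basis \<longrightarrow> bounded (range (\<lambda>z. norm z ^ k * foldr dderiv vs f z)))}"

definition C1_compact_support :: "('a::euclidean_space \<Rightarrow> real) \<Rightarrow> bool"
  where "C1_compact_support f \<longleftrightarrow> (\<forall>x. f differentiable (at x)) \<and>
    (\<forall>i\<in>Basis. continuous_on UNIV (dderiv i f)) \<and> compact (closure {x. f x \<noteq> 0})"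


subsection \<open>Form-bounded vector fields and their regularizations\<close>

definition locally_integrable :: "('a::euclidean_space \<Rightarrow> real) \<Rightarrow> bool"
  where "locally_integrable g \<longleftrightarrow> (\<forall>K. compact K \<longrightarrow> set_integrable lborel K g)"

text \<open>The square of the \<open>L\<^sup>2\<close> norm, possibly infinite.\<close>

definition L2_norm_sq :: "('a::euclidean_space \<Rightarrow> 'b::real_normed_vector) \<Rightarrow> ennreal"
  where "L2_norm_sq h = (\<integral>\<^sup>+x. ennreal ((norm (h x))\<^sup>2) \<partial>lborel)"

definition form_inequality ::
    "real \<Rightarrow> (real \<times> 'a::euclidean_space \<Rightarrow> 'a) \<Rightarrow> real \<Rightarrow> (real \<Rightarrow> real) \<Rightarrow> bool"
  where "form_inequality t b \<delta> g \<longleftrightarrow> (\<forall>f\<in>schwartz_space.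
    (\<integral>\<^sup>+\<tau>\<in>{0..t}. L2_norm_sq (\<lambda>x. f (\<tau>, x) *\<^sub>R b (\<tau>, x)) \<partial>lborel)
    \<le> ennreal \<delta> * (\<integral>\<^sup>+\<tau>\<in>{0..t}. L2_norm_sq (gradient (\<lambda>x. f (\<tau>, x))) \<partial>lborel)
      + (\<integral>\<^sup>+\<tau>\<in>{0..t}. ennreal (g \<tau>) * L2_norm_sq (\<lambda>x. f (\<tau>, x)) \<partial>lborel))"

definition form_bounded ::
    "real \<Rightarrow> (real \<Rightarrow> real) \<Rightarrow> (real \<times> 'a::euclidean_space \<Rightarrow> 'a) set"
  where "form_bounded \<delta> g = {b. b \<in> borel_measurable borel \<and>
    locally_integrable (\<lambda>z. (norm (b z))\<^sup>2) \<and>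
    locally_integrable g \<and> (\<forall>\<tau>. 0 \<le> g \<tau>) \<and>
    (\<forall>t>0. form_inequality t b \<delta> g)}"

text \<open>The functions \<open>gn\<close> may depend on the time horizon \<open>t\<close>. This is no loss: the form inequality is
  local in time, so bounds for different horizons can be glued. For the continuous functions
  \<open>bn n\<close>, membership in \<open>L\<^sup>\<infinity>\<close> is boundedness.\<close>

definition regularizing_sequences ::
    "real \<Rightarrow> (real \<times> 'a::euclidean_space \<Rightarrow> 'a) \<Rightarrow> (nat \<Rightarrow> real \<times> 'a \<Rightarrow> 'a) set"
  where "regularizing_sequences \<delta> b = {bn.
    (\<forall>n. smooth (bn n) \<and> bounded (range (bn n))) \<and>
    (\<forall>t>0.
      (\<forall>K. compact K \<longrightarrow>
        (\<lambda>n. \<integral>\<^sup>+z\<in>{0..t} \<times> K. ennreal ((norm (bn n z - b z))\<^sup>2) \<partial>lborel) \<longlonglongrightarrow> 0) \<and>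
      (\<exists>gn :: nat \<Rightarrow> real \<Rightarrow> real.
        (\<forall>n. locally_integrable (gn n) \<and> (\<forall>\<tau>. 0 \<le> gn n \<tau>)) \<and>
        (SUP n. \<integral>\<^sup>+\<tau>\<in>{0..t}. ennreal (gn n \<tau>) \<partial>lborel) < \<infinity> \<and>
        (\<forall>n. form_inequality t (bn n) \<delta> (gn n))))}"


subsection \<open>The Cauchy problem and its solution operators\<close>

text \<open>Bounded solutions of \<open>(\<partial>\<^sub>\<tau> - \<Delta> + b \<cdot> \<nabla>) u = 0\<close> for \<open>\<tau> > s\<close> with \<open>u(s) = f\<close> that are continuous up
  to the initial time and once in time, twice in space continuously differentiable after it.\<close>

definition classical_solution ::
    "(real \<times> 'a::euclidean_space \<Rightarrow> 'a) \<Rightarrow> real \<Rightarrow> ('a \<Rightarrow> real) \<Rightarrow> (real \<Rightarrow> 'a \<Rightarrow> real) \<Rightarrow> bool"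
  where "classical_solution b s f u \<longleftrightarrow>
    bounded ((\<lambda>(\<tau>, x). u \<tau> x) ` ({s..} \<times> UNIV)) \<and>
    continuous_on ({s..} \<times> UNIV) (\<lambda>(\<tau>, x). u \<tau> x) \<and>
    (\<forall>\<tau>>s. \<forall>x.
      (\<lambda>r. u r x) differentiable (at \<tau>) \<and>
      u \<tau> differentiable (at x) \<and>
      (\<forall>i\<in>Basis. dderiv i (u \<tau>) differentiable (at x))) \<and>
    continuous_on ({s<..} \<times> UNIV) (\<lambda>(\<tau>, x). deriv (\<lambda>r. u r x) \<tau>) \<and>
    (\<forall>i\<in>Basis. continuous_on ({s<..} \<times> UNIV) (\<lambda>(\<tau>, x). dderiv i (u \<tau>) x)) \<and>
    (\<forall>i\<in>Basis. \<forall>j\<in>Basis.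
      continuous_on ({s<..} \<times> UNIV) (\<lambda>(\<tau>, x). dderiv j (dderiv i (u \<tau>)) x)) \<and>
    (\<forall>\<tau>>s. \<forall>x. deriv (\<lambda>r. u r x) \<tau> - laplacian (u \<tau>) x + b (\<tau>, x) \<bullet> gradient (u \<tau>) x = 0) \<and>
    (\<forall>x. u s x = f x)"

text \<open>\<open>U t s\<close> stands for \<open>U\<^sup>t\<^sup>,\<^sup>s\<close>. Only the values at \<open>0 \<le> s \<le> t\<close> are meaningful. Since
  \<open>U t s\<close> is a bounded operator, prescribing it on \<open>C\<^sub>c\<^sup>1\<close>, which is dense, determines it.\<close>

definition solution_operators ::
    "(real \<times> 'a::euclidean_space \<Rightarrow> 'a) \<Rightarrow> (real \<Rightarrow> real \<Rightarrow> 'a C_infty \<Rightarrow>\<^sub>L 'a C_infty) \<Rightarrow> bool"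
  where "solution_operators b U \<longleftrightarrow> (\<forall>s\<ge>0. \<forall>f. C1_compact_support (ev f) \<longrightarrow>
    (\<exists>u. classical_solution b s (ev f) u \<and>
      (\<forall>t\<ge>s. ev (blinfun_apply (U t s) f) = u t)))"

definition feller_evolution_family ::
    "(real \<Rightarrow> real \<Rightarrow> 'a::euclidean_space C_infty \<Rightarrow>\<^sub>L 'a C_infty) \<Rightarrow> bool"
  where "feller_evolution_family U \<longleftrightarrow>
    (\<forall>s\<ge>0. U s s = id_blinfun) \<and>
    (\<forall>s r t. 0 \<le> s \<and> s \<le> r \<and> r \<le> t \<longrightarrow> U t s = U t r o\<^sub>L U r s) \<and>
    (\<forall>f. continuous_on {(t, s). 0 \<le> s \<and> s \<le> t} (\<lambda>(t, s). blinfun_apply (U t s) f)) \<and>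
    (\<forall>s t. 0 \<le> s \<and> s \<le> t \<longrightarrow>
      (\<forall>f. (\<forall>x. 0 \<le> ev f x) \<longrightarrow> (\<forall>x. 0 \<le> ev (blinfun_apply (U t s) f) x)) \<and>
      (\<forall>f. norm (blinfun_apply (U t s) f) \<le> norm f))"

end

theory Submission
  imports Defs
begin

text \<open>Both constraints on \<open>\<delta>\<close> imply \<open>\<surd>\<delta> q / 2 < 1\<close>, and \<open>q > d\<close>. Let \<open>u\<close> solve the equation with drift \<open>b\<^sub>n\<close>
  and initial datum in \<open>C\<^sub>c\<^sup>1\<close>, and let \<open>\<zeta>\<close> be a weight of compact support with \<open>|\<nabla>\<zeta>|\<close> dominated by \<open>\<zeta>\<close> up to
  an exponentially small error. Testing the differentiated equation with \<open>\<zeta>\<^sup>2 (1 + |\<nabla>u|\<^sup>2)\<^bsup>q/2-1\<^esup> \<nabla>u\<close> and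
  applying the form inequality to \<open>\<zeta> (1 + |\<nabla>u|\<^sup>2)\<^bsup>q/4\<^esup>\<close> bounds the integral of \<open>\<zeta>\<^sup>2 (1 + |\<nabla>u|\<^sup>2)\<^bsup>q/2\<^esup>\<close>
  uniformly in \<open>n\<close>, in the initial time and in the centre of \<open>\<zeta>\<close>; near the initial time a doubling of
  variables bounds \<open>\<nabla>u\<close> by a multiple of the Lipschitz constant of the datum. As \<open>q > d\<close>, Morrey's
  inequality reduces uniform smallness to smallness in the weighted \<open>L\<^sup>2\<close> norm. The \<open>L\<^sup>2\<close> energy inequality
  gives the decay of \<open>u\<close> at infinity, and, applied to \<open>u\<^sub>n - u\<^sub>m\<close>, whose equation has the source
  \<open>- (b\<^sub>n - b\<^sub>m) \<bullet> \<nabla>u\<^sub>m\<close>, the Cauchy property uniformly in time. By the maximum principle the operators are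
  positive contractions, so density of \<open>C\<^sub>c\<^sup>1\<close> extends the convergence to \<open>C\<^sub>\<infinity>\<close>, and the properties of a
  Feller evolution family pass to the limit.\<close>

subsection \<open>Integration by parts\<close>

text \<open>Two obstacles shape the proof. A classical solution has two derivatives in space and one
  in time, so neither the differentiated equation nor a time derivative of the gradient need exist.
  The equation itself is therefore tested, with the divergence \<open>V\<close> of the vector field
  \<zeta>^2 (1 + |\<nabla>u|^2)^(q/2-1) \<nabla>u; \<open>LINT_gradient_swap\<close> exchanges
  derivatives under the integral, and convexity of the power function supplies the time derivative
  of the weighted gradient integral. The second obstacle is that pointwise bounds of \<nabla>u_n
  depend on sup |b_n|, over which there is no control. They enter through the error of the truncated
  weight only, always with a factor exp (- 2 R). The weighted integrals increase with R, so R may be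
  taken as large as each single n demands, and the factor removes the dependence. For the same
  reason the gradient estimate starts at a time after s that depends on n and is so close to s that
  |\<nabla>u_n| is still at most 4 L. Beyond that only the integrals of the functions g_n matter:
  they bound the number of doublings in \<open>gronwall_doubling\<close>.\<close>

lemma integrable_bounded_support:
  fixes f :: "'a::euclidean_space \<Rightarrow> 'b::{banach, second_countable_topology}"
  assumes "continuous_on UNIV f" and "\<And>x. R < norm x \<Longrightarrow> f x = 0"
  shows "integrable lborel f"
proof -
  have "integrable lborel (\<lambda>x. indicator (cball 0 R) x *\<^sub>R f x)"
    by (rule borel_integrable_compact) (auto intro: continuous_on_subset[OF assms(1)])
  also have "(\<lambda>x. indicator (cball 0 R) x *\<^sub>R f x) = f"
    using assms(2) by (force simp: indicator_def)
  finally show ?thesis .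
qed

lemma LINT_eq_integral_cbox:
  fixes f :: "'a::euclidean_space \<Rightarrow> real"
  assumes "continuous_on UNIV f" and "\<And>x. x \<notin> cbox a b \<Longrightarrow> f x = 0"
  shows "(LINT x|lborel. f x) = integral (cbox a b) f"
proof -
  have "set_integrable lborel (cbox a b) f"
    unfolding set_integrable_def
    by (rule borel_integrable_compact) (auto intro: continuous_on_subset[OF assms(1)])
  then have "(LINT x:cbox a b|lborel. f x) = integral (cbox a b) f"
    by (rule set_borel_integral_eq_integral)
  moreover have "(LINT x:cbox a b|lborel. f x) = (LINT x|lborel. f x)"
    unfolding set_lebesgue_integral_def
    by (rule Bochner_Integration.integral_cong) (use assms(2) in \<open>auto simp: indicator_def\<close>)
  ultimately show ?thesis by simp
qed

lemma ball_subset_cbox: "\<exists>a b. cball (0::'a::euclidean_space) R \<subseteq> cbox a b"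
  using bounded_subset_cbox_symmetric[OF bounded_cball[of "0::'a" R]] by blast

lemma continuous_on_LINT:
  fixes f :: "'p::topological_space \<Rightarrow> 'a::euclidean_space \<Rightarrow> real"
  assumes "continuous_on (U \<times> UNIV) (\<lambda>(p, x). f p x)"
    and z: "\<And>p x. p \<in> U \<Longrightarrow> R < norm x \<Longrightarrow> f p x = 0"
  shows "continuous_on U (\<lambda>p. LINT x|lborel. f p x)"
proof -
  obtain a b :: 'a where ab: "cball 0 R \<subseteq> cbox a b"
    using ball_subset_cbox by blast
  have *: "(LINT x|lborel. f p x) = integral (cbox a b) (f p)" if "p \<in> U" for p
  proof (rule LINT_eq_integral_cbox)
    have "continuous_on UNIV (\<lambda>x. (\<lambda>(p, x). f p x) (p, x))"
      by (rule continuous_on_compose2[OF assms(1)]) (use that in \<open>auto intro!: continuous_intros\<close>)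
    then show "continuous_on UNIV (f p)" by simp
    show "f p x = 0" if "x \<notin> cbox a b" for x
      using ab z[OF \<open>p \<in> U\<close>, of x] that by force
  qed
  have "continuous_on U (\<lambda>p. integral (cbox a b) (f p))"
    by (rule integral_continuous_on_param) (auto intro: continuous_on_subset[OF assms(1)])
  then show ?thesis
    by (rule continuous_on_eq) (simp add: *)
qed

lemma has_derivative_along_line:
  fixes f :: "'a::real_inner \<Rightarrow> real"
  assumes "\<And>x. (f has_derivative (\<lambda>v. G x \<bullet> v)) (at x)"
  shows "((\<lambda>t. f (x + t *\<^sub>R v)) has_real_derivative G (x + t *\<^sub>R v) \<bullet> v) (at t)"
proof -
  have "((\<lambda>t. x + t *\<^sub>R v) has_derivative (\<lambda>h. h *\<^sub>R v)) (at t)"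
    by (auto intro!: derivative_eq_intros)
  from has_derivative_compose[OF this assms] show ?thesis
    by (simp add: has_field_derivative_def mult.commute[of "G _ \<bullet> _"] mult_commute_abs)
qed

lemma difference_along_line:
  fixes f :: "'a::real_inner \<Rightarrow> real"
  assumes "\<And>x. (f has_derivative (\<lambda>v. G x \<bullet> v)) (at x)"
  shows "\<exists>t. 0 \<le> t \<and> t \<le> 1 \<and> f (x + v) - f x = G (x + t *\<^sub>R v) \<bullet> v"
proof -
  have "\<exists>z::real. 0 < z \<and> z < 1 \<and> f (x + 1 *\<^sub>R v) - f (x + 0 *\<^sub>R v) = (1 - 0) * (G (x + z *\<^sub>R v) \<bullet> v)"
    by (rule MVT2) (auto intro: has_derivative_along_line[OF assms])
  then obtain z where "0 < z" "z < 1" "f (x + v) - f x = G (x + z *\<^sub>R v) \<bullet> v" by auto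
  then show ?thesis by (auto intro!: exI[of _ z])
qed

text \<open>The support condition is on the product, since either factor may be the one of compact support.\<close>

lemma tendsto_LINT_difference_quotient:
  fixes k p :: "'a::euclidean_space \<Rightarrow> real" and h :: "nat \<Rightarrow> real"
  assumes k: "continuous_on UNIV k"
    and p: "\<And>x. (p has_derivative (\<lambda>v. P x \<bullet> v)) (at x)"
    and P: "continuous_on UNIV P"
    and z: "\<And>x h. R < norm x \<Longrightarrow> \<bar>h\<bar> \<le> 1 \<Longrightarrow> k x * (p (x + h *\<^sub>R v) - p x) = 0"
    and h: "h \<longlonglongrightarrow> 0" "\<And>n. h n \<noteq> 0" "\<And>n. \<bar>h n\<bar> \<le> 1"
  shows "(\<lambda>n. LINT x|lborel. k x * ((p (x + h n *\<^sub>R v) - p x) / h n)) \<longlonglongrightarrow> (LINT x|lborel. k x * (P x \<bullet> v))"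
proof -
  have pc: "continuous_on UNIV p"
    using p by (meson differentiable_def differentiable_imp_continuous_on differentiable_on_def
        differentiable_at_withinI)
  have "bounded (k ` cball 0 R)"
    by (intro compact_imp_bounded compact_continuous_image continuous_on_subset[OF k]) auto
  then obtain A where A: "\<And>x. norm x \<le> R \<Longrightarrow> \<bar>k x\<bar> \<le> A" "A > 0"
    unfolding bounded_pos by force
  have "bounded ((\<lambda>x. P x \<bullet> v) ` cball 0 (R + norm v))"
    by (intro compact_imp_bounded compact_continuous_image continuous_intros
        continuous_on_subset[OF P]) auto
  then obtain B where B: "\<And>x. norm x \<le> R + norm v \<Longrightarrow> \<bar>P x \<bullet> v\<bar> \<le> B" "B > 0"
    unfolding bounded_pos by force
  show ?thesis
  proof (rule integral_dominated_convergence[where w = "\<lambda>x. (A * B) * indicator (cball 0 R) x"])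
    show "(\<lambda>x. k x * (P x \<bullet> v)) \<in> borel_measurable lborel"
      by simp (intro borel_measurable_continuous_onI continuous_intros k P)
    show "(\<lambda>x. k x * ((p (x + h n *\<^sub>R v) - p x) / h n)) \<in> borel_measurable lborel" for n
      by simp (intro borel_measurable_continuous_onI continuous_intros k
          continuous_on_compose2[OF pc], use h(2) in auto)
    show "integrable lborel (\<lambda>x. (A * B) * indicator (cball (0::'a) R) x)"
      by (intro integrable_mult_right) (use emeasure_bounded_finite[OF bounded_cball[of "0::'a" R]] in \<open>simp add: integrable_indicator_iff\<close>)
    show "AE x in lborel. (\<lambda>n. k x * ((p (x + h n *\<^sub>R v) - p x) / h n)) \<longlonglongrightarrow> k x * (P x \<bullet> v)"
    proof (rule AE_I2, rule tendsto_mult[OF tendsto_const])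
      fix x
      have "((\<lambda>t. p (x + t *\<^sub>R v)) has_real_derivative P (x + 0 *\<^sub>R v) \<bullet> v) (at 0)"
        by (rule has_derivative_along_line[OF p])
      then have "((\<lambda>t. (p (x + t *\<^sub>R v) - p x) / t) \<longlongrightarrow> P x \<bullet> v) (at 0)"
        by (simp add: has_field_derivative_iff)
      moreover have "filterlim h (at 0) sequentially"
        using h by (auto simp: filterlim_at)
      ultimately show "(\<lambda>n. (p (x + h n *\<^sub>R v) - p x) / h n) \<longlonglongrightarrow> P x \<bullet> v"
        by (rule filterlim_compose)
    qed
    show "AE x in lborel. norm (k x * ((p (x + h n *\<^sub>R v) - p x) / h n)) \<le> (A * B) * indicator (cball 0 R) x" for n
    proof (rule AE_I2)
      fix x
      show "norm (k x * ((p (x + h n *\<^sub>R v) - p x) / h n)) \<le> (A * B) * indicator (cball 0 R) x"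
      proof (cases "norm x \<le> R")
        case True
        obtain t where t: "0 \<le> t" "t \<le> 1" "p (x + h n *\<^sub>R v) - p x = P (x + t *\<^sub>R (h n *\<^sub>R v)) \<bullet> (h n *\<^sub>R v)"
          using difference_along_line[OF p] by blast
        have "norm (x + t *\<^sub>R (h n *\<^sub>R v)) \<le> R + norm v"
        proof -
          have "norm (t *\<^sub>R (h n *\<^sub>R v)) = (t * \<bar>h n\<bar>) * norm v" using t by (simp add: abs_mult)
          also have "\<dots> \<le> 1 * norm v"
            using t h(3)[of n] by (intro mult_right_mono mult_le_one) auto
          finally show ?thesis using True norm_triangle_ineq[of x "t *\<^sub>R (h n *\<^sub>R v)"] by simp
        qed
        then have "\<bar>(p (x + h n *\<^sub>R v) - p x) / h n\<bar> \<le> B"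
          using B(1) t h(2)[of n] by simp
        then have "\<bar>k x\<bar> * \<bar>(p (x + h n *\<^sub>R v) - p x) / h n\<bar> \<le> A * B"
          using A True by (intro mult_mono) auto
        then show ?thesis using True by (simp add: abs_mult)
      next
        case False
        then show ?thesis using z[of x "h n"] h(3)[of n] by auto
      qed
    qed
  qed
qed

lemma zero_gradient_outside_support:
  fixes f :: "'a::euclidean_space \<Rightarrow> real"
  assumes f: "(f has_derivative (\<lambda>v. G \<bullet> v)) (at x)"
    and z: "\<And>x. R < norm x \<Longrightarrow> f x = 0" and x: "R < norm x"
  shows "G = 0"
proof -
  have "((\<lambda>x. 0) has_derivative (\<lambda>v. G \<bullet> v)) (at x)"
  proof (rule has_derivative_transform_within_open[OF f])
    show "open {x::'a. R < norm x}" by (intro open_Collect_less continuous_intros)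
  qed (use z x in auto)
  then have "(\<lambda>v. G \<bullet> v) = (\<lambda>v. 0)"
    using has_derivative_unique has_derivative_const by blast
  then have "G \<bullet> G = 0" by meson
  then show ?thesis by simp
qed

lemma has_derivative_continuous_on_UNIV:
  assumes "\<And>x. (f has_derivative f' x) (at x)"
  shows "continuous_on UNIV f"
  using assms by (meson continuous_at_imp_continuous_on has_derivative_continuous)

lemma LINT_translate:
  fixes f :: "'a::euclidean_space \<Rightarrow> real"
  assumes "f \<in> borel_measurable borel"
  shows "(LINT x|lborel. f (x + c)) = (LINT x|lborel. f x)"
  using assms by (subst (2) lborel_distr_plus[of c, symmetric]) (simp add: integral_distr add.commute)

text \<open>Translation invariance makes every difference quotient of \<open>f\<close> integrate to
  zero, and the quotients converge under the integral to the directional derivative.\<close>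

lemma LINT_gradient_zero:
  fixes f :: "'a::euclidean_space \<Rightarrow> real"
  assumes f: "\<And>x. (f has_derivative (\<lambda>v. G x \<bullet> v)) (at x)" and G: "continuous_on UNIV G"
    and z: "\<And>x. R < norm x \<Longrightarrow> f x = 0"
  shows "(LINT x|lborel. G x \<bullet> v) = 0"
proof -
  define h where "h n = 1 / real (Suc n)" for n
  have fc: "continuous_on UNIV f" by (rule has_derivative_continuous_on_UNIV[OF f])
  have i1: "integrable lborel f" by (rule integrable_bounded_support[OF fc z])
  have i2: "integrable lborel (\<lambda>x. f (x + w))" for w
  proof (rule integrable_bounded_support)
    show "continuous_on UNIV (\<lambda>x. f (x + w))"
      by (intro continuous_on_compose2[OF fc] continuous_intros) auto
    show "f (x + w) = 0" if "R + norm w < norm x" for x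
      using z[of "x + w"] that norm_diff_ineq[of x w] by auto
  qed
  \<comment> \<open>The steps are at most 1, so a translate has its support in a ball larger by
    \<open>norm v\<close>; the absolute value covers a negative \<open>R\<close>.\<close>
  have "(\<lambda>n. LINT x|lborel. 1 * ((f (x + h n *\<^sub>R v) - f x) / h n)) \<longlonglongrightarrow> (LINT x|lborel. 1 * (G x \<bullet> v))"
  proof (rule tendsto_LINT_difference_quotient[OF _ f G, where R = "\<bar>R\<bar> + norm v"])
    fix x :: 'a and t :: real assume *: "\<bar>R\<bar> + norm v < norm x" "\<bar>t\<bar> \<le> 1"
    have "norm (t *\<^sub>R v) \<le> norm v" using * by (simp add: mult_left_le_one_le)
    then have "R < norm (x + t *\<^sub>R v)" using * norm_diff_ineq[of x "t *\<^sub>R v"] by linarith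
    moreover have "R < norm x" using * norm_ge_zero[of v] by linarith
    ultimately show "1 * (f (x + t *\<^sub>R v) - f x) = 0"
      by (simp add: z)
  next
    show "h \<longlonglongrightarrow> 0" unfolding h_def by (rule LIMSEQ_Suc[OF lim_1_over_n])
  qed (auto simp: h_def)
  moreover have "(LINT x|lborel. 1 * ((f (x + h n *\<^sub>R v) - f x) / h n)) = 0" for n
  proof -
    have "f \<in> borel_measurable borel" by (rule borel_measurable_continuous_onI[OF fc])
    from LINT_translate[OF this] have "(LINT x|lborel. f (x + h n *\<^sub>R v)) = (LINT x|lborel. f x)" .
    then show ?thesis using i1 i2 by simp
  qed
  ultimately have "(\<lambda>n. 0) \<longlonglongrightarrow> (LINT x|lborel. G x \<bullet> v)" by (simp only: mult_1)
  then show ?thesis using LIMSEQ_unique tendsto_const by blast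
qed

text \<open>Compact support of \<open>f\<close> is inherited by the product of \<open>f\<close> and
  \<open>g\<close>, whose gradient has integral zero by \<open>LINT_gradient_zero\<close>;
  \<open>g\<close> is unrestricted at infinity.\<close>

lemma LINT_by_parts:
  fixes f g :: "'a::euclidean_space \<Rightarrow> real"
  assumes f: "\<And>x. (f has_derivative (\<lambda>v. F x \<bullet> v)) (at x)" and F: "continuous_on UNIV F"
    and g: "\<And>x. (g has_derivative (\<lambda>v. G x \<bullet> v)) (at x)" and G: "continuous_on UNIV G"
    and z: "\<And>x. R < norm x \<Longrightarrow> f x = 0"
  shows "(LINT x|lborel. f x * (G x \<bullet> v)) = - (LINT x|lborel. g x * (F x \<bullet> v))"
proof -
  have fc: "continuous_on UNIV f" and gc: "continuous_on UNIV g"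
    by (rule has_derivative_continuous_on_UNIV[OF f] has_derivative_continuous_on_UNIV[OF g])+
  have "(LINT x|lborel. (f x *\<^sub>R G x + g x *\<^sub>R F x) \<bullet> v) = 0"
  proof (rule LINT_gradient_zero)
    show "((\<lambda>x. f x * g x) has_derivative (\<lambda>v. (f x *\<^sub>R G x + g x *\<^sub>R F x) \<bullet> v)) (at x)" for x
      by (auto intro!: derivative_eq_intros f g simp: inner_simps algebra_simps)
  qed (use z in \<open>auto intro!: continuous_intros fc gc F G\<close>)
  moreover have "integrable lborel (\<lambda>x. f x * (G x \<bullet> v))"
    by (rule integrable_bounded_support) (use z in \<open>auto intro!: continuous_intros fc G\<close>)
  moreover have "integrable lborel (\<lambda>x. g x * (F x \<bullet> v))"
  proof (rule integrable_bounded_support)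
    show "g x * (F x \<bullet> v) = 0" if "R < norm x" for x
      using zero_gradient_outside_support[OF f z that] by simp
  qed (intro continuous_intros gc F)
  ultimately show ?thesis
    by (simp add: inner_simps)
qed

text \<open>For twice differentiable \<open>c\<close> this is integration by parts; difference quotients of \<open>c\<close> reduce
  the general case to it.\<close>

lemma LINT_gradient_swap:
  fixes a c :: "'a::euclidean_space \<Rightarrow> real"
  assumes a: "\<And>x. (a has_derivative (\<lambda>v. A x \<bullet> v)) (at x)" and A: "continuous_on UNIV A"
    and c: "\<And>x. (c has_derivative (\<lambda>v. C x \<bullet> v)) (at x)" and C: "continuous_on UNIV C"
    and z: "\<And>x. R < norm x \<Longrightarrow> a x = 0"
  shows "(LINT x|lborel. (A x \<bullet> v) * (C x \<bullet> w)) = (LINT x|lborel. (A x \<bullet> w) * (C x \<bullet> v))"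
proof -
  define h where "h n = 1 / real (Suc n)" for n
  have h: "h \<longlonglongrightarrow> 0" unfolding h_def by (rule LIMSEQ_Suc[OF lim_1_over_n])
  have ac: "continuous_on UNIV a" and cc: "continuous_on UNIV c"
    by (rule has_derivative_continuous_on_UNIV[OF a] has_derivative_continuous_on_UNIV[OF c])+
  have Az: "R < norm x \<Longrightarrow> A x = 0" for x
    by (rule zero_gradient_outside_support[OF a z])
  have 1: "(\<lambda>n. LINT x|lborel. (A x \<bullet> v) * ((c (x + h n *\<^sub>R w) - c x) / h n))
      \<longlonglongrightarrow> (LINT x|lborel. (A x \<bullet> v) * (C x \<bullet> w))"
    by (rule tendsto_LINT_difference_quotient[OF _ c C _ h, where R = R])
      (auto simp: h_def Az intro!: continuous_intros A)
  have 2: "(\<lambda>n. LINT x|lborel. (C x \<bullet> v) * ((a (x + (- h n) *\<^sub>R w) - a x) / (- h n)))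
      \<longlonglongrightarrow> (LINT x|lborel. (C x \<bullet> v) * (A x \<bullet> w))"
  proof (rule tendsto_LINT_difference_quotient[OF _ a A, where R = "\<bar>R\<bar> + norm w"])
    fix x :: 'a and t :: real assume *: "\<bar>R\<bar> + norm w < norm x" "\<bar>t\<bar> \<le> 1"
    have "norm (t *\<^sub>R w) \<le> norm w" using * by (simp add: mult_left_le_one_le)
    then have "R < norm (x + t *\<^sub>R w)" using * norm_diff_ineq[of x "t *\<^sub>R w"] by linarith
    moreover have "R < norm x" using * norm_ge_zero[of w] by linarith
    ultimately show "(C x \<bullet> v) * (a (x + t *\<^sub>R w) - a x) = 0"
      by (simp add: z)
  next
    show "(\<lambda>n. - h n) \<longlonglongrightarrow> 0" using tendsto_minus[OF h] by simp
  qed (auto simp: h_def intro!: continuous_intros C)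
  \<comment> \<open>The difference quotient of \<open>c\<close> is still of class C^1. Integration
    by parts moves the derivative in direction \<open>v\<close> from \<open>a\<close> to it, and a
    translation by \<open>t\<close> then moves the quotient from \<open>C\<close> to
    \<open>a\<close>, which turns the step into \<open>- h n\<close>.\<close>
  have "(LINT x|lborel. (A x \<bullet> v) * ((c (x + h n *\<^sub>R w) - c x) / h n))
      = (LINT x|lborel. (C x \<bullet> v) * ((a (x + (- h n) *\<^sub>R w) - a x) / (- h n)))" for n
  proof -
    define t where "t = h n *\<^sub>R w"
    have hn: "h n \<noteq> 0" by (simp add: h_def)
    have Ct: "continuous_on UNIV (\<lambda>x. C (x + y))" and at: "continuous_on UNIV (\<lambda>x. a (x + y))" for y
      by (intro continuous_on_compose2[OF C] continuous_on_compose2[OF ac] continuous_intros; simp)+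
    have ct: "((\<lambda>x. c (x + t)) has_derivative (\<lambda>v. C (x + t) \<bullet> v)) (at x)" for x
    proof -
      have "((\<lambda>x. x + t) has_derivative (\<lambda>v. v)) (at x)" by (auto intro!: derivative_eq_intros)
      from has_derivative_compose[OF this c] show ?thesis .
    qed
    have i: "integrable lborel (\<lambda>x. a x * (C (x + y) \<bullet> v))" for y
      by (rule integrable_bounded_support) (use z in \<open>auto intro!: continuous_intros ac Ct\<close>)
    have i2: "integrable lborel (\<lambda>x. a (x - t) * (C x \<bullet> v))"
    proof (rule integrable_bounded_support)
      show "a (x - t) * (C x \<bullet> v) = 0" if "R + norm t < norm x" for x
        using z[of "x - t"] that norm_triangle_ineq2[of x t] by auto
    qed (use at[of "-t"] in \<open>auto intro!: continuous_intros C\<close>)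
    have "(LINT x|lborel. ((c (x + t) - c x) / h n) * (A x \<bullet> v))
        = - (LINT x|lborel. a x * (((C (x + t) - C x) /\<^sub>R h n) \<bullet> v))"
    proof -
      have g: "((\<lambda>x. (c (x + t) - c x) / h n) has_derivative (\<lambda>v. ((C (x + t) - C x) /\<^sub>R h n) \<bullet> v)) (at x)" for x
        using has_derivative_mult_left[OF has_derivative_diff[OF ct[of x] c[of x]], of "inverse (h n)"]
        by (simp add: inner_simps divide_inverse mult.commute)
      have G: "continuous_on UNIV (\<lambda>x. (C (x + t) - C x) /\<^sub>R h n)"
        by (intro continuous_intros Ct C)
      show ?thesis
        using LINT_by_parts[OF a A g G z] by simp
    qed
    also have "(LINT x|lborel. a x * (((C (x + t) - C x) /\<^sub>R h n) \<bullet> v))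
        = ((LINT x|lborel. a x * (C (x + t) \<bullet> v)) - (LINT x|lborel. a x * (C x \<bullet> v))) / h n"
    proof -
      have "(LINT x|lborel. a x * (((C (x + t) - C x) /\<^sub>R h n) \<bullet> v))
          = (LINT x|lborel. (a x * (C (x + t) \<bullet> v) - a x * (C x \<bullet> v)) / h n)"
        by (simp add: inner_simps divide_simps right_diff_distrib)
      then show ?thesis using i[of t] i[of 0] by simp
    qed
    also have "(LINT x|lborel. a x * (C (x + t) \<bullet> v)) = (LINT x|lborel. a (x - t) * (C x \<bullet> v))"
    proof -
      have "(\<lambda>x. a (x - t) * (C x \<bullet> v)) \<in> borel_measurable borel"
        using borel_measurable_integrable[OF i2] by simp
      from LINT_translate[OF this, of t] show ?thesis by simp
    qed
    also have "- (((LINT x|lborel. a (x - t) * (C x \<bullet> v)) - (LINT x|lborel. a x * (C x \<bullet> v))) / h n)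
       = (LINT x|lborel. (C x \<bullet> v) * ((a (x - t) - a x) / (- h n)))"
      using i2 i[of 0] by (simp add: algebra_simps diff_divide_distrib)
    finally show ?thesis
      by (simp add: t_def mult.commute)
  qed
  with 1 2 have "(LINT x|lborel. (A x \<bullet> v) * (C x \<bullet> w)) = (LINT x|lborel. (C x \<bullet> v) * (A x \<bullet> w))"
    using LIMSEQ_unique by simp
  then show ?thesis by (simp add: mult.commute)
qed

subsection \<open>The maximum principle and the Lipschitz estimate\<close>

text \<open>The derivatives are carried as functions: \<open>w\<close> is the gradient and
  \<open>H t x\<close> the Hessian as a linear map, whose symmetry is proved later
  (\<open>H_symmetric\<close>). The source \<open>S\<close> makes the class closed under subtraction
  of solutions with another drift and of barrier functions.\<close>

locale parabolic =
  fixes b :: "real \<times> 'a::euclidean_space \<Rightarrow> 'a" and S :: "real \<Rightarrow> 'a \<Rightarrow> real" and s :: real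
    and u ut :: "real \<Rightarrow> 'a \<Rightarrow> real" and w :: "real \<Rightarrow> 'a \<Rightarrow> 'a" and H :: "real \<Rightarrow> 'a \<Rightarrow> 'a \<Rightarrow> 'a"
  assumes u_cont: "continuous_on ({s..} \<times> UNIV) (\<lambda>(t, x). u t x)"
    and u_t: "\<And>t x. s < t \<Longrightarrow> ((\<lambda>r. u r x) has_real_derivative ut t x) (at t)"
    and u_x: "\<And>t x. s < t \<Longrightarrow> (u t has_derivative (\<lambda>v. w t x \<bullet> v)) (at x)"
    and w_x: "\<And>t x. s < t \<Longrightarrow> (w t has_derivative H t x) (at x)"
    and ut_cont: "continuous_on ({s<..} \<times> UNIV) (\<lambda>(t, x). ut t x)"
    and w_cont: "continuous_on ({s<..} \<times> UNIV) (\<lambda>(t, x). w t x)"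
    and H_cont: "\<And>v. continuous_on ({s<..} \<times> UNIV) (\<lambda>(t, x). H t x v)"
    and eq: "\<And>t x. s < t \<Longrightarrow> ut t x = (\<Sum>i\<in>Basis. H t x i \<bullet> i) - b (t, x) \<bullet> w t x + S t x"

lemma differentiable_gradient:
  fixes f :: "'a::euclidean_space \<Rightarrow> real"
  assumes "f differentiable (at x)"
  shows "(f has_derivative (\<lambda>v. gradient f x \<bullet> v)) (at x)"
proof -
  have d: "(f has_derivative frechet_derivative f (at x)) (at x)"
    using assms by (simp add: frechet_derivative_works)
  then interpret linear "frechet_derivative f (at x)"
    by (rule has_derivative_linear)
  have "frechet_derivative f (at x) v = gradient f x \<bullet> v" for v
  proof -
    have "frechet_derivative f (at x) (\<Sum>i\<in>Basis. (v \<bullet> i) *\<^sub>R i) = (\<Sum>i\<in>Basis. (v \<bullet> i) * frechet_derivative f (at x) i)"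
      by (simp add: sum scale)
    then show ?thesis
      unfolding euclidean_representation
      by (simp add: gradient_def dderiv_def inner_sum_left inner_commute[of v] mult.commute)
  qed
  then show ?thesis using d by (metis (no_types, lifting) ext)
qed

lemma classical_solution_parabolic:
  fixes b :: "real \<times> 'a::euclidean_space \<Rightarrow> 'a"
  assumes "classical_solution b s f u"
  shows "parabolic b (\<lambda>t x. 0) s u (\<lambda>t x. deriv (\<lambda>r. u r x) t) (\<lambda>t. gradient (u t))
    (\<lambda>t x v. \<Sum>i\<in>Basis. (gradient (dderiv i (u t)) x \<bullet> v) *\<^sub>R i)"
proof -
  note a = assms[unfolded classical_solution_def]
  have c1: "continuous_on ({s<..} \<times> UNIV) (\<lambda>(t, x). dderiv i (u t) x)" if "i \<in> Basis" for i
    using a that by blast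
  have c2: "continuous_on ({s<..} \<times> UNIV) (\<lambda>(t, x). dderiv j (dderiv i (u t)) x)" if "i \<in> Basis" "j \<in> Basis" for i j
    using a that by blast
  show ?thesis
  proof
    show "((\<lambda>r. u r x) has_real_derivative deriv (\<lambda>r. u r x) t) (at t)" if "s < t" for t x
      using a that by (simp add: DERIV_deriv_iff_real_differentiable)
    show "(u t has_derivative (\<lambda>v. gradient (u t) x \<bullet> v)) (at x)" if "s < t" for t x
      using a that by (intro differentiable_gradient) blast
    show "(gradient (u t) has_derivative (\<lambda>v. \<Sum>i\<in>Basis. (gradient (dderiv i (u t)) x \<bullet> v) *\<^sub>R i)) (at x)"
      if "s < t" for t x
      unfolding gradient_def[of "u t", abs_def]
    proof (intro has_derivative_sum has_derivative_scaleR_left)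
      fix i :: 'a assume "i \<in> Basis"
      then show "(dderiv i (u t) has_derivative (\<lambda>v. gradient (dderiv i (u t)) x \<bullet> v)) (at x)"
        using a that by (intro differentiable_gradient) blast
    qed
    show "continuous_on ({s<..} \<times> UNIV) (\<lambda>(t, x). gradient (u t) x)"
      using c1 unfolding gradient_def split_def by (intro continuous_intros) auto
    show "continuous_on ({s<..} \<times> UNIV) (\<lambda>(t, x). \<Sum>i\<in>Basis. (gradient (dderiv i (u t)) x \<bullet> v) *\<^sub>R i)" for v
      using c2 unfolding gradient_def split_def by (intro continuous_intros) auto
    show "deriv (\<lambda>r. u r x) t = (\<Sum>i\<in>Basis. (\<Sum>j\<in>Basis. (gradient (dderiv j (u t)) x \<bullet> i) *\<^sub>R j) \<bullet> i) - b (t, x) \<bullet> gradient (u t) x + 0"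
      if "s < t" for t x
    proof -
      have "(\<Sum>j\<in>Basis. (gradient (dderiv j (u t)) x \<bullet> i) *\<^sub>R j) \<bullet> i = dderiv i (dderiv i (u t)) x"
        if "i \<in> Basis" for i
        using that by (simp add: inner_sum_left inner_Basis if_distrib cong: if_cong)
          (simp add: gradient_def inner_sum_left inner_Basis if_distrib cong: if_cong)
      then have "(\<Sum>i\<in>Basis. (\<Sum>j\<in>Basis. (gradient (dderiv j (u t)) x \<bullet> i) *\<^sub>R j) \<bullet> i) = laplacian (u t) x"
        by (simp add: laplacian_def)
      moreover have "deriv (\<lambda>r. u r x) t - laplacian (u t) x + b (t, x) \<bullet> gradient (u t) x = 0"
        using a that by blast
      ultimately show ?thesis by linarith
    qed
  qed (use a in blast)+
qed

text \<open>Only earlier times are compared, because the maximum over a closed time interval may sit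
  at its right end.\<close>

lemma derivative_nonneg_at_max:
  fixes g :: "real \<Rightarrow> real"
  assumes "(g has_real_derivative c) (at t0)" "s < t0" "\<And>t. s \<le> t \<Longrightarrow> t \<le> t0 \<Longrightarrow> g t \<le> g t0"
  shows "0 \<le> c"
proof (rule ccontr)
  assume "\<not> 0 \<le> c"
  with DERIV_neg_dec_left[OF assms(1)] obtain d where d: "d > 0" "\<And>h. 0 < h \<Longrightarrow> h < d \<Longrightarrow> g t0 < g (t0 - h)"
    by auto
  define h where "h = min (d / 2) (t0 - s)"
  have "0 < h" "h < d" "s \<le> t0 - h" using d(1) assms(2) by (auto simp: h_def)
  then show False using d(2)[of h] assms(3)[of "t0 - h"] by auto
qed

lemma second_derivative_nonpos_at_max:
  fixes g :: "real \<Rightarrow> real"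
  assumes g: "\<And>r. (g has_real_derivative g' r) (at r)" and c: "(g' has_real_derivative c) (at 0)"
    and d: "0 < d" and m: "\<And>r. \<bar>r\<bar> < d \<Longrightarrow> g r \<le> g 0"
  shows "g' 0 = 0" and "c \<le> 0"
proof -
  show z: "g' 0 = 0"
    by (rule DERIV_local_max[OF g d]) (use m in auto)
  show "c \<le> 0"
  proof (rule ccontr)
    assume "\<not> c \<le> 0"
    with DERIV_pos_inc_right[OF c] obtain e where e: "e > 0" "\<And>h. 0 < h \<Longrightarrow> h < e \<Longrightarrow> g' 0 < g' (0 + h)"
      by auto
    define h where "h = min d e / 2"
    have h: "0 < h" "h < d" "h < e" using d e(1) by (auto simp: h_def)
    obtain z where "0 < z" "z < h" "g h - g 0 = (h - 0) * g' z"
      using MVT2[OF h(1), of g g'] g by blast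
    moreover have "0 < g' z" using e(2)[of z] \<open>0 < z\<close> \<open>z < h\<close> h z by simp
    ultimately have "g 0 < g h" using h(1) by (simp add: algebra_simps)
    with m[of h] h show False by simp
  qed
qed

text \<open>The reflection in the hyperplane orthogonal to \<open>e\<close> is an orthogonal map, so
  it preserves the trace. This permits the Laplacian at the second of two doubled points to be
  computed along reflected directions.\<close>

lemma linear_trace_reflection:
  fixes h :: "'a::euclidean_space \<Rightarrow> 'a"
  assumes "linear h" "norm e = 1"
  shows "(\<Sum>i\<in>Basis. h (i - (2 * (i \<bullet> e)) *\<^sub>R e) \<bullet> (i - (2 * (i \<bullet> e)) *\<^sub>R e)) = (\<Sum>i\<in>Basis. h i \<bullet> i)"
proof -
  interpret linear h by fact
  have e: "e = (\<Sum>i\<in>Basis. (i \<bullet> e) *\<^sub>R i)"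
    by (subst euclidean_representation[of e, symmetric]) (simp add: inner_commute)
  have 1: "(\<Sum>i\<in>Basis. (i \<bullet> e) * (h i \<bullet> e)) = h e \<bullet> e"
  proof -
    have "h e = (\<Sum>i\<in>Basis. (i \<bullet> e) *\<^sub>R h i)" by (subst e) (simp add: sum scale)
    then show ?thesis by (simp add: inner_sum_left)
  qed
  have 2: "(\<Sum>i\<in>Basis. (i \<bullet> e) * (h e \<bullet> i)) = h e \<bullet> e"
  proof -
    have "h e \<bullet> e = h e \<bullet> (\<Sum>i\<in>Basis. (i \<bullet> e) *\<^sub>R i)" using e by simp
    then show ?thesis by (simp add: inner_sum_right)
  qed
  have 3: "(\<Sum>i\<in>Basis. (i \<bullet> e) * (i \<bullet> e)) = 1"
    using assms(2) euclidean_inner[of e e] by (simp add: norm_eq_sqrt_inner inner_commute)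
  have "h (i - (2 * (i \<bullet> e)) *\<^sub>R e) \<bullet> (i - (2 * (i \<bullet> e)) *\<^sub>R e)
     = h i \<bullet> i - 2 * ((i \<bullet> e) * (h i \<bullet> e)) - 2 * ((i \<bullet> e) * (h e \<bullet> i)) + 4 * (((i \<bullet> e) * (i \<bullet> e)) * (h e \<bullet> e))" for i
    by (simp add: diff scale inner_simps algebra_simps)
  then show ?thesis
    by (simp add: sum.distrib sum_subtractf 1 2 3 flip: sum_distrib_left sum_distrib_right)
qed

text \<open>The derivative in the direction opposite to \<open>G\<close> is \<open>- norm G\<close>,
  so a bound for the decrease of \<open>f\<close> is enough. At a maximum of the doubled function
  only this half of a Lipschitz estimate is available.\<close>

lemma gradient_le_one_sided:
  fixes f :: "'a::euclidean_space \<Rightarrow> real"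
  assumes f: "(f has_derivative (\<lambda>v. G \<bullet> v)) (at x)"
    and L: "\<And>y. f x - f y \<le> C * norm (x - y)" and C: "0 \<le> C"
  shows "norm G \<le> C"
proof (cases "G = 0")
  case True
  then show ?thesis using C by simp
next
  case False
  define v where "v = - G /\<^sub>R norm G"
  have v: "norm v = 1" using False by (simp add: v_def)
  have "((\<lambda>t. x + t *\<^sub>R v) has_derivative (\<lambda>h. h *\<^sub>R v)) (at 0)"
    by (auto intro!: derivative_eq_intros)
  from has_derivative_compose[OF this, of f "\<lambda>v. G \<bullet> v"] f
  have "((\<lambda>t. f (x + t *\<^sub>R v)) has_real_derivative G \<bullet> v) (at 0)"
    by (simp add: has_field_derivative_def mult.commute[of "G \<bullet> v"] mult_commute_abs)
  then have "((\<lambda>t. (f (x + t *\<^sub>R v) - f x) / t) \<longlongrightarrow> G \<bullet> v) (at_right 0)"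
    by (simp add: has_field_derivative_iff filterlim_at_split)
  then have "- C \<le> G \<bullet> v"
  proof (rule tendsto_lowerbound)
    have "- C \<le> (f (x + t *\<^sub>R v) - f x) / t" if "t > 0" for t
      using L[of "x + t *\<^sub>R v"] v that by (simp add: field_simps)
    then show "\<forall>\<^sub>F t in at_right 0. - C \<le> (f (x + t *\<^sub>R v) - f x) / t"
      by (auto simp: eventually_at intro!: exI[of _ 1])
  qed simp
  moreover have "G \<bullet> v = - norm G" using False by (simp add: v_def dot_square_norm power2_eq_square)
  ultimately show ?thesis by simp
qed

context parabolic
begin

lemma H_linear: "s < t \<Longrightarrow> linear (H t x)"
  using w_x has_derivative_linear by blast

lemma u_line: "s < t \<Longrightarrow> ((\<lambda>r. u t (x + r *\<^sub>R v)) has_real_derivative w t (x + r *\<^sub>R v) \<bullet> v) (at r)"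
  by (rule has_derivative_along_line[OF u_x])

lemma w_line: "s < t \<Longrightarrow> ((\<lambda>r. w t (x + r *\<^sub>R v) \<bullet> v) has_real_derivative H t x v \<bullet> v) (at 0)"
proof -
  assume t: "s < t"
  interpret linear "H t x" by (rule H_linear[OF t])
  have 1: "((\<lambda>r. x + r *\<^sub>R v) has_derivative (\<lambda>h. h *\<^sub>R v)) (at 0)"
    by (auto intro!: derivative_eq_intros)
  have "((\<lambda>r. w t (x + r *\<^sub>R v)) has_derivative (\<lambda>h. H t x (h *\<^sub>R v))) (at 0)"
    by (rule has_derivative_compose[OF 1]) (use w_x[OF t] in simp)
  then have "((\<lambda>r. w t (x + r *\<^sub>R v) \<bullet> v) has_derivative (\<lambda>h. H t x (h *\<^sub>R v) \<bullet> v)) (at 0)"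
    by (rule has_derivative_inner_left)
  then show ?thesis
    by (simp add: scale has_field_derivative_def mult.commute[of "_ \<bullet> v"] mult_commute_abs)
qed

lemma u_cont_on: "X \<subseteq> {s..} \<times> UNIV \<Longrightarrow> continuous_on X (\<lambda>p. u (fst p) (snd p))"
  using continuous_on_subset[OF u_cont] by (simp add: split_def)

text \<open>A penalty growing like |x|^2 forces the maximum into a compact set, where the first and
  second order conditions contradict the equation. The bound \<open>M\<close> is only qualitative:
  it makes the penalty win at infinity and is absent from the conclusion.\<close>

theorem max_principle:
  assumes b: "\<And>t x. norm (b (t, x)) \<le> B"
    and M: "\<And>t x. s \<le> t \<Longrightarrow> t \<le> T \<Longrightarrow> u t x \<le> M"
    and S: "\<And>t x. s < t \<Longrightarrow> t \<le> T \<Longrightarrow> S t x \<le> 0"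
    and m: "\<And>x. u s x \<le> m" and t1: "s \<le> t1" "t1 \<le> T"
  shows "u t1 x1 \<le> m"
proof (rule ccontr)
  assume n: "\<not> u t1 x1 \<le> m"
  \<comment> \<open>With E = exp (K (t - s)) the penalty \<open>g\<close> has Laplacian 2 d E and a
    drift term of size at most B E (1 + |x|^2), by 2 |x| \<le> 1 + |x|^2. This \<open>K\<close>
    makes the time derivative exceed both by E (1 + |x|^2).\<close>
  define K where "K = 2 * real DIM('a) + B + 1"
  have B: "0 \<le> B" using b[of s 0] norm_ge_zero order_trans by blast
  define g where "g t x = exp (K * (t - s)) * (1 + x \<bullet> x)" for t and x :: 'a
  have g: "g t x > 0" for t x by (simp add: g_def add_pos_nonneg)
  \<comment> \<open>The penalty takes half of the supposed excess at \<open>(t1, x1)\<close>, so the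
    penalised function still exceeds \<open>m\<close> there.\<close>
  define \<epsilon> where "\<epsilon> = (u t1 x1 - m) / (2 * g t1 x1)"
  have \<epsilon>: "\<epsilon> > 0" using n g by (simp add: \<epsilon>_def)
  define \<Phi> where "\<Phi> t x = u t x - \<epsilon> * g t x" for t x
  have 1: "\<Phi> t1 x1 > m" using n g[of t1 x1] by (simp add: \<Phi>_def \<epsilon>_def field_simps)
  define R where "R = 1 + \<bar>M - m\<bar> / \<epsilon> + norm x1"
  have far: "\<Phi> t x \<le> m" if "s \<le> t" "t \<le> T" "R < norm x" for t x
  proof -
    have "0 \<le> \<bar>M - m\<bar> / \<epsilon>" using \<epsilon> by simp
    then have R1: "1 < norm x" "\<bar>M - m\<bar> / \<epsilon> < norm x" using that(3) norm_ge_zero[of x1] unfolding R_def by linarith+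
    have "norm x * 1 \<le> norm x * norm x" using R1 by (intro mult_left_mono) auto
    then have "\<bar>M - m\<bar> / \<epsilon> \<le> 1 * (1 + x \<bullet> x)" using R1 by (simp add: dot_square_norm power2_eq_square)
    also have "1 * (1 + x \<bullet> x) \<le> g t x"
      unfolding g_def using that B by (intro mult_right_mono) (auto simp: K_def)
    finally have "\<bar>M - m\<bar> \<le> \<epsilon> * g t x" using \<epsilon> by (simp add: field_simps)
    then show ?thesis using M[OF that(1,2), of x] by (simp add: \<Phi>_def)
  qed
  have "compact ({s..T} \<times> cball (0::'a) R)" by (intro compact_Times) auto
  moreover have "(t1, x1) \<in> {s..T} \<times> cball 0 R" using t1 \<epsilon> by (simp add: R_def)
  moreover have "continuous_on ({s..T} \<times> cball 0 R) (\<lambda>p. \<Phi> (fst p) (snd p))"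
    unfolding \<Phi>_def g_def by (intro continuous_intros u_cont_on) auto
  ultimately obtain p where "p \<in> {s..T} \<times> cball 0 R"
    and "\<And>q. q \<in> {s..T} \<times> cball 0 R \<Longrightarrow> \<Phi> (fst q) (snd q) \<le> \<Phi> (fst p) (snd p)"
    using continuous_attains_sup[of "{s..T} \<times> cball 0 R" "\<lambda>p. \<Phi> (fst p) (snd p)"] by blast
  moreover obtain t0 x0 where "p = (t0, x0)" by (cases p)
  ultimately have p: "s \<le> t0" "t0 \<le> T" and
    sup: "\<And>t x. s \<le> t \<Longrightarrow> t \<le> T \<Longrightarrow> norm x \<le> R \<Longrightarrow> \<Phi> t x \<le> \<Phi> t0 x0" by force+
  have 2: "\<Phi> t0 x0 > m" using sup[of t1 x1] 1 t1 \<epsilon> by (simp add: R_def)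
  have max: "\<Phi> t x \<le> \<Phi> t0 x0" if "s \<le> t" "t \<le> T" for t x
    using sup[OF that, of x] far[OF that, of x] 2 by (cases "norm x \<le> R") auto
  have "t0 \<noteq> s"
  proof
    assume "t0 = s"
    then have "\<Phi> t0 x0 \<le> u s x0" using \<epsilon> g[of s x0] by (simp add: \<Phi>_def)
    with m[of x0] 2 show False by simp
  qed
  with p have t0: "s < t0" by simp
  define E where "E = exp (K * (t0 - s))"
  have E: "E > 0" by (simp add: E_def)
  have gE: "g t0 x0 = E * (1 + x0 \<bullet> x0)" by (simp add: g_def E_def)
  have dt: "0 \<le> ut t0 x0 - \<epsilon> * (K * g t0 x0)"
  proof (rule derivative_nonneg_at_max[OF _ t0])
    show "((\<lambda>t. \<Phi> t x0) has_real_derivative ut t0 x0 - \<epsilon> * (K * g t0 x0)) (at t0)"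
      unfolding \<Phi>_def g_def by (auto intro!: derivative_eq_intros u_t[OF t0])
  qed (use max p in auto)
  have dx: "w t0 x0 \<bullet> i = 2 * \<epsilon> * E * (x0 \<bullet> i)" "H t0 x0 i \<bullet> i \<le> 2 * \<epsilon> * E" if i: "i \<in> Basis" for i
  proof -
    have g1: "g t0 (x0 + r *\<^sub>R i) = E * (1 + x0 \<bullet> x0 + 2 * r * (x0 \<bullet> i) + r\<^sup>2)" for r
      using i by (simp add: g_def E_def inner_simps inner_commute algebra_simps power2_eq_square)
    have d1: "((\<lambda>r. \<Phi> t0 (x0 + r *\<^sub>R i)) has_real_derivative
        w t0 (x0 + r *\<^sub>R i) \<bullet> i - \<epsilon> * (E * (2 * (x0 \<bullet> i) + 2 * r))) (at r)" for r
      unfolding \<Phi>_def g1 by (rule derivative_eq_intros u_line[OF t0] refl | simp)+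
    have d2: "((\<lambda>r. w t0 (x0 + r *\<^sub>R i) \<bullet> i - \<epsilon> * (E * (2 * (x0 \<bullet> i) + 2 * r))) has_real_derivative
        H t0 x0 i \<bullet> i - \<epsilon> * (E * 2)) (at 0)"
      by (rule derivative_eq_intros w_line[OF t0] refl | simp)+
    have d3: "\<Phi> t0 (x0 + r *\<^sub>R i) \<le> \<Phi> t0 (x0 + 0 *\<^sub>R i)" for r using max p by simp
    from second_derivative_nonpos_at_max[OF d1 d2 zero_less_one d3]
    show "w t0 x0 \<bullet> i = 2 * \<epsilon> * E * (x0 \<bullet> i)" "H t0 x0 i \<bullet> i \<le> 2 * \<epsilon> * E" by simp_all
  qed
  have w0: "w t0 x0 = (2 * \<epsilon> * E) *\<^sub>R x0"
    by (rule euclidean_eqI) (simp add: dx)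
  have tr: "(\<Sum>i\<in>Basis. H t0 x0 i \<bullet> i) \<le> real DIM('a) * (2 * \<epsilon> * E)"
    using sum_bounded_above[of Basis "\<lambda>i. H t0 x0 i \<bullet> i" "2 * \<epsilon> * E"] dx(2) by simp
  have bw: "- (b (t0, x0) \<bullet> w t0 x0) \<le> \<epsilon> * E * (B * (1 + x0 \<bullet> x0))"
  proof -
    have "- (b (t0, x0) \<bullet> x0) \<le> norm (b (t0, x0)) * norm x0" using Cauchy_Schwarz_ineq2[of "b (t0, x0)" x0] by simp
    also have "\<dots> \<le> B * norm x0" using b by (intro mult_right_mono) auto
    finally have "2 * - (b (t0, x0) \<bullet> x0) \<le> B * (2 * norm x0)" by linarith
    also have "\<dots> \<le> B * (1 + x0 \<bullet> x0)"
      using B sum_squares_bound[of 1 "norm x0"] by (intro mult_left_mono) (auto simp: dot_square_norm)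
    finally have "(\<epsilon> * E) * (2 * - (b (t0, x0) \<bullet> x0)) \<le> (\<epsilon> * E) * (B * (1 + x0 \<bullet> x0))"
      using \<epsilon> E by (intro mult_left_mono) auto
    then show ?thesis by (simp add: w0 mult_ac)
  qed
  have "ut t0 x0 \<le> real DIM('a) * (2 * \<epsilon> * E) + \<epsilon> * E * (B * (1 + x0 \<bullet> x0))"
    using eq[OF t0, of x0] tr bw S[OF t0 p(2), of x0] by linarith
  with dt have "\<epsilon> * E * (K * (1 + x0 \<bullet> x0)) \<le> \<epsilon> * E * (2 * real DIM('a) + B * (1 + x0 \<bullet> x0))"
    by (simp add: gE algebra_simps)
  then have "K * (1 + x0 \<bullet> x0) \<le> 2 * real DIM('a) + B * (1 + x0 \<bullet> x0)"
    using \<epsilon> E by (simp add: mult_le_cancel_left)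
  moreover have "2 * real DIM('a) * 1 \<le> 2 * real DIM('a) * (1 + x0 \<bullet> x0)" by (intro mult_left_mono) auto
  moreover have "K * (1 + x0 \<bullet> x0) = 2 * real DIM('a) * (1 + x0 \<bullet> x0) + B * (1 + x0 \<bullet> x0) + (1 + x0 \<bullet> x0)"
    by (simp add: K_def algebra_simps)
  ultimately show False using inner_ge_zero[of x0] by linarith
qed

text \<open>Doubling of variables with the modulus \<open>\<psi>\<close>: comparing the second derivatives along \<open>i\<close> at \<open>x\<close>
  and along the reflection of \<open>i\<close> at \<open>y\<close> makes \<open>\<bar>x - y\<bar>\<close> an affine function, and the
  concavity of \<open>\<psi>\<close> near \<open>0\<close> outweighs the drift. The bound on the gradient does not depend on
  the drift as \<open>t\<close> decreases to \<open>s\<close>.\<close>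

theorem gradient_bound_near_initial_time:
  assumes b: "\<And>t x. norm (b (t, x)) \<le> B"
    and M: "\<And>t x. s \<le> t \<Longrightarrow> t \<le> T \<Longrightarrow> \<bar>u t x\<bar> \<le> M"
    and S: "\<And>t x. S t x = 0"
    and L: "\<And>x y. \<bar>u s x - u s y\<bar> \<le> L * norm (x - y)" "L > 0"
  shows "\<exists>c. \<forall>t x. s < t \<longrightarrow> t \<le> T \<longrightarrow> norm (w t x) \<le> 2 * L * exp (c * (t - s))"
proof -
  have B: "0 \<le> B" using b[of s 0] norm_ge_zero order_trans by blast
  define \<kappa> where "\<kappa> = 2 * B + 1"
  have lam: "\<kappa> > 0" using B by (simp add: \<kappa>_def)
  \<comment> \<open>From exp (- \<kappa> r) \<ge> 1 - \<kappa> r, the concavity term loses at most 4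
    \<kappa>^2 L r away from r = 0; the growth term \<open>c * \<psi> r\<close> is at least 4
    \<kappa>^2 L r and pays for it. What remains is 4 L (B - \<kappa>) < 0.\<close>
  define c where "c = 4 * \<kappa>\<^sup>2"
  define K where "K = 2 * real DIM('a) + 2 * B + 1"
  \<comment> \<open>The slope of \<open>\<psi>\<close> decreases from 2 L to L. The lower value
    makes \<open>\<psi>\<close> dominate the datum at time \<open>s\<close>, the upper one is the
    factor 2 L of the conclusion, and \<psi>'' = - \<kappa> L exp (- \<kappa> r) is of order
    \<kappa> near 0, where it must beat the drift.\<close>
  define \<psi> where "\<psi> r = L * (r + (1 - exp (- \<kappa> * r)) / \<kappa>)" for r
  define \<psi>' where "\<psi>' r = L * (1 + exp (- \<kappa> * r))" for r
  have \<psi>_deriv: "(\<psi> has_real_derivative \<psi>' r) (at r)" for r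
    unfolding \<psi>_def \<psi>'_def by (rule derivative_eq_intros refl | use lam in simp)+
  have \<psi>'_deriv: "(\<psi>' has_real_derivative - \<kappa> * L * exp (- \<kappa> * r)) (at r)" for r
    unfolding \<psi>'_def by (rule derivative_eq_intros refl | simp)+
  have \<psi>_ge: "L * r \<le> \<psi> r" if "0 \<le> r" for r
    using that L lam by (simp add: \<psi>_def algebra_simps)
  have \<psi>_nonneg: "0 \<le> \<psi> r" if "0 \<le> r" for r
    using \<psi>_ge[OF that] mult_nonneg_nonneg[of L r] that L by linarith
  have \<psi>_lip: "\<psi> r' - \<psi> r \<le> 2 * L * \<bar>r' - r\<bar>" if "0 \<le> r" "0 \<le> r'" for r r'
  proof (cases "r < r'")
    case True
    obtain z where z: "r < z" "\<psi> r' - \<psi> r = (r' - r) * \<psi>' z"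
      using MVT2[OF True, of \<psi> \<psi>'] \<psi>_deriv by blast
    have "\<psi>' z \<le> 2 * L" using z that L lam by (simp add: \<psi>'_def)
    then show ?thesis using z True by (simp add: mult.commute)
  next
    case False
    have "exp (- \<kappa> * r) \<le> exp (- \<kappa> * r')" using False lam by simp
    then have "(1 - exp (- \<kappa> * r')) / \<kappa> \<le> (1 - exp (- \<kappa> * r)) / \<kappa>" using lam by (intro divide_right_mono) auto
    then have "\<psi> r' \<le> \<psi> r" using L False by (simp add: \<psi>_def)
    moreover have "0 \<le> 2 * L * \<bar>r' - r\<bar>" using L by simp
    ultimately show ?thesis by linarith
  qed
  define E where "E t = exp (c * (t - s))" for t
  have E: "E t > 0" "1 \<le> t - s + 1 \<Longrightarrow> E t \<ge> 1" for t by (auto simp: E_def c_def)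
  have key: "u t1 x1 - u t1 y1 \<le> E t1 * \<psi> (norm (x1 - y1))" if t1: "s \<le> t1" "t1 \<le> T" for t1 x1 y1
  proof (rule ccontr)
    assume n: "\<not> ?thesis"
    define g where "g t x = exp (K * (t - s)) * (1 + x \<bullet> x)" for t and x :: 'a
    have g: "g t x > 0" for t x by (simp add: g_def add_pos_nonneg)
    define a where "a = u t1 x1 - u t1 y1 - E t1 * \<psi> (norm (x1 - y1))"
    define \<epsilon> where "\<epsilon> = a / (2 * g t1 x1)"
    have a: "a > 0" using n by (simp add: a_def)
    have \<epsilon>: "\<epsilon> > 0" using a g by (simp add: \<epsilon>_def)
    define \<Phi> where "\<Phi> t x y = u t x - u t y - E t * \<psi> (norm (x - y)) - \<epsilon> * g t x" for t x y
    have 1: "\<Phi> t1 x1 y1 > 0" using a g[of t1 x1] by (simp add: \<Phi>_def \<epsilon>_def a_def[symmetric])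
    have M0: "0 \<le> M" using M[OF t1, of x1] by linarith
    define R where "R = 1 + 2 * M / \<epsilon> + norm x1"
    define R2 where "R2 = R + 2 * M / L + norm y1 + norm x1"
    \<comment> \<open>The penalty acts on \<open>x\<close> alone. Once \<open>x\<close> is bounded,
      a distant \<open>y\<close> is excluded by \<open>\<psi>\<close> itself, which is at least L |x
      - y| and so exceeds the oscillation 2 M.\<close>
    have far: "\<Phi> t x y \<le> 0" if t: "s \<le> t" "t \<le> T" and "R < norm x \<or> (norm x \<le> R \<and> R2 < norm y)" for t x y
      using that(3)
    proof
      assume "R < norm x"
      have "0 \<le> 2 * M / \<epsilon>" using \<epsilon> M0 by simp
      then have R1: "1 < norm x" "2 * M / \<epsilon> < norm x" using \<open>R < norm x\<close> norm_ge_zero[of x1] unfolding R_def by linarith+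
      have "norm x * 1 \<le> norm x * norm x" using R1 by (intro mult_left_mono) auto
      then have "2 * M / \<epsilon> \<le> 1 * (1 + x \<bullet> x)" using R1 by (simp add: dot_square_norm power2_eq_square)
      also have "1 * (1 + x \<bullet> x) \<le> g t x"
        unfolding g_def using that B by (intro mult_right_mono) (auto simp: K_def)
      finally have "2 * M \<le> \<epsilon> * g t x" using \<epsilon> by (simp add: field_simps)
      moreover have "0 \<le> E t * \<psi> (norm (x - y))"
        using E[of t] \<psi>_nonneg[of "norm (x - y)"] by simp
      ultimately show ?thesis using M[OF t, of x] M[OF t, of y] by (simp add: \<Phi>_def)
    next
      assume r: "norm x \<le> R \<and> R2 < norm y"
      then have "2 * M / L \<le> norm (x - y)"
        using norm_triangle_ineq2[of y x] norm_ge_zero[of x1] norm_ge_zero[of y1] norm_minus_commute[of x y]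
        unfolding R2_def by linarith
      then have "2 * M \<le> L * norm (x - y)" using L by (simp add: field_simps)
      also have "\<dots> \<le> \<psi> (norm (x - y))" by (rule \<psi>_ge) simp
      also have "\<dots> \<le> E t * \<psi> (norm (x - y))"
        using mult_right_mono[of 1 "E t" "\<psi> (norm (x - y))"] E(2)[of t] t \<psi>_nonneg[of "norm (x - y)"] by simp
      finally show ?thesis using M[OF t, of x] M[OF t, of y] mult_pos_pos[OF \<epsilon> g[of t x]] unfolding \<Phi>_def by linarith
    qed
    let ?C = "{s..T} \<times> cball (0::'a) R \<times> cball (0::'a) R2"
    have "compact ?C" by (intro compact_Times) auto
    moreover have in1: "norm x1 \<le> R" "norm y1 \<le> R2" using \<epsilon> M0 L by (auto simp: R_def R2_def intro!: add_nonneg_nonneg)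
    then have "(t1, x1, y1) \<in> ?C" using t1 by simp
    moreover have "continuous_on ?C (\<lambda>p. \<Phi> (fst p) (fst (snd p)) (snd (snd p)))"
    proof -
      have *: "continuous_on X (\<lambda>p. u (f p) (g p))" if "continuous_on X f" "continuous_on X g" "f ` X \<subseteq> {s..}"
        for X and f :: "real \<times> 'a \<times> 'a \<Rightarrow> real" and g
        using continuous_on_compose2[OF u_cont, of X "\<lambda>p. (f p, g p)"] that by (auto intro: continuous_intros)
      show ?thesis
        unfolding \<Phi>_def g_def E_def \<psi>_def using lam by (intro continuous_intros *) auto
    qed
    ultimately obtain p where "p \<in> ?C"
      and "\<And>q. q \<in> ?C \<Longrightarrow> \<Phi> (fst q) (fst (snd q)) (snd (snd q)) \<le> \<Phi> (fst p) (fst (snd p)) (snd (snd p))"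
      using continuous_attains_sup[of ?C "\<lambda>p. \<Phi> (fst p) (fst (snd p)) (snd (snd p))"] by blast
    moreover obtain t0 x0 y0 where "p = (t0, x0, y0)" by (cases p)
    ultimately have p: "s \<le> t0" "t0 \<le> T" and
      sup: "\<And>t x y. s \<le> t \<Longrightarrow> t \<le> T \<Longrightarrow> norm x \<le> R \<Longrightarrow> norm y \<le> R2 \<Longrightarrow> \<Phi> t x y \<le> \<Phi> t0 x0 y0" by force+
    have 2: "\<Phi> t0 x0 y0 > 0" using sup[OF t1 in1] 1 by linarith
    have max: "\<Phi> t x y \<le> \<Phi> t0 x0 y0" if "s \<le> t" "t \<le> T" for t x y
      using sup[OF that, of x y] far[OF that, of x y] 2 by (cases "norm x \<le> R"; cases "norm y \<le> R2") auto
    have "t0 \<noteq> s"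
    proof
      assume "t0 = s"
      then have "\<Phi> t0 x0 y0 = u s x0 - u s y0 - \<psi> (norm (x0 - y0)) - \<epsilon> * g s x0" by (simp add: \<Phi>_def E_def)
      with 2 L(1)[of x0 y0] \<psi>_ge[of "norm (x0 - y0)"] mult_pos_pos[OF \<epsilon> g[of s x0]] show False
        by (simp add: abs_le_iff)
    qed
    with p have t0: "s < t0" by simp
    have "x0 \<noteq> y0"
    proof
      assume "x0 = y0"
      then have "\<Phi> t0 x0 y0 = - \<epsilon> * g t0 x0" by (simp add: \<Phi>_def \<psi>_def)
      with 2 mult_pos_pos[OF \<epsilon> g[of t0 x0]] show False by simp
    qed
    define r0 where "r0 = norm (x0 - y0)"
    define e where "e = (x0 - y0) /\<^sub>R r0"
    have r0: "r0 > 0" using \<open>x0 \<noteq> y0\<close> by (simp add: r0_def)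
    have e: "norm e = 1" using r0 by (simp add: e_def r0_def)
    have xy: "x0 - y0 = r0 *\<^sub>R e" using r0 by (simp add: e_def)
    define G where "G = exp (K * (t0 - s))"
    have G: "G > 0" by (simp add: G_def)
    have gE: "g t0 x0 = G * (1 + x0 \<bullet> x0)" by (simp add: g_def G_def)
    have dt: "0 \<le> ut t0 x0 - ut t0 y0 - c * E t0 * \<psi> r0 - \<epsilon> * (K * g t0 x0)"
    proof (rule derivative_nonneg_at_max[OF _ t0])
      show "((\<lambda>t. \<Phi> t x0 y0) has_real_derivative ut t0 x0 - ut t0 y0 - c * E t0 * \<psi> r0 - \<epsilon> * (K * g t0 x0)) (at t0)"
        unfolding \<Phi>_def g_def E_def r0_def[symmetric] by (auto intro!: derivative_eq_intros u_t[OF t0])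
    qed (use max p in auto)
    have g1: "g t0 (x0 + r *\<^sub>R v) = G * (1 + x0 \<bullet> x0 + 2 * r * (x0 \<bullet> v) + r\<^sup>2 * (v \<bullet> v))" for r v
      by (simp add: g_def G_def inner_simps inner_commute algebra_simps power2_eq_square)
    \<comment> \<open>Moving both points by the same vector leaves their distance unchanged, so the
      gradients at \<open>x0\<close> and \<open>y0\<close> can differ only by the gradient of the
      penalty.\<close>
    have wx: "w t0 x0 = w t0 y0 + (2 * \<epsilon> * G) *\<^sub>R x0"
    proof (rule euclidean_eqI)
      fix v :: 'a
      have d1: "((\<lambda>r. \<Phi> t0 (x0 + r *\<^sub>R v) (y0 + r *\<^sub>R v)) has_real_derivative
        w t0 (x0 + r *\<^sub>R v) \<bullet> v - w t0 (y0 + r *\<^sub>R v) \<bullet> v - \<epsilon> * (G * (2 * (x0 \<bullet> v) + 2 * r * (v \<bullet> v)))) (at r)" for r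
        unfolding \<Phi>_def g1 add_diff_add diff_self add_0_right
        by (rule derivative_eq_intros u_line[OF t0] refl | simp)+
      have "w t0 (x0 + 0 *\<^sub>R v) \<bullet> v - w t0 (y0 + 0 *\<^sub>R v) \<bullet> v - \<epsilon> * (G * (2 * (x0 \<bullet> v) + 2 * 0 * (v \<bullet> v))) = 0"
        by (rule DERIV_local_max[OF d1 zero_less_one]) (use max p in auto)
      then show "w t0 x0 \<bullet> v = (w t0 y0 + (2 * \<epsilon> * G) *\<^sub>R x0) \<bullet> v" by (simp add: inner_simps)
    qed
    \<comment> \<open>Here \<open>y\<close> moves alone; the maximum then bounds the decrease of
      \<open>u\<close> from \<open>y0\<close> by an increment of \<open>\<psi>\<close>, whose slope
      is at most 2 L.\<close>
    have wy: "norm (w t0 y0) \<le> 2 * L * E t0"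
    proof (rule gradient_le_one_sided[OF u_x[OF t0]])
      fix y
      have "\<Phi> t0 x0 y \<le> \<Phi> t0 x0 y0" using max p by simp
      then have "u t0 y0 - u t0 y \<le> E t0 * (\<psi> (norm (x0 - y)) - \<psi> (norm (x0 - y0)))"
        by (simp add: \<Phi>_def algebra_simps)
      also have "\<dots> \<le> E t0 * (2 * L * \<bar>norm (x0 - y) - norm (x0 - y0)\<bar>)"
        using E[of t0] by (intro mult_left_mono \<psi>_lip) auto
      also have "\<dots> \<le> E t0 * (2 * L * norm (y0 - y))"
        using E[of t0] L norm_triangle_ineq3[of "x0 - y" "x0 - y0"] by (intro mult_left_mono) (auto simp: norm_minus_commute)
      finally show "u t0 y0 - u t0 y \<le> 2 * L * E t0 * norm (y0 - y)" by (simp add: mult_ac)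
    qed (use L E[of t0] in simp)
    have dxy: "H t0 x0 i \<bullet> i - H t0 y0 (i - (2 * (i \<bullet> e)) *\<^sub>R e) \<bullet> (i - (2 * (i \<bullet> e)) *\<^sub>R e)
        \<le> - 4 * E t0 * \<kappa> * L * exp (- \<kappa> * r0) * ((e \<bullet> i) * (e \<bullet> i)) + 2 * \<epsilon> * G" if i: "i \<in> Basis" for i
    proof -
      define k where "k = 2 * (i \<bullet> e)"
      define v where "v = i - k *\<^sub>R e"
      define f where "f r = u t0 (x0 + r *\<^sub>R i) - u t0 (y0 + r *\<^sub>R v) - E t0 * \<psi> (r0 + r * k)
         - \<epsilon> * (G * (1 + x0 \<bullet> x0 + 2 * r * (x0 \<bullet> i) + r\<^sup>2 * (i \<bullet> i)))" for r
      define f' where "f' r = w t0 (x0 + r *\<^sub>R i) \<bullet> i - w t0 (y0 + r *\<^sub>R v) \<bullet> v - E t0 * (\<psi>' (r0 + r * k) * k)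
         - \<epsilon> * (G * (2 * (x0 \<bullet> i) + 2 * r * (i \<bullet> i)))" for r
      have d1: "(f has_real_derivative f' r) (at r)" for r
        unfolding f_def f'_def
        by (rule derivative_eq_intros u_line[OF t0] DERIV_chain2[OF \<psi>_deriv] refl | simp)+
      have d2: "(f' has_real_derivative H t0 x0 i \<bullet> i - H t0 y0 v \<bullet> v - E t0 * ((- \<kappa> * L * exp (- \<kappa> * (r0 + 0 * k)) * k) * k)
         - \<epsilon> * (G * (2 * (i \<bullet> i)))) (at 0)"
        unfolding f'_def
        by (rule derivative_eq_intros w_line[OF t0] DERIV_chain2[OF \<psi>'_deriv] refl | simp)+
      have f_eq: "f r = \<Phi> t0 (x0 + r *\<^sub>R i) (y0 + r *\<^sub>R v)" if "0 \<le> r0 + r * k" for r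
      proof -
        have "(x0 + r *\<^sub>R i) - (y0 + r *\<^sub>R v) = (r0 + r * k) *\<^sub>R e"
          using xy by (simp add: v_def algebra_simps)
        then have "norm ((x0 + r *\<^sub>R i) - (y0 + r *\<^sub>R v)) = r0 + r * k" using e that by simp
        then show ?thesis unfolding \<Phi>_def f_def g1 by simp
      qed
      \<comment> \<open>For |r| below this radius \<open>r0 + r * k\<close> stays nonnegative, hence
        is the distance of the two moving points and not merely its signed version.\<close>
      define d where "d = r0 / (1 + \<bar>k\<bar>)"
      have d: "d > 0" using r0 by (simp add: d_def)
      have fm: "f r \<le> f 0" if "\<bar>r\<bar> < d" for r
      proof -
        have "\<bar>r * k\<bar> \<le> \<bar>r\<bar> * (1 + \<bar>k\<bar>)" by (simp add: abs_mult algebra_simps)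
        also have "\<dots> < r0" using that by (simp add: d_def field_simps)
        finally have "0 \<le> r0 + r * k" by linarith
        then show ?thesis using f_eq[of r] f_eq[of 0] r0 max[OF p] by simp
      qed
      from second_derivative_nonpos_at_max(2)[OF d1 d2 d fm]
      show ?thesis using i unfolding v_def[symmetric] k_def[symmetric]
        by (simp add: k_def inner_commute[of e] algebra_simps)
    qed
    have "(\<Sum>i\<in>Basis. H t0 x0 i \<bullet> i) - (\<Sum>i\<in>Basis. H t0 y0 i \<bullet> i)
      = (\<Sum>i\<in>Basis. H t0 x0 i \<bullet> i - H t0 y0 (i - (2 * (i \<bullet> e)) *\<^sub>R e) \<bullet> (i - (2 * (i \<bullet> e)) *\<^sub>R e))"
      by (simp add: sum_subtractf linear_trace_reflection[OF H_linear[OF t0] e])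
    also have "\<dots> \<le> (\<Sum>i\<in>Basis. - 4 * E t0 * \<kappa> * L * exp (- \<kappa> * r0) * ((e \<bullet> i) * (e \<bullet> i)) + 2 * \<epsilon> * G)"
      by (rule sum_mono) (use dxy in blast)
    also have "\<dots> = - 4 * E t0 * \<kappa> * L * exp (- \<kappa> * r0) * (e \<bullet> e) + real DIM('a) * (2 * \<epsilon> * G)"
      by (simp only: sum.distrib euclidean_inner[of e e] sum_distrib_left) simp
    finally have tr: "(\<Sum>i\<in>Basis. H t0 x0 i \<bullet> i) - (\<Sum>i\<in>Basis. H t0 y0 i \<bullet> i)
      \<le> - 4 * E t0 * \<kappa> * L * exp (- \<kappa> * r0) + real DIM('a) * (2 * \<epsilon> * G)"
      using e by (simp add: norm_eq_1)
    have bw: "- (b (t0, x0) \<bullet> w t0 x0) + b (t0, y0) \<bullet> w t0 y0 \<le> 4 * B * L * E t0 + \<epsilon> * G * (B * (1 + x0 \<bullet> x0))"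
    proof -
      have "- (b (t0, x0) \<bullet> x0) \<le> norm (b (t0, x0)) * norm x0" using Cauchy_Schwarz_ineq2[of "b (t0, x0)" x0] by simp
      also have "\<dots> \<le> B * norm x0" using b by (intro mult_right_mono) auto
      finally have "2 * - (b (t0, x0) \<bullet> x0) \<le> B * (2 * norm x0)" by linarith
      also have "\<dots> \<le> B * (1 + x0 \<bullet> x0)"
        using B sum_squares_bound[of 1 "norm x0"] by (intro mult_left_mono) (auto simp: dot_square_norm)
      finally have 1: "(\<epsilon> * G) * (2 * - (b (t0, x0) \<bullet> x0)) \<le> (\<epsilon> * G) * (B * (1 + x0 \<bullet> x0))"
        using \<epsilon> G by (intro mult_left_mono) auto
      have "(b (t0, y0) - b (t0, x0)) \<bullet> w t0 y0 \<le> norm (b (t0, y0) - b (t0, x0)) * norm (w t0 y0)"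
        by (rule norm_cauchy_schwarz)
      also have "\<dots> \<le> (B + B) * (2 * L * E t0)"
        using b wy B by (intro mult_mono norm_triangle_le_diff add_mono) auto
      finally have "(b (t0, y0) - b (t0, x0)) \<bullet> w t0 y0 \<le> 4 * B * L * E t0" by simp
      with 1 show ?thesis by (simp add: wx inner_simps mult_ac)
    qed
    have "ut t0 x0 - ut t0 y0 \<le> - 4 * E t0 * \<kappa> * L * exp (- \<kappa> * r0) + real DIM('a) * (2 * \<epsilon> * G)
       + 4 * B * L * E t0 + \<epsilon> * G * (B * (1 + x0 \<bullet> x0))"
      using eq[OF t0, of x0] eq[OF t0, of y0] tr bw by (simp add: S)
    with dt have "0 \<le> E t0 * (4 * B * L - 4 * \<kappa> * L * exp (- \<kappa> * r0) - c * \<psi> r0)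
       + \<epsilon> * G * (2 * real DIM('a) + B * (1 + x0 \<bullet> x0) - K * (1 + x0 \<bullet> x0))"
      by (simp add: gE algebra_simps)
    moreover have "E t0 * (4 * B * L - 4 * \<kappa> * L * exp (- \<kappa> * r0) - c * \<psi> r0) < 0"
    proof -
      have "4 * \<kappa> * L * (1 + (- \<kappa> * r0)) \<le> 4 * \<kappa> * L * exp (- \<kappa> * r0)"
        using lam L by (intro mult_left_mono exp_ge_add_one_self) auto
      moreover have "c * (L * r0) \<le> c * \<psi> r0" using r0 by (intro mult_left_mono \<psi>_ge) (auto simp: c_def)
      moreover have "4 * B * L < 4 * \<kappa> * L" using L B by (simp add: \<kappa>_def)
      ultimately have "4 * B * L - 4 * \<kappa> * L * exp (- \<kappa> * r0) - c * \<psi> r0 < 0"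
        by (simp add: c_def power2_eq_square algebra_simps)
      then show ?thesis using E[of t0] by (simp add: mult_pos_neg)
    qed
    moreover have "\<epsilon> * G * (2 * real DIM('a) + B * (1 + x0 \<bullet> x0) - K * (1 + x0 \<bullet> x0)) \<le> 0"
    proof -
      have "2 * real DIM('a) * 1 \<le> 2 * real DIM('a) * (1 + x0 \<bullet> x0)" by (intro mult_left_mono) auto
      moreover have "0 \<le> B * (1 + x0 \<bullet> x0)" using B by simp
      moreover have "0 \<le> 1 + x0 \<bullet> x0" by simp
      moreover have "K * (1 + x0 \<bullet> x0) = 2 * real DIM('a) * (1 + x0 \<bullet> x0) + 2 * (B * (1 + x0 \<bullet> x0)) + (1 + x0 \<bullet> x0)"
        by (simp add: K_def algebra_simps)
      ultimately have "2 * real DIM('a) + B * (1 + x0 \<bullet> x0) - K * (1 + x0 \<bullet> x0) \<le> 0"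
        by linarith
      then show ?thesis using \<epsilon> G by (simp add: mult_nonneg_nonpos)
    qed
    ultimately show False by linarith
  qed
  have "norm (w t x) \<le> 2 * L * E t" if t: "s < t" "t \<le> T" for t x
  proof (rule gradient_le_one_sided[OF u_x[OF t(1)]])
    fix y
    have "u t x - u t y \<le> E t * (\<psi> (norm (x - y)) - \<psi> 0)" using key[of t x y] t by (simp add: \<psi>_def)
    also have "\<dots> \<le> E t * (2 * L * \<bar>norm (x - y) - 0\<bar>)"
      using E[of t] by (intro mult_left_mono \<psi>_lip) auto
    finally show "u t x - u t y \<le> 2 * L * E t * norm (x - y)" by (simp add: mult_ac)
  qed (use L E[of t] in simp)
  then show ?thesis unfolding E_def by blast
qed

end

subsection \<open>Mollification by Gaussians\<close>

lemma integrable_exp_abs: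
  assumes "a > 0"
  shows "(\<integral>\<^sup>+t. ennreal (exp (- a * \<bar>t::real\<bar>)) \<partial>lborel) < \<infinity>"
proof -
  have half: "(\<integral>\<^sup>+t. ennreal (exp (- a * t)) * indicator {0..} t \<partial>lborel) = ennreal (0 - (- exp (- a * 0) / a))"
  proof (rule nn_integral_FTC_atLeast)
    show "((\<lambda>t. - exp (- a * t) / a) has_real_derivative exp (- a * t)) (at t)" for t
      using assms by (auto intro!: derivative_eq_intros)
    have "filterlim (\<lambda>t. - a * t) at_bot at_top"
      using assms by (simp add: filterlim_uminus_at_bot filterlim_tendsto_pos_mult_at_top[OF tendsto_const])
        (rule filterlim_tendsto_pos_mult_at_top[OF tendsto_const _ filterlim_ident], simp)
    then have "((\<lambda>t. exp (- a * t)) \<longlongrightarrow> 0) at_top"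
      by (rule filterlim_compose[OF exp_at_bot])
    then show "((\<lambda>t. - exp (- a * t) / a) \<longlongrightarrow> 0) at_top"
      using tendsto_divide[OF tendsto_minus tendsto_const[of a]] assms by fastforce
  qed auto
  have "(\<integral>\<^sup>+t. ennreal (exp (- a * \<bar>t\<bar>)) \<partial>lborel)
      \<le> (\<integral>\<^sup>+t. ennreal (exp (- a * t)) * indicator {0..} t + ennreal (exp (- a * (- t))) * indicator {0..} (- t) \<partial>lborel)"
    by (rule nn_integral_mono) (auto simp: indicator_def abs_if)
  also have "\<dots> = (\<integral>\<^sup>+t. ennreal (exp (- a * t)) * indicator {0..} t \<partial>lborel)
     + (\<integral>\<^sup>+t. ennreal (exp (- a * (- t))) * indicator {0..} (- t) \<partial>lborel)"
    by (rule nn_integral_add) auto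
  also have "(\<integral>\<^sup>+t. ennreal (exp (- a * (- t))) * indicator {0..} (- t) \<partial>lborel)
     = (\<integral>\<^sup>+t. ennreal (exp (- a * t)) * indicator {0..} t \<partial>lborel)"
    using nn_integral_real_affine[of "\<lambda>t. ennreal (exp (- a * t)) * indicator {0..} t" "-1" 0] by simp
  finally show ?thesis unfolding half
    by (rule order_le_less_trans) (simp add: ennreal_add_eq_top less_top[symmetric])
qed

lemma integrable_exp_l1_norm:
  assumes "a > 0"
  shows "integrable lborel (\<lambda>x::'a::euclidean_space. exp (- a * (\<Sum>i\<in>Basis. \<bar>x \<bullet> i\<bar>)))"
proof (rule integrableI_bounded)
  have "(\<integral>\<^sup>+(x::'a). ennreal (norm (exp (- a * (\<Sum>i\<in>Basis. \<bar>x \<bullet> i\<bar>)))) \<partial>lborel)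
      = (\<integral>\<^sup>+(x::'a). (\<Prod>i\<in>Basis. ennreal (exp (- a * \<bar>x \<bullet> i\<bar>))) \<partial>lborel)"
    by (simp add: exp_sum sum_distrib_left prod_ennreal sum_negf[symmetric] abs_prod)
  also have "\<dots> = (\<Prod>i\<in>(Basis::'a set). (\<integral>\<^sup>+t. ennreal (exp (- a * \<bar>t\<bar>)) \<partial>lborel))"
    by (rule nn_integral_lborel_prod) auto
  also have "\<dots> < \<infinity>"
    using integrable_exp_abs[OF assms] by (simp add: power_less_top_ennreal)
  finally show "(\<integral>\<^sup>+(x::'a). ennreal (norm (exp (- a * (\<Sum>i\<in>Basis. \<bar>x \<bullet> i\<bar>)))) \<partial>lborel) < \<infinity>" .
qed measurable

lemma integrable_gaussian: "integrable lborel (\<lambda>x::'a::euclidean_space. exp (- (x \<bullet> x)))"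
proof (rule Bochner_Integration.integrable_bound)
  show "integrable lborel (\<lambda>x::'a. exp (real DIM('a)) * exp (- 1 * (\<Sum>i\<in>Basis. \<bar>x \<bullet> i\<bar>)))"
    by (intro integrable_mult_right integrable_exp_l1_norm) simp
  have "exp (- (x \<bullet> x)) \<le> exp (real DIM('a)) * exp (- 1 * (\<Sum>i\<in>Basis. \<bar>x \<bullet> i\<bar>))" for x :: 'a
  proof -
    have "(\<Sum>i\<in>Basis. \<bar>x \<bullet> i\<bar>) \<le> (\<Sum>i\<in>Basis. (x \<bullet> i) * (x \<bullet> i) + 1)"
    proof (rule sum_mono)
      fix i :: 'a
      show "\<bar>x \<bullet> i\<bar> \<le> (x \<bullet> i) * (x \<bullet> i) + 1"
        using sum_squares_bound[of "\<bar>x \<bullet> i\<bar>" 1] by (simp add: power2_eq_square)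
    qed
    then have "(\<Sum>i\<in>Basis. \<bar>x \<bullet> i\<bar>) \<le> x \<bullet> x + real DIM('a)"
      by (simp add: sum.distrib euclidean_inner[of x x])
    then show ?thesis by (simp flip: exp_add)
  qed
  then show "AE x::'a in lborel. norm (exp (- (x \<bullet> x))) \<le> norm (exp (real DIM('a)) * exp (- 1 * (\<Sum>i\<in>Basis. \<bar>x \<bullet> i\<bar>)))"
    by simp
qed simp

lemma real_polynomial_function_gradient:
  fixes p :: "'a::euclidean_space \<Rightarrow> real"
  assumes "real_polynomial_function p"
  shows "\<exists>P. (\<forall>x. (p has_derivative (\<lambda>v. P x \<bullet> v)) (at x)) \<and> (\<forall>i. real_polynomial_function (\<lambda>x. P x \<bullet> i))"
  using assms
proof induction
  case (linear f)
  have "f v = (\<Sum>i\<in>Basis. f i *\<^sub>R i) \<bullet> v" for v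
  proof -
    interpret bounded_linear f by fact
    have "f (\<Sum>i\<in>Basis. (v \<bullet> i) *\<^sub>R i) = (\<Sum>i\<in>Basis. (v \<bullet> i) * f i)" by (simp add: sum scale)
    then show ?thesis
      unfolding euclidean_representation by (simp add: inner_sum_left inner_sum_right inner_commute mult.commute)
  qed
  then have "(f has_derivative (\<lambda>v. (\<Sum>i\<in>Basis. f i *\<^sub>R i) \<bullet> v)) (at x)" for x
    using bounded_linear_imp_has_derivative[OF linear, of "at x"] by (metis (no_types, lifting) ext)
  then show ?case by (intro exI[of _ "\<lambda>x. \<Sum>i\<in>Basis. f i *\<^sub>R i"]) auto
next
  case (const c)
  show ?case by (intro exI[of _ "\<lambda>x. 0"]) auto
next
  case (add f g)
  then obtain F G where "\<forall>x. (f has_derivative (\<lambda>v. F x \<bullet> v)) (at x)" "\<forall>i. real_polynomial_function (\<lambda>x. F x \<bullet> i)"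
    "\<forall>x. (g has_derivative (\<lambda>v. G x \<bullet> v)) (at x)" "\<forall>i. real_polynomial_function (\<lambda>x. G x \<bullet> i)" by blast
  then show ?case
    by (intro exI[of _ "\<lambda>x. F x + G x"]) (auto simp: inner_simps intro!: derivative_eq_intros)
next
  case (mult f g)
  then obtain F G where "\<forall>x. (f has_derivative (\<lambda>v. F x \<bullet> v)) (at x)" "\<forall>i. real_polynomial_function (\<lambda>x. F x \<bullet> i)"
    "\<forall>x. (g has_derivative (\<lambda>v. G x \<bullet> v)) (at x)" "\<forall>i. real_polynomial_function (\<lambda>x. G x \<bullet> i)" by blast
  with mult(1,2) show ?case
    by (intro exI[of _ "\<lambda>x. f x *\<^sub>R G x + g x *\<^sub>R F x"])
      (auto simp: inner_simps algebra_simps intro!: derivative_eq_intros real_polynomial_function.intros(3,4))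
qed

lemma real_polynomial_function_growth:
  fixes p :: "'a::euclidean_space \<Rightarrow> real"
  assumes "real_polynomial_function p"
  shows "\<exists>C m. C \<ge> 0 \<and> (\<forall>x. \<bar>p x\<bar> \<le> C * (1 + norm x) ^ m)"
  using assms
proof induction
  case (linear f)
  obtain C where C: "C > 0" "\<And>x. norm (f x) \<le> norm x * C" using bounded_linear.pos_bounded[OF linear] by blast
  then have "\<bar>f x\<bar> \<le> C * (1 + norm x) ^ 1" for x
    using C(2)[of x] C(1) by (simp add: algebra_simps) (smt (verit))
  with C(1) show ?case by (meson less_imp_le)
next
  case (const c)
  show ?case by (intro exI[of _ "\<bar>c\<bar>"] exI[of _ 0]) simp
next
  case (add f g)
  then obtain A m B n where *: "A \<ge> 0" "\<forall>x. \<bar>f x\<bar> \<le> A * (1 + norm x) ^ m" "B \<ge> 0" "\<forall>x. \<bar>g x\<bar> \<le> B * (1 + norm x) ^ n" by blast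
  have "\<bar>f x + g x\<bar> \<le> (A + B) * (1 + norm x) ^ (m + n)" for x
  proof -
    have "A * (1 + norm x) ^ m \<le> A * (1 + norm x) ^ (m + n)" "B * (1 + norm x) ^ n \<le> B * (1 + norm x) ^ (m + n)"
      using * by (intro mult_left_mono power_increasing; simp)+
    moreover have "\<bar>f x\<bar> \<le> A * (1 + norm x) ^ m" "\<bar>g x\<bar> \<le> B * (1 + norm x) ^ n" using * by auto
    ultimately show ?thesis by (simp add: distrib_right)
  qed
  with * show ?case by (meson add_nonneg_nonneg)
next
  case (mult f g)
  then obtain A m B n where *: "A \<ge> 0" "\<forall>x. \<bar>f x\<bar> \<le> A * (1 + norm x) ^ m" "B \<ge> 0" "\<forall>x. \<bar>g x\<bar> \<le> B * (1 + norm x) ^ n" by blast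
  have "\<bar>f x * g x\<bar> \<le> (A * B) * (1 + norm x) ^ (m + n)" for x
  proof -
    have "\<bar>f x\<bar> * \<bar>g x\<bar> \<le> (A * (1 + norm x) ^ m) * (B * (1 + norm x) ^ n)"
      using * by (intro mult_mono) auto
    then show ?thesis by (simp add: abs_mult power_add mult_ac)
  qed
  with * show ?case by (meson mult_nonneg_nonneg)
qed

text \<open>Polynomials times a Gaussian are stable under partial derivatives
  (\<open>gaussian_gradient\<close>) and decay faster than any power. Convolution with such a kernel
  therefore lands in the Schwartz space, for which alone the form inequality is given.\<close>

definition gaussian :: "real \<Rightarrow> ('a::euclidean_space \<Rightarrow> real) \<Rightarrow> 'a \<Rightarrow> real"
  where "gaussian c p z = p z * exp (- c * (z \<bullet> z))"

lemma continuous_real_polynomial: "real_polynomial_function p \<Longrightarrow> continuous_on S p"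
  by (simp add: continuous_at_imp_continuous_on continuous_real_polymonial_function)

lemma gaussian_continuous: "real_polynomial_function p \<Longrightarrow> continuous_on S (gaussian c p)"
  unfolding gaussian_def by (intro continuous_intros continuous_real_polynomial)

lemma gaussian_gradient:
  fixes p :: "'a::euclidean_space \<Rightarrow> real"
  assumes "real_polynomial_function p"
  shows "\<exists>G. (\<forall>z. (gaussian c p has_derivative (\<lambda>v. G z \<bullet> v)) (at z)) \<and> continuous_on UNIV G
    \<and> (\<forall>i. \<exists>p'. real_polynomial_function p' \<and> (\<forall>z. G z \<bullet> i = gaussian c p' z))"
proof -
  obtain P where P: "\<And>x. (p has_derivative (\<lambda>v. P x \<bullet> v)) (at x)" "\<And>i. real_polynomial_function (\<lambda>x. P x \<bullet> i)"
    using real_polynomial_function_gradient[OF assms] by blast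
  define G where "G z = exp (- c * (z \<bullet> z)) *\<^sub>R (P z - (2 * c * p z) *\<^sub>R z)" for z
  have "(gaussian c p has_derivative (\<lambda>v. G z \<bullet> v)) (at z)" for z
    unfolding gaussian_def
    by (auto intro!: derivative_eq_intros P(1) simp: G_def inner_simps algebra_simps inner_commute)
  moreover have 2: "\<exists>p'. real_polynomial_function p' \<and> (\<forall>z. G z \<bullet> i = gaussian c p' z)" for i
  proof (intro exI conjI)
    have "real_polynomial_function (\<lambda>z. z \<bullet> i)" by (simp add: real_polynomial_function.intros(1) bounded_linear_inner_left)
    then show "real_polynomial_function (\<lambda>z. P z \<bullet> i - (2 * c) * (p z * (z \<bullet> i)))"
      using P(2) assms by (intro real_polynomial_function_diff real_polynomial_function.intros(2,4))
  qed (simp add: G_def gaussian_def inner_simps)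
  moreover have "continuous_on UNIV G"
    by (subst continuous_on_componentwise) (metis 2 continuous_on_cong gaussian_continuous)
  ultimately show ?thesis by blast
qed

lemma power_le_fact_exp:
  fixes x :: real
  assumes "0 \<le> x"
  shows "x ^ n \<le> fact n * exp x"
proof -
  have "(\<Sum>k<Suc n. x ^ k /\<^sub>R fact k) \<le> exp x"
    unfolding exp_def by (rule sum_le_suminf[OF summable_exp_generic]) (use assms in auto)
  moreover have "x ^ n /\<^sub>R fact n \<le> (\<Sum>k<Suc n. x ^ k /\<^sub>R fact k)"
    using assms by (simp add: sum_nonneg)
  ultimately have "x ^ n /\<^sub>R fact n \<le> exp x" by linarith
  then show ?thesis by (simp add: field_simps)
qed

text \<open>The shift by \<open>R\<close> prepares the convolution estimate, where norm z \<le> norm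
  (z - y) + R for \<open>y\<close> in the box. The bound itself comes from completing the square in
  x - c x^2.\<close>

lemma gaussian_decay:
  fixes p :: "'a::euclidean_space \<Rightarrow> real"
  assumes "real_polynomial_function p" "c > 0" "R \<ge> 0"
  shows "\<exists>M. \<forall>z. (norm z + R) ^ k * \<bar>gaussian c p z\<bar> \<le> M"
proof -
  obtain C m where C: "C \<ge> 0" "\<And>x. \<bar>p x\<bar> \<le> C * (1 + norm x) ^ m"
    using real_polynomial_function_growth[OF assms(1)] by blast
  define n where "n = k + m"
  define r where "r = 1 + R"
  have ex: "(x + r) ^ n * exp (- c * x\<^sup>2) \<le> fact n * exp (r + 1 / (4 * c))" if "0 \<le> x" for x
  proof -
    have "(x + r) ^ n \<le> fact n * exp (x + r)"
      using power_le_fact_exp[of "x + r" n] that assms(3) by (simp add: r_def)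
    then have "(x + r) ^ n * exp (- c * x\<^sup>2) \<le> (fact n * exp (x + r)) * exp (- c * x\<^sup>2)"
      by (rule mult_right_mono) simp
    also have "\<dots> = fact n * exp (x + r - c * x\<^sup>2)" by (simp add: exp_add exp_diff exp_minus field_simps)
    also have "\<dots> \<le> fact n * exp (r + 1 / (4 * c))"
    proof -
      have "0 \<le> (2 * c * x - 1)\<^sup>2 / (4 * c)" using assms(2) by simp
      also have "\<dots> = c * x\<^sup>2 - x + 1 / (4 * c)" using assms(2) by (simp add: field_simps power2_eq_square)
      finally show ?thesis by simp
    qed
    finally show ?thesis .
  qed
  have "(norm z + R) ^ k * \<bar>gaussian c p z\<bar> \<le> C * (fact n * exp (r + 1 / (4 * c)))" for z
  proof -
    have "(norm z + R) ^ k * \<bar>p z\<bar> \<le> (norm z + r) ^ k * (C * (norm z + r) ^ m)"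
    proof (intro mult_mono power_mono)
      show "\<bar>p z\<bar> \<le> C * (norm z + r) ^ m"
        using C(2)[of z] mult_left_mono[OF power_mono[of "1 + norm z" "norm z + r" m] C(1)] assms(3) by (simp add: r_def)
    qed (use assms(3) C(1) in \<open>auto simp: r_def\<close>)
    then have "(norm z + R) ^ k * \<bar>p z\<bar> * exp (- c * (norm z)\<^sup>2) \<le> (norm z + r) ^ k * (C * (norm z + r) ^ m) * exp (- c * (norm z)\<^sup>2)"
      by (rule mult_right_mono) simp
    also have "\<dots> = C * ((norm z + r) ^ n * exp (- c * (norm z)\<^sup>2))" by (simp add: n_def power_add)
    also have "\<dots> \<le> C * (fact n * exp (r + 1 / (4 * c)))" using C(1) ex[of "norm z"] by (intro mult_left_mono) auto
    finally show ?thesis by (simp add: gaussian_def abs_mult dot_square_norm mult.assoc)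
  qed
  then show ?thesis by blast
qed

text \<open>The integral over a box amounts to extending \<open>\<psi>\<close> by zero; compactness
  of the box makes differentiation under the integral a matter of continuity.\<close>

definition conv :: "'a::euclidean_space \<Rightarrow> 'a \<Rightarrow> ('a \<Rightarrow> real) \<Rightarrow> ('a \<Rightarrow> real) \<Rightarrow> 'a \<Rightarrow> real"
  where "conv a b \<psi> k z = integral (cbox a b) (\<lambda>y. \<psi> y * k (z - y))"

lemma conv_has_derivative:
  fixes \<psi> :: "'a::euclidean_space \<Rightarrow> real"
  assumes \<psi>: "continuous_on (cbox a b) \<psi>"
    and k: "\<And>z. (k has_derivative (\<lambda>v. G z \<bullet> v)) (at z)" and G: "continuous_on UNIV G"
  shows "(conv a b \<psi> k has_derivative (\<lambda>v. conv a b \<psi> (\<lambda>z. G z \<bullet> v) z)) (at z)"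
proof -
  define fx where "fx z y = \<psi> y *\<^sub>R blinfun_inner_right (G (z - y))" for z y
  have kc: "continuous_on UNIV k" by (rule has_derivative_continuous_on_UNIV[OF k])
  have fxc: "continuous_on (UNIV \<times> cbox a b) (\<lambda>(z, y). fx z y)"
    unfolding fx_def split_def
    by (intro continuous_intros continuous_on_compose2[OF \<psi>] continuous_on_compose2[OF G]
        bounded_linear.continuous_on[OF bounded_linear_blinfun_inner_right]) auto
  have "((\<lambda>z. integral (cbox a b) (\<lambda>y. \<psi> y * k (z - y))) has_derivative integral (cbox a b) (fx z)) (at z within UNIV)"
  proof (rule leibniz_rule[OF _ _ fxc])
    show "((\<lambda>z. \<psi> y * k (z - y)) has_derivative blinfun_apply (fx z y)) (at z within UNIV)" for z y
    proof -
      have "((\<lambda>z. z - y) has_derivative (\<lambda>v. v)) (at z)" by (auto intro!: derivative_eq_intros)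
      from has_derivative_mult_right[OF has_derivative_compose[OF this k], of "\<psi> y"]
      show ?thesis by (simp add: fx_def scaleR_blinfun.rep_eq)
    qed
    show "(\<lambda>y. \<psi> y * k (z - y)) integrable_on cbox a b" for z
      by (intro integrable_continuous continuous_intros \<psi> continuous_on_compose2[OF kc]) auto
  qed auto
  moreover have "blinfun_apply (integral (cbox a b) (fx z)) v = conv a b \<psi> (\<lambda>z. G z \<bullet> v) z" for v
  proof -
    have "continuous_on (cbox a b) (\<lambda>y. (\<lambda>(z, y). fx z y) (z, y))"
      by (rule continuous_on_compose2[OF fxc]) (auto intro!: continuous_intros)
    then have "fx z integrable_on cbox a b" by (intro integrable_continuous) simp
    then have "blinfun_apply (integral (cbox a b) (fx z)) v = integral (cbox a b) (\<lambda>y. blinfun_apply (fx z y) v)"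
      by (rule blinfun_apply_integral)
    then show ?thesis by (simp add: conv_def fx_def scaleR_blinfun.rep_eq)
  qed
  ultimately have "blinfun_apply (integral (cbox a b) (fx z)) = (\<lambda>v. conv a b \<psi> (\<lambda>z. G z \<bullet> v) z)"
    and "(conv a b \<psi> k has_derivative blinfun_apply (integral (cbox a b) (fx z))) (at z)"
    by (auto simp: conv_def[abs_def])
  then show ?thesis by simp
qed

lemma conv_gaussian_bounded:
  fixes \<psi> :: "'a::euclidean_space \<Rightarrow> real"
  assumes \<psi>: "continuous_on (cbox a b) \<psi>" and p: "real_polynomial_function p" and c: "c > 0"
  shows "bounded (range (\<lambda>z. norm z ^ k * conv a b \<psi> (gaussian c p) z))"
proof -
  obtain R where R: "R > 0" "\<And>y. y \<in> cbox a b \<Longrightarrow> norm y \<le> R"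
    using bounded_cbox[of a b] unfolding bounded_pos by blast
  obtain M where M: "\<And>z. (norm z + R) ^ k * \<bar>gaussian c p z\<bar> \<le> M"
    using gaussian_decay[OF p c, of R k] R by auto
  have "norm (norm z ^ k * conv a b \<psi> (gaussian c p) z) \<le> integral (cbox a b) (\<lambda>y. \<bar>\<psi> y\<bar> * M)" for z
  proof -
    have kc: "continuous_on (cbox a b) (\<lambda>y. gaussian c p (z - y))"
      by (intro continuous_on_compose2[OF gaussian_continuous[OF p, of UNIV]] continuous_intros) auto
    have "norm (integral (cbox a b) (\<lambda>y. norm z ^ k * (\<psi> y * gaussian c p (z - y)))) \<le> integral (cbox a b) (\<lambda>y. \<bar>\<psi> y\<bar> * M)"
    proof (rule integral_norm_bound_integral)
      fix y assume y: "y \<in> cbox a b"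
      have "norm z \<le> norm (z - y) + R" using norm_triangle_sub[of z y] R(2)[OF y] by simp
      then have "norm z ^ k * \<bar>gaussian c p (z - y)\<bar> \<le> (norm (z - y) + R) ^ k * \<bar>gaussian c p (z - y)\<bar>"
        by (intro mult_right_mono power_mono) auto
      also note M
      finally have "\<bar>\<psi> y\<bar> * (norm z ^ k * \<bar>gaussian c p (z - y)\<bar>) \<le> \<bar>\<psi> y\<bar> * M"
        by (rule mult_left_mono) simp
      then show "norm (norm z ^ k * (\<psi> y * gaussian c p (z - y))) \<le> \<bar>\<psi> y\<bar> * M" by (simp add: abs_mult mult_ac)
    qed (intro integrable_continuous continuous_intros \<psi> kc)+
    then show ?thesis by (simp add: conv_def)
  qed
  then show ?thesis unfolding bounded_iff by blast
qed

lemma conv_gaussian_schwartz: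
  fixes \<psi> :: "'a::euclidean_space \<Rightarrow> real"
  assumes \<psi>: "continuous_on (cbox a b) \<psi>" and p: "real_polynomial_function p" and c: "c > 0"
  shows "conv a b \<psi> (gaussian c p) \<in> schwartz_space"
proof -
  have *: "\<exists>p'. real_polynomial_function p' \<and> foldr dderiv vs (conv a b \<psi> (gaussian c p)) = conv a b \<psi> (gaussian c p')" for vs
  proof (induction vs)
    case Nil
    then show ?case using p by auto
  next
    case (Cons v vs)
    then obtain p' where p': "real_polynomial_function p'" "foldr dderiv vs (conv a b \<psi> (gaussian c p)) = conv a b \<psi> (gaussian c p')"
      by blast
    obtain G where G: "\<And>z. (gaussian c p' has_derivative (\<lambda>v. G z \<bullet> v)) (at z)" "continuous_on UNIV G"
      "\<And>i. \<exists>p'. real_polynomial_function p' \<and> (\<forall>z. G z \<bullet> i = gaussian c p' z)"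
      using gaussian_gradient[OF p'(1), of c] by blast
    obtain p2 where p2: "real_polynomial_function p2" "\<And>z. G z \<bullet> v = gaussian c p2 z" using G(3)[of v] by blast
    have "dderiv v (conv a b \<psi> (gaussian c p')) z = conv a b \<psi> (gaussian c p2) z" for z
      unfolding dderiv_def frechet_derivative_at[OF conv_has_derivative[OF \<psi> G(1,2)], symmetric] by (simp add: p2)
    with p' p2(1) show ?case by auto
  qed
  have "conv a b \<psi> (gaussian c p') differentiable (at z)" if "real_polynomial_function p'" for p' z
    using gaussian_gradient[OF that, of c] conv_has_derivative[OF \<psi>] unfolding differentiable_def by metis
  note d = this
  show ?thesis
    unfolding schwartz_space_def smooth_def mem_Collect_eq
  proof (intro conjI allI impI)
    fix vs :: "'a list" and x :: 'a and k :: nat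
    obtain p' where p': "real_polynomial_function p'" "foldr dderiv vs (conv a b \<psi> (gaussian c p)) = conv a b \<psi> (gaussian c p')"
      using * by blast
    show "foldr dderiv vs (conv a b \<psi> (gaussian c p)) differentiable (at x)"
      unfolding p'(2) by (rule d[OF p'(1)])
    show "bounded (range (\<lambda>z. norm z ^ k * foldr dderiv vs (conv a b \<psi> (gaussian c p)) z))"
      unfolding p'(2) by (rule conv_gaussian_bounded[OF \<psi> p'(1) c])
  qed
qed

section \<open>Gaussian averages of measurable functions\<close>

lemma nn_integral_affine:
  fixes f :: "'a::euclidean_space \<Rightarrow> ennreal"
  assumes [measurable]: "f \<in> borel_measurable borel" and "c \<noteq> 0"
  shows "(\<integral>\<^sup>+x. f x \<partial>lborel) = ennreal (\<bar>c\<bar> ^ DIM('a)) * (\<integral>\<^sup>+x. f (t + c *\<^sub>R x) \<partial>lborel)"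
  by (subst lborel_affine[OF assms(2), of t])
    (simp add: nn_integral_density nn_integral_distr nn_integral_cmult)

lemma LINT_affine:
  fixes f :: "'a::euclidean_space \<Rightarrow> real"
  assumes [measurable]: "f \<in> borel_measurable borel" and "c \<noteq> 0"
  shows "(LINT x|lborel. f x) = \<bar>c\<bar> ^ DIM('a) * (LINT x|lborel. f (t + c *\<^sub>R x))"
  by (subst lborel_affine[OF assms(2), of t])
    (simp add: integral_density integral_distr)

text \<open>The normalising integral is left unevaluated; only its finiteness and positivity
  enter.\<close>

definition heat_kernel :: "'a::euclidean_space \<Rightarrow> real"
  where "heat_kernel y = exp (- (y \<bullet> y)) / (LINT x::'a|lborel. exp (- (x \<bullet> x)))"

lemma gauss_integral_pos: "0 < (LINT x::'a::euclidean_space|lborel. exp (- (x \<bullet> x)))"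
proof -
  have "0 \<noteq> (LINT x::'a|lborel. exp (- (x \<bullet> x)))"
  proof
    assume "0 = (LINT x::'a|lborel. exp (- (x \<bullet> x)))"
    then have "AE x in (lborel :: 'a measure). exp (- (x \<bullet> x)) = 0"
      using integral_nonneg_eq_0_iff_AE[OF integrable_gaussian[where 'a='a]] by simp
    then show False by (simp add: eventually_False ae_filter_eq_bot_iff)
  qed
  then show ?thesis by (simp add: order.strict_iff_order)
qed

lemma heat_kernel_pos [simp]: "heat_kernel (y::'a::euclidean_space) > 0"
  using gauss_integral_pos[where 'a='a] by (simp add: heat_kernel_def)

lemma heat_kernel_nonneg [simp]: "heat_kernel (y::'a::euclidean_space) \<ge> 0"
  using heat_kernel_pos[of y] by linarith

lemma heat_kernel_props:
  shows "integrable lborel (heat_kernel :: 'a::euclidean_space \<Rightarrow> real)"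
    "(LINT y::'a|lborel. heat_kernel y) = 1" "(heat_kernel :: 'a \<Rightarrow> real) \<in> borel_measurable borel"
    "(\<integral>\<^sup>+(y::'a). ennreal (heat_kernel y) \<partial>lborel) = 1"
proof -
  show i: "integrable lborel (heat_kernel :: 'a \<Rightarrow> real)"
    unfolding heat_kernel_def by (intro integrable_divide integrable_gaussian)
  show l: "(LINT y::'a|lborel. heat_kernel y) = 1"
    using gauss_integral_pos[where 'a='a] by (simp add: heat_kernel_def)
  show "(heat_kernel :: 'a \<Rightarrow> real) \<in> borel_measurable borel" using borel_measurable_integrable[OF i] by simp
  show "(\<integral>\<^sup>+(y::'a). ennreal (heat_kernel y) \<partial>lborel) = 1"
    using nn_integral_eq_integral[OF i] l by simp
qed

declare heat_kernel_props(3)[measurable]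

text \<open>The probabilistic form of mollification. It makes sense for bounded measurable
  functions, so the measure-theoretic facts are proved here, while smoothness is proved for
  \<open>conv\<close>; \<open>mollify_eq_mean\<close> identifies the two.\<close>

definition mean :: "real \<Rightarrow> ('a::euclidean_space \<Rightarrow> real) \<Rightarrow> 'a \<Rightarrow> real"
  where "mean e h z = (LINT y|lborel. heat_kernel y * h (z - e *\<^sub>R y))"

lemma mean_integrable:
  fixes h :: "'a::euclidean_space \<Rightarrow> real"
  assumes [measurable]: "h \<in> borel_measurable borel" and B: "\<And>y. \<bar>h y\<bar> \<le> B"
  shows "integrable lborel (\<lambda>y. heat_kernel y * h (z - e *\<^sub>R y))"
proof (rule Bochner_Integration.integrable_bound)
  show "integrable lborel (\<lambda>y::'a. heat_kernel y * B)"
    by (intro integrable_mult_left heat_kernel_props)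
  show "AE y::'a in lborel. norm (heat_kernel y * h (z - e *\<^sub>R y)) \<le> norm (heat_kernel y * B)"
    using B order_trans[OF B abs_ge_self] by (intro AE_I2) (auto simp: abs_mult intro!: mult_left_mono)
qed measurable

text \<open>Jensen's inequality for the density \<open>heat_kernel\<close>, obtained from the
  nonnegativity of the variance.\<close>

lemma mean_square_le:
  fixes h :: "'a::euclidean_space \<Rightarrow> real"
  assumes [measurable]: "h \<in> borel_measurable borel" and B: "\<And>y. \<bar>h y\<bar> \<le> B"
  shows "(mean e h z)\<^sup>2 \<le> mean e (\<lambda>y. (h y)\<^sup>2) z"
proof -
  have B2: "\<bar>(h y)\<^sup>2\<bar> \<le> B\<^sup>2" for y using B[of y] by (simp add: abs_le_square_iff[symmetric])
  have i: "integrable lborel (\<lambda>y. heat_kernel y * h (z - e *\<^sub>R y))" by (rule mean_integrable[OF _ B]) simp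
  have i2: "integrable lborel (\<lambda>y. heat_kernel y * (h (z - e *\<^sub>R y))\<^sup>2)" by (rule mean_integrable[OF _ B2]) simp
  define m where "m = mean e h z"
  have "0 \<le> (LINT y|lborel. heat_kernel y * (h (z - e *\<^sub>R y) - m)\<^sup>2)"
    by (intro integral_nonneg_AE AE_I2) simp
  also have "(\<lambda>y. heat_kernel y * (h (z - e *\<^sub>R y) - m)\<^sup>2)
      = (\<lambda>y. heat_kernel y * (h (z - e *\<^sub>R y))\<^sup>2 - 2 * m * (heat_kernel y * h (z - e *\<^sub>R y)) + m\<^sup>2 * heat_kernel y)"
    by (auto simp: power2_diff algebra_simps)
  also have "(LINT y|lborel. \<dots> y) = mean e (\<lambda>y. (h y)\<^sup>2) z - 2 * m * m + m\<^sup>2 * 1"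
    using i i2 heat_kernel_props(1,2)[where 'a='a] by (simp add: mean_def m_def)
  finally show ?thesis by (simp add: m_def power2_eq_square)
qed

lemma mean_eq_nn_integral:
  fixes h :: "'a::euclidean_space \<Rightarrow> real"
  assumes [measurable]: "h \<in> borel_measurable borel" and B: "\<And>y. \<bar>h y\<bar> \<le> B" and h: "\<And>y. 0 \<le> h y"
  shows "ennreal (mean e h z) = (\<integral>\<^sup>+y. ennreal (heat_kernel y * h (z - e *\<^sub>R y)) \<partial>lborel)"
  unfolding mean_def using h
  by (intro nn_integral_eq_integral[symmetric] mean_integrable[OF _ B] AE_I2) (auto simp: less_imp_le)

lemma mean_measurable [measurable]:
  fixes h :: "'a::euclidean_space \<Rightarrow> real"
  assumes [measurable]: "h \<in> borel_measurable borel"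
  shows "mean e h \<in> borel_measurable borel"
  unfolding mean_def by measurable

text \<open>Tonelli and translation invariance. Together with \<open>mean_square_le\<close> this
  says that mollification does not increase the L^2 norm.\<close>

lemma nn_integral_mean:
  fixes h :: "'a::euclidean_space \<Rightarrow> real"
  assumes [measurable]: "h \<in> borel_measurable borel" and B: "\<And>y. \<bar>h y\<bar> \<le> B" and h: "\<And>y. 0 \<le> h y"
  shows "(\<integral>\<^sup>+z. ennreal (mean e h z) \<partial>lborel) = (\<integral>\<^sup>+z. ennreal (h z) \<partial>lborel)"
proof -
  have "(\<integral>\<^sup>+z. ennreal (mean e h z) \<partial>lborel)
      = (\<integral>\<^sup>+z. \<integral>\<^sup>+y. ennreal (heat_kernel y * h (z - e *\<^sub>R y)) \<partial>lborel \<partial>lborel)"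
    by (simp add: mean_eq_nn_integral[OF assms])
  also have "\<dots> = (\<integral>\<^sup>+y. \<integral>\<^sup>+z. ennreal (heat_kernel y * h (z - e *\<^sub>R y)) \<partial>lborel \<partial>lborel)"
    by (rule lborel_pair.Fubini'[symmetric]) measurable
  also have "\<dots> = (\<integral>\<^sup>+(y::'a). ennreal (heat_kernel y) * (\<integral>\<^sup>+z. ennreal (h z) \<partial>lborel) \<partial>lborel)"
  proof (rule nn_integral_cong)
    fix y :: 'a
    have "(\<integral>\<^sup>+z. ennreal (heat_kernel y * h (z - e *\<^sub>R y)) \<partial>lborel)
        = ennreal (heat_kernel y) * (\<integral>\<^sup>+z. ennreal (h (z - e *\<^sub>R y)) \<partial>lborel)"
      using h by (simp add: ennreal_mult nn_integral_cmult)
    also have "(\<integral>\<^sup>+z. ennreal (h (z - e *\<^sub>R y)) \<partial>lborel) = (\<integral>\<^sup>+z. ennreal (h z) \<partial>lborel)"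
      using nn_integral_affine[of "\<lambda>z. ennreal (h z)" 1 "- e *\<^sub>R y"] by simp
    finally show "(\<integral>\<^sup>+z. ennreal (heat_kernel y * h (z - e *\<^sub>R y)) \<partial>lborel) = ennreal (heat_kernel y) * (\<integral>\<^sup>+z. ennreal (h z) \<partial>lborel)" .
  qed
  also have "\<dots> = (\<integral>\<^sup>+z. ennreal (h z) \<partial>lborel)"
    using heat_kernel_props(4)[where 'a='a] by (simp add: nn_integral_multc)
  finally show ?thesis .
qed

lemma mean_tendsto:
  fixes h :: "'a::euclidean_space \<Rightarrow> real"
  assumes [measurable]: "h \<in> borel_measurable borel" and B: "\<And>y. \<bar>h y\<bar> \<le> B" and c: "isCont h z"
    and e: "e \<longlonglongrightarrow> 0"
  shows "(\<lambda>n. mean (e n) h z) \<longlonglongrightarrow> h z"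
proof -
  have "(\<lambda>n. LINT y|lborel. heat_kernel y * h (z - e n *\<^sub>R y)) \<longlonglongrightarrow> (LINT y::'a|lborel. heat_kernel y * h z)"
  proof (rule integral_dominated_convergence[where w = "\<lambda>y::'a. heat_kernel y * B"])
    show "integrable lborel (\<lambda>y::'a. heat_kernel y * B)" by (intro integrable_mult_left heat_kernel_props)
    show "AE y::'a in lborel. norm (heat_kernel y * h (z - e n *\<^sub>R y)) \<le> heat_kernel y * B" for n
      using B by (intro AE_I2) (auto simp: abs_mult intro!: mult_left_mono)
    show "AE y in lborel. (\<lambda>n. heat_kernel y * h (z - e n *\<^sub>R y)) \<longlonglongrightarrow> heat_kernel y * h z"
    proof (intro AE_I2 tendsto_mult tendsto_const)
      fix y
      have "(\<lambda>n. z - e n *\<^sub>R y) \<longlonglongrightarrow> z - 0 *\<^sub>R y" by (intro tendsto_intros e)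
      then show "(\<lambda>n. h (z - e n *\<^sub>R y)) \<longlonglongrightarrow> h z" using isCont_tendsto_compose[OF c] by simp
    qed
  qed measurable
  then show ?thesis by (simp add: mean_def heat_kernel_props)
qed

definition mollify :: "'a::euclidean_space \<Rightarrow> 'a \<Rightarrow> real \<Rightarrow> ('a \<Rightarrow> real) \<Rightarrow> 'a \<Rightarrow> real"
  where "mollify a b e \<psi> = conv a b \<psi> (gaussian (1 / e\<^sup>2) (\<lambda>_. 1 / (e ^ DIM('a) * (LINT x::'a|lborel. exp (- (x \<bullet> x))))))"

text \<open>The substitution y = z - e y' absorbs the factor e^(-d) of the scaled kernel.\<close>

lemma mollify_eq_mean:
  fixes \<psi> :: "'a::euclidean_space \<Rightarrow> real"
  assumes \<psi>: "continuous_on (cbox a b) \<psi>" and e: "e > 0"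
  shows "mollify a b e \<psi> z = mean e (\<lambda>y. indicator (cbox a b) y * \<psi> y) z"
proof -
  define N where "N = (LINT x::'a|lborel. exp (- (x \<bullet> x)))"
  define k where "k = gaussian (1 / e\<^sup>2) (\<lambda>_::'a. 1 / (e ^ DIM('a) * N))"
  have kc: "continuous_on S k" for S unfolding k_def by (rule gaussian_continuous) (rule real_polynomial_function.intros)
  have "set_integrable lborel (cbox a b) (\<lambda>y. \<psi> y * k (z - y))"
    unfolding set_integrable_def
    by (rule borel_integrable_compact)
      (auto intro!: continuous_intros \<psi> continuous_on_compose2[OF kc[of UNIV]])
  then have "mollify a b e \<psi> z = (LINT y:cbox a b|lborel. \<psi> y * k (z - y))"
    by (simp add: mollify_def conv_def k_def N_def set_borel_integral_eq_integral)
  also have "\<dots> = (LINT y|lborel. (indicator (cbox a b) y * \<psi> y) * k (z - y))"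
    by (simp add: set_lebesgue_integral_def mult_ac)
  also have "\<dots> = \<bar>- e\<bar> ^ DIM('a) * (LINT y|lborel. (indicator (cbox a b) (z + (- e) *\<^sub>R y) * \<psi> (z + (- e) *\<^sub>R y)) * k (z - (z + (- e) *\<^sub>R y)))"
  proof (rule LINT_affine)
    have "(\<lambda>y. indicator (cbox a b) y *\<^sub>R \<psi> y) \<in> borel_measurable borel"
      using borel_measurable_continuous_on_indicator[OF _ \<psi>] by auto
    moreover have "(\<lambda>y. k (z - y)) \<in> borel_measurable borel"
      by (intro borel_measurable_continuous_onI continuous_on_compose2[OF kc[of UNIV]] continuous_intros) auto
    ultimately show "(\<lambda>y. (indicator (cbox a b) y * \<psi> y) * k (z - y)) \<in> borel_measurable borel" by simp
  qed (use e in simp)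
  also have "\<dots> = mean e (\<lambda>y. indicator (cbox a b) y * \<psi> y) z"
  proof -
    have k: "\<bar>- e\<bar> ^ DIM('a) * k (z - (z + (- e) *\<^sub>R y)) = heat_kernel y" for y
      using e by (simp add: k_def gaussian_def heat_kernel_def N_def power2_eq_square)
    have "\<bar>- e\<bar> ^ DIM('a) * ((indicator (cbox a b) (z + (- e) *\<^sub>R y) * \<psi> (z + (- e) *\<^sub>R y)) * k (z - (z + (- e) *\<^sub>R y)))
        = heat_kernel y * (indicator (cbox a b) (z - e *\<^sub>R y) * \<psi> (z - e *\<^sub>R y))" for y
      unfolding k[symmetric] by simp
    then show ?thesis
      unfolding mean_def integral_mult_right_zero[symmetric] by (rule Bochner_Integration.integral_cong[OF refl])
  qed
  finally show ?thesis .
qed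

lemma mollify_schwartz:
  assumes "continuous_on (cbox a b) \<psi>" "e > 0"
  shows "mollify a b e \<psi> \<in> schwartz_space"
  unfolding mollify_def by (rule conv_gaussian_schwartz) (use assms in \<open>auto intro: real_polynomial_function.intros\<close>)

text \<open>The derivative first falls on the kernel; for each fixed time an integration by parts in
  space moves it to \<open>\<psi>\<close>. Time slices are treated separately, so the jump at
  \<open>t1\<close> and \<open>t2\<close> of the zero extension of \<open>\<psi>\<close> does no
  harm.\<close>

lemma mollify_gradient:
  fixes \<psi> :: "real \<times> 'a::euclidean_space \<Rightarrow> real"
  assumes \<psi>: "continuous_on ({t1..t2} \<times> UNIV) \<psi>" and G: "continuous_on ({t1..t2} \<times> UNIV) G"
    and d: "\<And>t x. t1 \<le> t \<Longrightarrow> t \<le> t2 \<Longrightarrow> ((\<lambda>x. \<psi> (t, x)) has_derivative (\<lambda>v. G (t, x) \<bullet> v)) (at x)"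
    and z: "\<And>t x. t1 \<le> t \<Longrightarrow> t \<le> t2 \<Longrightarrow> R < norm x \<Longrightarrow> \<psi> (t, x) = 0"
    and ab: "cball 0 R \<subseteq> cbox a b" and e: "e > 0"
  shows "((\<lambda>x. mollify (t1, a) (t2, b) e \<psi> (t, x)) has_derivative (\<lambda>v. mollify (t1, a) (t2, b) e (\<lambda>y. G y \<bullet> v) (t, x))) (at x)"
proof -
  define p where "p = (\<lambda>_::real \<times> 'a. 1 / (e ^ DIM(real \<times> 'a) * (LINT x::real \<times> 'a|lborel. exp (- (x \<bullet> x)))))"
  define c where "c = 1 / e\<^sup>2"
  define k where "k = gaussian c p"
  have p: "real_polynomial_function p" unfolding p_def by (rule real_polynomial_function.intros)
  obtain K where K: "\<And>z. (k has_derivative (\<lambda>v. K z \<bullet> v)) (at z)" "continuous_on UNIV K"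
    using gaussian_gradient[OF p, of c] unfolding k_def by blast
  have kc: "continuous_on UNIV k" by (rule has_derivative_continuous_on_UNIV[OF K(1)])
  have sub: "cbox (t1, a) (t2, b) \<subseteq> {t1..t2} \<times> UNIV" by (auto simp: cbox_Pair_eq)
  have "((\<lambda>x. (t, x)) has_derivative (\<lambda>v. (0, v))) (at x)"
    by (auto intro!: derivative_eq_intros)
  from has_derivative_compose[OF this conv_has_derivative[OF continuous_on_subset[OF \<psi> sub] K]]
  have "((\<lambda>x. conv (t1, a) (t2, b) \<psi> k (t, x)) has_derivative
      (\<lambda>v. conv (t1, a) (t2, b) \<psi> (\<lambda>z. K z \<bullet> (0, v)) (t, x))) (at x)" .
  moreover have "conv (t1, a) (t2, b) \<psi> (\<lambda>z. K z \<bullet> (0, v)) (t, x) = conv (t1, a) (t2, b) (\<lambda>y. G y \<bullet> v) k (t, x)" for v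
  proof -
    have "conv (t1, a) (t2, b) \<psi> (\<lambda>z. K z \<bullet> (0, v)) (t, x)
        = integral (cbox t1 t2) (\<lambda>r. integral (cbox a b) (\<lambda>y. \<psi> (r, y) * (K ((t, x) - (r, y)) \<bullet> (0, v))))"
      unfolding conv_def
      by (rule integral_prod_continuous)
        (intro continuous_intros continuous_on_subset[OF \<psi> sub] continuous_on_compose2[OF K(2)], auto)
    also have "\<dots> = integral (cbox t1 t2) (\<lambda>r. integral (cbox a b) (\<lambda>y. (G (r, y) \<bullet> v) * k ((t, x) - (r, y))))"
    proof (rule integral_cong)
      fix r assume "r \<in> cbox t1 t2"
      then have r: "t1 \<le> r" "r \<le> t2" by auto
      have Gr: "continuous_on UNIV (\<lambda>y. G (r, y))" and \<psi>r: "continuous_on UNIV (\<lambda>y. \<psi> (r, y))"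
        by (rule continuous_on_compose2[OF G] continuous_on_compose2[OF \<psi>]; use r in \<open>auto intro!: continuous_intros\<close>)+
      have Kr: "continuous_on UNIV (\<lambda>y. K ((t, x) - (r, y)))" and kr: "continuous_on UNIV (\<lambda>y. k ((t, x) - (r, y)))"
        by (rule continuous_on_compose2[OF K(2)] continuous_on_compose2[OF kc]; auto intro!: continuous_intros)+
      have out: "R < norm y" if "y \<notin> cbox a b" for y using ab that by force
      define K2 where "K2 y = - snd (K ((t, x) - (r, y)))" for y
      have k2: "((\<lambda>y. k ((t, x) - (r, y))) has_derivative (\<lambda>v. K2 y \<bullet> v)) (at y)" for y
      proof -
        have "((\<lambda>y. (t, x) - (r, y)) has_derivative (\<lambda>v. (0, - v))) (at y)"
          by (auto intro!: derivative_eq_intros)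
        from has_derivative_compose[OF this K(1)] show ?thesis by (simp add: K2_def inner_prod_def)
      qed
      have K2: "continuous_on UNIV K2" unfolding K2_def by (intro continuous_intros Kr)
      have Gz: "G (r, y) = 0" if "R < norm y" for y
        by (rule zero_gradient_outside_support[OF d[OF r] z[OF r] that])
      have "integral (cbox a b) (\<lambda>y. \<psi> (r, y) * (K ((t, x) - (r, y)) \<bullet> (0, v)))
          = - (LINT y|lborel. \<psi> (r, y) * (K2 y \<bullet> v))"
      proof -
        have "(LINT y|lborel. \<psi> (r, y) * (K ((t, x) - (r, y)) \<bullet> (0, v)))
            = integral (cbox a b) (\<lambda>y. \<psi> (r, y) * (K ((t, x) - (r, y)) \<bullet> (0, v)))"
        proof (rule LINT_eq_integral_cbox)
          show "\<psi> (r, y) * (K ((t, x) - (r, y)) \<bullet> (0, v)) = 0" if "y \<notin> cbox a b" for y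
            using z[OF r out[OF that]] by simp
        qed (intro continuous_intros \<psi>r Kr)
        then show ?thesis by (simp add: K2_def inner_prod_def)
      qed
      also have "\<dots> = (LINT y|lborel. k ((t, x) - (r, y)) * (G (r, y) \<bullet> v))"
        using LINT_by_parts[OF d[OF r] Gr k2 K2 z[OF r], where v = v] by simp
      also have "\<dots> = integral (cbox a b) (\<lambda>y. k ((t, x) - (r, y)) * (G (r, y) \<bullet> v))"
      proof (rule LINT_eq_integral_cbox)
        show "k ((t, x) - (r, y)) * (G (r, y) \<bullet> v) = 0" if "y \<notin> cbox a b" for y
          using Gz[OF out[OF that]] by simp
      qed (intro continuous_intros kr Gr)
      finally show "integral (cbox a b) (\<lambda>y. \<psi> (r, y) * (K ((t, x) - (r, y)) \<bullet> (0, v)))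
        = integral (cbox a b) (\<lambda>y. (G (r, y) \<bullet> v) * k ((t, x) - (r, y)))" by (simp add: mult.commute)
    qed
    also have "\<dots> = conv (t1, a) (t2, b) (\<lambda>y. G y \<bullet> v) k (t, x)"
      unfolding conv_def
      by (rule integral_prod_continuous[symmetric])
        (intro continuous_intros continuous_on_subset[OF G sub] continuous_on_compose2[OF kc], auto)
    finally show ?thesis .
  qed
  ultimately show ?thesis by (simp add: mollify_def p_def c_def k_def)
qed

subsection \<open>The form inequality for functions on strips\<close>

lemma nn_integral_lborel_fst:
  fixes f :: "'a::euclidean_space \<times> 'b::euclidean_space \<Rightarrow> ennreal"
  assumes "f \<in> borel_measurable borel"
  shows "(\<integral>\<^sup>+x. (\<integral>\<^sup>+y. f (x, y) \<partial>lborel) \<partial>lborel) = (\<integral>\<^sup>+z. f z \<partial>lborel)"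
    and "(\<lambda>x. \<integral>\<^sup>+y. f (x, y) \<partial>lborel) \<in> borel_measurable borel"
proof -
  have f: "f \<in> borel_measurable (lborel \<Otimes>\<^sub>M lborel)" using assms by (simp add: lborel_prod)
  show "(\<integral>\<^sup>+x. (\<integral>\<^sup>+y. f (x, y) \<partial>lborel) \<partial>lborel) = (\<integral>\<^sup>+z. f z \<partial>lborel)"
    using lborel.nn_integral_fst[OF f] by (simp add: lborel_prod)
  show "(\<lambda>x. \<integral>\<^sup>+y. f (x, y) \<partial>lborel) \<in> borel_measurable borel"
    using lborel.borel_measurable_nn_integral_fst[OF f] by simp
qed

lemma borel_measurable_slice:
  fixes f :: "'a::euclidean_space \<times> 'b::euclidean_space \<Rightarrow> 'c::topological_space"
  assumes [measurable]: "f \<in> borel_measurable borel"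
  shows "(\<lambda>y. f (x, y)) \<in> borel_measurable borel"
proof -
  have "(\<lambda>y. (x, y)) \<in> borel_measurable borel" by (intro borel_measurable_continuous_onI continuous_intros)
  then show ?thesis by measurable
qed

lemma norm_square_eq_sum_Basis: "(norm (x::'a::euclidean_space))\<^sup>2 = (\<Sum>i\<in>Basis. (x \<bullet> i)\<^sup>2)"
  unfolding power2_norm_eq_inner by (subst euclidean_inner) (simp add: power2_eq_square)

text \<open>Passes from Schwartz functions on [0, T] to functions on a shorter strip that are C^1 in
  space and cut off abruptly in time. This is possible because the form inequality contains no time
  derivative. The three terms of the mollified inequality need different arguments: Fatou for the
  left side, contractivity for the gradient term, dominated convergence for the term with
  \<open>g\<close>, which is merely integrable in time.\<close>

lemma form_inequality_test:
  fixes b :: "real \<times> 'a::euclidean_space \<Rightarrow> 'a"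
  assumes fi: "form_inequality T b \<delta> g" and bc: "continuous_on UNIV b"
    and g: "set_integrable lborel {0..T} g" "\<And>t. 0 \<le> g t"
    and t: "0 \<le> t1" "t1 \<le> t2" "t2 \<le> T"
    and \<psi>: "continuous_on ({t1..t2} \<times> UNIV) \<psi>" and G: "continuous_on ({t1..t2} \<times> UNIV) G"
    and d: "\<And>t x. t1 \<le> t \<Longrightarrow> t \<le> t2 \<Longrightarrow> ((\<lambda>x. \<psi> (t, x)) has_derivative (\<lambda>v. G (t, x) \<bullet> v)) (at x)"
    and z: "\<And>t x. t1 \<le> t \<Longrightarrow> t \<le> t2 \<Longrightarrow> R < norm x \<Longrightarrow> \<psi> (t, x) = 0"
  shows "(\<integral>\<^sup>+\<tau>\<in>{t1..t2}. L2_norm_sq (\<lambda>x. \<psi> (\<tau>, x) *\<^sub>R b (\<tau>, x)) \<partial>lborel)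
    \<le> ennreal \<delta> * (\<integral>\<^sup>+\<tau>\<in>{t1..t2}. L2_norm_sq (\<lambda>x. G (\<tau>, x)) \<partial>lborel)
      + (\<integral>\<^sup>+\<tau>\<in>{t1..t2}. ennreal (g \<tau>) * L2_norm_sq (\<lambda>x. \<psi> (\<tau>, x)) \<partial>lborel)"
proof -
  obtain a c :: 'a where ab: "cball 0 R \<subseteq> cbox a c" using ball_subset_cbox by blast
  let ?C = "cbox (t1, a) (t2, c)"
  have C_iff: "(r, x) \<in> ?C \<longleftrightarrow> t1 \<le> r \<and> r \<le> t2 \<and> x \<in> cbox a c" for r x by (simp add: cbox_Pair_eq)
  have sub: "?C \<subseteq> {t1..t2} \<times> UNIV" by (auto simp: cbox_Pair_eq)
  have out: "R < norm x" if "x \<notin> cbox a c" for x using ab that by force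
  have Gz: "G (r, x) = 0" if "t1 \<le> r" "r \<le> t2" "R < norm x" for r x
    by (rule zero_gradient_outside_support[OF d[OF that(1,2)] z[OF that(1,2)] that(3)])
  \<comment> \<open>Zero extension in time. On functions with the common spatial support it agrees
    with the restriction to the compact box \<open>?C\<close> that enters \<open>mollify\<close>,
    yet it is continuous in space across the boundary of the box.\<close>
  define ext where "ext k p = indicator {t1..t2} (fst p) * k p" for k :: "real \<times> 'a \<Rightarrow> real" and p
  have ext_eq: "indicator ?C p * k p = ext k p" if "\<And>t x. t1 \<le> t \<Longrightarrow> t \<le> t2 \<Longrightarrow> R < norm x \<Longrightarrow> k (t, x) = 0" for k p
    using that out by (cases p) (auto simp: ext_def indicator_def C_iff)
  have ext_meas: "ext k \<in> borel_measurable borel" if k: "continuous_on ({t1..t2} \<times> UNIV) k" for k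
  proof -
    have "closed ({t1..t2} \<times> (UNIV :: 'a set))" by (intro closed_Times) auto
    then have "(\<lambda>p. indicator ({t1..t2} \<times> UNIV) p *\<^sub>R k p) \<in> borel_measurable borel"
      by (intro borel_measurable_continuous_on_indicator[OF _ k]) simp
    then show ?thesis by (simp add: ext_def[abs_def] indicator_times)
  qed
  have ext_bdd: "\<exists>B. \<forall>p. \<bar>ext k p\<bar> \<le> B" if k: "continuous_on ({t1..t2} \<times> UNIV) k"
    and kz: "\<And>t x. t1 \<le> t \<Longrightarrow> t \<le> t2 \<Longrightarrow> R < norm x \<Longrightarrow> k (t, x) = 0" for k
  proof -
    have "bounded (k ` ?C)"
      by (intro compact_imp_bounded compact_continuous_image continuous_on_subset[OF k sub] compact_cbox)
    then obtain B where B: "B > 0" "\<And>p. p \<in> ?C \<Longrightarrow> \<bar>k p\<bar> \<le> B" unfolding bounded_pos by force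
    have "\<bar>ext k p\<bar> \<le> B" for p
    proof -
      have "ext k p = indicator ?C p * k p" by (rule ext_eq[symmetric]) (rule kz)
      then show ?thesis using B by (simp add: indicator_def)
    qed
    then show ?thesis by blast
  qed
  define e where "e n = 1 / real (Suc n)" for n
  have e: "e n > 0" for n by (simp add: e_def)
  have e0: "e \<longlonglongrightarrow> 0" unfolding e_def by (rule LIMSEQ_Suc[OF lim_1_over_n])
  define f where "f n = mollify (t1, a) (t2, c) (e n) \<psi>" for n
  define h where "h = ext \<psi>"
  define hi where "hi i = ext (\<lambda>p. G p \<bullet> i)" for i
  have hm [measurable]: "h \<in> borel_measurable borel" unfolding h_def by (rule ext_meas[OF \<psi>])
  have him [measurable]: "hi i \<in> borel_measurable borel" for i
    unfolding hi_def by (intro ext_meas continuous_intros G)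
  obtain B where B: "\<And>p. \<bar>h p\<bar> \<le> B" unfolding h_def using ext_bdd[OF \<psi> z] by blast
  have B0: "0 \<le> B" using B[of "(0, 0)"] by linarith
  have Bi: "\<exists>B. \<forall>p. \<bar>hi i p\<bar> \<le> B" for i
    unfolding hi_def by (rule ext_bdd) (auto intro!: continuous_intros G simp: Gz)
  have f_mean: "f n p = mean (e n) h p" for n p
  proof -
    have "(\<lambda>p. indicator ?C p * \<psi> p) = h"
      unfolding h_def by (rule ext, rule ext_eq) (rule z)
    then show ?thesis
      unfolding f_def mollify_eq_mean[OF continuous_on_subset[OF \<psi> sub] e] by simp
  qed
  have hi_eq: "(\<lambda>p. indicator ?C p * (G p \<bullet> i)) = hi i" for i
    unfolding hi_def by (rule ext, rule ext_eq) (simp add: Gz)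
  have bm [measurable]: "b \<in> borel_measurable borel" by (rule borel_measurable_continuous_onI[OF bc])
  have fm [measurable]: "f n \<in> borel_measurable borel" for n
    using mean_measurable[OF hm, of "e n"] by (simp add: f_mean[abs_def])

  have X_eq: "(\<integral>\<^sup>+p. ennreal (\<Sum>i\<in>Basis. (hi i p)\<^sup>2) \<partial>lborel) = (\<integral>\<^sup>+\<tau>\<in>{t1..t2}. L2_norm_sq (\<lambda>x. G (\<tau>, x)) \<partial>lborel)" (is "_ = ?X")
  proof -
    have "(\<integral>\<^sup>+p. ennreal (\<Sum>i\<in>Basis. (hi i p)\<^sup>2) \<partial>lborel)
        = (\<integral>\<^sup>+\<tau>. \<integral>\<^sup>+x. ennreal (\<Sum>i\<in>Basis. (hi i (\<tau>, x))\<^sup>2) \<partial>lborel \<partial>lborel)"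
      by (rule nn_integral_lborel_fst(1)[symmetric]) measurable
    also have "\<dots> = ?X"
    proof (rule nn_integral_cong)
      fix r
      show "(\<integral>\<^sup>+x. ennreal (\<Sum>i\<in>Basis. (hi i (r, x))\<^sup>2) \<partial>lborel) = L2_norm_sq (\<lambda>x. G (r, x)) * indicator {t1..t2} r"
        by (simp add: hi_def ext_def L2_norm_sq_def indicator_def norm_square_eq_sum_Basis)
    qed
    finally show ?thesis .
  qed
  \<comment> \<open>Jensen and preservation of the integral give a bound by the limit term for every
    \<open>n\<close>.\<close>
  have grad: "(\<integral>\<^sup>+\<tau>\<in>{0..T}. L2_norm_sq (gradient (\<lambda>x. f n (\<tau>, x))) \<partial>lborel) \<le> ?X" for n
  proof -
    have "(\<integral>\<^sup>+\<tau>\<in>{0..T}. L2_norm_sq (gradient (\<lambda>x. f n (\<tau>, x))) \<partial>lborel)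
       \<le> (\<integral>\<^sup>+\<tau>. \<integral>\<^sup>+x. (\<Sum>i\<in>Basis. ennreal (mean (e n) (\<lambda>p. (hi i p)\<^sup>2) (\<tau>, x))) \<partial>lborel \<partial>lborel)"
    proof (rule nn_integral_mono)
      fix r
      have "ennreal ((norm (gradient (\<lambda>x. f n (r, x)) x))\<^sup>2) \<le> (\<Sum>i\<in>Basis. ennreal (mean (e n) (\<lambda>p. (hi i p)\<^sup>2) (r, x)))" for x
      proof -
        have fd: "frechet_derivative (\<lambda>x. f n (r, x)) (at x) = (\<lambda>v. mollify (t1, a) (t2, c) (e n) (\<lambda>y. G y \<bullet> v) (r, x))"
          unfolding f_def by (rule frechet_derivative_at[symmetric], rule mollify_gradient[OF \<psi> G d z ab e])
        have "gradient (\<lambda>x. f n (r, x)) x = (\<Sum>i\<in>Basis. mean (e n) (hi i) (r, x) *\<^sub>R i)"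
          unfolding gradient_def dderiv_def fd
        proof (rule sum.cong[OF refl])
          fix i
          have "continuous_on ?C (\<lambda>y. G y \<bullet> i)" by (intro continuous_intros continuous_on_subset[OF G sub])
          from mollify_eq_mean[OF this e, of n "(r, x)"]
          show "mollify (t1, a) (t2, c) (e n) (\<lambda>y. G y \<bullet> i) (r, x) *\<^sub>R i = mean (e n) (hi i) (r, x) *\<^sub>R i"
            using hi_eq[of i] by simp
        qed
        then have "(norm (gradient (\<lambda>x. f n (r, x)) x))\<^sup>2 = (\<Sum>i\<in>Basis. (mean (e n) (hi i) (r, x))\<^sup>2)"
          by (simp add: norm_square_eq_sum_Basis inner_sum_left inner_Basis if_distrib cong: if_cong)
        also have "\<dots> \<le> (\<Sum>i\<in>Basis. mean (e n) (\<lambda>p. (hi i p)\<^sup>2) (r, x))"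
          by (intro sum_mono) (metis Bi him mean_square_le)
        finally show ?thesis
          by (subst sum_ennreal) (auto intro!: ennreal_leI simp: mean_def)
      qed
      then show "L2_norm_sq (gradient (\<lambda>x. f n (r, x))) * indicator {0..T} r
         \<le> (\<integral>\<^sup>+x. (\<Sum>i\<in>Basis. ennreal (mean (e n) (\<lambda>p. (hi i p)\<^sup>2) (r, x))) \<partial>lborel)"
        unfolding L2_norm_sq_def by (auto simp: indicator_def intro!: nn_integral_mono)
    qed
    also have "\<dots> = (\<integral>\<^sup>+p. (\<Sum>i\<in>Basis. ennreal (mean (e n) (\<lambda>p. (hi i p)\<^sup>2) p)) \<partial>lborel)"
      by (rule nn_integral_lborel_fst(1)) measurable
    also have "\<dots> = (\<Sum>i\<in>Basis. \<integral>\<^sup>+p. ennreal (mean (e n) (\<lambda>p. (hi i p)\<^sup>2) p) \<partial>lborel)"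
      by (rule nn_integral_sum) measurable
    also have "\<dots> = (\<Sum>i\<in>Basis. \<integral>\<^sup>+p. ennreal ((hi i p)\<^sup>2) \<partial>lborel)"
    proof (rule sum.cong[OF refl])
      fix i
      obtain Bi' where "\<And>p. \<bar>hi i p\<bar> \<le> Bi'" using Bi by blast
      then have "\<bar>(hi i p)\<^sup>2\<bar> \<le> Bi'\<^sup>2" for p by (simp add: abs_le_square_iff[symmetric])
        (metis abs_ge_self order_trans)
      then show "(\<integral>\<^sup>+p. ennreal (mean (e n) (\<lambda>p. (hi i p)\<^sup>2) p) \<partial>lborel) = (\<integral>\<^sup>+p. ennreal ((hi i p)\<^sup>2) \<partial>lborel)"
        by (intro nn_integral_mean) auto
    qed
    also have "\<dots> = (\<integral>\<^sup>+p. (\<Sum>i\<in>Basis. ennreal ((hi i p)\<^sup>2)) \<partial>lborel)"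
      by (rule nn_integral_sum[symmetric]) measurable
    also have "\<dots> = ?X" unfolding X_eq[symmetric] by (simp add: sum_ennreal)
    finally show ?thesis .
  qed

  define m0 where "m0 r = (LINT x|lborel. (\<psi> (r, x))\<^sup>2)" for r
  define m where "m r = indicator {t1..t2} r * m0 r" for r
  have \<psi>r: "continuous_on UNIV (\<lambda>y. \<psi> (r, y))" if "t1 \<le> r" "r \<le> t2" for r
    by (rule continuous_on_compose2[OF \<psi>]; use that in \<open>auto intro!: continuous_intros\<close>)
  have m0c: "continuous_on {t1..t2} m0"
    unfolding m0_def by (rule continuous_on_LINT[where R = R]) (use \<psi> z in \<open>auto simp: split_def intro!: continuous_intros\<close>)
  have m0_nn: "ennreal (m0 r) = L2_norm_sq (\<lambda>x. \<psi> (r, x))" if "t1 \<le> r" "r \<le> t2" for r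
  proof -
    have "integrable lborel (\<lambda>x. (\<psi> (r, x))\<^sup>2)"
      by (rule integrable_bounded_support[where R = R]) (use z that in \<open>auto intro!: continuous_intros \<psi>r\<close>)
    then show ?thesis by (simp add: m0_def L2_norm_sq_def nn_integral_eq_integral)
  qed
  have m_nn: "(\<integral>\<^sup>+x. ennreal ((h (r, x))\<^sup>2) \<partial>lborel) = ennreal (m r)" for r
    using m0_nn[of r] by (auto simp: h_def ext_def m_def indicator_def L2_norm_sq_def)
  have mm [measurable]: "m \<in> borel_measurable borel"
    unfolding m_def using borel_measurable_continuous_on_indicator[OF _ m0c] by simp
  have m_nonneg: "0 \<le> m r" for r by (simp add: m_def m0_def)
  obtain Bm where Bm: "\<And>r. \<bar>m r\<bar> \<le> Bm"
  proof -
    have "bounded (m0 ` {t1..t2})" by (intro compact_imp_bounded compact_continuous_image m0c) auto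
    then obtain B where "B > 0" "\<And>r. r \<in> {t1..t2} \<Longrightarrow> \<bar>m0 r\<bar> \<le> B" unfolding bounded_pos by force
    then have "\<bar>m r\<bar> \<le> B" for r by (auto simp: m_def indicator_def)
    then show ?thesis using that by blast
  qed
  \<comment> \<open>The squared norm of each slice, viewed as a function on space-time that is
    constant in space, so that its average over time shifts is again a \<open>mean\<close>.\<close>
  define mz where "mz = (\<lambda>p::real \<times> 'a. m (fst p))"
  have mzm [measurable]: "mz \<in> borel_measurable borel"
  proof -
    have "(fst :: real \<times> 'a \<Rightarrow> real) \<in> borel_measurable borel" by (intro borel_measurable_continuous_onI continuous_intros)
    then show ?thesis unfolding mz_def by measurable
  qed
  \<comment> \<open>After Jensen and Tonelli the spatial shift disappears in the space integral.
    What is left is a time average of the bounded function \<open>m\<close>, which an integrable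
    \<open>g\<close> can be paired with.\<close>
  have L2f: "L2_norm_sq (\<lambda>x. f n (r, x)) \<le> ennreal (mean (e n) mz (r, 0))" for n r
  proof -
    have B2: "\<bar>(h p)\<^sup>2\<bar> \<le> B\<^sup>2" for p using B[of p] B0 by (simp add: abs_le_square_iff[symmetric])
    have k[measurable]: "(\<lambda>(x, y). h (r - e n * fst y, x - e n *\<^sub>R snd y)) \<in> borel_measurable (borel \<Otimes>\<^sub>M borel)"
    proof -
      have "(\<lambda>p. h (r - e n * fst (snd p), fst p - e n *\<^sub>R snd (snd p))) \<in> borel_measurable borel"
        by (rule measurable_compose[OF _ hm]) (intro borel_measurable_continuous_onI continuous_intros)
      then show ?thesis by (simp add: borel_prod split_def)
    qed
    have "L2_norm_sq (\<lambda>x. f n (r, x)) \<le> (\<integral>\<^sup>+x. ennreal (mean (e n) (\<lambda>p. (h p)\<^sup>2) (r, x)) \<partial>lborel)"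
      unfolding L2_norm_sq_def using mean_square_le[OF hm B] by (intro nn_integral_mono ennreal_leI) (simp add: f_mean)
    also have "\<dots> = (\<integral>\<^sup>+x. \<integral>\<^sup>+y. ennreal (heat_kernel y * (h (r - e n * fst y, x - e n *\<^sub>R snd y))\<^sup>2) \<partial>lborel \<partial>lborel)"
      by (subst mean_eq_nn_integral[OF _ B2]) (auto simp: minus_prod_def scaleR_prod_def)
    also have "\<dots> = (\<integral>\<^sup>+y. \<integral>\<^sup>+x. ennreal (heat_kernel y * (h (r - e n * fst y, x - e n *\<^sub>R snd y))\<^sup>2) \<partial>lborel \<partial>lborel)"
      by (rule lborel_pair.Fubini'[symmetric]) measurable
    also have "\<dots> = (\<integral>\<^sup>+(y::real \<times> 'a). ennreal (heat_kernel y * mz ((r, 0) - e n *\<^sub>R y)) \<partial>lborel)"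
    proof (rule nn_integral_cong)
      fix y :: "real \<times> 'a"
      let ?r = "r - e n * fst y"
      have hr: "(\<lambda>x. h (?r, x)) \<in> borel_measurable borel" by (rule borel_measurable_slice[OF hm])
      have "(\<integral>\<^sup>+x. ennreal (heat_kernel y * (h (?r, x - e n *\<^sub>R snd y))\<^sup>2) \<partial>lborel)
          = ennreal (heat_kernel y) * (\<integral>\<^sup>+x. ennreal ((h (?r, - (e n *\<^sub>R snd y) + 1 *\<^sub>R x))\<^sup>2) \<partial>lborel)"
        using measurable_compose[OF _ hr, of "\<lambda>x. x - e n *\<^sub>R snd y" borel]
        by (simp add: ennreal_mult nn_integral_cmult)
      also have "(\<integral>\<^sup>+x. ennreal ((h (?r, - (e n *\<^sub>R snd y) + 1 *\<^sub>R x))\<^sup>2) \<partial>lborel) = ennreal (m ?r)"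
        using nn_integral_affine[of "\<lambda>x. ennreal ((h (?r, x))\<^sup>2)" 1 "- (e n *\<^sub>R snd y)"] hr by (simp add: m_nn)
      finally show "(\<integral>\<^sup>+x. ennreal (heat_kernel y * (h (?r, x - e n *\<^sub>R snd y))\<^sup>2) \<partial>lborel)
         = ennreal (heat_kernel y * mz ((r, 0) - e n *\<^sub>R y))"
        using m_nonneg by (simp add: mz_def ennreal_mult)
    qed
    also have "\<dots> = ennreal (mean (e n) mz (r, 0))"
      by (rule mean_eq_nn_integral[symmetric]) (use Bm m_nonneg in \<open>auto simp: mz_def mzm[unfolded mz_def]\<close>)
    finally show ?thesis .
  qed

  define g' where "g' r = indicator {0..T} r * g r" for r
  have g': "integrable lborel g'" using g(1) by (simp add: set_integrable_def g'_def[abs_def])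
  have g'm [measurable]: "g' \<in> borel_measurable borel" using borel_measurable_integrable[OF g'] by simp
  have g'0: "0 \<le> g' r" for r using g(2) by (simp add: g'_def)
  define J where "J n = (\<integral>\<^sup>+r. ennreal (g' r * mean (e n) mz (r, 0)) \<partial>lborel)" for n
  define J' where "J' = (\<integral>\<^sup>+r. ennreal (g' r * m r) \<partial>lborel)"
  have mean_nonneg: "0 \<le> mean (e n) mz p" for n p unfolding mean_def mz_def by (simp add: m_nonneg)
  have gterm: "(\<integral>\<^sup>+\<tau>\<in>{0..T}. ennreal (g \<tau>) * L2_norm_sq (\<lambda>x. f n (\<tau>, x)) \<partial>lborel) \<le> J n" for n
    unfolding J_def
  proof (rule nn_integral_mono)
    fix r
    have "ennreal (g r) * L2_norm_sq (\<lambda>x. f n (r, x)) * indicator {0..T} r = ennreal (g' r) * L2_norm_sq (\<lambda>x. f n (r, x))"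
      by (simp add: g'_def indicator_def)
    also have "\<dots> \<le> ennreal (g' r) * ennreal (mean (e n) mz (r, 0))" by (intro mult_left_mono L2f) simp
    finally show "ennreal (g r) * L2_norm_sq (\<lambda>x. f n (r, x)) * indicator {0..T} r \<le> ennreal (g' r * mean (e n) mz (r, 0))"
      using g'0 mean_nonneg by (simp add: ennreal_mult)
  qed
  \<comment> \<open>The zero extensions can be discontinuous only at the times \<open>t1\<close> and
    \<open>t2\<close>, so the averages converge for almost every time.\<close>
  have isCont_m: "isCont mz (r, 0)" and isCont_h: "\<And>x. isCont h (r, x)" if "r \<noteq> t1" "r \<noteq> t2" for r
  proof -
    have *: "isCont (ext k) (r, x)" if k: "continuous_on ({t1..t2} \<times> UNIV) k" for k x
    proof (cases "t1 < r \<and> r < t2")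
      case True
      have o: "open ({t1<..<t2} \<times> (UNIV :: 'a set))" by (intro open_Times) auto
      have "continuous_on ({t1<..<t2} \<times> UNIV) k" by (rule continuous_on_subset[OF k]) auto
      then have "\<forall>p\<in>{t1<..<t2} \<times> UNIV. isCont k p" using continuous_on_eq_continuous_at[OF o] by blast
      then have "isCont k (r, x)" using True by auto
      moreover have "\<forall>\<^sub>F p in nhds (r, x). ext k p = k p"
        using eventually_nhds_in_open[OF o, of "(r, x)"] True by (auto elim!: eventually_mono simp: ext_def)
      ultimately show ?thesis using isCont_cong by fast
    next
      case False
      then have "r \<notin> {t1..t2}" using \<open>r \<noteq> t1\<close> \<open>r \<noteq> t2\<close> by auto
      have o: "open ((- {t1..t2}) \<times> (UNIV :: 'a set))" by (intro open_Times) auto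
      have "\<forall>\<^sub>F p in nhds (r, x). ext k p = 0"
        using eventually_nhds_in_open[OF o, of "(r, x)"] \<open>r \<notin> {t1..t2}\<close> by (auto elim!: eventually_mono simp: ext_def)
      moreover have "isCont (\<lambda>_. 0 :: real) (r, x)" by simp
      ultimately show ?thesis using isCont_cong by fast
    qed
    show "isCont h (r, x)" for x unfolding h_def by (rule *[OF \<psi>])
    have "continuous_on ({t1..t2} \<times> (UNIV :: 'a set)) (\<lambda>p. m0 (fst p))"
      by (rule continuous_on_compose2[OF m0c]) (auto intro!: continuous_intros)
    from *[OF this, of 0] show "isCont mz (r, 0)" by (simp add: mz_def m_def ext_def[abs_def])
  qed
  have AEt: "AE r in lborel. r \<noteq> t1 \<and> r \<noteq> t2"
    using AE_lborel_singleton[of t1] AE_lborel_singleton[of t2] by eventually_elim auto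
  have mean_slice [measurable]: "(\<lambda>r. mean (e n) mz (r, 0)) \<in> borel_measurable borel" for n
  proof -
    have "(\<lambda>r::real. (r, 0::'a)) \<in> borel_measurable borel" by (intro borel_measurable_continuous_onI continuous_intros)
    from measurable_compose[OF this mean_measurable[OF mzm]] show ?thesis .
  qed
  have J: "J \<longlonglongrightarrow> J'"
    unfolding J_def J'_def
  proof (rule nn_integral_dominated_convergence[where w = "\<lambda>r. ennreal (g' r * Bm)"])
    show "(\<integral>\<^sup>+r. ennreal (g' r * Bm) \<partial>lborel) < \<infinity>"
    proof (subst nn_integral_eq_integral)
      show "integrable lborel (\<lambda>r. g' r * Bm)" by (intro integrable_mult_left g')
      show "AE r in lborel. 0 \<le> g' r * Bm" using Bm[of 0] g'0 by (intro AE_I2 mult_nonneg_nonneg) auto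
    qed simp
    show "AE r in lborel. ennreal (g' r * mean (e n) mz (r, 0)) \<le> ennreal (g' r * Bm)" for n
    proof (rule AE_I2, intro ennreal_leI mult_left_mono g'0)
      fix r
      have "mean (e n) mz (r, 0) \<le> (LINT y::real \<times> 'a|lborel. heat_kernel y * Bm)"
        unfolding mean_def
      proof (rule integral_mono)
        show "integrable lborel (\<lambda>y. heat_kernel y * mz ((r, 0) - e n *\<^sub>R y))"
          by (rule mean_integrable[OF mzm]) (use Bm in \<open>simp add: mz_def\<close>)
        show "integrable lborel (\<lambda>y::real \<times> 'a. heat_kernel y * Bm)" by (intro integrable_mult_left heat_kernel_props)
        show "heat_kernel y * mz ((r, 0) - e n *\<^sub>R y) \<le> heat_kernel y * Bm" for y :: "real \<times> 'a"
          using Bm by (intro mult_left_mono) (auto simp: mz_def abs_le_iff)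
      qed
      then show "mean (e n) mz (r, 0) \<le> Bm" by (simp add: heat_kernel_props)
    qed
    show "AE r in lborel. (\<lambda>n. ennreal (g' r * mean (e n) mz (r, 0))) \<longlonglongrightarrow> ennreal (g' r * m r)"
      using AEt
    proof eventually_elim
      fix r assume r: "r \<noteq> t1 \<and> r \<noteq> t2"
      have "(\<lambda>n. mean (e n) mz (r, 0)) \<longlonglongrightarrow> mz (r, 0)"
        by (rule mean_tendsto[OF mzm _ isCont_m e0]) (use r Bm in \<open>auto simp: mz_def\<close>)
      then show "(\<lambda>n. ennreal (g' r * mean (e n) mz (r, 0))) \<longlonglongrightarrow> ennreal (g' r * m r)"
        by (intro tendsto_ennrealI tendsto_mult tendsto_const) (simp add: mz_def)
    qed
  qed measurable

  have step: "(\<integral>\<^sup>+\<tau>\<in>{0..T}. L2_norm_sq (\<lambda>x. f n (\<tau>, x) *\<^sub>R b (\<tau>, x)) \<partial>lborel) \<le> ennreal \<delta> * ?X + J n" for n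
  proof -
    have "f n \<in> schwartz_space"
      unfolding f_def by (rule mollify_schwartz[OF continuous_on_subset[OF \<psi> sub] e])
    then have "(\<integral>\<^sup>+\<tau>\<in>{0..T}. L2_norm_sq (\<lambda>x. f n (\<tau>, x) *\<^sub>R b (\<tau>, x)) \<partial>lborel)
      \<le> ennreal \<delta> * (\<integral>\<^sup>+\<tau>\<in>{0..T}. L2_norm_sq (gradient (\<lambda>x. f n (\<tau>, x))) \<partial>lborel)
        + (\<integral>\<^sup>+\<tau>\<in>{0..T}. ennreal (g \<tau>) * L2_norm_sq (\<lambda>x. f n (\<tau>, x)) \<partial>lborel)"
      using fi unfolding form_inequality_def by blast
    also have "\<dots> \<le> ennreal \<delta> * ?X + J n" by (intro add_mono mult_left_mono grad gterm) simp
    finally show ?thesis .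
  qed
  define A where "A n r = L2_norm_sq (\<lambda>x. f n (r, x) *\<^sub>R b (r, x)) * indicator {0..T} r" for n r
  have Am: "A n \<in> borel_measurable borel" for n
    unfolding A_def[abs_def] L2_norm_sq_def
    by (intro borel_measurable_times_ennreal nn_integral_lborel_fst(2)) measurable
  \<comment> \<open>Fatou's lemma twice, in space and then in time. Here \<open>b\<close> is only
    assumed continuous and may grow, while the mollified functions no longer have compact support,
    so there is no evident dominating function.\<close>
  have "(\<integral>\<^sup>+\<tau>\<in>{t1..t2}. L2_norm_sq (\<lambda>x. \<psi> (\<tau>, x) *\<^sub>R b (\<tau>, x)) \<partial>lborel) \<le> (\<integral>\<^sup>+r. liminf (\<lambda>n. A n r) \<partial>lborel)"
  proof (rule nn_integral_mono_AE, use AEt in eventually_elim)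
    fix r assume r: "r \<noteq> t1 \<and> r \<noteq> t2"
    show "L2_norm_sq (\<lambda>x. \<psi> (r, x) *\<^sub>R b (r, x)) * indicator {t1..t2} r \<le> liminf (\<lambda>n. A n r)"
    proof (cases "r \<in> {t1..t2}")
      case True
      then have "r \<in> {0..T}" using t by auto
      have "L2_norm_sq (\<lambda>x. \<psi> (r, x) *\<^sub>R b (r, x)) = (\<integral>\<^sup>+x. liminf (\<lambda>n. ennreal ((norm (f n (r, x) *\<^sub>R b (r, x)))\<^sup>2)) \<partial>lborel)"
        unfolding L2_norm_sq_def
      proof (rule nn_integral_cong)
        fix x
        have "(\<lambda>n. mean (e n) h (r, x)) \<longlonglongrightarrow> h (r, x)"
          by (rule mean_tendsto[OF hm B isCont_h e0]) (use r in auto)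
        then have "(\<lambda>n. ennreal ((norm (f n (r, x) *\<^sub>R b (r, x)))\<^sup>2)) \<longlonglongrightarrow> ennreal ((norm (h (r, x) *\<^sub>R b (r, x)))\<^sup>2)"
          unfolding f_mean by (intro tendsto_intros tendsto_ennrealI)
        then have "liminf (\<lambda>n. ennreal ((norm (f n (r, x) *\<^sub>R b (r, x)))\<^sup>2)) = ennreal ((norm (h (r, x) *\<^sub>R b (r, x)))\<^sup>2)"
          by (intro lim_imp_Liminf) auto
        then show "ennreal ((norm (\<psi> (r, x) *\<^sub>R b (r, x)))\<^sup>2) = liminf (\<lambda>n. ennreal ((norm (f n (r, x) *\<^sub>R b (r, x)))\<^sup>2))"
          using True by (simp add: h_def ext_def)
      qed
      also have "\<dots> \<le> liminf (\<lambda>n. \<integral>\<^sup>+x. ennreal ((norm (f n (r, x) *\<^sub>R b (r, x)))\<^sup>2) \<partial>lborel)"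
      proof (rule nn_integral_liminf)
        fix n
        have "(\<lambda>p. ennreal ((norm (f n p *\<^sub>R b p))\<^sup>2)) \<in> borel_measurable borel" by measurable
        then show "(\<lambda>x. ennreal ((norm (f n (r, x) *\<^sub>R b (r, x)))\<^sup>2)) \<in> borel_measurable lborel"
          using borel_measurable_slice by simp
      qed
      finally show ?thesis using True \<open>r \<in> {0..T}\<close> by (simp add: A_def L2_norm_sq_def)
    qed simp
  qed
  also have "\<dots> \<le> liminf (\<lambda>n. \<integral>\<^sup>+r. A n r \<partial>lborel)"
    by (rule nn_integral_liminf) (use Am in simp)
  also have "\<dots> \<le> liminf (\<lambda>n. ennreal \<delta> * ?X + J n)"
    by (rule Liminf_mono) (use step in \<open>simp add: A_def\<close>)
  also have "\<dots> = ennreal \<delta> * ?X + J'"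
    by (rule lim_imp_Liminf) (auto intro!: tendsto_add J)
  also have "J' = (\<integral>\<^sup>+\<tau>\<in>{t1..t2}. ennreal (g \<tau>) * L2_norm_sq (\<lambda>x. \<psi> (\<tau>, x)) \<partial>lborel)"
    unfolding J'_def
  proof (rule nn_integral_cong)
    fix r
    show "ennreal (g' r * m r) = ennreal (g r) * L2_norm_sq (\<lambda>x. \<psi> (r, x)) * indicator {t1..t2} r"
      using t m0_nn[of r] g(2)[of r] m_nonneg[of r] by (auto simp: g'_def m_def indicator_def ennreal_mult)
  qed
  finally show ?thesis .
qed

text \<open>Continuity and a common compact support make every term finite, and \<open>g\<close>
  times a bounded function of time remains integrable; the inequality can then be read in the reals
  with time integrals to which the fundamental theorem of calculus applies.\<close>

lemma form_inequality_real:
  fixes b :: "real \<times> 'a::euclidean_space \<Rightarrow> 'a" and \<psi> :: "real \<Rightarrow> 'a \<Rightarrow> real" and G :: "real \<Rightarrow> 'a \<Rightarrow> 'a"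
  assumes fi: "form_inequality T b \<delta> g" and bc: "continuous_on UNIV b" and \<delta>: "0 \<le> \<delta>"
    and g: "set_integrable lborel {0..T} g" "\<And>t. 0 \<le> g t"
    and t: "0 \<le> t1" "t1 \<le> t2" "t2 \<le> T"
    and \<psi>: "continuous_on ({t1..t2} \<times> UNIV) (\<lambda>(t, x). \<psi> t x)" and G: "continuous_on ({t1..t2} \<times> UNIV) (\<lambda>(t, x). G t x)"
    and d: "\<And>t x. t1 \<le> t \<Longrightarrow> t \<le> t2 \<Longrightarrow> (\<psi> t has_derivative (\<lambda>v. G t x \<bullet> v)) (at x)"
    and z: "\<And>t x. t1 \<le> t \<Longrightarrow> t \<le> t2 \<Longrightarrow> R < norm x \<Longrightarrow> \<psi> t x = 0"
  shows "integral {t1..t2} (\<lambda>t. LINT x|lborel. (\<psi> t x)\<^sup>2 * (norm (b (t, x)))\<^sup>2)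
    \<le> \<delta> * integral {t1..t2} (\<lambda>t. LINT x|lborel. (norm (G t x))\<^sup>2)
      + integral {t1..t2} (\<lambda>t. g t * (LINT x|lborel. (\<psi> t x)\<^sup>2))"
    and "(\<lambda>t. g t * (LINT x|lborel. (\<psi> t x)\<^sup>2)) integrable_on {t1..t2}"
proof -
  have Gz: "G t x = 0" if "t1 \<le> t" "t \<le> t2" "R < norm x" for t x
    by (rule zero_gradient_outside_support[OF d[OF that(1,2)] z[OF that(1,2)] that(3)])
  have c1: "continuous_on ({t1..t2} \<times> UNIV) (\<lambda>(t, x). (\<psi> t x)\<^sup>2 * (norm (b (t, x)))\<^sup>2)"
    using \<psi> by (auto simp: split_def intro!: continuous_intros continuous_on_compose2[OF bc])
  have c2: "continuous_on ({t1..t2} \<times> UNIV) (\<lambda>(t, x). (norm (G t x))\<^sup>2)"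
    using G by (auto simp: split_def intro!: continuous_intros)
  have c3: "continuous_on ({t1..t2} \<times> UNIV) (\<lambda>(t, x). (\<psi> t x)\<^sup>2)"
    using \<psi> by (auto simp: split_def intro!: continuous_intros)
  have slice: "integrable lborel (f t)" if "t \<in> {t1..t2}" "continuous_on ({t1..t2} \<times> UNIV) (\<lambda>(t, x). f t x)"
    "\<And>x. R < norm x \<Longrightarrow> f t x = 0" for f :: "real \<Rightarrow> 'a \<Rightarrow> real" and t
  proof (rule integrable_bounded_support[OF _ that(3)])
    have "continuous_on UNIV (\<lambda>x. (\<lambda>(t, x). f t x) (t, x))"
      by (rule continuous_on_compose2[OF that(2)]) (use that(1) in \<open>auto intro!: continuous_intros\<close>)
    then show "continuous_on UNIV (f t)" by simp
  qed
  define A where "A t = (LINT x|lborel. (\<psi> t x)\<^sup>2 * (norm (b (t, x)))\<^sup>2)" for t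
  define D where "D t = (LINT x|lborel. (norm (G t x))\<^sup>2)" for t
  define m where "m t = (LINT x|lborel. (\<psi> t x)\<^sup>2)" for t
  have nonneg: "0 \<le> A t" "0 \<le> D t" "0 \<le> m t" for t by (simp_all add: A_def D_def m_def)
  have Ac: "continuous_on {t1..t2} A" unfolding A_def by (rule continuous_on_LINT[OF c1]) (use z in auto)
  have Dc: "continuous_on {t1..t2} D" unfolding D_def by (rule continuous_on_LINT[OF c2]) (use Gz in auto)
  have mc: "continuous_on {t1..t2} m" unfolding m_def by (rule continuous_on_LINT[OF c3]) (use z in auto)
  have A: "L2_norm_sq (\<lambda>x. \<psi> t x *\<^sub>R b (t, x)) = ennreal (A t)" if "t \<in> {t1..t2}" for t
  proof -
    have "integrable lborel (\<lambda>x. (\<psi> t x)\<^sup>2 * (norm (b (t, x)))\<^sup>2)" by (rule slice[OF that c1]) (use z that in auto)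
    then show ?thesis by (simp add: L2_norm_sq_def A_def power_mult_distrib nn_integral_eq_integral)
  qed
  have D: "L2_norm_sq (\<lambda>x. G t x) = ennreal (D t)" if "t \<in> {t1..t2}" for t
    using slice[OF that c2] Gz that by (simp add: L2_norm_sq_def D_def nn_integral_eq_integral)
  have m: "L2_norm_sq (\<lambda>x. \<psi> t x) = ennreal (m t)" if "t \<in> {t1..t2}" for t
    using slice[OF that c3] z that by (simp add: L2_norm_sq_def m_def nn_integral_eq_integral)
  have gm: "set_integrable lborel {t1..t2} (\<lambda>t. g t * m t)"
  proof -
    have g1: "set_integrable lborel {t1..t2} g" by (rule set_integrable_subset[OF g(1)]) (use t in auto)
    have "bounded (m ` {t1..t2})" by (intro compact_imp_bounded compact_continuous_image mc) auto
    then obtain B where B: "\<And>r. r \<in> {t1..t2} \<Longrightarrow> \<bar>m r\<bar> \<le> B" unfolding bounded_pos by force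
    show ?thesis
      unfolding set_integrable_def
    proof (rule Bochner_Integration.integrable_bound)
      show "integrable lborel (\<lambda>t. B * (indicator {t1..t2} t *\<^sub>R g t))"
        using g1 unfolding set_integrable_def by (rule integrable_mult_right)
      have "(\<lambda>t. indicator {t1..t2} t *\<^sub>R m t) \<in> borel_measurable borel"
        by (rule borel_measurable_continuous_on_indicator[OF _ mc]) simp
      moreover have "(\<lambda>t. indicator {t1..t2} t *\<^sub>R g t) \<in> borel_measurable borel"
        using borel_measurable_integrable[OF g1[unfolded set_integrable_def]] by simp
      ultimately have "(\<lambda>t. (indicator {t1..t2} t *\<^sub>R g t) * (indicator {t1..t2} t *\<^sub>R m t)) \<in> borel_measurable borel"
        by measurable
      moreover have "(\<lambda>t. (indicator {t1..t2} t *\<^sub>R g t) * (indicator {t1..t2} t *\<^sub>R m t))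
          = (\<lambda>t. indicator {t1..t2} t *\<^sub>R (g t * m t))" by (auto simp: indicator_def)
      ultimately show "(\<lambda>t. indicator {t1..t2} t *\<^sub>R (g t * m t)) \<in> borel_measurable lborel" by simp
      show "AE t in lborel. norm (indicator {t1..t2} t *\<^sub>R (g t * m t)) \<le> norm (B * (indicator {t1..t2} t *\<^sub>R g t))"
      proof (rule AE_I2)
        fix t
        show "norm (indicator {t1..t2} t *\<^sub>R (g t * m t)) \<le> norm (B * (indicator {t1..t2} t *\<^sub>R g t))"
        proof (cases "t \<in> {t1..t2}")
          case True
          have "g t * \<bar>m t\<bar> \<le> g t * \<bar>B\<bar>"
            using B[OF True] g(2)[of t] by (intro mult_left_mono) auto
          then show ?thesis using True g(2)[of t] by (simp add: abs_mult mult.commute)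
        qed simp
      qed
    qed
  qed
  show "(\<lambda>t. g t * (LINT x|lborel. (\<psi> t x)\<^sup>2)) integrable_on {t1..t2}"
    using set_borel_integral_eq_integral(1)[OF gm] by (simp add: m_def)
  have HK: "(\<integral>\<^sup>+t\<in>{t1..t2}. ennreal (f t) \<partial>lborel) = ennreal (integral {t1..t2} f)"
    if "set_integrable lborel {t1..t2} f" "\<And>t. t \<in> {t1..t2} \<Longrightarrow> 0 \<le> f t" for f
  proof -
    have "(\<integral>\<^sup>+t\<in>{t1..t2}. ennreal (f t) \<partial>lborel) = (\<integral>\<^sup>+t. ennreal (indicator {t1..t2} t *\<^sub>R f t) \<partial>lborel)"
      by (intro nn_integral_cong) (simp add: indicator_def)
    also have "\<dots> = ennreal (LINT t:{t1..t2}|lborel. f t)"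
      unfolding set_lebesgue_integral_def
      by (rule nn_integral_eq_integral) (use that in \<open>auto simp: set_integrable_def indicator_def\<close>)
    finally show ?thesis using set_borel_integral_eq_integral(2)[OF that(1)] by simp
  qed
  have ci: "set_integrable lborel {t1..t2} f" if "continuous_on {t1..t2} f" for f :: "real \<Rightarrow> real"
    unfolding set_integrable_def by (rule borel_integrable_compact[OF _ that]) simp
  have "(\<integral>\<^sup>+\<tau>\<in>{t1..t2}. L2_norm_sq (\<lambda>x. \<psi> \<tau> x *\<^sub>R b (\<tau>, x)) \<partial>lborel)
    \<le> ennreal \<delta> * (\<integral>\<^sup>+\<tau>\<in>{t1..t2}. L2_norm_sq (\<lambda>x. G \<tau> x) \<partial>lborel)
      + (\<integral>\<^sup>+\<tau>\<in>{t1..t2}. ennreal (g \<tau>) * L2_norm_sq (\<lambda>x. \<psi> \<tau> x) \<partial>lborel)"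
    using form_inequality_test[OF fi bc g t \<psi> G, of R] d z by simp
  also have "(\<integral>\<^sup>+\<tau>\<in>{t1..t2}. L2_norm_sq (\<lambda>x. \<psi> \<tau> x *\<^sub>R b (\<tau>, x)) \<partial>lborel) = (\<integral>\<^sup>+t\<in>{t1..t2}. ennreal (A t) \<partial>lborel)"
    by (intro nn_integral_cong) (simp add: A indicator_def)
  also have "(\<integral>\<^sup>+\<tau>\<in>{t1..t2}. L2_norm_sq (\<lambda>x. G \<tau> x) \<partial>lborel) = (\<integral>\<^sup>+t\<in>{t1..t2}. ennreal (D t) \<partial>lborel)"
    by (intro nn_integral_cong) (simp add: D indicator_def)
  also have "(\<integral>\<^sup>+\<tau>\<in>{t1..t2}. ennreal (g \<tau>) * L2_norm_sq (\<lambda>x. \<psi> \<tau> x) \<partial>lborel) = (\<integral>\<^sup>+t\<in>{t1..t2}. ennreal (g t * m t) \<partial>lborel)"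
    by (intro nn_integral_cong) (use g(2) nonneg in \<open>simp add: m indicator_def ennreal_mult\<close>)
  finally have "ennreal (integral {t1..t2} A) \<le> ennreal \<delta> * ennreal (integral {t1..t2} D) + ennreal (integral {t1..t2} (\<lambda>t. g t * m t))"
    using HK[OF ci[OF Ac]] HK[OF ci[OF Dc]] HK[OF gm] nonneg g(2) by simp
  also have "\<dots> = ennreal (\<delta> * integral {t1..t2} D + integral {t1..t2} (\<lambda>t. g t * m t))"
    using \<delta> nonneg g(2) set_borel_integral_eq_integral(1)[OF gm] Dc
    by (simp add: ennreal_mult ennreal_plus integral_nonneg integrable_continuous_interval)
  finally have "integral {t1..t2} A \<le> \<delta> * integral {t1..t2} D + integral {t1..t2} (\<lambda>t. g t * m t)"
    using \<delta> nonneg g(2) set_borel_integral_eq_integral(1)[OF gm] Dc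
    by (subst (asm) ennreal_le_iff) (auto intro!: add_nonneg_nonneg mult_nonneg_nonneg integral_nonneg integrable_continuous_interval)
  then show "integral {t1..t2} (\<lambda>t. LINT x|lborel. (\<psi> t x)\<^sup>2 * (norm (b (t, x)))\<^sup>2)
    \<le> \<delta> * integral {t1..t2} (\<lambda>t. LINT x|lborel. (norm (G t x))\<^sup>2)
      + integral {t1..t2} (\<lambda>t. g t * (LINT x|lborel. (\<psi> t x)\<^sup>2))"
    by (simp add: A_def[abs_def] D_def[abs_def] m_def)
qed

text \<open>A crude form of Gronwall's inequality with an integrable kernel: on each piece on which \<open>a\<close> has
  integral \<open>1 / 2\<close> the function at most doubles, up to \<open>\<sigma>\<close>.\<close>

lemma gronwall_doubling:
  fixes E a :: "real \<Rightarrow> real"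
  assumes E: "continuous_on {t0..T} E" "\<And>t. 0 \<le> E t" and a: "a integrable_on {t0..T}" "\<And>t. 0 \<le> a t"
    and \<sigma>: "0 \<le> \<sigma>"
    and i: "\<And>t1 t2. t0 \<le> t1 \<Longrightarrow> t1 \<le> t2 \<Longrightarrow> t2 \<le> T \<Longrightarrow> (\<lambda>t. a t * E t) integrable_on {t1..t2}"
    and le: "\<And>t1 t2. t0 \<le> t1 \<Longrightarrow> t1 \<le> t2 \<Longrightarrow> t2 \<le> T \<Longrightarrow> E t2 \<le> E t1 + integral {t1..t2} (\<lambda>t. a t * E t) + \<sigma>"
    and t: "t0 \<le> t" "t \<le> T" and N: "integral {t0..t} a \<le> real N / 2"
  shows "E t \<le> 2 ^ N * (E t0 + 3 * \<sigma>)"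
proof -
  define \<phi> where "\<phi> t = integral {t0..t} a" for t
  \<comment> \<open>The values y_k = 2^k X - 2 \<sigma> solve y_(k+1) = 2 (y_k + \<sigma>) with y_0
    = E t0 + \<sigma>; this is the recursion produced by one doubling step.\<close>
  define X where "X = E t0 + 3 * \<sigma>"
  have X: "0 \<le> X" using E(2) \<sigma> by (simp add: X_def)
  have ai: "a integrable_on {r1..r2}" if "t0 \<le> r1" "r2 \<le> T" for r1 r2
    by (rule integrable_on_subinterval[OF a(1)]) (use that in auto)
  have \<phi>c: "continuous_on {t0..T} \<phi>" unfolding \<phi>_def by (rule indefinite_integral_continuous_1[OF a(1)])
  have \<phi>_diff: "integral {r1..r2} a = \<phi> r2 - \<phi> r1" if "t0 \<le> r1" "r1 \<le> r2" "r2 \<le> T" for r1 r2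
    using Henstock_Kurzweil_Integration.integral_combine[OF that(1,2) ai[OF order_refl that(3)]] by (simp add: \<phi>_def)
  have int_le: "integral {r1..r2} (\<lambda>t. a t * E t) \<le> S * (\<phi> r2 - \<phi> r1)"
    if "t0 \<le> r1" "r1 \<le> r2" "r2 \<le> T" "\<And>r. r1 \<le> r \<Longrightarrow> r \<le> r2 \<Longrightarrow> E r \<le> S" for r1 r2 S
  proof -
    have "integral {r1..r2} (\<lambda>t. a t * E t) \<le> integral {r1..r2} (\<lambda>t. S * a t)"
    proof (rule integral_le[OF i[OF that(1-3)]])
      show "(\<lambda>t. S * a t) integrable_on {r1..r2}"
        using integrable_on_cmult_left[OF ai[OF that(1,3)], of S] by simp
      show "a r * E r \<le> S * a r" if "r \<in> {r1..r2}" for r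
        using \<open>\<And>r. r1 \<le> r \<Longrightarrow> r \<le> r2 \<Longrightarrow> E r \<le> S\<close>[of r] that mult_left_mono[OF _ a(2), of "E r" S r] by (simp add: mult.commute)
    qed
    then show ?thesis using \<phi>_diff[OF that(1-3)] by simp
  qed
  have "\<phi> t \<le> real k / 2 \<Longrightarrow> E t \<le> 2 ^ k * X - 2 * \<sigma>" if "t0 \<le> t" "t \<le> T" for k t
    using that
  proof (induction k arbitrary: t)
    case 0
    have S: "\<exists>S. \<forall>r. t0 \<le> r \<longrightarrow> r \<le> t \<longrightarrow> E r \<le> S"
    proof -
      have "bounded (E ` {t0..T})" by (intro compact_imp_bounded compact_continuous_image E(1)) auto
      then obtain B where "\<And>r. r \<in> {t0..T} \<Longrightarrow> \<bar>E r\<bar> \<le> B" unfolding bounded_pos by force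
      then show ?thesis using 0 by (intro exI[of _ B]) (force simp: abs_le_iff)
    qed
    then obtain S where S: "\<And>r. t0 \<le> r \<Longrightarrow> r \<le> t \<Longrightarrow> E r \<le> S" by blast
    have S0: "0 \<le> S" using S[of t0] E(2)[of t0] 0 by simp
    have "integral {t0..t} (\<lambda>t. a t * E t) \<le> S * (\<phi> t - \<phi> t0)" by (rule int_le) (use 0 S in auto)
    also have "\<dots> \<le> 0" using 0 S0 by (simp add: \<phi>_def mult_nonneg_nonpos)
    finally show ?case using le[of t0 t] 0 by (simp add: X_def)
  next
    case (Suc k)
    show ?case
    proof (cases "\<phi> t \<le> real k / 2")
      case True
      with Suc have "E t \<le> 2 ^ k * X - 2 * \<sigma>" by blast
      moreover have "0 \<le> 2 ^ k * X" using X by simp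
      ultimately show ?thesis by simp
    next
      case False
      \<comment> \<open>At \<open>r\<close> the kernel has integral k/2, so at most 1/2 of it is
        left on [r, t].\<close>
      have "\<exists>r\<ge>t0. r \<le> t \<and> \<phi> r = real k / 2"
        by (rule IVT') (use False Suc in \<open>auto simp: \<phi>_def intro: continuous_on_subset[OF \<phi>c[unfolded \<phi>_def]]\<close>)
      then obtain r where r: "t0 \<le> r" "r \<le> t" "\<phi> r = real k / 2" by blast
      have Er: "E r \<le> 2 ^ k * X - 2 * \<sigma>" using Suc r by (intro Suc.IH) auto
      \<comment> \<open>At a maximum \<open>p\<close> of \<open>E\<close> on [r, t] the integral
        term is at most E p / 2 and can be absorbed on the left.\<close>
      have "continuous_on {r..t} E" by (rule continuous_on_subset[OF E(1)]) (use r Suc in auto)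
      then obtain p where p: "r \<le> p" "p \<le> t" and sup: "\<And>q. r \<le> q \<Longrightarrow> q \<le> t \<Longrightarrow> E q \<le> E p"
        using continuous_attains_sup[of "{r..t}" E] r by auto
      have \<phi>p: "\<phi> p \<le> \<phi> t"
        using \<phi>_diff[of p t] p r Suc integral_nonneg[OF ai[of p t]] a(2) by auto
      have "E p \<le> E r + integral {r..p} (\<lambda>t. a t * E t) + \<sigma>" by (rule le) (use p r Suc in auto)
      also have "integral {r..p} (\<lambda>t. a t * E t) \<le> E p * (\<phi> p - \<phi> r)" by (rule int_le) (use p r Suc sup in auto)
      also have "\<dots> \<le> E p * (1 / 2)" using \<phi>p r Suc E(2) by (intro mult_left_mono) auto
      finally have "E p \<le> 2 * (2 ^ k * X - 2 * \<sigma> + \<sigma>)" using Er by simp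
      with sup[of t] r show ?thesis by simp
    qed
  qed
  from this[OF t, of N] N \<sigma> show ?thesis by (simp add: \<phi>_def X_def)
qed

subsection \<open>Exponential weights\<close>

text \<open>A smooth substitute for |x| with gradient of length at most 1, so that
  \<open>exp (- japanese x)\<close> dominates its own gradient.\<close>

definition japanese :: "'a::euclidean_space \<Rightarrow> real"
  where "japanese x = sqrt (1 + x \<bullet> x)"

definition rho :: "'a::euclidean_space \<Rightarrow> 'a \<Rightarrow> real"
  where "rho x0 x = exp (- 2 * japanese (x - x0))"

definition rho_mass :: "'a::euclidean_space itself \<Rightarrow> real"
  where "rho_mass _ = (LINT x::'a|lborel. rho 0 x)"

text \<open>A \<open>C\<^sup>1\<close> function of compact support approximating \<open>rho x0\<close> whose gradient is dominated by the
  function itself, up to an error of order \<open>exp (- R)\<close>.\<close>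

definition cutoff :: "'a::euclidean_space \<Rightarrow> real \<Rightarrow> 'a \<Rightarrow> real"
  where "cutoff x0 R x = (max 0 (exp (- japanese (x - x0)) - exp (- R)))\<^sup>2"

definition cutoff_grad :: "'a::euclidean_space \<Rightarrow> real \<Rightarrow> 'a \<Rightarrow> 'a"
  where "cutoff_grad x0 R x = (- (2 * max 0 (exp (- japanese (x - x0)) - exp (- R)) * exp (- japanese (x - x0)) / japanese (x - x0))) *\<^sub>R (x - x0)"

lemma japanese_ge: "1 \<le> japanese x" "norm x \<le> japanese x"
  by (simp_all add: japanese_def norm_eq_sqrt_inner)

lemma japanese_le: "japanese x \<le> 1 + norm x"
  unfolding japanese_def by (rule real_le_lsqrt) (auto simp: power2_eq_square algebra_simps dot_square_norm)

lemma japanese_continuous [continuous_intros]: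
  "continuous_on S f \<Longrightarrow> continuous_on S (\<lambda>x. japanese (f x))"
  unfolding japanese_def by (intro continuous_intros)

lemma rho_continuous [continuous_intros]: "continuous_on S f \<Longrightarrow> continuous_on S (\<lambda>x. rho x0 (f x))"
  unfolding rho_def by (intro continuous_intros)

lemma rho_pos [simp]: "0 < rho x0 x" "0 \<le> rho x0 x" by (simp_all add: rho_def)

lemma rho_integrable: "integrable lborel (rho (x0::'a::euclidean_space))"
    "(LINT x|lborel. rho x0 x) = rho_mass TYPE('a)"
proof -
  have 0: "integrable lborel (rho (0::'a))"
  proof (rule Bochner_Integration.integrable_bound)
    show "integrable lborel (\<lambda>x::'a. exp (- (1 / real DIM('a)) * (\<Sum>i\<in>Basis. \<bar>x \<bullet> i\<bar>)))"
      by (rule integrable_exp_l1_norm) simp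
    show "rho (0::'a) \<in> borel_measurable lborel"
      by simp (intro borel_measurable_continuous_onI continuous_intros)
    have "rho 0 x \<le> exp (- (1 / real DIM('a)) * (\<Sum>i\<in>Basis. \<bar>x \<bullet> i\<bar>))" for x :: 'a
    proof -
      have "(\<Sum>i\<in>Basis. \<bar>x \<bullet> i\<bar>) \<le> real DIM('a) * norm x"
        using sum_bounded_above[of Basis "\<lambda>i. \<bar>x \<bullet> i\<bar>" "norm x", OF Basis_le_norm] by simp
      also have "\<dots> \<le> real DIM('a) * (2 * japanese x)"
        using japanese_ge[of x] by (intro mult_left_mono) auto
      finally show ?thesis by (simp add: rho_def field_simps)
    qed
    then show "AE x::'a in lborel. norm (rho 0 x) \<le> norm (exp (- (1 / real DIM('a)) * (\<Sum>i\<in>Basis. \<bar>x \<bullet> i\<bar>)))"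
      by simp
  qed
  have m: "rho (0::'a) \<in> borel_measurable borel" using borel_measurable_integrable[OF 0] by simp
  have eq: "rho x0 = (\<lambda>x. rho 0 (x + - x0))" by (auto simp: rho_def)
  show "(LINT x|lborel. rho x0 x) = rho_mass TYPE('a)"
    unfolding rho_mass_def eq by (rule LINT_translate[OF m])
  show "integrable lborel (rho x0)"
  proof (rule integrableI_bounded)
    show "rho x0 \<in> borel_measurable lborel" by simp (intro borel_measurable_continuous_onI continuous_intros)
    have "(\<integral>\<^sup>+x. ennreal (norm (rho x0 x)) \<partial>lborel) = (\<integral>\<^sup>+(x::'a). ennreal (rho 0 x) \<partial>lborel)"
      using nn_integral_affine[of "\<lambda>x. ennreal (rho 0 x)" 1 "- x0"] m by (simp add: eq)
    also have "\<dots> < \<infinity>" using nn_integral_eq_integral[OF 0] by simp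
    finally show "(\<integral>\<^sup>+x. ennreal (norm (rho x0 x)) \<partial>lborel) < \<infinity>" .
  qed
qed

lemma rho_mass_nonneg: "0 \<le> rho_mass TYPE('a::euclidean_space)"
  unfolding rho_mass_def by (rule integral_nonneg_AE) simp

text \<open>Squaring removes the kink of the positive part at 0; this is why \<open>cutoff\<close>
  is a square.\<close>

lemma DERIV_max_0_square: "((\<lambda>r::real. (max 0 r)\<^sup>2) has_real_derivative 2 * max 0 r) (at r)"
proof (cases "r = 0")
  case True
  have "((\<lambda>h. (max 0 h)\<^sup>2 / h) \<longlongrightarrow> 0) (at (0::real))"
  proof (rule tendsto_rabs_zero_cancel, rule tendsto_sandwich[OF _ _ tendsto_const])
    show "\<forall>\<^sub>F h in at (0::real). \<bar>(max 0 h)\<^sup>2 / h\<bar> \<le> \<bar>h\<bar>"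
      by (auto simp: max_def power2_eq_square)
    show "((\<lambda>h::real. \<bar>h\<bar>) \<longlongrightarrow> 0) (at 0)" by (rule tendsto_rabs_zero) simp
  qed simp
  then show ?thesis using True by (simp add: has_field_derivative_iff)
next
  case False
  show ?thesis
  proof (cases "r > 0")
    case True
    have "((\<lambda>r. r\<^sup>2) has_real_derivative 2 * r) (at r)" by (auto intro!: derivative_eq_intros)
    moreover have "\<forall>\<^sub>F y in nhds r. (max 0 y)\<^sup>2 = y\<^sup>2"
      using eventually_nhds_in_open[OF open_greaterThan, of r 0] True by (auto elim!: eventually_mono simp: max_def)
    ultimately show ?thesis using True DERIV_cong_ev[OF refl _ refl, of "\<lambda>y. (max 0 y)\<^sup>2" "\<lambda>y. y\<^sup>2" r "2 * r"] by simp
  next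
    case F: False
    then have "r < 0" using False by simp
    have "((\<lambda>r. 0) has_real_derivative 0) (at r)" by simp
    moreover have "\<forall>\<^sub>F y in nhds r. (max 0 y)\<^sup>2 = 0"
      using eventually_nhds_in_open[OF open_lessThan, of r 0] \<open>r < 0\<close> by (auto elim!: eventually_mono simp: max_def)
    ultimately show ?thesis using \<open>r < 0\<close> DERIV_cong_ev[OF refl _ refl, of "\<lambda>y. (max 0 y)\<^sup>2" "\<lambda>y. 0" r 0] by simp
  qed
qed

lemma cutoff_has_derivative: "(cutoff x0 R has_derivative (\<lambda>v. cutoff_grad x0 R x \<bullet> v)) (at x)"
proof -
  let ?y = "\<lambda>x. exp (- japanese (x - x0))"
  have pos: "0 < 1 + (x - x0) \<bullet> (x - x0)" by (simp add: add_pos_nonneg)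
  have j: "((\<lambda>x. japanese (x - x0)) has_derivative (\<lambda>v. ((x - x0) \<bullet> v) / japanese (x - x0))) (at x)"
  proof -
    have "((\<lambda>x. 1 + (x - x0) \<bullet> (x - x0)) has_derivative (\<lambda>v. 2 * ((x - x0) \<bullet> v))) (at x)"
      by (auto intro!: derivative_eq_intros simp: inner_commute)
    from has_derivative_compose[OF this DERIV_real_sqrt[OF pos, unfolded has_field_derivative_def]]
    moreover have "inverse a / 2 * (2 * c) = c / a" for a c :: real by (cases "a = 0") (simp_all add: field_simps)
    ultimately show ?thesis by (simp only: japanese_def)
  qed
  have y: "((\<lambda>x. ?y x - exp (- R)) has_derivative (\<lambda>v. - (?y x * (((x - x0) \<bullet> v) / japanese (x - x0))))) (at x)"
    by (auto intro!: derivative_eq_intros j simp: mult.commute)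
  have "((\<lambda>x. (max 0 (?y x - exp (- R)))\<^sup>2) has_derivative
     (\<lambda>v. - (?y x * (((x - x0) \<bullet> v) / japanese (x - x0))) * (2 * max 0 (?y x - exp (- R))))) (at x)"
    using has_derivative_compose[OF y DERIV_max_0_square[unfolded has_field_derivative_def]] by (simp add: mult.commute)
  then show ?thesis by (simp add: cutoff_def[abs_def] cutoff_grad_def mult_ac)
qed

lemma cutoff_continuous [continuous_intros]:
  "continuous_on S f \<Longrightarrow> continuous_on S (\<lambda>x. cutoff x0 R (f x))"
  unfolding cutoff_def by (intro continuous_intros)

lemma cutoff_grad_continuous [continuous_intros]:
  assumes "continuous_on S f"
  shows "continuous_on S (\<lambda>x. cutoff_grad x0 R (f x))"
proof -
  have "japanese (f x - x0) \<noteq> 0" for x using japanese_ge(1)[of "f x - x0"] by linarith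
  then show ?thesis unfolding cutoff_grad_def by (intro continuous_intros assms) auto
qed

lemma cutoff_zero: "R + norm x0 < norm x \<Longrightarrow> cutoff x0 R x = 0"
proof -
  assume "R + norm x0 < norm x"
  then have "R \<le> japanese (x - x0)" using norm_triangle_ineq2[of x x0] japanese_ge(2)[of "x - x0"] by linarith
  then show ?thesis by (simp add: cutoff_def)
qed

lemma cutoff_bounds: "0 \<le> cutoff x0 R x" "cutoff x0 R x \<le> rho x0 x" "cutoff x0 R x \<le> 1" "rho x0 x \<le> 1"
proof -
  show "0 \<le> cutoff x0 R x" by (simp add: cutoff_def)
  have "(max 0 (exp (- japanese (x - x0)) - exp (- R)))\<^sup>2 \<le> (exp (- japanese (x - x0)))\<^sup>2"
    by (intro power_mono) auto
  also have "\<dots> = rho x0 x" by (simp add: rho_def power2_eq_square flip: exp_add)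
  finally show 1: "cutoff x0 R x \<le> rho x0 x" by (simp add: cutoff_def)
  show 2: "rho x0 x \<le> 1" using japanese_ge(1)[of "x - x0"] by (simp add: rho_def)
  show "cutoff x0 R x \<le> 1" using 1 2 by linarith
qed

text \<open>With y the exponential and p the positive part of y - exp (- R), the weight is p^2 and
  its gradient has length at most 2 p y. Since y \<le> p + exp (- R) on the support, the deviation
  from being dominated by the weight carries exp (- 2 R) and remains integrable in space.\<close>

lemma cutoff_grad_bound:
  "(norm (cutoff_grad x0 R x))\<^sup>2 \<le> 8 * (cutoff x0 R x)\<^sup>2 + 8 * exp (- 2 * R) * rho x0 x"
proof -
  define y where "y = exp (- japanese (x - x0))"
  define p where "p = max 0 (y - exp (- R))"
  have p: "0 \<le> p" "p \<le> y" "y \<le> p + exp (- R)" by (auto simp: p_def y_def)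
  have j: "norm (x - x0) \<le> japanese (x - x0)" "0 < japanese (x - x0)" using japanese_ge[of "x - x0"] by auto
  have "norm (cutoff_grad x0 R x) = 2 * p * y * (norm (x - x0) / japanese (x - x0))"
    using p(1) j by (simp add: cutoff_grad_def y_def[symmetric] p_def[symmetric]) (simp add: y_def)
  also have "\<dots> \<le> 2 * p * y * 1"
    using p j by (intro mult_left_mono) (auto simp: y_def)
  finally have "(norm (cutoff_grad x0 R x))\<^sup>2 \<le> (2 * p * y)\<^sup>2" by (intro power_mono) auto
  also have "\<dots> = 4 * p\<^sup>2 * y\<^sup>2" by (simp add: power2_eq_square)
  also have "\<dots> \<le> 4 * p\<^sup>2 * (2 * p\<^sup>2 + 2 * (exp (- R))\<^sup>2)"
  proof (rule mult_left_mono)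
    have "y\<^sup>2 \<le> (p + exp (- R))\<^sup>2" using p by (intro power_mono) (auto simp: y_def)
    also have "\<dots> \<le> 2 * p\<^sup>2 + 2 * (exp (- R))\<^sup>2" using sum_squares_bound[of p "exp (- R)"] by (simp add: power2_sum)
    finally show "y\<^sup>2 \<le> 2 * p\<^sup>2 + 2 * (exp (- R))\<^sup>2" .
  qed simp
  also have "\<dots> = 8 * (p\<^sup>2)\<^sup>2 + 8 * (exp (- R))\<^sup>2 * p\<^sup>2" by (simp add: power2_eq_square algebra_simps)
  also have "\<dots> \<le> 8 * (p\<^sup>2)\<^sup>2 + 8 * (exp (- R))\<^sup>2 * y\<^sup>2" using p by (intro add_mono mult_left_mono power_mono) auto
  also have "\<dots> = 8 * (cutoff x0 R x)\<^sup>2 + 8 * exp (- 2 * R) * rho x0 x"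
    by (simp add: cutoff_def y_def[symmetric] p_def[symmetric]) (simp add: y_def rho_def power2_eq_square flip: exp_add)
  finally show ?thesis .
qed

text \<open>A lower bound free of \<open>R\<close>, through which weighted integrals control local
  ones. One unit of room between the exponents suffices because e \<ge> 2.\<close>

lemma cutoff_lower_bound:
  assumes "norm (x - x0) \<le> r" "2 + r \<le> R"
  shows "exp (- 2 * (2 + r)) \<le> cutoff x0 R x"
proof -
  have "exp (- (2 + r)) + exp (- R) \<le> exp (- (1 + r))"
  proof -
    have "2 * exp (- (2 + r)) \<le> exp 1 * exp (- (2 + r))"
      using exp_ge_add_one_self[of 1] by (intro mult_right_mono) auto
    also have "\<dots> = exp (- (1 + r))" by (simp flip: exp_add)
    finally show ?thesis using assms(2) by (smt (verit) exp_le_cancel_iff)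
  qed
  also have "\<dots> \<le> exp (- japanese (x - x0))" using japanese_le[of "x - x0"] assms by simp
  finally have "(exp (- (2 + r)))\<^sup>2 \<le> (max 0 (exp (- japanese (x - x0)) - exp (- R)))\<^sup>2"
    by (intro power_mono) auto
  then show ?thesis by (simp add: cutoff_def power2_eq_square flip: exp_add)
qed

subsection \<open>The energy inequality\<close>

text \<open>Every integrand of the energy estimates has this form. The class is stable under sums
  and multiples, its space integrals are continuous in time, and all integrability conditions reduce
  to membership.\<close>

definition cont_supported :: "real set \<Rightarrow> real \<Rightarrow> (real \<Rightarrow> 'a::euclidean_space \<Rightarrow> real) \<Rightarrow> bool"
  where "cont_supported I r f \<longleftrightarrow> continuous_on (I \<times> UNIV) (\<lambda>(t, x). f t x) \<and> (\<forall>t\<in>I. \<forall>x. r < norm x \<longrightarrow> f t x = 0)"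

definition spacetime_integral :: "real \<Rightarrow> real \<Rightarrow> (real \<Rightarrow> 'a::euclidean_space \<Rightarrow> real) \<Rightarrow> real"
  where "spacetime_integral t1 t2 f = integral {t1..t2} (\<lambda>t. LINT x|lborel. f t x)"

lemma cont_supportedI:
  assumes "continuous_on (I \<times> UNIV) (\<lambda>p. f (fst p) (snd p))" "\<And>t x. t \<in> I \<Longrightarrow> r < norm x \<Longrightarrow> f t x = 0"
  shows "cont_supported I r f"
  using assms by (simp add: cont_supported_def split_def)

lemma continuous_on_slice:
  assumes "continuous_on ({t} \<times> UNIV) (\<lambda>p. f (fst p) (snd p))"
  shows "continuous_on UNIV (f t)"
proof -
  have "continuous_on UNIV (\<lambda>x. (\<lambda>p. f (fst p) (snd p)) (t, x))"
    by (rule continuous_on_compose2[OF assms]) (auto intro!: continuous_intros)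
  then show ?thesis by simp
qed

lemma cont_supported_add: "cont_supported I r f \<Longrightarrow> cont_supported I r g \<Longrightarrow> cont_supported I r (\<lambda>t x. f t x + g t x)"
  by (auto simp: cont_supported_def split_def intro!: continuous_intros)

lemma cont_supported_cmult: "cont_supported I r f \<Longrightarrow> cont_supported I r (\<lambda>t x. c * f t x)"
  by (auto simp: cont_supported_def split_def intro!: continuous_intros)

lemma cont_supported_slice: "cont_supported I r f \<Longrightarrow> t \<in> I \<Longrightarrow> continuous_on UNIV (f t)"
proof -
  assume a: "cont_supported I r f" "t \<in> I"
  have "continuous_on UNIV (\<lambda>x. (\<lambda>(t, x). f t x) (t, x))"
    by (rule continuous_on_compose2[of "I \<times> UNIV"]) (use a in \<open>auto simp: cont_supported_def intro!: continuous_intros\<close>)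
  then show ?thesis by simp
qed

lemma cont_supported_integrable: "cont_supported I r f \<Longrightarrow> t \<in> I \<Longrightarrow> integrable lborel (f t)"
  by (rule integrable_bounded_support[OF cont_supported_slice]) (auto simp: cont_supported_def)

lemma cont_supported_continuous_LINT: "cont_supported I r f \<Longrightarrow> continuous_on I (\<lambda>t. LINT x|lborel. f t x)"
  by (rule continuous_on_LINT) (auto simp: cont_supported_def)

lemma spacetime_integral_add:
  assumes "cont_supported {t1..t2} r f" "cont_supported {t1..t2} r g"
  shows "spacetime_integral t1 t2 (\<lambda>t x. f t x + g t x) = spacetime_integral t1 t2 f + spacetime_integral t1 t2 g"
proof -
  have "spacetime_integral t1 t2 (\<lambda>t x. f t x + g t x) = integral {t1..t2} (\<lambda>t. (LINT x|lborel. f t x) + (LINT x|lborel. g t x))"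
    unfolding spacetime_integral_def
    by (rule Henstock_Kurzweil_Integration.integral_cong) (intro Bochner_Integration.integral_add cont_supported_integrable[OF assms(1)] cont_supported_integrable[OF assms(2)])
  then show ?thesis
    unfolding spacetime_integral_def
    by (subst (asm) Henstock_Kurzweil_Integration.integral_add)
      (auto intro!: integrable_continuous_interval cont_supported_continuous_LINT assms)
qed

lemma spacetime_integral_cmult: "spacetime_integral t1 t2 (\<lambda>t x. c * f t x) = c * spacetime_integral t1 t2 f"
  by (simp add: spacetime_integral_def)

lemma spacetime_integral_mono:
  assumes "cont_supported {t1..t2} r f" "cont_supported {t1..t2} r g" "\<And>t x. t \<in> {t1..t2} \<Longrightarrow> f t x \<le> g t x"
  shows "spacetime_integral t1 t2 f \<le> spacetime_integral t1 t2 g"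
  unfolding spacetime_integral_def
proof (rule integral_le)
  show "(\<lambda>t. LINT x|lborel. f t x) integrable_on {t1..t2}" "(\<lambda>t. LINT x|lborel. g t x) integrable_on {t1..t2}"
    by (auto intro!: integrable_continuous_interval cont_supported_continuous_LINT assms)
  show "(LINT x|lborel. f t x) \<le> (LINT x|lborel. g t x)" if "t \<in> {t1..t2}" for t
    by (rule integral_mono[OF cont_supported_integrable[OF assms(1) that] cont_supported_integrable[OF assms(2) that]]) (rule assms(3)[OF that])
qed

lemma spacetime_integral_const: "t1 \<le> t2 \<Longrightarrow> spacetime_integral t1 t2 (\<lambda>t. f) = (t2 - t1) * (LINT x|lborel. f x)"
  by (simp add: spacetime_integral_def)

lemma LINT_has_real_derivative:
  fixes f f' :: "real \<Rightarrow> 'a::euclidean_space \<Rightarrow> real"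
  assumes f: "\<And>p x. c < p \<Longrightarrow> ((\<lambda>p. f p x) has_real_derivative f' p x) (at p)"
    and fa: "cont_supported {c<..} r f" and fa': "cont_supported {c<..} r f'" and p: "c < p"
  shows "((\<lambda>p. LINT x|lborel. f p x) has_real_derivative (LINT x|lborel. f' p x)) (at p)"
proof -
  obtain a b :: 'a where ab: "cball 0 r \<subseteq> cbox a b" using ball_subset_cbox by blast
  have *: "(LINT x|lborel. h p x) = integral (cbox a b) (h p)" if "cont_supported {c<..} r h" "c < p" for h p
  proof (rule LINT_eq_integral_cbox[OF cont_supported_slice[OF that(1)]])
    show "h p x = 0" if "x \<notin> cbox a b" for x
    proof -
      have "r < norm x" using ab that by force
      then show ?thesis using \<open>cont_supported {c<..} r h\<close> \<open>c < p\<close> by (simp add: cont_supported_def)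
    qed
  qed (use that in simp)
  have "((\<lambda>p. integral (cbox a b) (f p)) has_field_derivative integral (cbox a b) (f' p)) (at p within {c<..})"
  proof (rule leibniz_rule_field_derivative)
    show "((\<lambda>p. f p x) has_field_derivative f' p x) (at p within {c<..})" if "p \<in> {c<..}" for p x
      using f[of p x] that by (simp add: has_field_derivative_at_within)
    show "f p integrable_on cbox a b" if "p \<in> {c<..}" for p
      by (intro integrable_continuous continuous_on_subset[OF cont_supported_slice[OF fa]]) (use that in auto)
    show "continuous_on ({c<..} \<times> cbox a b) (\<lambda>(p, x). f' p x)"
      using fa' unfolding cont_supported_def by (rule continuous_on_subset[OF conjunct1]) auto
  qed (use p in auto)
  then have "((\<lambda>p. integral (cbox a b) (f p)) has_real_derivative integral (cbox a b) (f' p)) (at p)"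
    using p by (simp add: at_within_open[OF _ open_greaterThan])
  then have "((\<lambda>p. integral (cbox a b) (f p)) has_real_derivative (LINT x|lborel. f' p x)) (at p)"
    using *[OF fa' p] by simp
  then show ?thesis
  proof (rule has_field_derivative_transform_within_open)
    show "open {c<..}" "p \<in> {c<..}" using p by auto
  qed (simp add: *[OF fa])
qed

lemma young: "0 < k \<Longrightarrow> 2 * (a * b) \<le> k * a\<^sup>2 + b\<^sup>2 / (k::real)"
proof -
  assume k: "0 < k"
  have "0 \<le> (k * a - b)\<^sup>2 / k" using k by simp
  also have "\<dots> = k * a\<^sup>2 - 2 * (a * b) + b\<^sup>2 / k" using k by (simp add: field_simps power2_eq_square)
  finally show ?thesis by simp
qed

lemma norm_add_square_le:
  assumes "0 < k"
  shows "(norm (a + b))\<^sup>2 \<le> (1 + k) * (norm a)\<^sup>2 + (1 + 1 / k) * (norm b)\<^sup>2"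
proof -
  have "(norm (a + b))\<^sup>2 \<le> (norm a + norm b)\<^sup>2" by (intro power_mono norm_triangle_ineq) auto
  also have "\<dots> = (norm a)\<^sup>2 + (norm b)\<^sup>2 + 2 * (norm a * norm b)" by (simp add: power2_sum)
  also have "\<dots> \<le> (1 + k) * (norm a)\<^sup>2 + (1 + 1 / k) * (norm b)\<^sup>2"
    using young[OF assms, of "norm a" "norm b"] by (simp add: algebra_simps)
  finally show ?thesis .
qed

lemma inner_young: "0 < k \<Longrightarrow> 2 * \<bar>a \<bullet> b\<bar> \<le> k * (norm a)\<^sup>2 + (norm b)\<^sup>2 / k"
  using young[of k "norm a" "norm b"] Cauchy_Schwarz_ineq2[of a b] by linarith

lemma cutoff_grad_zero: "R + norm x0 < norm x \<Longrightarrow> cutoff_grad x0 R x = 0"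
  by (rule zero_gradient_outside_support[OF cutoff_has_derivative cutoff_zero])

text \<open>The part of |\<nabla>\<zeta>|^2 that 8 \<zeta>^2 fails to dominate. Unlike the explicit
  majorant with \<open>rho\<close> it has compact support, as \<open>cont_supported\<close> demands;
  its integral is of order exp (- 2 R).\<close>

definition cutoff_excess :: "'a::euclidean_space \<Rightarrow> real \<Rightarrow> 'a \<Rightarrow> real"
  where "cutoff_excess x0 R x = max 0 ((norm (cutoff_grad x0 R x))\<^sup>2 - 8 * (cutoff x0 R x)\<^sup>2)"

lemma cutoff_excess:
  shows "(norm (cutoff_grad x0 R x))\<^sup>2 \<le> 8 * (cutoff x0 R x)\<^sup>2 + cutoff_excess x0 R x"
    and "0 \<le> cutoff_excess x0 R x"
    and "R + norm x0 < norm x \<Longrightarrow> cutoff_excess x0 R x = 0"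
    and "continuous_on A (cutoff_excess x0 R)"
    and "(LINT x|lborel. cutoff_excess (x0::'a::euclidean_space) R x) \<le> 8 * exp (- 2 * R) * rho_mass TYPE('a)"
proof -
  show c: "continuous_on A (cutoff_excess x0 R)" for A
    unfolding cutoff_excess_def by (intro continuous_intros)
  show z: "R + norm x0 < norm x \<Longrightarrow> cutoff_excess x0 R x = 0" for x
    by (simp add: cutoff_excess_def cutoff_grad_zero)
  have "(LINT x|lborel. cutoff_excess x0 R x) \<le> (LINT x|lborel. 8 * exp (- 2 * R) * rho x0 x)"
  proof (rule integral_mono)
    show "integrable lborel (cutoff_excess x0 R)" by (rule integrable_bounded_support[OF c z])
    show "integrable lborel (\<lambda>x. 8 * exp (- 2 * R) * rho x0 x)" by (intro integrable_mult_right rho_integrable)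
    show "cutoff_excess x0 R x \<le> 8 * exp (- 2 * R) * rho x0 x" for x
      using cutoff_grad_bound[of x0 R x] by (simp add: cutoff_excess_def)
  qed
  then show "(LINT x|lborel. cutoff_excess x0 R x) \<le> 8 * exp (- 2 * R) * rho_mass TYPE('a)"
    by (simp add: rho_integrable)
qed (auto simp: cutoff_excess_def)

context parabolic
begin

text \<open>The gradient of the component of \<open>w\<close> along \<open>i\<close>. Its equality
  with \<open>H t x i\<close> is the symmetry of the Hessian, which is established later.\<close>

definition Hrow :: "'a \<Rightarrow> real \<Rightarrow> 'a \<Rightarrow> 'a"
  where "Hrow i t x = (\<Sum>j\<in>Basis. (H t x j \<bullet> i) *\<^sub>R j)"

lemma Hrow_inner: "s < t \<Longrightarrow> Hrow i t x \<bullet> v = H t x v \<bullet> i"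
proof -
  assume t: "s < t"
  interpret linear "H t x" by (rule H_linear[OF t])
  have "H t x v = (\<Sum>j\<in>Basis. (v \<bullet> j) *\<^sub>R H t x j)"
    by (subst (1) euclidean_representation[of v, symmetric]) (simp add: sum scale)
  then show ?thesis by (simp add: Hrow_def inner_sum_left inner_sum_right inner_commute[of _ v] mult.commute)
qed

lemma w_component: "s < t \<Longrightarrow> ((\<lambda>x. w t x \<bullet> i) has_derivative (\<lambda>v. Hrow i t x \<bullet> v)) (at x)"
  by (simp add: Hrow_inner) (intro has_derivative_inner_left w_x)

lemma cont:
  assumes "I \<subseteq> {s<..}"
  shows "continuous_on (I \<times> UNIV) (\<lambda>p. u (fst p) (snd p))"
    "continuous_on (I \<times> UNIV) (\<lambda>p. ut (fst p) (snd p))"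
    "continuous_on (I \<times> UNIV) (\<lambda>p. w (fst p) (snd p))"
    "continuous_on (I \<times> UNIV) (\<lambda>p. H (fst p) (snd p) v)"
    "continuous_on (I \<times> UNIV) (\<lambda>p. Hrow i (fst p) (snd p))"
proof -
  have sub: "I \<times> UNIV \<subseteq> {s<..} \<times> (UNIV :: 'a set)" using assms by auto
  show "continuous_on (I \<times> UNIV) (\<lambda>p. u (fst p) (snd p))" by (rule u_cont_on) (use assms in auto)
  show "continuous_on (I \<times> UNIV) (\<lambda>p. ut (fst p) (snd p))"
    "continuous_on (I \<times> UNIV) (\<lambda>p. w (fst p) (snd p))"
    using continuous_on_subset[OF ut_cont sub] continuous_on_subset[OF w_cont sub] by (simp_all add: split_def)
  show H: "continuous_on (I \<times> UNIV) (\<lambda>p. H (fst p) (snd p) v)" for v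
    using continuous_on_subset[OF H_cont[of v] sub] by (simp add: split_def)
  show "continuous_on (I \<times> UNIV) (\<lambda>p. Hrow i (fst p) (snd p))"
    unfolding Hrow_def by (intro continuous_intros H)
qed

lemma cont_slice:
  assumes "s < t"
  shows "continuous_on UNIV (u t)" "continuous_on UNIV (ut t)" "continuous_on UNIV (w t)"
    "continuous_on UNIV (\<lambda>x. H t x v)" "continuous_on UNIV (Hrow i t)"
proof -
  have "{t} \<subseteq> {s<..}" using assms by simp
  note c = cont[OF this]
  show "continuous_on UNIV (u t)" by (rule continuous_on_slice[OF c(1)])
  show "continuous_on UNIV (ut t)" by (rule continuous_on_slice[OF c(2)])
  show "continuous_on UNIV (w t)" by (rule continuous_on_slice[OF c(3)])
  show "continuous_on UNIV (\<lambda>x. H t x v)" by (rule continuous_on_slice[of t "\<lambda>t x. H t x v", OF c(4)])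
  show "continuous_on UNIV (Hrow i t)" by (rule continuous_on_slice[OF c(5)])
qed

lemma LINT_trace_by_parts:
  assumes t: "s < t" and f: "\<And>x. (f has_derivative (\<lambda>v. F x \<bullet> v)) (at x)" and F: "continuous_on UNIV F"
    and z: "\<And>x. r < norm x \<Longrightarrow> f x = 0"
  shows "(LINT x|lborel. f x * (\<Sum>i\<in>Basis. H t x i \<bullet> i)) = - (LINT x|lborel. F x \<bullet> w t x)"
proof -
  have fc: "continuous_on UNIV f" by (rule has_derivative_continuous_on_UNIV[OF f])
  have Fz: "F x = 0" if "r < norm x" for x by (rule zero_gradient_outside_support[OF f z that])
  have i1: "integrable lborel (\<lambda>x. f x * (H t x i \<bullet> i))" for i
    by (rule integrable_bounded_support[where R = r]) (use z in \<open>auto intro!: continuous_intros fc cont_slice t\<close>)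
  have i2: "integrable lborel (\<lambda>x. (w t x \<bullet> i) * (F x \<bullet> i))" for i
    by (rule integrable_bounded_support[where R = r]) (use Fz in \<open>auto intro!: continuous_intros F cont_slice t\<close>)
  have "(LINT x|lborel. f x * (\<Sum>i\<in>Basis. H t x i \<bullet> i)) = (\<Sum>i\<in>Basis. LINT x|lborel. f x * (H t x i \<bullet> i))"
    using i1 by (simp add: sum_distrib_left)
  also have "\<dots> = (\<Sum>i\<in>Basis. - (LINT x|lborel. (w t x \<bullet> i) * (F x \<bullet> i)))"
  proof (rule sum.cong[OF refl])
    fix i
    show "(LINT x|lborel. f x * (H t x i \<bullet> i)) = - (LINT x|lborel. (w t x \<bullet> i) * (F x \<bullet> i))"
      using LINT_by_parts[OF f F w_component[OF t] cont_slice(5)[OF t] z, where v = i]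
      by (simp add: Hrow_inner[OF t])
  qed
  also have "\<dots> = - (LINT x|lborel. (\<Sum>i\<in>Basis. (w t x \<bullet> i) * (F x \<bullet> i)))"
    using i2 by (simp add: sum_negf)
  also have "(\<lambda>x. \<Sum>i\<in>Basis. (w t x \<bullet> i) * (F x \<bullet> i)) = (\<lambda>x. F x \<bullet> w t x)"
    by (auto simp: euclidean_inner[of "F _" "w t _"] mult.commute)
  finally show ?thesis .
qed

end

text \<open>Coefficient of u^2 |\<nabla>\<zeta>|^2 for e = sqrt \<delta> and the Young weight k = 1
  - e: 4 / k comes from the cross term of \<nabla>\<zeta> and \<nabla>u, and e (1 + 1 / k) from the
  gradient of \<zeta> u in the form inequality.\<close>

definition L2_rate :: "real \<Rightarrow> real"
  where "L2_rate e = 4 / (1 - e) + e * (1 + 1 / (1 - e))"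

text \<open>No assumption mentions \<open>x0\<close> and \<open>R\<close>, so the locale predicate
  does not take them: one verified instance yields the estimates for all centres and radii of the
  weight.\<close>

locale parabolic_form = parabolic b S s u ut w H
  for b :: "real \<times> 'a::euclidean_space \<Rightarrow> 'a" and S s u ut w H +
  fixes T \<delta> :: real and g :: "real \<Rightarrow> real" and x0 :: 'a and R :: real
  assumes form: "form_inequality T b \<delta> g" and b_cont: "continuous_on UNIV b"
    and \<delta>: "0 < \<delta>" "\<delta> < 1" and s0: "0 \<le> s"
    and g_int: "set_integrable lborel {0..T} g" and g_nonneg: "\<And>t. 0 \<le> g t"
    and S_cont: "continuous_on ({s<..} \<times> UNIV) (\<lambda>(t, x). S t x)"
begin

abbreviation "\<zeta> \<equiv> cutoff x0 R"
abbreviation "Z \<equiv> cutoff_grad x0 R"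
abbreviation "r \<equiv> R + norm x0"

lemma b_cont_on: "continuous_on X b"
  using continuous_on_subset[OF b_cont] by blast

lemma S_cont_on:
  assumes "I \<subseteq> {s<..}"
  shows "continuous_on (I \<times> UNIV) (\<lambda>p. S (fst p) (snd p))"
  using continuous_on_subset[OF S_cont, of "I \<times> UNIV"] assms by (auto simp: split_def)

lemma g_integrable_on: "0 \<le> t1 \<Longrightarrow> t2 \<le> T \<Longrightarrow> g integrable_on {t1..t2}"
  using set_borel_integral_eq_integral(1)[OF set_integrable_subset[OF g_int, of "{t1..t2}"]] by auto

lemma L2_dissipation:
  assumes t: "s < t"
  shows "(LINT x|lborel. 2 * ((\<zeta> x)\<^sup>2 * u t x) * ut t x)
    = (LINT x|lborel. - 2 * (\<zeta> x)\<^sup>2 * (norm (w t x))\<^sup>2 - 4 * \<zeta> x * u t x * (Z x \<bullet> w t x)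
        - 2 * (\<zeta> x)\<^sup>2 * u t x * (b (t, x) \<bullet> w t x) + 2 * (\<zeta> x)\<^sup>2 * u t x * S t x)"
proof -
  note c = cont_slice[OF t]
  have Sc: "continuous_on UNIV (S t)"
    by (rule continuous_on_slice, rule S_cont_on) (use t in simp)
  have bt: "continuous_on UNIV (\<lambda>x. b (t, x))"
    by (rule continuous_on_compose2[OF b_cont]) (auto intro!: continuous_intros)
  define F where "F x = (2 * \<zeta> x * u t x) *\<^sub>R Z x + (\<zeta> x)\<^sup>2 *\<^sub>R w t x" for x
  have Fc: "continuous_on UNIV F" unfolding F_def by (intro continuous_intros c)
  have F: "((\<lambda>x. (\<zeta> x)\<^sup>2 * u t x) has_derivative (\<lambda>v. F x \<bullet> v)) (at x)" for x
    by (auto intro!: derivative_eq_intros cutoff_has_derivative u_x[OF t] simp: F_def inner_simps algebra_simps)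
  have "integrable lborel (\<lambda>x. F x \<bullet> w t x)"
    by (rule integrable_bounded_support[where R = r])
      (auto simp: F_def cutoff_zero intro!: continuous_intros Fc[unfolded F_def] c)
  moreover have "integrable lborel (\<lambda>x. ((\<zeta> x)\<^sup>2 * u t x) * (\<Sum>i\<in>Basis. H t x i \<bullet> i))"
    by (rule integrable_bounded_support[where R = r]) (auto simp: cutoff_zero intro!: continuous_intros c)
  moreover have i3: "integrable lborel (\<lambda>x. ((\<zeta> x)\<^sup>2 * u t x) * (S t x - b (t, x) \<bullet> w t x))"
    by (rule integrable_bounded_support[where R = r]) (auto simp: cutoff_zero intro!: continuous_intros c Sc bt)
  moreover have "(LINT x|lborel. ((\<zeta> x)\<^sup>2 * u t x) * (\<Sum>i\<in>Basis. H t x i \<bullet> i)) = - (LINT x|lborel. F x \<bullet> w t x)"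
    by (rule LINT_trace_by_parts[OF t F Fc, where r = r]) (simp add: cutoff_zero)
  ultimately have "(LINT x|lborel. ((\<zeta> x)\<^sup>2 * u t x) * (\<Sum>i\<in>Basis. H t x i \<bullet> i) + ((\<zeta> x)\<^sup>2 * u t x) * (S t x - b (t, x) \<bullet> w t x))
     = (LINT x|lborel. - (F x \<bullet> w t x) + ((\<zeta> x)\<^sup>2 * u t x) * (S t x - b (t, x) \<bullet> w t x))"
    by simp
  then have "2 * (LINT x|lborel. ((\<zeta> x)\<^sup>2 * u t x) * (\<Sum>i\<in>Basis. H t x i \<bullet> i) + ((\<zeta> x)\<^sup>2 * u t x) * (S t x - b (t, x) \<bullet> w t x))
     = 2 * (LINT x|lborel. - (F x \<bullet> w t x) + ((\<zeta> x)\<^sup>2 * u t x) * (S t x - b (t, x) \<bullet> w t x))"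
    by simp
  then show ?thesis
    unfolding integral_mult_right_zero[symmetric]
    by (simp add: eq[OF t] F_def algebra_simps inner_simps power2_norm_eq_inner)
qed

definition E2 :: "real \<Rightarrow> real"
  where "E2 t = (LINT x|lborel. (\<zeta> x * u t x)\<^sup>2)"

lemma E2_increment:
  assumes "s < t1" "t1 \<le> t2"
  shows "E2 t2 - E2 t1 = spacetime_integral t1 t2 (\<lambda>t x. 2 * ((\<zeta> x)\<^sup>2 * u t x) * ut t x)"
proof -
  have "(E2 has_real_derivative (LINT x|lborel. 2 * ((\<zeta> x)\<^sup>2 * u t x) * ut t x)) (at t)" if "s < t" for t
    unfolding E2_def
  proof (rule LINT_has_real_derivative[where c = s])
    show "cont_supported {s<..} r (\<lambda>t x. (\<zeta> x * u t x)\<^sup>2)" "cont_supported {s<..} r (\<lambda>t x. 2 * ((\<zeta> x)\<^sup>2 * u t x) * ut t x)"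
      by (rule cont_supportedI; auto simp: cutoff_zero intro!: continuous_intros cont)+
    show "((\<lambda>t. (\<zeta> x * u t x)\<^sup>2) has_real_derivative 2 * ((\<zeta> x)\<^sup>2 * u t x) * ut t x) (at t)" if "s < t" for t x
      by (rule derivative_eq_intros u_t[OF that] refl | simp)+ (simp add: power2_eq_square)
  qed (rule that)
  then have "((\<lambda>t. LINT x|lborel. 2 * ((\<zeta> x)\<^sup>2 * u t x) * ut t x) has_integral E2 t2 - E2 t1) {t1..t2}"
    using assms
    by (intro fundamental_theorem_of_calculus)
      (auto simp: has_real_derivative_iff_has_vector_derivative[symmetric] intro: has_field_derivative_at_within)
  then show ?thesis by (simp add: spacetime_integral_def integral_unique)
qed

text \<open>Young's inequality with weight e = sqrt \<delta> splits the drift term, and the form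
  inequality returns e |\<nabla>(\<zeta> u)|^2 for its half with |b|^2. With k = 1 - e for the
  cutoff terms the coefficient of \<zeta>^2 |\<nabla>u|^2 becomes - (1 - e)^2, so the gradient drops
  out exactly because \<delta> < 1.\<close>

lemma L2_inequality:
  assumes t: "s < t1" "t1 \<le> t2" "t2 \<le> T" and M: "\<And>t x. s \<le> t \<Longrightarrow> t \<le> T \<Longrightarrow> \<bar>u t x\<bar> \<le> M"
  shows "E2 t2 \<le> E2 t1 + integral {t1..t2} (\<lambda>t. (8 * L2_rate (sqrt \<delta>) + g t / sqrt \<delta>) * E2 t)
      + (8 * L2_rate (sqrt \<delta>) * T * M\<^sup>2 * exp (- 2 * R) * rho_mass TYPE('a) + spacetime_integral t1 t2 (\<lambda>t x. 2 * (\<zeta> x)\<^sup>2 * (\<bar>u t x\<bar> * \<bar>S t x\<bar>)))"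
    and "(\<lambda>t. (8 * L2_rate (sqrt \<delta>) + g t / sqrt \<delta>) * E2 t) integrable_on {t1..t2}"
proof -
  define e where "e = sqrt \<delta>"
  have e: "0 < e" "e < 1" "e\<^sup>2 = \<delta>" using \<delta> by (auto simp: e_def)
  define k where "k = 1 - e"
  have k: "0 < k" using e by (simp add: k_def)
  define C where "C = L2_rate e"
  have C_eq: "C = 4 / k + e * (1 + 1 / k)" by (simp add: C_def L2_rate_def k_def)
  have C: "0 < C" unfolding C_eq using k e by (intro add_pos_pos mult_pos_pos divide_pos_pos) auto
  let ?I = "{t1..t2}"
  have sub: "?I \<subseteq> {s<..}" using t by auto
  note c = cont[OF sub] S_cont_on[OF sub]
  define \<psi> where "\<psi> t x = \<zeta> x * u t x" for t x
  define G where "G t x = u t x *\<^sub>R Z x + \<zeta> x *\<^sub>R w t x" for t x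
  have Gd: "(\<psi> t has_derivative (\<lambda>v. G t x \<bullet> v)) (at x)" if "t1 \<le> t" "t \<le> t2" for t x
    unfolding \<psi>_def using that t
    by (auto intro!: derivative_eq_intros cutoff_has_derivative u_x simp: G_def inner_simps algebra_simps)
  have \<psi>z: "\<psi> t x = 0" if "r < norm x" for t x using that by (simp add: \<psi>_def cutoff_zero)
  define Q where "Q t x = (\<psi> t x)\<^sup>2 * (norm (b (t, x)))\<^sup>2" for t x
  define D where "D t x = (norm (G t x))\<^sup>2" for t x
  define P where "P t x = - (2 - k - e) * (\<zeta> x)\<^sup>2 * (norm (w t x))\<^sup>2 + (4 / k) * (u t x)\<^sup>2 * (norm (Z x))\<^sup>2
      + 2 * (\<zeta> x)\<^sup>2 * (\<bar>u t x\<bar> * \<bar>S t x\<bar>)" for t x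
  have aQ: "cont_supported ?I r Q" unfolding Q_def \<psi>_def
    by (rule cont_supportedI) (auto simp: cutoff_zero intro!: continuous_intros c continuous_on_compose2[OF b_cont])
  have aD: "cont_supported ?I r D" unfolding D_def G_def
    by (rule cont_supportedI) (auto simp: cutoff_zero cutoff_grad_zero intro!: continuous_intros c)
  have aP: "cont_supported ?I r P" unfolding P_def
    by (rule cont_supportedI) (use k in \<open>auto simp: cutoff_zero cutoff_grad_zero intro!: continuous_intros c\<close>)
  have aS: "cont_supported ?I r (\<lambda>t x. 2 * (\<zeta> x)\<^sup>2 * (\<bar>u t x\<bar> * \<bar>S t x\<bar>))"
    by (rule cont_supportedI) (auto simp: cutoff_zero intro!: continuous_intros c)
  have a2: "cont_supported ?I r (\<lambda>t x. (\<psi> t x)\<^sup>2)" unfolding \<psi>_def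
    by (rule cont_supportedI) (auto simp: cutoff_zero intro!: continuous_intros c)
  have aX: "cont_supported ?I r (\<lambda>t. cutoff_excess x0 R)"
    by (rule cont_supportedI) (auto simp: cutoff_excess(3) intro!: continuous_on_compose2[OF cutoff_excess(4)[of UNIV]] continuous_intros)
  have E2_eq: "E2 t = (LINT x|lborel. (\<psi> t x)\<^sup>2)" for t by (simp add: E2_def \<psi>_def)
  define R1 where "R1 t x = - 2 * (\<zeta> x)\<^sup>2 * (norm (w t x))\<^sup>2 - 4 * \<zeta> x * u t x * (Z x \<bullet> w t x)
        - 2 * (\<zeta> x)\<^sup>2 * u t x * (b (t, x) \<bullet> w t x) + 2 * (\<zeta> x)\<^sup>2 * u t x * S t x" for t x
  have aR1: "cont_supported ?I r R1" unfolding R1_def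
    by (rule cont_supportedI) (auto simp: cutoff_zero intro!: continuous_intros c continuous_on_compose2[OF b_cont])
  have "E2 t2 - E2 t1 = spacetime_integral t1 t2 (\<lambda>t x. 2 * ((\<zeta> x)\<^sup>2 * u t x) * ut t x)" by (rule E2_increment[OF t(1,2)])
  also have "\<dots> = spacetime_integral t1 t2 R1"
    unfolding spacetime_integral_def R1_def
    by (rule Henstock_Kurzweil_Integration.integral_cong) (rule L2_dissipation, use t in auto)
  also have "\<dots> \<le> spacetime_integral t1 t2 (\<lambda>t x. (1 / e) * Q t x + P t x)"
  proof (rule spacetime_integral_mono[OF aR1 cont_supported_add[OF cont_supported_cmult[OF aQ] aP]])
    fix t x
    have "- 4 * \<zeta> x * u t x * (Z x \<bullet> w t x) \<le> 2 * \<bar>(\<zeta> x *\<^sub>R w t x) \<bullet> ((2 * u t x) *\<^sub>R Z x)\<bar>"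
      using abs_ge_minus_self[of "4 * \<zeta> x * u t x * (Z x \<bullet> w t x)"] by (simp add: inner_commute abs_mult mult_ac)
    also have "\<dots> \<le> k * (norm (\<zeta> x *\<^sub>R w t x))\<^sup>2 + (norm ((2 * u t x) *\<^sub>R Z x))\<^sup>2 / k" by (rule inner_young[OF k])
    finally have 1: "- 4 * \<zeta> x * u t x * (Z x \<bullet> w t x) \<le> k * (\<zeta> x)\<^sup>2 * (norm (w t x))\<^sup>2 + (4 / k) * (u t x)\<^sup>2 * (norm (Z x))\<^sup>2"
      by (simp add: power_mult_distrib)
    have "- 2 * (\<zeta> x)\<^sup>2 * u t x * (b (t, x) \<bullet> w t x) \<le> 2 * \<bar>(\<zeta> x *\<^sub>R w t x) \<bullet> (\<psi> t x *\<^sub>R b (t, x))\<bar>"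
      using abs_ge_minus_self[of "2 * (\<zeta> x)\<^sup>2 * u t x * (b (t, x) \<bullet> w t x)"]
      by (simp add: \<psi>_def inner_commute abs_mult mult_ac power2_eq_square)
    also have "\<dots> \<le> e * (norm (\<zeta> x *\<^sub>R w t x))\<^sup>2 + (norm (\<psi> t x *\<^sub>R b (t, x)))\<^sup>2 / e" by (rule inner_young[OF e(1)])
    finally have 2: "- 2 * (\<zeta> x)\<^sup>2 * u t x * (b (t, x) \<bullet> w t x) \<le> e * (\<zeta> x)\<^sup>2 * (norm (w t x))\<^sup>2 + (1 / e) * Q t x"
      by (simp add: Q_def power_mult_distrib)
    have 3: "2 * (\<zeta> x)\<^sup>2 * u t x * S t x \<le> 2 * (\<zeta> x)\<^sup>2 * (\<bar>u t x\<bar> * \<bar>S t x\<bar>)"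
      using abs_ge_self[of "2 * (\<zeta> x)\<^sup>2 * u t x * S t x"] by (simp add: abs_mult)
    show "R1 t x \<le> (1 / e) * Q t x + P t x"
      using 1 2 3 by (simp add: R1_def P_def algebra_simps)
  qed
  also have "\<dots> = (1 / e) * spacetime_integral t1 t2 Q + spacetime_integral t1 t2 P"
    by (simp only: spacetime_integral_add[OF cont_supported_cmult[OF aQ] aP] spacetime_integral_cmult)
  also have "(1 / e) * spacetime_integral t1 t2 Q \<le> (1 / e) * (\<delta> * spacetime_integral t1 t2 D + integral {t1..t2} (\<lambda>t. g t * E2 t))"
  proof (rule mult_left_mono)
    show "spacetime_integral t1 t2 Q \<le> \<delta> * spacetime_integral t1 t2 D + integral {t1..t2} (\<lambda>t. g t * E2 t)"
      unfolding spacetime_integral_def Q_def D_def E2_eq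
    proof (rule form_inequality_real(1)[OF form b_cont _ g_int g_nonneg, where R = r])
      show "continuous_on (?I \<times> UNIV) (\<lambda>(t, x). \<psi> t x)" "continuous_on (?I \<times> UNIV) (\<lambda>(t, x). G t x)"
        unfolding \<psi>_def G_def split_def by (intro continuous_intros c)+
    qed (use t s0 \<delta> Gd \<psi>z in auto)
  qed (use e in simp)
  also have "\<dots> = e * spacetime_integral t1 t2 D + (1 / e) * integral {t1..t2} (\<lambda>t. g t * E2 t)"
    using e by (simp add: field_simps power2_eq_square flip: e(3))
  finally have A: "E2 t2 - E2 t1 \<le> e * spacetime_integral t1 t2 D + spacetime_integral t1 t2 P + (1 / e) * integral {t1..t2} (\<lambda>t. g t * E2 t)"
    by simp
  have "e * spacetime_integral t1 t2 D + spacetime_integral t1 t2 P = spacetime_integral t1 t2 (\<lambda>t x. e * D t x + P t x)"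
    by (simp only: spacetime_integral_add[OF cont_supported_cmult[OF aD] aP] spacetime_integral_cmult)
  also have "\<dots> \<le> spacetime_integral t1 t2 (\<lambda>t x. (8 * C) * (\<psi> t x)\<^sup>2 + ((C * M\<^sup>2) * cutoff_excess x0 R x + 2 * (\<zeta> x)\<^sup>2 * (\<bar>u t x\<bar> * \<bar>S t x\<bar>)))"
  proof (rule spacetime_integral_mono[OF cont_supported_add[OF cont_supported_cmult[OF aD] aP] cont_supported_add[OF cont_supported_cmult[OF a2] cont_supported_add[OF cont_supported_cmult[OF aX] aS]]])
    fix t x assume ti: "t \<in> ?I"
    have "e * D t x \<le> e * ((1 + k) * (norm (\<zeta> x *\<^sub>R w t x))\<^sup>2 + (1 + 1 / k) * (norm (u t x *\<^sub>R Z x))\<^sup>2)"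
      unfolding D_def G_def using norm_add_square_le[OF k, of "\<zeta> x *\<^sub>R w t x" "u t x *\<^sub>R Z x"] e
      by (intro mult_left_mono) (auto simp: add.commute)
    then have "e * D t x + P t x \<le> (e * (1 + k) - (2 - k - e)) * ((\<zeta> x)\<^sup>2 * (norm (w t x))\<^sup>2) + C * ((u t x)\<^sup>2 * (norm (Z x))\<^sup>2)
        + 2 * (\<zeta> x)\<^sup>2 * (\<bar>u t x\<bar> * \<bar>S t x\<bar>)"
      by (simp add: P_def C_eq power_mult_distrib algebra_simps)
    moreover have "(e * (1 + k) - (2 - k - e)) * ((\<zeta> x)\<^sup>2 * (norm (w t x))\<^sup>2) \<le> 0"
    proof (rule mult_nonpos_nonneg)
      have "e * (1 + k) - (2 - k - e) = - (1 - e)\<^sup>2" by (simp add: k_def power2_eq_square algebra_simps)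
      then show "e * (1 + k) - (2 - k - e) \<le> 0" by simp
    qed simp
    moreover have "C * ((u t x)\<^sup>2 * (norm (Z x))\<^sup>2) \<le> C * (8 * (\<psi> t x)\<^sup>2 + M\<^sup>2 * cutoff_excess x0 R x)"
    proof (rule mult_left_mono)
      have "(u t x)\<^sup>2 * (norm (Z x))\<^sup>2 \<le> (u t x)\<^sup>2 * (8 * (\<zeta> x)\<^sup>2 + cutoff_excess x0 R x)"
        by (intro mult_left_mono cutoff_excess) simp
      also have "\<dots> \<le> 8 * (\<psi> t x)\<^sup>2 + M\<^sup>2 * cutoff_excess x0 R x"
      proof -
        have "(u t x)\<^sup>2 \<le> M\<^sup>2" using M[of t x] ti t by (simp add: abs_le_square_iff[symmetric])
        then have "(u t x)\<^sup>2 * cutoff_excess x0 R x \<le> M\<^sup>2 * cutoff_excess x0 R x"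
          by (intro mult_right_mono cutoff_excess)
        then show ?thesis by (simp add: \<psi>_def power_mult_distrib algebra_simps)
      qed
      finally show "(u t x)\<^sup>2 * (norm (Z x))\<^sup>2 \<le> 8 * (\<psi> t x)\<^sup>2 + M\<^sup>2 * cutoff_excess x0 R x" .
    qed (use C in simp)
    ultimately show "e * D t x + P t x \<le> (8 * C) * (\<psi> t x)\<^sup>2 + ((C * M\<^sup>2) * cutoff_excess x0 R x + 2 * (\<zeta> x)\<^sup>2 * (\<bar>u t x\<bar> * \<bar>S t x\<bar>))"
      by (simp add: algebra_simps)
  qed
  also have "\<dots> = (8 * C) * integral {t1..t2} E2 + ((C * M\<^sup>2) * ((t2 - t1) * (LINT x|lborel. cutoff_excess x0 R x))
      + spacetime_integral t1 t2 (\<lambda>t x. 2 * (\<zeta> x)\<^sup>2 * (\<bar>u t x\<bar> * \<bar>S t x\<bar>)))"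
    unfolding spacetime_integral_add[OF cont_supported_cmult[OF a2] cont_supported_add[OF cont_supported_cmult[OF aX] aS]] spacetime_integral_add[OF cont_supported_cmult[OF aX] aS] spacetime_integral_cmult spacetime_integral_const[OF t(2)]
    by (simp add: spacetime_integral_def E2_eq[abs_def])
  finally have B: "e * spacetime_integral t1 t2 D + spacetime_integral t1 t2 P \<le> \<dots>" .
  have X: "(C * M\<^sup>2) * ((t2 - t1) * (LINT x|lborel. cutoff_excess x0 R x)) \<le> (C * M\<^sup>2) * (T * (8 * exp (- 2 * R) * rho_mass TYPE('a)))"
    using C t s0 rho_mass_nonneg[where 'a='a] by (intro mult_left_mono mult_mono cutoff_excess(5) integral_nonneg_AE) (auto intro: cutoff_excess(2))
  have E2c: "continuous_on {t1..t2} E2" unfolding E2_eq[abs_def] by (rule cont_supported_continuous_LINT[OF a2])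
  have gE: "(\<lambda>t. g t * E2 t) integrable_on {t1..t2}"
    unfolding E2_eq
  proof (rule form_inequality_real(2)[OF form b_cont _ g_int g_nonneg, where R = r])
    show "continuous_on (?I \<times> UNIV) (\<lambda>(t, x). \<psi> t x)" "continuous_on (?I \<times> UNIV) (\<lambda>(t, x). G t x)"
      unfolding \<psi>_def G_def split_def by (intro continuous_intros c)+
  qed (use t s0 \<delta> Gd \<psi>z in auto)
  have i1: "(\<lambda>t. (8 * C) * E2 t) integrable_on {t1..t2}" and i2: "(\<lambda>t. (1 / e) * (g t * E2 t)) integrable_on {t1..t2}"
    using integrable_cmul[OF integrable_continuous_interval[OF E2c], of "8 * C"] integrable_cmul[OF gE, of "1 / e"] by simp_all
  have split: "(8 * L2_rate (sqrt \<delta>) + g t / sqrt \<delta>) * E2 t = (8 * C) * E2 t + (1 / e) * (g t * E2 t)" for t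
    by (simp add: C_def e_def algebra_simps)
  show "(\<lambda>t. (8 * L2_rate (sqrt \<delta>) + g t / sqrt \<delta>) * E2 t) integrable_on {t1..t2}"
    unfolding split by (rule Henstock_Kurzweil_Integration.integrable_add[OF i1 i2])
  have "integral {t1..t2} (\<lambda>t. (8 * L2_rate (sqrt \<delta>) + g t / sqrt \<delta>) * E2 t)
     = (8 * C) * integral {t1..t2} E2 + (1 / e) * integral {t1..t2} (\<lambda>t. g t * E2 t)"
    unfolding split by (subst Henstock_Kurzweil_Integration.integral_add[OF i1 i2]) simp
  then show "E2 t2 \<le> E2 t1 + integral {t1..t2} (\<lambda>t. (8 * L2_rate (sqrt \<delta>) + g t / sqrt \<delta>) * E2 t)
      + (8 * L2_rate (sqrt \<delta>) * T * M\<^sup>2 * exp (- 2 * R) * rho_mass TYPE('a) + spacetime_integral t1 t2 (\<lambda>t x. 2 * (\<zeta> x)\<^sup>2 * (\<bar>u t x\<bar> * \<bar>S t x\<bar>)))"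
    using A B X by (simp add: C_def e_def mult_ac)
qed

end

text \<open>Shared by the energies of the solution and of its gradient. The kernel is integrated
  over all of [0, T], so the number \<open>N\<close> of doublings depends neither on the initial
  time nor on \<open>t\<close>. The start lies strictly after \<open>s\<close>, where derivatives
  exist.\<close>

lemma (in parabolic_form) growth_from_inequality:
  assumes E: "continuous_on {t1..T} E" "\<And>t. 0 \<le> E t" and t: "s < t1" "t1 \<le> t" "t \<le> T"
    and c: "0 \<le> c1" "0 \<le> c2" "0 \<le> X"
    and i: "\<And>r1 r2. s < r1 \<Longrightarrow> r1 \<le> r2 \<Longrightarrow> r2 \<le> T \<Longrightarrow> (\<lambda>t. (c1 + c2 * g t) * E t) integrable_on {r1..r2}"
    and le: "\<And>r1 r2. s < r1 \<Longrightarrow> r1 \<le> r2 \<Longrightarrow> r2 \<le> T \<Longrightarrow> E r2 \<le> E r1 + integral {r1..r2} (\<lambda>t. (c1 + c2 * g t) * E t) + X"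
    and N: "c1 * T + c2 * integral {0..T} g \<le> real N / 2"
  shows "E t \<le> 2 ^ N * (E t1 + 3 * X)"
proof (rule gronwall_doubling[OF E])
  have gi: "g integrable_on {r1..r2}" if "0 \<le> r1" "r2 \<le> T" for r1 r2 by (rule g_integrable_on[OF that])
  have ai: "(\<lambda>t. c1 + c2 * g t) integrable_on {r1..r2}" if "0 \<le> r1" "r2 \<le> T" for r1 r2
    using Henstock_Kurzweil_Integration.integrable_add[OF integrable_const_ivl[of c1] integrable_cmul[OF gi[OF that], of c2]] by simp
  show "(\<lambda>t. c1 + c2 * g t) integrable_on {t1..T}" using ai s0 t by simp
  show "0 \<le> c1 + c2 * g t" for t using c g_nonneg by simp
  have "integral {t1..t} (\<lambda>t. c1 + c2 * g t) = c1 * (t - t1) + c2 * integral {t1..t} g"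
    using Henstock_Kurzweil_Integration.integral_add[OF integrable_const_ivl[of c1 t1 t] integrable_cmul[OF gi[of t1 t], of c2]] s0 t by simp
  also have "\<dots> \<le> c1 * T + c2 * integral {0..T} g"
    using c s0 t g_nonneg by (intro add_mono mult_left_mono integral_subset_le gi) auto
  finally show "integral {t1..t} (\<lambda>t. c1 + c2 * g t) \<le> real N / 2" using N by linarith
qed (use t c i le in auto)

lemma (in parabolic_form) E2_continuous: "continuous_on {s..} E2"
proof -
  have "cont_supported {s..} r (\<lambda>t x. (\<zeta> x * u t x)\<^sup>2)"
    by (rule cont_supportedI) (auto simp: cutoff_zero intro!: continuous_intros u_cont_on)
  from cont_supported_continuous_LINT[OF this] show ?thesis by (simp add: E2_def[abs_def])
qed

theorem (in parabolic_form) L2_growth: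
  assumes M: "\<And>t x. s \<le> t \<Longrightarrow> t \<le> T \<Longrightarrow> \<bar>u t x\<bar> \<le> M"
    and \<sigma>: "\<And>t1 t2. s < t1 \<Longrightarrow> t1 \<le> t2 \<Longrightarrow> t2 \<le> T \<Longrightarrow> spacetime_integral t1 t2 (\<lambda>t x. 2 * (\<zeta> x)\<^sup>2 * (\<bar>u t x\<bar> * \<bar>S t x\<bar>)) \<le> \<sigma>" "0 \<le> \<sigma>"
    and N: "8 * L2_rate (sqrt \<delta>) * T + integral {0..T} g / sqrt \<delta> \<le> real N / 2"
    and t: "s \<le> t" "t \<le> T"
  shows "E2 t \<le> 2 ^ N * (E2 s + 3 * (8 * L2_rate (sqrt \<delta>) * T * M\<^sup>2 * exp (- 2 * R) * rho_mass TYPE('a) + \<sigma>))"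
proof -
  define X where "X = 8 * L2_rate (sqrt \<delta>) * T * M\<^sup>2 * exp (- 2 * R) * rho_mass TYPE('a) + \<sigma>"
  have rate: "0 < L2_rate (sqrt \<delta>)"
    using \<delta> unfolding L2_rate_def by (intro add_pos_pos mult_pos_pos divide_pos_pos) auto
  have X: "0 \<le> X"
    using rate t s0 \<sigma>(2) rho_mass_nonneg[where 'a='a] by (simp add: X_def)
  have E2n: "0 \<le> E2 t" for t by (simp add: E2_def)
  have N1: "(1::real) \<le> 2 ^ N" by simp
  show ?thesis
  proof (cases "t = s")
    case True
    have "1 * (E2 s + 0) \<le> 2 ^ N * (E2 s + 3 * X)"
      using X E2n N1 by (intro mult_mono) auto
    then show ?thesis using True by (simp add: X_def)
  next
    case False
    with t have st: "s < t" by simp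
    have *: "E2 t \<le> 2 ^ N * (E2 t1 + 3 * X)" if "s < t1" "t1 \<le> t" for t1
    proof (rule growth_from_inequality[OF _ E2n, where ?c1.0 = "8 * L2_rate (sqrt \<delta>)" and ?c2.0 = "1 / sqrt \<delta>"])
      show "continuous_on {t1..T} E2" by (rule continuous_on_subset[OF E2_continuous]) (use that in auto)
      show "(\<lambda>t. (8 * L2_rate (sqrt \<delta>) + 1 / sqrt \<delta> * g t) * E2 t) integrable_on {r1..r2}"
        if "s < r1" "r1 \<le> r2" "r2 \<le> T" for r1 r2
        using L2_inequality(2)[OF that M] by simp
      show "E2 r2 \<le> E2 r1 + integral {r1..r2} (\<lambda>t. (8 * L2_rate (sqrt \<delta>) + 1 / sqrt \<delta> * g t) * E2 t) + X"
        if "s < r1" "r1 \<le> r2" "r2 \<le> T" for r1 r2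
        using L2_inequality(1)[OF that M] \<sigma>(1)[OF that] by (simp add: X_def)
    qed (use that t X rate \<delta> N in auto)
    \<comment> \<open>The solution is continuous down to time \<open>s\<close>, so the starting time
      may tend to \<open>s\<close>.\<close>
    have "((\<lambda>t1. 2 ^ N * (E2 t1 + 3 * X)) \<longlongrightarrow> 2 ^ N * (E2 s + 3 * X)) (at_right s)"
    proof (intro tendsto_intros)
      have "(E2 \<longlongrightarrow> E2 s) (at s within {s..})" using E2_continuous by (simp add: continuous_on_def)
      then show "(E2 \<longlongrightarrow> E2 s) (at_right s)" by (rule tendsto_within_subset) auto
    qed
    then have "E2 t \<le> 2 ^ N * (E2 s + 3 * X)"
    proof (rule tendsto_lowerbound)
      show "\<forall>\<^sub>F t1 in at_right s. E2 t \<le> 2 ^ N * (E2 t1 + 3 * X)"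
        using * st by (auto simp: eventually_at_right[OF st])
    qed simp
    then show ?thesis by (simp add: X_def)
  qed
qed

text \<open>The fundamental lemma of the calculus of variations: \<open>cutoff x0 R\<close> lives
  where \<open>japanese (x - x0)\<close> is less than \<open>R\<close>, a small ball around
  \<open>x0\<close> when \<open>R\<close> is slightly above 1. A one-sided conclusion suffices,
  since both signs can be inserted.\<close>

lemma LINT_cutoff_eq_zero_imp:
  fixes h :: "'a::euclidean_space \<Rightarrow> real"
  assumes h: "continuous_on UNIV h" and z: "\<And>R. (LINT x|lborel. cutoff x0 R x * h x) = 0"
  shows "h x0 \<le> 0"
proof (rule ccontr)
  assume "\<not> h x0 \<le> 0"
  then have hp: "h x0 > 0" by simp
  then obtain e where e: "e > 0" "\<And>x. dist x x0 < e \<Longrightarrow> dist (h x) (h x0) < h x0"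
    using h unfolding continuous_on_iff by (metis UNIV_I)
  \<comment> \<open>The value of \<open>japanese\<close> at distance \<open>e\<close> from the
    centre; the basis vector merely supplies a vector of length \<open>e\<close>.\<close>
  define R where "R = japanese (e *\<^sub>R (SOME i::'a. i \<in> Basis))"
  have nR: "R = sqrt (1 + e\<^sup>2)"
    using SOME_Basis[where 'a='a] by (simp add: R_def japanese_def power2_eq_square)
  have R1: "1 < R" using e(1) by (simp add: nR)
  have far: "cutoff x0 R x = 0" if "e \<le> dist x x0" for x
  proof -
    have "e\<^sup>2 \<le> (norm (x - x0))\<^sup>2" using that e(1) by (intro power_mono) (auto simp: dist_norm)
    then have "R \<le> japanese (x - x0)" by (simp add: nR japanese_def power2_norm_eq_inner)
    then show ?thesis by (simp add: cutoff_def)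
  qed
  have nonneg: "0 \<le> cutoff x0 R x * h x" for x
    using e(2)[of x] far[of x] cutoff_bounds(1)[of x0 R x] by (cases "dist x x0 < e") (auto simp: dist_real_def)
  have p0: "0 < cutoff x0 R x0 * h x0"
    using hp R1 by (simp add: cutoff_def japanese_def)
  obtain a b where ab: "cball 0 (R + norm x0 + 1) \<subseteq> cbox a (b :: 'a)" using ball_subset_cbox by blast
  have out: "cutoff x0 R x * h x = 0" if "x \<notin> cbox a b" for x
  proof -
    have "R + norm x0 + 1 < norm x" using ab that by force
    then show ?thesis by (simp add: cutoff_zero)
  qed
  have c: "continuous_on UNIV (\<lambda>x. cutoff x0 R x * h x)" by (intro continuous_intros h)
  have "x0 \<in> cbox a b" using ab R1 by (intro subsetD[OF ab]) auto
  moreover have "box a b \<noteq> {}"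
  proof -
    have "ball 0 (R + norm x0 + 1) \<subseteq> interior (cbox a b)" using ab by (intro interior_maximal) auto
    moreover have "0 < R + norm x0 + 1" using R1 norm_ge_zero[of x0] by linarith
    then have "0 \<in> ball (0 :: 'a) (R + norm x0 + 1)" by simp
    ultimately show ?thesis unfolding interior_cbox by blast
  qed
  moreover have "integral (cbox a b) (\<lambda>x. cutoff x0 R x * h x) = 0"
    using LINT_eq_integral_cbox[OF c out] z by simp
  ultimately have "cutoff x0 R x0 * h x0 = 0"
    using integral_cbox_eq_0_iff[OF continuous_on_subset[OF c], of a b] nonneg by auto
  with p0 show False by simp
qed

context parabolic
begin

text \<open>Integrated against a weight, both sides become integrals of first derivatives of the
  weight and of \<open>u\<close>, which \<open>LINT_gradient_swap\<close> identifies. The weights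
  concentrate at an arbitrary point, so the identity is pointwise.\<close>

lemma H_symmetric_Basis:
  assumes t: "s < t"
  shows "H t x i \<bullet> j = H t x j \<bullet> i"
proof -
  have le: "Hrow i t x \<bullet> j - Hrow j t x \<bullet> i \<le> 0" for i j x
  proof (rule LINT_cutoff_eq_zero_imp[where h = "\<lambda>x. Hrow i t x \<bullet> j - Hrow j t x \<bullet> i"])
    show "continuous_on UNIV (\<lambda>x. Hrow i t x \<bullet> j - Hrow j t x \<bullet> i)" by (intro continuous_intros cont_slice t)
  next
    fix R
    show "(LINT y|lborel. cutoff x R y * (Hrow i t y \<bullet> j - Hrow j t y \<bullet> i)) = 0"
    proof -
      have Zc: "continuous_on UNIV (cutoff_grad x R)" by (intro continuous_intros)
      have int: "integrable lborel (\<lambda>y. cutoff x R y * (Hrow i t y \<bullet> j))" for i j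
        by (rule integrable_bounded_support[where R = "R + norm x"]) (auto simp: cutoff_zero intro!: continuous_intros cont_slice t)
      have "(LINT y|lborel. cutoff x R y * (Hrow i t y \<bullet> j)) = - (LINT y|lborel. (w t y \<bullet> i) * (cutoff_grad x R y \<bullet> j))" for i j
        by (rule LINT_by_parts[OF cutoff_has_derivative Zc w_component[OF t] cont_slice(5)[OF t] cutoff_zero])
      moreover have "(LINT y|lborel. (cutoff_grad x R y \<bullet> j) * (w t y \<bullet> i)) = (LINT y|lborel. (cutoff_grad x R y \<bullet> i) * (w t y \<bullet> j))"
        by (rule LINT_gradient_swap[OF cutoff_has_derivative Zc u_x[OF t] cont_slice(3)[OF t] cutoff_zero])
      ultimately show ?thesis using int by (simp add: right_diff_distrib mult.commute)
    qed
  qed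
  from le[of i x j] le[of j x i] show ?thesis by (simp add: Hrow_inner[OF t])
qed

lemma H_symmetric:
  assumes t: "s < t"
  shows "H t x v \<bullet> v' = H t x v' \<bullet> v"
  by (rule H_symmetric_Basis[OF t])

end

subsection \<open>Growth of the gradient\<close>

text \<open>Convexity of the power function, in a form that evaluates the slope at \<open>b\<close>
  whether \<open>b\<close> is the smaller or the larger argument.\<close>

lemma powr_tangent_le:
  fixes a b p :: real
  assumes "0 < a" "0 < b" "1 \<le> p"
  shows "b powr p - a powr p \<le> p * b powr (p - 1) * (b - a)"
proof (cases a b rule: linorder_cases)
  case less
  obtain z where z: "a < z" "z < b" "b powr p - a powr p = (b - a) * (p * z powr (p - 1))"
    using MVT2[OF less, of "\<lambda>x. x powr p" "\<lambda>x. p * x powr (p - 1)"] assms by (force intro: has_real_derivative_powr)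
  have *: "p * z powr (p - 1) \<le> p * b powr (p - 1)" using z assms by (intro mult_left_mono powr_mono2) auto
  have "(b - a) * (p * z powr (p - 1)) \<le> (b - a) * (p * b powr (p - 1))" by (rule mult_left_mono[OF *]) (use less in simp)
  then show ?thesis using z by (simp add: mult_ac)
next
  case greater
  obtain z where z: "b < z" "z < a" "a powr p - b powr p = (a - b) * (p * z powr (p - 1))"
    using MVT2[OF greater, of "\<lambda>x. x powr p" "\<lambda>x. p * x powr (p - 1)"] assms by (force intro: has_real_derivative_powr)
  have *: "p * b powr (p - 1) \<le> p * z powr (p - 1)" using z assms by (intro mult_left_mono powr_mono2) auto
  have "(a - b) * (p * b powr (p - 1)) \<le> (a - b) * (p * z powr (p - 1))" by (rule mult_left_mono[OF *]) (use greater in simp)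
  then show ?thesis using z by (simp add: algebra_simps)
qed simp

locale gradient_form = parabolic_form b "\<lambda>t x. 0" s u ut w H T \<delta> g x0 R
  for b :: "real \<times> 'a::euclidean_space \<Rightarrow> 'a" and s u ut w H T \<delta> g and x0 :: 'a and R +
  fixes q :: real
  assumes q: "2 < q" and q_form: "sqrt \<delta> * q / 2 < 1"
begin

text \<open>\<open>\<nu> P\<close> is the divergence of \<open>\<nu> w\<close> and \<open>V\<close> that of \<open>\<zeta>\<^sup>2 \<nu> w\<close>.\<close>

definition "N t x = 1 + w t x \<bullet> w t x"
text \<open>Half the gradient of \<open>N\<close>. The summand 1 in \<open>N\<close> keeps all real
  powers differentiable where the gradient of \<open>u\<close> vanishes.\<close>

definition "A t x = (\<Sum>j\<in>Basis. (H t x j \<bullet> w t x) *\<^sub>R j)"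
definition "lap t x = (\<Sum>i\<in>Basis. H t x i \<bullet> i)"
definition "I0 t x = (\<Sum>i\<in>Basis. (norm (H t x i))\<^sup>2)"
definition "J0 t x = (norm (A t x))\<^sup>2 / N t x"
definition "P t x = lap t x + (q - 2) * ((w t x \<bullet> A t x) / N t x)"
definition "\<nu> t x = N t x powr ((q - 2) / 2)"
definition "\<Psi> t x = N t x powr (q / 2)"
definition "V t x = (\<zeta> x)\<^sup>2 * (\<nu> t x * P t x) + 2 * \<zeta> x * \<nu> t x * (Z x \<bullet> w t x)"
definition "E3 t = (LINT x|lborel. (\<zeta> x)\<^sup>2 * \<Psi> t x)"

lemma N_ge: "1 \<le> N t x" "0 < N t x" "N t x \<noteq> 0"
  using inner_ge_zero[of "w t x"] unfolding N_def by linarith+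

lemma \<nu>_pos: "0 < \<nu> t x" using N_ge(2)[of t x] by (simp add: \<nu>_def)

lemma \<Psi>_eq: "\<Psi> t x = \<nu> t x * N t x"
proof -
  have "N t x powr ((q - 2) / 2 + 1) = N t x powr ((q - 2) / 2) * N t x"
    using N_ge(2)[of t x] by (simp only: powr_add powr_one)
  moreover have "(q - 2) / 2 + 1 = q / 2" by (simp add: field_simps)
  ultimately show ?thesis by (simp add: \<Psi>_def \<nu>_def)
qed

lemma \<Psi>_pos: "0 < \<Psi> t x" using N_ge(2)[of t x] by (simp add: \<Psi>_def)

lemma A_inner: "s < t \<Longrightarrow> A t x \<bullet> v = H t x v \<bullet> w t x"
proof -
  assume t: "s < t"
  interpret linear "H t x" by (rule H_linear[OF t])
  have "H t x v = (\<Sum>j\<in>Basis. (v \<bullet> j) *\<^sub>R H t x j)"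
    by (subst (1) euclidean_representation[of v, symmetric]) (simp add: sum scale)
  then show ?thesis by (simp add: A_def inner_sum_left inner_sum_right inner_commute[of _ v] mult.commute)
qed

lemma A_eq: "s < t \<Longrightarrow> A t x = H t x (w t x)"
  by (rule euclidean_eqI) (simp add: A_inner H_symmetric[of t x _ "w t x"])

lemma Hrow_eq: "s < t \<Longrightarrow> Hrow i t x = H t x i"
  by (rule euclidean_eqI) (simp add: Hrow_inner H_symmetric[of t x _ i])

lemma A_sum: "s < t \<Longrightarrow> A t x = (\<Sum>j\<in>Basis. (w t x \<bullet> j) *\<^sub>R H t x j)"
proof -
  assume t: "s < t"
  interpret linear "H t x" by (rule H_linear[OF t])
  show ?thesis unfolding A_eq[OF t]
    by (subst (1) euclidean_representation[of "w t x", symmetric]) (simp add: sum scale)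
qed

lemma norm_A_le: "s < t \<Longrightarrow> (norm (A t x))\<^sup>2 \<le> N t x * I0 t x"
proof -
  assume t: "s < t"
  have "norm (A t x) \<le> (\<Sum>j\<in>Basis. \<bar>w t x \<bullet> j\<bar> * norm (H t x j))"
    unfolding A_sum[OF t] by (rule order_trans[OF norm_sum]) simp
  then have "(norm (A t x))\<^sup>2 \<le> (\<Sum>j\<in>Basis. \<bar>w t x \<bullet> j\<bar> * norm (H t x j))\<^sup>2" by (intro power_mono) auto
  also have "\<dots> \<le> (\<Sum>j\<in>Basis. \<bar>w t x \<bullet> j\<bar>\<^sup>2) * (\<Sum>j\<in>Basis. (norm (H t x j))\<^sup>2)"
    by (rule Cauchy_Schwarz_ineq_sum)
  also have "\<dots> = (norm (w t x))\<^sup>2 * I0 t x" by (simp add: I0_def norm_square_eq_sum_Basis[of "w t x"])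
  also have "\<dots> \<le> N t x * I0 t x"
    by (intro mult_right_mono) (auto simp: N_def I0_def power2_norm_eq_inner sum_nonneg)
  finally show ?thesis .
qed

lemma J0_bounds:
  assumes "s < t"
  shows "0 \<le> J0 t x" "J0 t x \<le> I0 t x" "((w t x \<bullet> A t x) / N t x)\<^sup>2 \<le> J0 t x"
    "(lap t x)\<^sup>2 \<le> real DIM('a) * I0 t x"
proof -
  show "0 \<le> J0 t x" using N_ge(2)[of t x] by (simp add: J0_def)
  show "J0 t x \<le> I0 t x" using norm_A_le[OF assms, of x] N_ge(2)[of t x] by (simp add: J0_def field_simps)
  have "(w t x \<bullet> A t x)\<^sup>2 \<le> (norm (w t x))\<^sup>2 * (norm (A t x))\<^sup>2"
    using Cauchy_Schwarz_ineq[of "w t x" "A t x"] by (simp add: power2_norm_eq_inner)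
  also have "\<dots> \<le> N t x * (norm (A t x))\<^sup>2" by (intro mult_right_mono) (auto simp: N_def power2_norm_eq_inner)
  finally show "((w t x \<bullet> A t x) / N t x)\<^sup>2 \<le> J0 t x"
    using N_ge(2)[of t x] by (simp add: J0_def power_divide divide_simps power2_eq_square mult_ac)
  have "(lap t x)\<^sup>2 = (\<Sum>i\<in>Basis. 1 * (H t x i \<bullet> i))\<^sup>2" by (simp add: lap_def)
  also have "\<dots> \<le> (\<Sum>i\<in>(Basis::'a set). 1\<^sup>2) * (\<Sum>i\<in>Basis. (H t x i \<bullet> i)\<^sup>2)" by (rule Cauchy_Schwarz_ineq_sum)
  also have "\<dots> \<le> real DIM('a) * I0 t x"
  proof -
    have "(H t x i \<bullet> i)\<^sup>2 \<le> (norm (H t x i))\<^sup>2" if "i \<in> Basis" for i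
      using Basis_le_norm[OF that, of "H t x i"] by (simp add: abs_le_square_iff[symmetric])
    then have "(\<Sum>i\<in>Basis. (H t x i \<bullet> i)\<^sup>2) \<le> I0 t x" unfolding I0_def by (rule sum_mono)
    then show ?thesis by simp
  qed
  finally show "(lap t x)\<^sup>2 \<le> real DIM('a) * I0 t x" .
qed

lemma cont_grad:
  assumes "I \<subseteq> {s<..}"
  shows "continuous_on (I \<times> UNIV) (\<lambda>p. N (fst p) (snd p))"
    "continuous_on (I \<times> UNIV) (\<lambda>p. A (fst p) (snd p))"
    "continuous_on (I \<times> UNIV) (\<lambda>p. lap (fst p) (snd p))"
    "continuous_on (I \<times> UNIV) (\<lambda>p. I0 (fst p) (snd p))"
    "continuous_on (I \<times> UNIV) (\<lambda>p. J0 (fst p) (snd p))"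
    "continuous_on (I \<times> UNIV) (\<lambda>p. P (fst p) (snd p))"
    "continuous_on (I \<times> UNIV) (\<lambda>p. \<nu> (fst p) (snd p))"
    "continuous_on (I \<times> UNIV) (\<lambda>p. \<Psi> (fst p) (snd p))"
    "continuous_on (I \<times> UNIV) (\<lambda>p. V (fst p) (snd p))"
    "continuous_on (I \<times> UNIV) (\<lambda>p. N (fst p) (snd p) powr a)"
proof -
  note c = cont[OF assms]
  show N: "continuous_on (I \<times> UNIV) (\<lambda>p. N (fst p) (snd p))" unfolding N_def by (intro continuous_intros c)
  show A: "continuous_on (I \<times> UNIV) (\<lambda>p. A (fst p) (snd p))" unfolding A_def by (intro continuous_intros c)
  show lap: "continuous_on (I \<times> UNIV) (\<lambda>p. lap (fst p) (snd p))" unfolding lap_def by (intro continuous_intros c)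
  show "continuous_on (I \<times> UNIV) (\<lambda>p. I0 (fst p) (snd p))" unfolding I0_def by (intro continuous_intros c)
  show "continuous_on (I \<times> UNIV) (\<lambda>p. J0 (fst p) (snd p))"
    unfolding J0_def by (intro continuous_intros A N) (simp add: N_ge)
  show P: "continuous_on (I \<times> UNIV) (\<lambda>p. P (fst p) (snd p))"
    unfolding P_def by (intro continuous_intros A N lap c) (simp add: N_ge)
  show powr: "continuous_on (I \<times> UNIV) (\<lambda>p. N (fst p) (snd p) powr a)" for a
    by (intro continuous_intros N) (simp add: N_ge)
  show \<nu>: "continuous_on (I \<times> UNIV) (\<lambda>p. \<nu> (fst p) (snd p))" unfolding \<nu>_def by (rule powr)
  show "continuous_on (I \<times> UNIV) (\<lambda>p. \<Psi> (fst p) (snd p))" unfolding \<Psi>_def by (rule powr)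
  show "continuous_on (I \<times> UNIV) (\<lambda>p. V (fst p) (snd p))"
    unfolding V_def by (intro continuous_intros \<nu> P c)
qed

lemma cont_grad_slice:
  assumes "s < t"
  shows "continuous_on UNIV (N t)" "continuous_on UNIV (A t)" "continuous_on UNIV (lap t)"
    "continuous_on UNIV (I0 t)" "continuous_on UNIV (J0 t)" "continuous_on UNIV (P t)"
    "continuous_on UNIV (\<nu> t)" "continuous_on UNIV (\<Psi> t)" "continuous_on UNIV (V t)"
proof -
  have "{t} \<subseteq> {s<..}" using assms by simp
  note c = cont_grad[OF this]
  show "continuous_on UNIV (N t)" "continuous_on UNIV (A t)" "continuous_on UNIV (lap t)"
    "continuous_on UNIV (I0 t)" "continuous_on UNIV (J0 t)" "continuous_on UNIV (P t)"
    "continuous_on UNIV (\<nu> t)" "continuous_on UNIV (\<Psi> t)" "continuous_on UNIV (V t)"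
    by (rule continuous_on_slice, rule c)+
qed

lemma N_derivative: "s < t \<Longrightarrow> (N t has_derivative (\<lambda>v. 2 * (A t x \<bullet> v))) (at x)"
  unfolding N_def
  by (auto intro!: derivative_eq_intros w_x simp: A_inner inner_commute[of "w t x"])

lemma N_powr_derivative:
  assumes "s < t"
  shows "((\<lambda>x. N t x powr a) has_derivative (\<lambda>v. a * N t x powr (a - 1) * (2 * (A t x \<bullet> v)))) (at x)"
proof -
  have "((\<lambda>y. y powr a) has_derivative (\<lambda>h. a * N t x powr (a - 1) * h)) (at (N t x))"
    using has_real_derivative_powr[OF N_ge(2)[of t x], of a] by (simp add: has_field_derivative_def)
  from has_derivative_compose[OF N_derivative[OF assms] this] show ?thesis .
qed

text \<open>The gradient of \<open>\<nu>\<close> is \<open>\<mu>\<close> times \<open>A\<close>.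
  Accordingly \<open>\<Phi> i\<close> is the gradient of the \<open>i\<close>-th component of the
  field \<zeta>^2 \<nu> w, and its trace over \<open>i\<close> is \<open>V\<close>.\<close>

definition "\<mu> t x = (q - 2) * (\<nu> t x / N t x)"

definition \<Phi> :: "'a \<Rightarrow> real \<Rightarrow> 'a \<Rightarrow> 'a"
  where "\<Phi> i t x = (2 * \<zeta> x * \<nu> t x * (w t x \<bullet> i)) *\<^sub>R Z x
    + (\<zeta> x)\<^sup>2 *\<^sub>R (\<nu> t x *\<^sub>R Hrow i t x + (\<mu> t x * (w t x \<bullet> i)) *\<^sub>R A t x)"

lemma \<Phi>_derivative:
  assumes t: "s < t"
  shows "((\<lambda>x. (\<zeta> x)\<^sup>2 * (\<nu> t x * (w t x \<bullet> i))) has_derivative (\<lambda>v. \<Phi> i t x \<bullet> v)) (at x)"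
proof -
  have "N t x powr ((q - 2) / 2 - 1) = \<nu> t x / N t x"
    using N_ge(2)[of t x] by (simp only: \<nu>_def powr_diff powr_one)
  then have \<nu>d: "(\<nu> t has_derivative (\<lambda>v. \<mu> t x * (A t x \<bullet> v))) (at x)"
    using N_powr_derivative[OF t, of "(q - 2) / 2" x] by (simp add: \<nu>_def[abs_def] \<mu>_def mult_ac)
  show ?thesis
    by (rule derivative_eq_intros cutoff_has_derivative \<nu>d w_component[OF t] refl)+
      (simp add: \<Phi>_def inner_simps algebra_simps power2_eq_square)
qed

lemma \<Phi>_continuous: "s < t \<Longrightarrow> continuous_on UNIV (\<Phi> i t)"
  unfolding \<Phi>_def \<mu>_def by (intro continuous_intros cont_grad_slice cont_slice) (simp_all add: N_ge)

lemma \<Phi>_trace: "s < t \<Longrightarrow> (\<Sum>i\<in>Basis. \<Phi> i t x \<bullet> i) = V t x"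
proof -
  assume t: "s < t"
  have "\<Phi> i t x \<bullet> i = (2 * \<zeta> x * \<nu> t x) * ((Z x \<bullet> i) * (w t x \<bullet> i)) + ((\<zeta> x)\<^sup>2 * \<nu> t x) * (H t x i \<bullet> i)
     + ((\<zeta> x)\<^sup>2 * \<mu> t x) * ((w t x \<bullet> i) * (A t x \<bullet> i))" for i
    by (simp add: \<Phi>_def inner_simps Hrow_inner[OF t] algebra_simps)
  then have "(\<Sum>i\<in>Basis. \<Phi> i t x \<bullet> i) = (2 * \<zeta> x * \<nu> t x) * (Z x \<bullet> w t x) + ((\<zeta> x)\<^sup>2 * \<nu> t x) * lap t x
     + ((\<zeta> x)\<^sup>2 * \<mu> t x) * (w t x \<bullet> A t x)"
    by (simp only: sum.distrib sum_distrib_left[symmetric] euclidean_inner[of "Z x" "w t x"] euclidean_inner[of "w t x" "A t x"] lap_def)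
  then show ?thesis
    by (simp add: V_def P_def \<mu>_def distrib_left mult_ac)
qed

lemma cut_zero: "r < norm x \<Longrightarrow> \<zeta> x = 0" "r < norm x \<Longrightarrow> Z x = 0"
  by (simp_all add: cutoff_zero cutoff_grad_zero)

lemma V_zero: "r < norm x \<Longrightarrow> V t x = 0"
  by (simp add: V_def cut_zero)

lemma LINT_V_by_parts:
  assumes t: "s < t" and f: "\<And>x. (f has_derivative (\<lambda>v. G x \<bullet> v)) (at x)" and G: "continuous_on UNIV G"
  shows "(LINT x|lborel. (\<zeta> x)\<^sup>2 * (\<nu> t x * (w t x \<bullet> G x))) = - (LINT x|lborel. f x * V t x)"
proof -
  have fc: "continuous_on UNIV f" by (rule has_derivative_continuous_on_UNIV[OF f])
  note c = cont_slice[OF t] cont_grad_slice[OF t]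
  have \<Phi>z: "\<Phi> i t x = 0" if "r < norm x" for i x using that by (simp add: \<Phi>_def cut_zero)
  have i1: "integrable lborel (\<lambda>x. ((\<zeta> x)\<^sup>2 * (\<nu> t x * (w t x \<bullet> i))) * (G x \<bullet> i))" for i
    by (rule integrable_bounded_support[where R = r]) (auto simp: cut_zero intro!: continuous_intros c G)
  have i2: "integrable lborel (\<lambda>x. f x * (\<Phi> i t x \<bullet> i))" for i
    by (rule integrable_bounded_support[where R = r]) (auto simp: \<Phi>z intro!: continuous_intros fc \<Phi>_continuous[OF t])
  have "(LINT x|lborel. (\<zeta> x)\<^sup>2 * (\<nu> t x * (w t x \<bullet> G x)))
      = (LINT x|lborel. (\<Sum>i\<in>Basis. ((\<zeta> x)\<^sup>2 * (\<nu> t x * (w t x \<bullet> i))) * (G x \<bullet> i)))"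
    by (simp add: euclidean_inner[of "w t _" "G _"] sum_distrib_left mult_ac)
  also have "\<dots> = (\<Sum>i\<in>Basis. LINT x|lborel. ((\<zeta> x)\<^sup>2 * (\<nu> t x * (w t x \<bullet> i))) * (G x \<bullet> i))"
    using i1 by simp
  also have "\<dots> = (\<Sum>i\<in>Basis. - (LINT x|lborel. f x * (\<Phi> i t x \<bullet> i)))"
    by (rule sum.cong[OF refl], rule LINT_by_parts[OF \<Phi>_derivative[OF t] \<Phi>_continuous[OF t] f G, where R = r])
      (simp add: cut_zero)
  also have "\<dots> = - (LINT x|lborel. (\<Sum>i\<in>Basis. f x * (\<Phi> i t x \<bullet> i)))"
    using i2 by (simp add: sum_negf)
  also have "(\<lambda>x. \<Sum>i\<in>Basis. f x * (\<Phi> i t x \<bullet> i)) = (\<lambda>x. f x * V t x)"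
    by (simp add: \<Phi>_trace[OF t] flip: sum_distrib_left)
  finally show ?thesis .
qed

text \<open>Formally two integrations by parts, with third derivatives of \<open>u\<close> in
  between. Swapping the two differentiation directions in each product of components of
  \<open>\<Phi>\<close> and \<open>Hrow\<close> reaches the same result with second derivatives
  only, and produces the dissipation \<open>I0 + (q - 2) * J0\<close>.\<close>

lemma LINT_lap_V:
  assumes t: "s < t"
  shows "(LINT x|lborel. lap t x * V t x)
    = (LINT x|lborel. (\<zeta> x)\<^sup>2 * \<nu> t x * (I0 t x + (q - 2) * J0 t x) + 2 * \<zeta> x * \<nu> t x * (A t x \<bullet> Z x))"
proof -
  note c = cont_slice[OF t] cont_grad_slice[OF t] \<Phi>_continuous[OF t]
  have \<Phi>z: "\<Phi> i t x = 0" if "r < norm x" for i x using that by (simp add: \<Phi>_def cut_zero)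
  have int: "integrable lborel (\<lambda>x. (\<Phi> j t x \<bullet> k) * (Hrow i t x \<bullet> l))" for i j k l
    by (rule integrable_bounded_support[where R = r]) (auto simp: \<Phi>z intro!: continuous_intros c)
  have "(LINT x|lborel. lap t x * V t x) = (LINT x|lborel. (\<Sum>i\<in>Basis. \<Sum>j\<in>Basis. (\<Phi> j t x \<bullet> j) * (Hrow i t x \<bullet> i)))"
    by (simp add: \<Phi>_trace[OF t, symmetric] lap_def Hrow_inner[OF t] sum_product mult.commute)
  also have "\<dots> = (\<Sum>i\<in>Basis. \<Sum>j\<in>Basis. LINT x|lborel. (\<Phi> j t x \<bullet> j) * (Hrow i t x \<bullet> i))"
    using int by simp
  also have "\<dots> = (\<Sum>i\<in>Basis. \<Sum>j\<in>Basis. LINT x|lborel. (\<Phi> j t x \<bullet> i) * (Hrow i t x \<bullet> j))"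
    by (intro sum.cong refl, rule LINT_gradient_swap[OF \<Phi>_derivative[OF t] \<Phi>_continuous[OF t] w_component[OF t] cont_slice(5)[OF t], where R = r])
      (simp add: cut_zero)
  also have "\<dots> = (LINT x|lborel. (\<Sum>i\<in>Basis. \<Sum>j\<in>Basis. (\<Phi> j t x \<bullet> i) * (Hrow i t x \<bullet> j)))"
    using int by simp
  also have "(\<lambda>x. \<Sum>i\<in>Basis. \<Sum>j\<in>Basis. (\<Phi> j t x \<bullet> i) * (Hrow i t x \<bullet> j))
     = (\<lambda>x. (\<zeta> x)\<^sup>2 * \<nu> t x * (I0 t x + (q - 2) * J0 t x) + 2 * \<zeta> x * \<nu> t x * (A t x \<bullet> Z x))"
  proof
    fix x
    have "(\<Sum>i\<in>Basis. \<Sum>j\<in>Basis. (\<Phi> j t x \<bullet> i) * (Hrow i t x \<bullet> j)) = (\<Sum>j\<in>Basis. \<Phi> j t x \<bullet> H t x j)"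
      by (subst sum.swap) (simp add: Hrow_inner[OF t] euclidean_inner[of "\<Phi> _ t x" "H t x _"])
    also have "\<dots> = (\<Sum>j\<in>Basis. 2 * \<zeta> x * \<nu> t x * (((w t x \<bullet> j) *\<^sub>R H t x j) \<bullet> Z x)
       + (\<zeta> x)\<^sup>2 * \<nu> t x * (norm (H t x j))\<^sup>2 + (\<zeta> x)\<^sup>2 * \<mu> t x * (((w t x \<bullet> j) *\<^sub>R H t x j) \<bullet> A t x))"
      by (intro sum.cong refl) (simp add: \<Phi>_def Hrow_eq[OF t] inner_simps power2_norm_eq_inner inner_commute algebra_simps)
    also have "\<dots> = 2 * \<zeta> x * \<nu> t x * (A t x \<bullet> Z x) + (\<zeta> x)\<^sup>2 * \<nu> t x * I0 t x + (\<zeta> x)\<^sup>2 * \<mu> t x * (A t x \<bullet> A t x)"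
      unfolding sum.distrib I0_def sum_distrib_left[symmetric] inner_sum_left[symmetric] A_sum[OF t, symmetric] ..
    also have "\<dots> = (\<zeta> x)\<^sup>2 * \<nu> t x * (I0 t x + (q - 2) * J0 t x) + 2 * \<zeta> x * \<nu> t x * (A t x \<bullet> Z x)"
      by (simp add: J0_def \<mu>_def power2_norm_eq_inner distrib_left mult_ac)
    finally show "(\<Sum>i\<in>Basis. \<Sum>j\<in>Basis. (\<Phi> j t x \<bullet> i) * (Hrow i t x \<bullet> j))
       = (\<zeta> x)\<^sup>2 * \<nu> t x * (I0 t x + (q - 2) * J0 t x) + 2 * \<zeta> x * \<nu> t x * (A t x \<bullet> Z x)" .
  qed
  finally show ?thesis .
qed

lemma \<Psi>_convex: "\<Psi> t2 x - \<Psi> t1 x \<le> q * (\<nu> t2 x * (w t2 x \<bullet> (w t2 x - w t1 x)))"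
proof -
  have "\<Psi> t2 x - \<Psi> t1 x \<le> q / 2 * N t2 x powr (q / 2 - 1) * (N t2 x - N t1 x)"
    unfolding \<Psi>_def by (rule powr_tangent_le) (use q N_ge in auto)
  also have "N t2 x powr (q / 2 - 1) = \<nu> t2 x" by (simp add: \<nu>_def diff_divide_distrib)
  also have "q / 2 * \<nu> t2 x * (N t2 x - N t1 x) \<le> q / 2 * \<nu> t2 x * (2 * (w t2 x \<bullet> (w t2 x - w t1 x)))"
  proof (rule mult_left_mono)
    have "0 \<le> (w t2 x - w t1 x) \<bullet> (w t2 x - w t1 x)" by simp
    then show "N t2 x - N t1 x \<le> 2 * (w t2 x \<bullet> (w t2 x - w t1 x))"
      by (simp add: N_def inner_simps inner_commute)
  qed (use q \<nu>_pos[of t2 x] in simp)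
  finally show ?thesis by simp
qed

text \<open>Convexity compares \<open>\<Psi>\<close> at two times through the difference of the
  gradients, and integration by parts turns that into a difference of \<open>u\<close>. No time
  derivative of the gradient occurs.\<close>

lemma E3_increment_le:
  assumes t: "s < t1" "s < t2"
  shows "E3 t2 - E3 t1 \<le> - q * (LINT x|lborel. (u t2 x - u t1 x) * V t2 x)"
proof -
  note c = cont_slice[OF t(1)] cont_slice[OF t(2)] cont_grad_slice[OF t(1)] cont_grad_slice[OF t(2)]
  have i: "integrable lborel (\<lambda>x. (\<zeta> x)\<^sup>2 * \<Psi> t1 x)" "integrable lborel (\<lambda>x. (\<zeta> x)\<^sup>2 * \<Psi> t2 x)"
    "integrable lborel (\<lambda>x. (\<zeta> x)\<^sup>2 * (\<nu> t2 x * (w t2 x \<bullet> (w t2 x - w t1 x))))"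
    by (rule integrable_bounded_support[where R = r]; auto simp: cut_zero intro!: continuous_intros c)+
  have "E3 t2 - E3 t1 = (LINT x|lborel. (\<zeta> x)\<^sup>2 * \<Psi> t2 x - (\<zeta> x)\<^sup>2 * \<Psi> t1 x)"
    using i by (simp add: E3_def)
  also have "\<dots> \<le> (LINT x|lborel. q * ((\<zeta> x)\<^sup>2 * (\<nu> t2 x * (w t2 x \<bullet> (w t2 x - w t1 x)))))"
  proof (rule integral_mono)
    fix x
    show "(\<zeta> x)\<^sup>2 * \<Psi> t2 x - (\<zeta> x)\<^sup>2 * \<Psi> t1 x \<le> q * ((\<zeta> x)\<^sup>2 * (\<nu> t2 x * (w t2 x \<bullet> (w t2 x - w t1 x))))"
      using mult_left_mono[OF \<Psi>_convex[of t2 x t1], of "(\<zeta> x)\<^sup>2"] by (simp add: algebra_simps)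
  qed (use i in auto)
  also have "\<dots> = q * (LINT x|lborel. (\<zeta> x)\<^sup>2 * (\<nu> t2 x * (w t2 x \<bullet> (w t2 x - w t1 x))))" by simp
  also have "\<dots> = q * - (LINT x|lborel. (u t2 x - u t1 x) * V t2 x)"
  proof (rule arg_cong[where f = "\<lambda>y. q * y"], rule LINT_V_by_parts[OF t(2)])
    show "((\<lambda>x. u t2 x - u t1 x) has_derivative (\<lambda>v. (w t2 x - w t1 x) \<bullet> v)) (at x)" for x
      using has_derivative_diff[OF u_x[OF t(2)] u_x[OF t(1)]] by (simp add: inner_simps)
  qed (intro continuous_intros c)
  finally show ?thesis by simp
qed

text \<open>\<open>E3_increment_le\<close> applied with the two times in both orders encloses the
  difference quotient between two expressions that tend to the same limit.\<close>

lemma E3_derivative: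
  assumes t: "s < t"
  shows "(E3 has_real_derivative - q * (LINT x|lborel. ut t x * V t x)) (at t)"
proof -
  \<comment> \<open>The difference quotient of \<open>u\<close> in time, written as an average of
    \<open>ut\<close> so that it is also defined at b = t and jointly continuous in time and
    space.\<close>
  define k where "k b x = integral {0..1} (\<lambda>\<theta>. ut (t + \<theta> * (b - t)) x)" for b x
  have pos: "s < t + \<theta> * (b - t)" if "s < b" "0 \<le> \<theta>" "\<theta> \<le> 1" for b \<theta>
  proof -
    have "min t b \<le> t + \<theta> * (b - t)"
      using mult_left_le_one_le[of "b - t" \<theta>] mult_left_le_one_le[of "t - b" \<theta>] that
        mult_nonneg_nonneg[of \<theta> "b - t"] by (cases "t \<le> b") (auto simp: min_def algebra_simps)
    then show ?thesis using t that by linarith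
  qed
  have k: "(b - t) * k b x = u b x - u t x" if b: "s < b" for b x
  proof -
    have "((\<lambda>\<theta>. (b - t) * ut (t + \<theta> * (b - t)) x) has_integral u (t + 1 * (b - t)) x - u (t + 0 * (b - t)) x) {0..1}"
    proof (rule fundamental_theorem_of_calculus)
      fix \<theta> :: real assume "\<theta> \<in> {0..1}"
      then have "((\<lambda>\<theta>. u (t + \<theta> * (b - t)) x) has_real_derivative ut (t + \<theta> * (b - t)) x * (b - t)) (at \<theta>)"
        by (intro DERIV_chain2[OF u_t]) (auto intro!: pos[OF b] derivative_eq_intros)
      then show "((\<lambda>\<theta>. u (t + \<theta> * (b - t)) x) has_vector_derivative (b - t) * ut (t + \<theta> * (b - t)) x) (at \<theta> within {0..1})"
        by (simp add: has_real_derivative_iff_has_vector_derivative mult.commute has_vector_derivative_at_within)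
    qed simp
    from integral_unique[OF this] show ?thesis
      unfolding k_def Henstock_Kurzweil_Integration.integral_mult_right by simp
  qed
  have kt: "k t x = ut t x" for x by (simp add: k_def)
  have kc: "continuous_on ({s<..} \<times> UNIV) (\<lambda>p. k (fst p) (snd p))"
  proof -
    have "continuous_on (({s<..} \<times> UNIV) \<times> cbox 0 1) (\<lambda>(p, \<theta>). ut (t + \<theta> * (fst p - t)) (snd p))"
    proof -
      have "continuous_on (({s<..} \<times> UNIV) \<times> {0..1}) (\<lambda>q. (\<lambda>(t, x). ut t x) (t + snd q * (fst (fst q) - t), snd (fst q)))"
        by (rule continuous_on_compose2[OF ut_cont]) (auto intro!: continuous_intros pos)
      then show ?thesis by (simp add: split_def)
    qed
    then have "continuous_on ({s<..} \<times> UNIV) (\<lambda>p. integral (cbox 0 1) (\<lambda>\<theta>. ut (t + \<theta> * (fst p - t)) (snd p)))"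
      by (rule integral_continuous_on_param)
    then show ?thesis by (simp add: k_def)
  qed
  define L1 where "L1 b = - q * (LINT x|lborel. k b x * V t x)" for b
  define L2 where "L2 b = - q * (LINT x|lborel. k b x * V b x)" for b
  have a1: "cont_supported {s<..} r (\<lambda>b x. k b x * V t x)"
    by (rule cont_supportedI) (auto simp: V_zero intro!: continuous_intros kc continuous_on_compose2[OF cont_grad_slice(9)[OF t]])
  have a2: "cont_supported {s<..} r (\<lambda>b x. k b x * V b x)"
    by (rule cont_supportedI) (auto simp: V_zero intro!: continuous_intros kc cont_grad)
  have "continuous_on {s<..} L1" "continuous_on {s<..} L2"
    unfolding L1_def L2_def by (intro continuous_intros cont_supported_continuous_LINT[OF a1] cont_supported_continuous_LINT[OF a2])+
  then have lim: "(L1 \<longlongrightarrow> L1 t) (at t)" "(L2 \<longlongrightarrow> L2 t) (at t)"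
    using t by (auto simp: continuous_on_eq_continuous_at[OF open_greaterThan] isCont_def)
  have L_eq: "L1 t = - q * (LINT x|lborel. ut t x * V t x)" "L2 t = L1 t" by (simp_all add: L1_def L2_def kt)
  have bd: "\<bar>(E3 b - E3 t) / (b - t) - L1 b\<bar> \<le> \<bar>L2 b - L1 b\<bar>" if b: "s < b" "b \<noteq> t" for b
  proof -
    have 1: "- q * (LINT x|lborel. (u b x - u t x) * V b x) = (b - t) * L2 b"
      and 2: "- q * (LINT x|lborel. (u t x - u b x) * V t x) = - (b - t) * L1 b"
    proof -
      have "(\<lambda>x. (u b x - u t x) * V b x) = (\<lambda>x. (b - t) * (k b x * V b x))"
        by (simp add: k[OF b(1), symmetric] mult.assoc)
      then show "- q * (LINT x|lborel. (u b x - u t x) * V b x) = (b - t) * L2 b"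
        by (simp add: L2_def)
      have "(\<lambda>x. (u t x - u b x) * V t x) = (\<lambda>x. (t - b) * (k b x * V t x))"
      proof
        fix x
        have "u t x - u b x = (t - b) * k b x" using k[OF b(1), of x] by (simp add: algebra_simps)
        then show "(u t x - u b x) * V t x = (t - b) * (k b x * V t x)" by simp
      qed
      then show "- q * (LINT x|lborel. (u t x - u b x) * V t x) = - (b - t) * L1 b"
        by (simp add: L1_def)
    qed
    have le: "E3 b - E3 t \<le> (b - t) * L2 b" "(b - t) * L1 b \<le> E3 b - E3 t"
      using E3_increment_le[OF t b(1)] E3_increment_le[OF b(1) t] 1 2 by (simp_all add: algebra_simps)
    show ?thesis
    proof (cases "t < b")
      case True
      then have "L1 b \<le> (E3 b - E3 t) / (b - t)" "(E3 b - E3 t) / (b - t) \<le> L2 b"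
        using le by (simp_all add: field_simps)
      then show ?thesis by linarith
    next
      case False
      with b have "b - t < 0" by simp
      then have "(E3 b - E3 t) / (b - t) \<le> L1 b" "L2 b \<le> (E3 b - E3 t) / (b - t)"
        using le by (simp_all add: field_simps)
      then show ?thesis by linarith
    qed
  qed
  have "((\<lambda>b. (E3 b - E3 t) / (b - t) - L1 b) \<longlongrightarrow> 0) (at t)"
  proof (rule Lim_null_comparison)
    have "\<forall>\<^sub>F b in at t. s < b" using eventually_at_in_open'[OF open_greaterThan, of t s] t by simp
    moreover have "\<forall>\<^sub>F b in at t. b \<noteq> t" by (rule eventually_neq_at_within)
    ultimately show "\<forall>\<^sub>F b in at t. norm ((E3 b - E3 t) / (b - t) - L1 b) \<le> \<bar>L2 b - L1 b\<bar>"
      by eventually_elim (use bd in auto)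
    have "((\<lambda>b. \<bar>L2 b - L1 b\<bar>) \<longlongrightarrow> \<bar>L2 t - L1 t\<bar>) (at t)" by (intro tendsto_intros lim)
    then show "((\<lambda>b. \<bar>L2 b - L1 b\<bar>) \<longlongrightarrow> 0) (at t)" by (simp add: L_eq)
  qed
  from tendsto_add[OF this lim(1)] have "((\<lambda>b. (E3 b - E3 t) / (b - t)) \<longlongrightarrow> L1 t) (at t)" by simp
  then show ?thesis by (simp add: has_field_derivative_iff L_eq)
qed

end

text \<open>With \<open>X = \<Delta>u\<close>, \<open>Y = \<nabla>u \<bullet> A / N\<close>, \<open>P = X + (q - 2) Y\<close> and \<open>Z = b \<bullet> \<nabla>u\<close> this is the step that makes
  \<open>\<beta> = \<surd>\<delta> q / 2 < 1\<close> sufficient: Young's inequality is used with the extremal weights for which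
  the terms in \<open>P\<^sup>2\<close> cancel.\<close>

lemma drift_absorption:
  fixes q \<beta> J X Y Z :: real
  assumes q: "2 < q" and \<beta>: "0 < \<beta>" and Y: "Y\<^sup>2 \<le> J"
  shows "Z * (X + (q - 2) * Y) - \<beta> / q * (X * (X + (q - 2) * Y))
    \<le> \<beta> * (q - 2) * (q - 1) / (2 * q) * J + (q - 1) / (2 * \<beta>) * Z\<^sup>2"
proof -
  define P where "P = X + (q - 2) * Y"
  have "2 * (Y * P) \<le> (q - 1) * Y\<^sup>2 + P\<^sup>2 / (q - 1)" by (rule young) (use q in simp)
  also have "\<dots> \<le> (q - 1) * J + P\<^sup>2 / (q - 1)" using Y q by (intro add_mono mult_left_mono) auto
  finally have 1: "(\<beta> * (q - 2) / (2 * q)) * (2 * (Y * P)) \<le> (\<beta> * (q - 2) / (2 * q)) * ((q - 1) * J + P\<^sup>2 / (q - 1))"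
    using q \<beta> by (intro mult_left_mono) auto
  have "2 * (P * Z) \<le> (\<beta> / (q - 1)) * P\<^sup>2 + Z\<^sup>2 / (\<beta> / (q - 1))" by (rule young) (use q \<beta> in simp)
  then have 2: "Z * P \<le> \<beta> / (2 * (q - 1)) * P\<^sup>2 + (q - 1) / (2 * \<beta>) * Z\<^sup>2"
    using q \<beta> by (simp add: field_simps)
  have 3: "X * P = P\<^sup>2 - (q - 2) * (Y * P)" by (simp add: P_def power2_eq_square algebra_simps)
  have 4: "- (\<beta> / q) * P\<^sup>2 + (\<beta> * (q - 2) / (2 * q)) * (P\<^sup>2 / (q - 1)) + \<beta> / (2 * (q - 1)) * P\<^sup>2 = 0"
  proof -
    have "- (\<beta> / q) + (\<beta> * (q - 2) / (2 * q)) / (q - 1) + \<beta> / (2 * (q - 1)) = 0"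
      using q by (simp add: divide_simps) (simp add: algebra_simps)
    then have "(- (\<beta> / q) + (\<beta> * (q - 2) / (2 * q)) / (q - 1) + \<beta> / (2 * (q - 1))) * P\<^sup>2 = 0" by simp
    then show ?thesis by (simp add: algebra_simps)
  qed
  have "Z * P - \<beta> / q * (X * P) = Z * P - (\<beta> / q) * P\<^sup>2 + (\<beta> * (q - 2) / (2 * q)) * (2 * (Y * P))"
    unfolding 3 using q by (simp add: field_simps)
  also have "\<dots> \<le> \<beta> * (q - 2) * (q - 1) / (2 * q) * J + (q - 1) / (2 * \<beta>) * Z\<^sup>2"
  proof -
    have "(\<beta> * (q - 2) / (2 * q)) * ((q - 1) * J + P\<^sup>2 / (q - 1))
        = \<beta> * (q - 2) * (q - 1) / (2 * q) * J + (\<beta> * (q - 2) / (2 * q)) * (P\<^sup>2 / (q - 1))"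
      by (simp add: distrib_left)
    with 1 2 4 show ?thesis by linarith
  qed
  finally show ?thesis by (simp add: P_def)
qed

text \<open>The midpoint of sqrt \<delta> q / 2 and 1. Its distance to the former gives room for the
  parameter \<kappa> in the form inequality, its distance to 1 pays for the terms with the gradient
  of the weight.\<close>

definition gr_beta :: "real \<Rightarrow> real \<Rightarrow> real"
  where "gr_beta \<delta> q = (1 + sqrt \<delta> * q / 2) / 2"

text \<open>Young weight of the terms with the gradient of the weight. They cost twice \<eta>
  through \<open>J0\<close> and d times \<eta> through (\<Delta>u)^2 \<le> d * \<open>I0\<close>,
  together exactly 1 - \<beta>.\<close>

definition gr_eta :: "real \<Rightarrow> real \<Rightarrow> real \<Rightarrow> real"
  where "gr_eta \<delta> q d = (1 - gr_beta \<delta> q) / (2 + d)"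

text \<open>Coefficient of \<zeta>^2 \<Psi> |b|^2 to which the form inequality is applied: the first
  part comes from \<open>drift_absorption\<close>, the second from the cross term of the drift with
  the gradient of the weight.\<close>

definition gr_gain :: "real \<Rightarrow> real \<Rightarrow> real \<Rightarrow> real"
  where "gr_gain \<delta> q d = (q - 1) / (2 * gr_beta \<delta> q) + gr_eta \<delta> q d"

text \<open>Coefficient of \<Psi> |\<nabla>\<zeta>|^2. The bracket is 1 + 1 / \<kappa> with (1 +
  \<kappa>) \<delta> q^2 / 4 = \<beta>^2, and the 3 counts the cross terms estimated with weight
  \<eta>.\<close>

definition gr_rate :: "real \<Rightarrow> real \<Rightarrow> real \<Rightarrow> real"
  where "gr_rate \<delta> q d = gr_gain \<delta> q d * \<delta> * (1 + 1 / ((gr_beta \<delta> q)\<^sup>2 / (sqrt \<delta> * q / 2)\<^sup>2 - 1)) + 3 / gr_eta \<delta> q d"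

context gradient_form
begin

text \<open>In the derivative of \<open>E3\<close> the Laplacian and the drift are both multiplied
  by \<open>V\<close>. A part of the Laplacian is kept in this form to absorb the drift, the rest
  becomes dissipation by \<open>LINT_lap_V\<close>; the form inequality for \<zeta> N^(q/4) converts
  the remaining |b|^2 into dissipation as well. The sup bound \<open>W\<close> enters only with exp
  (- 2 R).\<close>

lemma E3_inequality:
  assumes t: "s < t1" "t1 \<le> t2" "t2 \<le> T" and W: "\<And>t x. s < t \<Longrightarrow> t \<le> T \<Longrightarrow> \<Psi> t x \<le> W"
  defines "c1 \<equiv> 8 * q * gr_rate \<delta> q (real DIM('a))" and "c2 \<equiv> q * gr_gain \<delta> q (real DIM('a))"
  shows "E3 t2 \<le> E3 t1 + integral {t1..t2} (\<lambda>t. (c1 + c2 * g t) * E3 t) + c1 * T * W * exp (- 2 * R) * rho_mass TYPE('a)"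
    and "(\<lambda>t. (c1 + c2 * g t) * E3 t) integrable_on {t1..t2}"
    and "0 \<le> c1" "0 \<le> c2"
proof -
  define d where "d = real DIM('a)"
  define \<beta> where "\<beta> = gr_beta \<delta> q"
  define \<eta> where "\<eta> = gr_eta \<delta> q d"
  \<comment> \<open>The fraction of the Laplacian term that is not integrated by parts: it is the
    multiple \<beta> / q of X P subtracted in \<open>drift_absorption\<close>.\<close>
  define \<theta> where "\<theta> = \<beta> / q"
  define \<beta>0 where "\<beta>0 = sqrt \<delta> * q / 2"
  \<comment> \<open>Chosen so that splitting the gradient of \<zeta> N^(q/4) raises sqrt \<delta> q
    / 2 to \<beta> and no further.\<close>
  define \<kappa> where "\<kappa> = \<beta>\<^sup>2 / \<beta>0\<^sup>2 - 1"
  define a where "a = gr_gain \<delta> q d"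
  define C where "C = gr_rate \<delta> q d"
  have \<beta>0: "0 < \<beta>0" "\<beta>0 < 1" using q q_form \<delta> by (auto simp: \<beta>0_def)
  have \<beta>: "0 < \<beta>" "\<beta> < 1" "\<beta>0 < \<beta>" using \<beta>0 by (auto simp: \<beta>_def gr_beta_def \<beta>0_def)
  have d0: "0 \<le> d" by (simp add: d_def)
  have \<eta>: "0 < \<eta>" using \<beta> d0 by (simp add: \<eta>_def gr_eta_def \<beta>_def[symmetric])
  have \<eta>_eq: "\<eta> * (2 + d) = 1 - \<beta>" using d0 by (simp add: \<eta>_def gr_eta_def \<beta>_def[symmetric])
  have \<theta>: "0 < \<theta>" "\<theta> < 1" using \<beta> q by (auto simp: \<theta>_def)
  have \<kappa>: "0 < \<kappa>"
  proof -
    have "\<beta>0\<^sup>2 < \<beta>\<^sup>2" using \<beta>0 \<beta> by (intro power_strict_mono) auto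
    then show ?thesis using \<beta>0 by (simp add: \<kappa>_def field_simps)
  qed
  have a_eq: "a = (q - 1) / (2 * \<beta>) + \<eta>" by (simp add: a_def gr_gain_def \<beta>_def \<eta>_def)
  have a: "0 < a" unfolding a_eq using q \<beta> \<eta> by (intro add_pos_pos divide_pos_pos) auto
  have C_eq: "C = a * \<delta> * (1 + 1 / \<kappa>) + 3 / \<eta>"
    by (simp add: C_def gr_rate_def a_def \<kappa>_def \<beta>_def \<beta>0_def \<eta>_def)
  have C: "0 < C" unfolding C_eq using a \<delta> \<kappa> \<eta> by (intro add_pos_pos mult_pos_pos) auto
  have c1: "c1 = 8 * q * C" and c2: "c2 = q * a" by (simp_all add: c1_def c2_def C_def a_def d_def)
  show "0 \<le> c1" "0 \<le> c2" using q a C by (simp_all add: c1 c2)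
  have \<delta>q: "\<delta> * (1 + \<kappa>) * (q\<^sup>2 / 4) = \<beta>\<^sup>2"
  proof -
    have 1: "\<beta>0\<^sup>2 = \<delta> * (q\<^sup>2 / 4)" using \<delta> by (simp add: \<beta>0_def power2_eq_square field_simps)
    have 2: "(1 + \<kappa>) * \<beta>0\<^sup>2 = \<beta>\<^sup>2" using \<beta>0 by (simp add: \<kappa>_def field_simps)
    have "\<delta> * (1 + \<kappa>) * (q\<^sup>2 / 4) = (1 + \<kappa>) * (\<delta> * (q\<^sup>2 / 4))" by (simp only: mult_ac)
    then show ?thesis by (simp only: 1[symmetric] 2)
  qed
  let ?I = "{t1..t2}"
  have sub: "?I \<subseteq> {s<..}" using t by auto
  note c = cont[OF sub] cont_grad[OF sub]
  have bc: "continuous_on (?I \<times> UNIV) (\<lambda>p. b (fst p, snd p))" using b_cont_on by simp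
  define m where "m t x = (\<zeta> x)\<^sup>2 * \<nu> t x" for t x
  have m: "0 \<le> m t x" for t x using \<nu>_pos[of t x] by (simp add: m_def)
  define k1 where "k1 t x = 2 * \<zeta> x * \<nu> t x * (A t x \<bullet> Z x)" for t x
  define k2 where "k2 t x = 2 * \<zeta> x * \<nu> t x * (Z x \<bullet> w t x)" for t x
  define z where "z t x = b (t, x) \<bullet> w t x" for t x
  define \<psi> where "\<psi> t x = \<zeta> x * N t x powr (q / 4)" for t x
  define G where "G t x = N t x powr (q / 4) *\<^sub>R Z x + (\<zeta> x * (q / 2 * N t x powr (q / 4 - 1))) *\<^sub>R A t x" for t x
  have \<psi>2: "(\<psi> t x)\<^sup>2 = (\<zeta> x)\<^sup>2 * \<Psi> t x" for t x
  proof -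
    have "(N t x powr (q / 4))\<^sup>2 = N t x powr (q / 2)" using N_ge(2)[of t x] by (simp add: power2_eq_square flip: powr_add)
    then show ?thesis by (simp add: \<psi>_def \<Psi>_def power_mult_distrib)
  qed
  have Gd: "(\<psi> t has_derivative (\<lambda>v. G t x \<bullet> v)) (at x)" if "s < t" for t x
    unfolding \<psi>_def
    by (rule derivative_eq_intros cutoff_has_derivative N_powr_derivative[OF that] refl)+
      (simp add: G_def inner_simps algebra_simps)
  have \<psi>z: "\<psi> t x = 0" if "r < norm x" for t x using that by (simp add: \<psi>_def cut_zero)
  define Q where "Q t x = (\<psi> t x)\<^sup>2 * (norm (b (t, x)))\<^sup>2" for t x
  define D where "D t x = (norm (G t x))\<^sup>2" for t x
  define K where "K t x = - (1 - \<theta>) * (m t x * (I0 t x + (q - 2) * J0 t x) + k1 t x) + ((z t x - \<theta> * lap t x) * V t x)" for t x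
  define K3 where "K3 t x = - (1 - \<theta>) * (m t x * (I0 t x + (q - 2) * J0 t x))
      + (\<beta> * (q - 2) * (q - 1) / (2 * q) + \<eta>) * (m t x * J0 t x) + \<eta> * d * (m t x * I0 t x) + (3 / \<eta>) * (\<Psi> t x * (norm (Z x))\<^sup>2)" for t x
  have aK: "cont_supported ?I r K" unfolding K_def z_def m_def k1_def
    by (rule cont_supportedI) (auto simp: cut_zero V_zero intro!: continuous_intros c b_cont_on)
  have aK3: "cont_supported ?I r K3" unfolding K3_def m_def
    by (rule cont_supportedI) (use \<eta> q in \<open>auto simp: cut_zero intro!: continuous_intros c\<close>)
  have aQ: "cont_supported ?I r Q" unfolding Q_def \<psi>_def
    by (rule cont_supportedI) (auto simp: cut_zero intro!: continuous_intros c b_cont_on)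
  have Gc: "continuous_on (?I \<times> UNIV) (\<lambda>p. G (fst p) (snd p))" unfolding G_def by (intro continuous_intros c)
  have \<psi>c: "continuous_on (?I \<times> UNIV) (\<lambda>p. \<psi> (fst p) (snd p))" unfolding \<psi>_def by (intro continuous_intros c)
  have aD: "cont_supported ?I r D" unfolding D_def
    by (rule cont_supportedI, intro continuous_intros Gc) (simp add: cut_zero G_def)
  have a\<Psi>: "cont_supported ?I r (\<lambda>t x. (\<zeta> x)\<^sup>2 * \<Psi> t x)"
    by (rule cont_supportedI) (auto simp: cut_zero intro!: continuous_intros c)
  have aX: "cont_supported ?I r (\<lambda>t. cutoff_excess x0 R)"
    by (rule cont_supportedI) (auto simp: cutoff_excess(3) intro!: continuous_on_compose2[OF cutoff_excess(4)[of UNIV]] continuous_intros)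
  have E3_eq: "E3 t = (LINT x|lborel. (\<psi> t x)\<^sup>2)" for t by (simp add: E3_def \<psi>2)

  \<comment> \<open>Each factor of the weight goes to \<open>p\<close>, a second derivative or the
    drift term, so that this half is dissipation or |b|^2; the other half keeps the gradient of the
    weight.\<close>
  have cross: "2 * \<zeta> x * \<nu> t x * \<bar>p * y\<bar> \<le> \<eta> * (m t x * p\<^sup>2) + \<nu> t x * y\<^sup>2 / \<eta>" for t x p y
  proof -
    have "\<nu> t x * (2 * ((\<zeta> x * \<bar>p\<bar>) * \<bar>y\<bar>)) \<le> \<nu> t x * (\<eta> * (\<zeta> x * \<bar>p\<bar>)\<^sup>2 + \<bar>y\<bar>\<^sup>2 / \<eta>)"
      using \<nu>_pos[of t x] by (intro mult_left_mono young \<eta>) auto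
    then show ?thesis by (simp add: m_def abs_mult power_mult_distrib algebra_simps)
  qed
  have \<zeta>0: "0 \<le> \<zeta> x" for x by (rule cutoff_bounds)
  have wN: "(norm (w t x))\<^sup>2 \<le> N t x" for t x by (simp add: N_def power2_norm_eq_inner)
  have \<Psi>Z: "\<nu> t x * (p * norm (Z x))\<^sup>2 / \<eta> \<le> (1 / \<eta>) * (\<Psi> t x * (norm (Z x))\<^sup>2)" if "p\<^sup>2 \<le> N t x" for t x p
  proof -
    have "\<nu> t x * (p * norm (Z x))\<^sup>2 = \<nu> t x * (norm (Z x))\<^sup>2 * p\<^sup>2" by (simp add: power_mult_distrib)
    also have "\<dots> \<le> \<nu> t x * (norm (Z x))\<^sup>2 * N t x" using that \<nu>_pos[of t x] by (intro mult_left_mono) auto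
    finally show ?thesis using \<eta> by (simp add: \<Psi>_eq divide_right_mono mult_ac)
  qed
  have K_le: "K t x \<le> a * Q t x + K3 t x" if tI: "t \<in> ?I" for t x
  proof -
    have st: "s < t" using tI t by simp
    note J = J0_bounds[OF st, of x]
    have k2_le: "\<bar>p * k2 t x\<bar> \<le> \<eta> * (m t x * p\<^sup>2) + (1 / \<eta>) * (\<Psi> t x * (norm (Z x))\<^sup>2)" for p
    proof -
      have "\<bar>p * k2 t x\<bar> = 2 * \<zeta> x * \<nu> t x * (\<bar>p\<bar> * \<bar>Z x \<bullet> w t x\<bar>)"
        using \<zeta>0[of x] \<nu>_pos[of t x] by (simp add: k2_def abs_mult mult_ac)
      also have "\<dots> \<le> 2 * \<zeta> x * \<nu> t x * (\<bar>p\<bar> * (norm (w t x) * norm (Z x)))"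
        using \<zeta>0[of x] \<nu>_pos[of t x] Cauchy_Schwarz_ineq2[of "Z x" "w t x"] by (intro mult_left_mono) (auto simp: mult.commute)
      also have "\<dots> = 2 * \<zeta> x * \<nu> t x * \<bar>p * (norm (w t x) * norm (Z x))\<bar>" by (simp add: abs_mult)
      also have "\<dots> \<le> \<eta> * (m t x * p\<^sup>2) + \<nu> t x * (norm (w t x) * norm (Z x))\<^sup>2 / \<eta>" by (rule cross)
      also have "\<dots> \<le> \<eta> * (m t x * p\<^sup>2) + (1 / \<eta>) * (\<Psi> t x * (norm (Z x))\<^sup>2)" using \<Psi>Z[OF wN] by simp
      finally show ?thesis .
    qed
    have k1_le: "\<bar>k1 t x\<bar> \<le> \<eta> * (m t x * J0 t x) + (1 / \<eta>) * (\<Psi> t x * (norm (Z x))\<^sup>2)"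
    proof -
      have A: "norm (A t x) = sqrt (J0 t x) * sqrt (N t x)"
        using N_ge(2)[of t x] by (simp add: J0_def real_sqrt_divide)
      have "\<bar>k1 t x\<bar> = 2 * \<zeta> x * \<nu> t x * \<bar>A t x \<bullet> Z x\<bar>"
        using \<zeta>0[of x] \<nu>_pos[of t x] by (simp add: k1_def abs_mult)
      also have "\<dots> \<le> 2 * \<zeta> x * \<nu> t x * (norm (A t x) * norm (Z x))"
        using \<zeta>0[of x] \<nu>_pos[of t x] Cauchy_Schwarz_ineq2[of "A t x" "Z x"] by (intro mult_left_mono) auto
      also have "\<dots> = 2 * \<zeta> x * \<nu> t x * \<bar>sqrt (J0 t x) * (sqrt (N t x) * norm (Z x))\<bar>"
        using J N_ge(2)[of t x] by (simp add: A abs_mult)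
      also have "\<dots> \<le> \<eta> * (m t x * (sqrt (J0 t x))\<^sup>2) + \<nu> t x * (sqrt (N t x) * norm (Z x))\<^sup>2 / \<eta>" by (rule cross)
      also have "\<dots> \<le> \<eta> * (m t x * J0 t x) + (1 / \<eta>) * (\<Psi> t x * (norm (Z x))\<^sup>2)"
        using \<Psi>Z[of "sqrt (N t x)" t x] J N_ge(2)[of t x] by simp
      finally show ?thesis .
    qed
    have mz: "m t x * (z t x)\<^sup>2 \<le> Q t x"
    proof -
      have "(z t x)\<^sup>2 \<le> (norm (b (t, x)))\<^sup>2 * (norm (w t x))\<^sup>2"
        using Cauchy_Schwarz_ineq[of "b (t, x)" "w t x"] by (simp add: z_def power2_norm_eq_inner)
      also have "\<dots> \<le> (norm (b (t, x)))\<^sup>2 * N t x" using wN by (intro mult_left_mono) auto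
      finally have "m t x * (z t x)\<^sup>2 \<le> m t x * ((norm (b (t, x)))\<^sup>2 * N t x)" using m by (intro mult_left_mono)
      then show ?thesis by (simp add: Q_def \<psi>2 \<Psi>_eq m_def mult_ac)
    qed
    have V_eq: "V t x = m t x * P t x + k2 t x" by (simp add: V_def m_def k2_def)
    have "(z t x - \<theta> * lap t x) * V t x = m t x * (z t x * P t x - \<theta> * (lap t x * P t x)) + (z t x * k2 t x - \<theta> * (lap t x * k2 t x))"
      unfolding V_eq by (simp add: algebra_simps)
    also have "m t x * (z t x * P t x - \<theta> * (lap t x * P t x))
        \<le> m t x * (\<beta> * (q - 2) * (q - 1) / (2 * q) * J0 t x + (q - 1) / (2 * \<beta>) * (z t x)\<^sup>2)"
      unfolding P_def \<theta>_def by (intro mult_left_mono m drift_absorption q \<beta> J)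
    also have "z t x * k2 t x - \<theta> * (lap t x * k2 t x)
        \<le> \<eta> * (m t x * (z t x)\<^sup>2) + \<eta> * d * (m t x * I0 t x) + (2 / \<eta>) * (\<Psi> t x * (norm (Z x))\<^sup>2)"
    proof -
      have "- (\<theta> * (lap t x * k2 t x)) \<le> 1 * \<bar>lap t x * k2 t x\<bar>"
        using \<theta> mult_right_mono[of \<theta> 1 "\<bar>lap t x * k2 t x\<bar>"] abs_ge_minus_self[of "\<theta> * (lap t x * k2 t x)"]
        by (simp add: abs_mult)
      also have "\<dots> \<le> \<eta> * (m t x * (lap t x)\<^sup>2) + (1 / \<eta>) * (\<Psi> t x * (norm (Z x))\<^sup>2)" using k2_le[of "lap t x"] by simp
      also have "\<eta> * (m t x * (lap t x)\<^sup>2) \<le> \<eta> * (m t x * (d * I0 t x))"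
        using J(4) m \<eta> by (intro mult_left_mono) (auto simp: d_def)
      finally show ?thesis using k2_le[of "z t x"] abs_ge_self[of "z t x * k2 t x"] by (simp add: algebra_simps)
    qed
    finally have 1: "(z t x - \<theta> * lap t x) * V t x \<le> m t x * (\<beta> * (q - 2) * (q - 1) / (2 * q) * J0 t x + (q - 1) / (2 * \<beta>) * (z t x)\<^sup>2)
        + (\<eta> * (m t x * (z t x)\<^sup>2) + \<eta> * d * (m t x * I0 t x) + (2 / \<eta>) * (\<Psi> t x * (norm (Z x))\<^sup>2))" by simp
    have 2: "- (1 - \<theta>) * k1 t x \<le> \<eta> * (m t x * J0 t x) + (1 / \<eta>) * (\<Psi> t x * (norm (Z x))\<^sup>2)"
    proof -
      have "- (1 - \<theta>) * k1 t x \<le> \<bar>(1 - \<theta>) * k1 t x\<bar>"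
        using abs_ge_minus_self[of "(1 - \<theta>) * k1 t x"] by (simp only: mult_minus_left)
      also have "\<dots> = (1 - \<theta>) * \<bar>k1 t x\<bar>" using \<theta> by (simp add: abs_mult)
      also have "\<dots> \<le> 1 * \<bar>k1 t x\<bar>" by (rule mult_right_mono) (use \<theta> in auto)
      finally have "- (1 - \<theta>) * k1 t x \<le> 1 * \<bar>k1 t x\<bar>" .
      then show ?thesis using k1_le by simp
    qed
    have 3: "a * (m t x * (z t x)\<^sup>2) \<le> a * Q t x" using mz a by (intro mult_left_mono) auto
    have "K t x = - (1 - \<theta>) * (m t x * (I0 t x + (q - 2) * J0 t x)) + (- (1 - \<theta>) * k1 t x) + (z t x - \<theta> * lap t x) * V t x"
      by (simp add: K_def algebra_simps)
    also have "\<dots> \<le> - (1 - \<theta>) * (m t x * (I0 t x + (q - 2) * J0 t x))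
        + (\<eta> * (m t x * J0 t x) + (1 / \<eta>) * (\<Psi> t x * (norm (Z x))\<^sup>2))
        + (m t x * (\<beta> * (q - 2) * (q - 1) / (2 * q) * J0 t x + (q - 1) / (2 * \<beta>) * (z t x)\<^sup>2)
        + (\<eta> * (m t x * (z t x)\<^sup>2) + \<eta> * d * (m t x * I0 t x) + (2 / \<eta>) * (\<Psi> t x * (norm (Z x))\<^sup>2)))"
      by (intro add_mono order_refl 1 2)
    also have "\<dots> = a * (m t x * (z t x)\<^sup>2) + K3 t x"
    proof -
      have "(1 / \<eta>) * y + (2 / \<eta>) * y = (3 / \<eta>) * y" for y :: real by (simp add: add_divide_distrib[symmetric])
      from this[of "\<Psi> t x * (norm (Z x))\<^sup>2"] show ?thesis by (simp add: a_eq K3_def distrib_left distrib_right mult_ac)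
    qed
    finally show ?thesis using 3 by linarith
  qed

  \<comment> \<open>The main part of the gradient of \<zeta> N^(q/4) has square (q^2 / 4) *
    \<open>m * J0\<close>. All second derivatives cancel against the dissipation, and only \<Psi>
    |\<nabla>\<zeta>|^2 is left.\<close>
  have pt: "a * \<delta> * D t x + K3 t x \<le> C * (\<Psi> t x * (norm (Z x))\<^sup>2)" if tI: "t \<in> ?I" for t x
  proof -
    have st: "s < t" using tI t by simp
    note J = J0_bounds[OF st, of x]
    have A: "(norm ((\<zeta> x * (q / 2 * N t x powr (q / 4 - 1))) *\<^sub>R A t x))\<^sup>2 = (q\<^sup>2 / 4) * (m t x * J0 t x)"
    proof -
      have "(N t x powr (q / 4 - 1))\<^sup>2 * N t x = N t x powr ((q / 4 - 1) + (q / 4 - 1) + 1)"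
        using N_ge(2)[of t x] by (simp only: powr_add powr_one power2_eq_square)
      also have "(q / 4 - 1) + (q / 4 - 1) + 1 = (q - 2) / 2" by (simp add: field_simps)
      finally have "(N t x powr (q / 4 - 1))\<^sup>2 * N t x = \<nu> t x" by (simp only: \<nu>_def)
      then have "(N t x powr (q / 4 - 1))\<^sup>2 = \<nu> t x / N t x" using N_ge(3)[of t x] by (simp add: field_simps)
      then show ?thesis by (simp add: m_def J0_def power_mult_distrib power_divide mult_ac)
    qed
    have B: "(norm (N t x powr (q / 4) *\<^sub>R Z x))\<^sup>2 = \<Psi> t x * (norm (Z x))\<^sup>2"
    proof -
      have "(N t x powr (q / 4))\<^sup>2 = \<Psi> t x" using N_ge(2)[of t x] by (simp add: \<Psi>_def power2_eq_square flip: powr_add)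
      then show ?thesis by (simp add: power_mult_distrib)
    qed
    have "D t x \<le> (1 + \<kappa>) * ((q\<^sup>2 / 4) * (m t x * J0 t x)) + (1 + 1 / \<kappa>) * (\<Psi> t x * (norm (Z x))\<^sup>2)"
      using norm_add_square_le[OF \<kappa>, of "(\<zeta> x * (q / 2 * N t x powr (q / 4 - 1))) *\<^sub>R A t x" "N t x powr (q / 4) *\<^sub>R Z x"]
      unfolding A B by (simp add: D_def G_def add.commute)
    then have "a * \<delta> * D t x \<le> a * \<delta> * ((1 + \<kappa>) * ((q\<^sup>2 / 4) * (m t x * J0 t x)) + (1 + 1 / \<kappa>) * (\<Psi> t x * (norm (Z x))\<^sup>2))"
      using a \<delta> by (intro mult_left_mono) auto
    also have "\<dots> = a * (\<delta> * (1 + \<kappa>) * (q\<^sup>2 / 4)) * (m t x * J0 t x) + a * \<delta> * (1 + 1 / \<kappa>) * (\<Psi> t x * (norm (Z x))\<^sup>2)"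
    proof -
      have "a * \<delta> * (k * (c * y) + e * v) = a * (\<delta> * k * c) * y + a * \<delta> * e * v" for k c y e v
        by (simp add: algebra_simps)
      then show ?thesis .
    qed
    also have "a * (\<delta> * (1 + \<kappa>) * (q\<^sup>2 / 4)) = (q - 1) * \<beta> / 2 + \<eta> * \<beta>\<^sup>2"
      unfolding \<delta>q a_eq using \<beta> by (simp add: field_simps power2_eq_square)
    finally have 1: "a * \<delta> * D t x \<le> ((q - 1) * \<beta> / 2 + \<eta> * \<beta>\<^sup>2) * (m t x * J0 t x) + a * \<delta> * (1 + 1 / \<kappa>) * (\<Psi> t x * (norm (Z x))\<^sup>2)" .
    define M where "M = m t x * (I0 t x + (q - 2) * J0 t x)"
    have MJ: "(q - 1) * (m t x * J0 t x) \<le> M"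
      using mult_left_mono[OF J(2) m[of t x]] by (simp add: M_def algebra_simps)
    have mJ: "0 \<le> m t x * J0 t x" using m J by simp
    have MI: "m t x * I0 t x \<le> M"
      using mJ q by (simp add: M_def distrib_left mult.left_commute[of "m t x"])
    have M1: "m t x * J0 t x \<le> M"
      using MI mult_left_mono[OF J(2) m[of t x]] by linarith
    have "((q - 1) * \<beta> / 2 + \<eta> * \<beta>\<^sup>2 + \<beta> * (q - 2) * (q - 1) / (2 * q) + \<eta>) * (m t x * J0 t x)
        = (\<beta> * (q - 1) / q) * ((q - 1) * (m t x * J0 t x)) + (\<eta> * \<beta>\<^sup>2 + \<eta>) * (m t x * J0 t x)"
    proof -
      have "(q - 1) * \<beta> / 2 + \<beta> * (q - 2) * (q - 1) / (2 * q) = (\<beta> * (q - 1) / q) * (q - 1)"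
        using q by (simp add: field_simps)
      then have "(q - 1) * \<beta> / 2 + \<eta> * \<beta>\<^sup>2 + \<beta> * (q - 2) * (q - 1) / (2 * q) + \<eta> = (\<beta> * (q - 1) / q) * (q - 1) + (\<eta> * \<beta>\<^sup>2 + \<eta>)"
        by linarith
      then show ?thesis by (simp only: distrib_right mult.assoc)
    qed
    also have "\<dots> \<le> (\<beta> * (q - 1) / q) * M + (2 * \<eta>) * M"
    proof (intro add_mono)
      show "(\<beta> * (q - 1) / q) * ((q - 1) * (m t x * J0 t x)) \<le> (\<beta> * (q - 1) / q) * M"
        using MJ q \<beta> by (intro mult_left_mono) auto
      have "\<eta> * \<beta>\<^sup>2 \<le> \<eta> * 1" using \<eta> \<beta> by (intro mult_left_mono) (auto simp: power_le_one)
      then have "(\<eta> * \<beta>\<^sup>2 + \<eta>) * (m t x * J0 t x) \<le> (2 * \<eta>) * (m t x * J0 t x)" using mJ by (intro mult_right_mono) auto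
      also have "\<dots> \<le> (2 * \<eta>) * M" using M1 \<eta> by (intro mult_left_mono) auto
      finally show "(\<eta> * \<beta>\<^sup>2 + \<eta>) * (m t x * J0 t x) \<le> (2 * \<eta>) * M" .
    qed
    finally have 2: "((q - 1) * \<beta> / 2 + \<eta> * \<beta>\<^sup>2 + \<beta> * (q - 2) * (q - 1) / (2 * q) + \<eta>) * (m t x * J0 t x)
        \<le> (\<beta> * (q - 1) / q) * M + (2 * \<eta>) * M" .
    have 3: "\<eta> * d * (m t x * I0 t x) \<le> \<eta> * d * M" using MI \<eta> d0 by (intro mult_left_mono) auto
    \<comment> \<open>The balance of all coefficients of the dissipation: it equals \<eta> (2 + d) -
      (1 - \<beta>), which vanishes by the choice of \<eta>. This is where \<beta> < 1 is
      spent.\<close>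
    have 4: "- (1 - \<theta>) * M + ((\<beta> * (q - 1) / q) * M + (2 * \<eta>) * M) + \<eta> * d * M = 0"
    proof -
      have "- (1 - \<theta>) + (\<beta> * (q - 1) / q + 2 * \<eta>) + \<eta> * d = \<eta> * (2 + d) - (1 - \<beta>)"
        using q by (simp add: \<theta>_def field_simps)
      then have "- (1 - \<theta>) + (\<beta> * (q - 1) / q + 2 * \<eta>) + \<eta> * d = 0" using \<eta>_eq by simp
      then have "(- (1 - \<theta>) + (\<beta> * (q - 1) / q + 2 * \<eta>) + \<eta> * d) * M = 0" by simp
      then show ?thesis by (simp only: distrib_right)
    qed
    have "a * \<delta> * D t x + K3 t x \<le> ((q - 1) * \<beta> / 2 + \<eta> * \<beta>\<^sup>2) * (m t x * J0 t x) + a * \<delta> * (1 + 1 / \<kappa>) * (\<Psi> t x * (norm (Z x))\<^sup>2) + K3 t x"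
      using 1 by simp
    also have "\<dots> = - (1 - \<theta>) * M + ((q - 1) * \<beta> / 2 + \<eta> * \<beta>\<^sup>2 + \<beta> * (q - 2) * (q - 1) / (2 * q) + \<eta>) * (m t x * J0 t x)
        + \<eta> * d * (m t x * I0 t x) + C * (\<Psi> t x * (norm (Z x))\<^sup>2)"
      unfolding K3_def C_eq M_def[symmetric] by (simp only: distrib_right)
    also have "\<dots> \<le> - (1 - \<theta>) * M + ((\<beta> * (q - 1) / q) * M + (2 * \<eta>) * M) + \<eta> * d * M + C * (\<Psi> t x * (norm (Z x))\<^sup>2)"
      by (intro add_mono order_refl 2 3)
    finally show ?thesis unfolding 4 by simp
  qed

  have E3c: "continuous_on {t1..t2} E3" unfolding E3_def by (rule cont_supported_continuous_LINT[OF a\<Psi>])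
  have gE: "(\<lambda>t. g t * E3 t) integrable_on {t1..t2}"
    and form_Q: "spacetime_integral t1 t2 Q \<le> \<delta> * spacetime_integral t1 t2 D + integral {t1..t2} (\<lambda>t. g t * E3 t)"
  proof -
    have "continuous_on (?I \<times> UNIV) (\<lambda>(t, x). \<psi> t x)" "continuous_on (?I \<times> UNIV) (\<lambda>(t, x). G t x)"
      using \<psi>c Gc by (simp_all add: split_def)
    note * = form_inequality_real[OF form b_cont _ g_int g_nonneg _ t(2,3) this, where R = r]
    show "(\<lambda>t. g t * E3 t) integrable_on {t1..t2}"
      unfolding E3_eq by (rule *(2)) (use t s0 \<delta> Gd \<psi>z in auto)
    show "spacetime_integral t1 t2 Q \<le> \<delta> * spacetime_integral t1 t2 D + integral {t1..t2} (\<lambda>t. g t * E3 t)"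
      unfolding E3_eq spacetime_integral_def Q_def D_def by (rule *(1)) (use t s0 \<delta> Gd \<psi>z in auto)
  qed

  have "E3 t2 - E3 t1 = integral {t1..t2} (\<lambda>t. - q * (LINT x|lborel. ut t x * V t x))"
  proof (rule integral_unique[symmetric], rule fundamental_theorem_of_calculus[OF t(2)])
    fix \<tau> assume "\<tau> \<in> {t1..t2}"
    then have "s < \<tau>" using t by simp
    from E3_derivative[OF this] show "(E3 has_vector_derivative - q * (LINT x|lborel. ut \<tau> x * V \<tau> x)) (at \<tau> within {t1..t2})"
      by (simp add: has_real_derivative_iff_has_vector_derivative has_vector_derivative_at_within)
  qed
  also have "\<dots> = q * spacetime_integral t1 t2 K"
  proof -
    have "- q * (LINT x|lborel. ut \<tau> x * V \<tau> x) = q * (LINT x|lborel. K \<tau> x)" if tI: "\<tau> \<in> {t1..t2}" for \<tau>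
    proof -
      have st: "s < \<tau>" using tI t by simp
      note cs = cont_slice[OF st] cont_grad_slice[OF st]
      have bs: "continuous_on UNIV (\<lambda>x. b (\<tau>, x))"
        by (rule continuous_on_compose2[OF b_cont]) (auto intro!: continuous_intros)
      have i1: "integrable lborel (\<lambda>x. lap \<tau> x * V \<tau> x)" "integrable lborel (\<lambda>x. z \<tau> x * V \<tau> x)"
        "integrable lborel (\<lambda>x. m \<tau> x * (I0 \<tau> x + (q - 2) * J0 \<tau> x) + k1 \<tau> x)"
        unfolding z_def m_def k1_def
        by (rule integrable_bounded_support[where R = r]; auto simp: V_zero cut_zero intro!: continuous_intros cs bs)+
      have L: "(LINT x|lborel. lap \<tau> x * V \<tau> x) = (LINT x|lborel. m \<tau> x * (I0 \<tau> x + (q - 2) * J0 \<tau> x) + k1 \<tau> x)"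
        using LINT_lap_V[OF st] by (simp add: m_def k1_def)
      have "(LINT x|lborel. K \<tau> x) = (LINT x|lborel. - (1 - \<theta>) * (m \<tau> x * (I0 \<tau> x + (q - 2) * J0 \<tau> x) + k1 \<tau> x)
          + (z \<tau> x * V \<tau> x - \<theta> * (lap \<tau> x * V \<tau> x)))"
        by (simp add: K_def algebra_simps)
      also have "\<dots> = - (1 - \<theta>) * (LINT x|lborel. lap \<tau> x * V \<tau> x) + ((LINT x|lborel. z \<tau> x * V \<tau> x) - \<theta> * (LINT x|lborel. lap \<tau> x * V \<tau> x))"
        unfolding L[symmetric]
        by (subst Bochner_Integration.integral_add)
          (use i1 in \<open>auto simp: L[symmetric] intro!: integrable_mult_right Bochner_Integration.integrable_diff\<close>)
      also have "\<dots> = - (LINT x|lborel. lap \<tau> x * V \<tau> x - z \<tau> x * V \<tau> x)"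
        using i1 by (simp add: algebra_simps)
      also have "(\<lambda>x. lap \<tau> x * V \<tau> x - z \<tau> x * V \<tau> x) = (\<lambda>x. ut \<tau> x * V \<tau> x)"
        using eq[OF st] by (simp add: lap_def z_def left_diff_distrib)
      finally show ?thesis by simp
    qed
    then have "integral {t1..t2} (\<lambda>t. - q * (LINT x|lborel. ut t x * V t x)) = integral {t1..t2} (\<lambda>t. q * (LINT x|lborel. K t x))"
      by (intro Henstock_Kurzweil_Integration.integral_cong)
    then show ?thesis by (simp add: spacetime_integral_def)
  qed
  also have "spacetime_integral t1 t2 K \<le> spacetime_integral t1 t2 (\<lambda>t x. a * Q t x + K3 t x)"
    by (rule spacetime_integral_mono[OF aK cont_supported_add[OF cont_supported_cmult[OF aQ] aK3] K_le])
  also have "\<dots> = a * spacetime_integral t1 t2 Q + spacetime_integral t1 t2 K3" by (simp only: spacetime_integral_add[OF cont_supported_cmult[OF aQ] aK3] spacetime_integral_cmult)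
  also have "a * spacetime_integral t1 t2 Q \<le> a * (\<delta> * spacetime_integral t1 t2 D + integral {t1..t2} (\<lambda>t. g t * E3 t))"
    using a form_Q by (intro mult_left_mono) auto
  also have "\<dots> + spacetime_integral t1 t2 K3 = spacetime_integral t1 t2 (\<lambda>t x. (a * \<delta>) * D t x + K3 t x) + a * integral {t1..t2} (\<lambda>t. g t * E3 t)"
    by (simp only: spacetime_integral_add[OF cont_supported_cmult[OF aD] aK3] spacetime_integral_cmult) (simp add: algebra_simps)
  also have "spacetime_integral t1 t2 (\<lambda>t x. (a * \<delta>) * D t x + K3 t x)
      \<le> spacetime_integral t1 t2 (\<lambda>t x. (8 * C) * ((\<zeta> x)\<^sup>2 * \<Psi> t x) + (C * W) * cutoff_excess x0 R x)"
  proof (rule spacetime_integral_mono[OF cont_supported_add[OF cont_supported_cmult[OF aD] aK3] cont_supported_add[OF cont_supported_cmult[OF a\<Psi>] cont_supported_cmult[OF aX]]])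
    fix \<tau> x assume tI: "\<tau> \<in> {t1..t2}"
    have "\<Psi> \<tau> x * (norm (Z x))\<^sup>2 \<le> \<Psi> \<tau> x * (8 * (\<zeta> x)\<^sup>2 + cutoff_excess x0 R x)"
      using \<Psi>_pos[of \<tau> x] by (intro mult_left_mono cutoff_excess) auto
    also have "\<dots> \<le> 8 * ((\<zeta> x)\<^sup>2 * \<Psi> \<tau> x) + W * cutoff_excess x0 R x"
      using mult_right_mono[OF W[of \<tau> x] cutoff_excess(2)[of x0 R x]] tI t by (simp add: algebra_simps)
    finally have "C * (\<Psi> \<tau> x * (norm (Z x))\<^sup>2) \<le> C * (8 * ((\<zeta> x)\<^sup>2 * \<Psi> \<tau> x) + W * cutoff_excess x0 R x)"
      using C by (intro mult_left_mono) auto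
    then show "(a * \<delta>) * D \<tau> x + K3 \<tau> x \<le> (8 * C) * ((\<zeta> x)\<^sup>2 * \<Psi> \<tau> x) + (C * W) * cutoff_excess x0 R x"
      using pt[OF tI, of x] by (simp add: algebra_simps)
  qed
  also have "spacetime_integral t1 t2 (\<lambda>t x. (8 * C) * ((\<zeta> x)\<^sup>2 * \<Psi> t x) + (C * W) * cutoff_excess x0 R x)
      = (8 * C) * integral {t1..t2} E3 + (C * W) * ((t2 - t1) * (LINT x|lborel. cutoff_excess x0 R x))"
    by (simp only: spacetime_integral_add[OF cont_supported_cmult[OF a\<Psi>] cont_supported_cmult[OF aX]] spacetime_integral_cmult spacetime_integral_const[OF t(2)])
      (simp add: spacetime_integral_def E3_def[abs_def])
  finally have fin: "E3 t2 - E3 t1 \<le> q * ((8 * C) * integral {t1..t2} E3 + (C * W) * ((t2 - t1) * (LINT x|lborel. cutoff_excess x0 R x))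
      + a * integral {t1..t2} (\<lambda>t. g t * E3 t))"
    using q by simp
  have W0: "0 \<le> W" using W[of t2 0] \<Psi>_pos[of t2 0] t by linarith
  have X: "(C * W) * ((t2 - t1) * (LINT x|lborel. cutoff_excess x0 R x)) \<le> (C * W) * (T * (8 * exp (- 2 * R) * rho_mass TYPE('a)))"
    using C W0 t s0 rho_mass_nonneg[where 'a='a] by (intro mult_left_mono mult_mono cutoff_excess(5) integral_nonneg_AE) (auto intro: cutoff_excess(2))
  have i1: "(\<lambda>t. c1 * E3 t) integrable_on {t1..t2}" and i2: "(\<lambda>t. c2 * (g t * E3 t)) integrable_on {t1..t2}"
    using integrable_cmul[OF integrable_continuous_interval[OF E3c], of c1] integrable_cmul[OF gE, of c2] by simp_all
  have split: "(c1 + c2 * g t) * E3 t = c1 * E3 t + c2 * (g t * E3 t)" for t by (simp add: algebra_simps)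
  show "(\<lambda>t. (c1 + c2 * g t) * E3 t) integrable_on {t1..t2}"
    unfolding split by (rule Henstock_Kurzweil_Integration.integrable_add[OF i1 i2])
  have "integral {t1..t2} (\<lambda>t. (c1 + c2 * g t) * E3 t) = c1 * integral {t1..t2} E3 + c2 * integral {t1..t2} (\<lambda>t. g t * E3 t)"
    unfolding split by (subst Henstock_Kurzweil_Integration.integral_add[OF i1 i2]) simp
  moreover have "q * ((C * W) * ((t2 - t1) * (LINT x|lborel. cutoff_excess x0 R x))) \<le> q * ((C * W) * (T * (8 * exp (- 2 * R) * rho_mass TYPE('a))))"
    by (rule mult_left_mono[OF X]) (use q in simp)
  ultimately show "E3 t2 \<le> E3 t1 + integral {t1..t2} (\<lambda>t. (c1 + c2 * g t) * E3 t) + c1 * T * W * exp (- 2 * R) * rho_mass TYPE('a)"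
    using fin by (simp add: c1 c2 algebra_simps)
qed

theorem gradient_growth:
  assumes W: "\<And>t x. s < t \<Longrightarrow> t \<le> T \<Longrightarrow> \<Psi> t x \<le> W" and t: "s < t1" "t1 \<le> t" "t \<le> T"
    and n: "8 * q * gr_rate \<delta> q (real DIM('a)) * T + q * gr_gain \<delta> q (real DIM('a)) * integral {0..T} g \<le> real n / 2"
  shows "E3 t \<le> 2 ^ n * (E3 t1 + 3 * (8 * q * gr_rate \<delta> q (real DIM('a)) * T * W * exp (- 2 * R) * rho_mass TYPE('a)))"
proof (rule growth_from_inequality[OF _ _ t _ _ _ _ _ n])
  have "cont_supported {t1..T} r (\<lambda>t x. (\<zeta> x)\<^sup>2 * \<Psi> t x)"
    by (rule cont_supportedI) (use t in \<open>auto simp: cut_zero intro!: continuous_intros cont_grad\<close>)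
  from cont_supported_continuous_LINT[OF this] show "continuous_on {t1..T} E3" by (simp add: E3_def[abs_def])
  show "0 \<le> E3 t" for t unfolding E3_def by (rule integral_nonneg_AE) (simp add: less_imp_le[OF \<Psi>_pos])
  have "0 \<le> W" using W[of t 0] \<Psi>_pos[of t 0] t by linarith
  then show "0 \<le> 8 * q * gr_rate \<delta> q (real DIM('a)) * T * W * exp (- 2 * R) * rho_mass TYPE('a)"
    using E3_inequality(3)[OF t W] t s0 rho_mass_nonneg[where 'a='a] by simp
qed (use E3_inequality[OF _ _ _ W] t in auto)

end

section \<open>Morrey's inequality on cubes\<close>

abbreviation unit_cube :: "'a::euclidean_space set"
  where "unit_cube \<equiv> cbox (- One) One"

lemma norm_unit_cube:
  assumes "y \<in> (unit_cube :: 'a::euclidean_space set)"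
  shows "norm y \<le> sqrt (real DIM('a))"
proof -
  have "(norm y)\<^sup>2 \<le> (\<Sum>i\<in>(Basis::'a set). 1)"
    unfolding norm_square_eq_sum_Basis
  proof (rule sum_mono)
    fix i :: 'a assume "i \<in> Basis"
    then have "\<bar>y \<bullet> i\<bar> \<le> 1" using assms by (auto simp: mem_box abs_le_iff)
    then show "(y \<bullet> i)\<^sup>2 \<le> 1" by (simp add: abs_square_le_1)
  qed
  then show ?thesis by (simp add: real_le_rsqrt)
qed

lemma integral_const_unit_cube: "integral (unit_cube :: 'a::euclidean_space set) (\<lambda>_. c) = 2 ^ DIM('a) * (c::real)"
proof -
  have "measure lborel (unit_cube :: 'a set) = (\<Prod>i\<in>(Basis :: 'a set). 2)"
    unfolding measure_lborel_cbox_eq by (auto intro!: prod.cong simp: inner_simps)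
  then show ?thesis unfolding integral_const by simp
qed

text \<open>The mean over a cube shrinking to \<open>x0\<close> is differentiated in its size. Its
  derivative is controlled by means of the gradient, which may blow up like \<rho>^(-\<alpha>); for
  \<alpha> < 1 this is integrable down to size zero.\<close>

theorem morrey:
  fixes h :: "'a::euclidean_space \<Rightarrow> real"
  assumes h: "\<And>x. (h has_derivative (\<lambda>v. G x \<bullet> v)) (at x)" and G: "continuous_on UNIV G"
    and \<alpha>: "0 < \<alpha>" "\<alpha> < 1" and r: "0 < r" "r \<le> 1"
    and K: "\<And>\<rho>. 0 < \<rho> \<Longrightarrow> \<rho> \<le> 1 \<Longrightarrow> integral unit_cube (\<lambda>y. norm (G (x0 + \<rho> *\<^sub>R y))) \<le> K * \<rho> powr (- \<alpha>)"
  shows "2 ^ DIM('a) * \<bar>h x0\<bar> \<le> integral unit_cube (\<lambda>y. \<bar>h (x0 + r *\<^sub>R y)\<bar>) + sqrt (real DIM('a)) * K / (1 - \<alpha>) * r powr (1 - \<alpha>)"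
proof -
  have hc: "continuous_on UNIV h" by (rule has_derivative_continuous_on_UNIV[OF h])
  define \<phi> where "\<phi> \<theta> = integral unit_cube (\<lambda>y. h (x0 + (\<theta> * r) *\<^sub>R y))" for \<theta>
  define \<phi>' where "\<phi>' \<theta> = integral unit_cube (\<lambda>y. G (x0 + (\<theta> * r) *\<^sub>R y) \<bullet> (r *\<^sub>R y))" for \<theta>
  define \<psi> where "\<psi> \<theta> = sqrt (real DIM('a)) * K * r powr (1 - \<alpha>) * (\<theta> powr (1 - \<alpha>) / (1 - \<alpha>))" for \<theta>
  have \<phi>_deriv: "(\<phi> has_vector_derivative \<phi>' \<theta>) (at \<theta>)" for \<theta>
  proof -
    have "((\<lambda>\<theta>. integral unit_cube (\<lambda>y. h (x0 + (\<theta> * r) *\<^sub>R y))) has_field_derivative \<phi>' \<theta>) (at \<theta> within UNIV)"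
      unfolding \<phi>'_def
    proof (rule leibniz_rule_field_derivative)
      show "((\<lambda>\<theta>. h (x0 + (\<theta> * r) *\<^sub>R y)) has_field_derivative G (x0 + (\<theta> * r) *\<^sub>R y) \<bullet> (r *\<^sub>R y)) (at \<theta> within UNIV)" for \<theta> y
        using has_derivative_along_line[OF h, of x0 "r *\<^sub>R y" \<theta>] by simp
      show "(\<lambda>y. h (x0 + (\<theta> * r) *\<^sub>R y)) integrable_on unit_cube" for \<theta>
        by (intro integrable_continuous continuous_on_compose2[OF hc] continuous_intros) auto
      show "continuous_on (UNIV \<times> unit_cube) (\<lambda>(\<theta>, y). G (x0 + (\<theta> * r) *\<^sub>R y) \<bullet> (r *\<^sub>R y))"
        unfolding split_def by (intro continuous_intros continuous_on_compose2[OF G]) auto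
    qed auto
    then show ?thesis by (simp add: \<phi>_def[abs_def] has_real_derivative_iff_has_vector_derivative)
  qed
  have "norm (\<phi> 1 - \<phi> 0) \<le> \<psi> 1 - \<psi> 0"
  proof (rule differentiable_bound_general[OF zero_less_one])
    show "continuous_on {0..1} \<phi>"
      by (intro continuous_at_imp_continuous_on ballI has_vector_derivative_continuous[OF \<phi>_deriv])
    show "continuous_on {0..1} \<psi>"
      unfolding \<psi>_def using \<alpha> by (intro continuous_intros continuous_on_powr') auto
    show "(\<psi> has_vector_derivative sqrt (real DIM('a)) * K * r powr (1 - \<alpha>) * \<theta> powr (- \<alpha>)) (at \<theta>)" if "0 < \<theta>" "\<theta> < 1" for \<theta>
    proof -
      have "(\<psi> has_real_derivative sqrt (real DIM('a)) * K * r powr (1 - \<alpha>) * ((1 - \<alpha>) * \<theta> powr (1 - \<alpha> - 1) / (1 - \<alpha>))) (at \<theta>)"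
        unfolding \<psi>_def using that by (intro DERIV_cmult DERIV_cdivide has_real_derivative_powr)
      then show ?thesis using \<alpha> by (simp add: has_real_derivative_iff_has_vector_derivative)
    qed
    show "norm (\<phi>' \<theta>) \<le> sqrt (real DIM('a)) * K * r powr (1 - \<alpha>) * \<theta> powr (- \<alpha>)" if \<theta>: "0 < \<theta>" "\<theta> < 1" for \<theta>
    proof -
      have \<rho>: "0 < \<theta> * r" "\<theta> * r \<le> 1" using \<theta> r by (auto intro: mult_le_one)
      have Gc: "continuous_on unit_cube (\<lambda>y. G (x0 + (\<theta> * r) *\<^sub>R y))"
        by (intro continuous_on_compose2[OF G] continuous_intros) auto
      have "norm (\<phi>' \<theta>) \<le> integral unit_cube (\<lambda>y. (r * sqrt (real DIM('a))) * norm (G (x0 + (\<theta> * r) *\<^sub>R y)))"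
        unfolding \<phi>'_def
      proof (rule integral_norm_bound_integral)
        show "(\<lambda>y. G (x0 + (\<theta> * r) *\<^sub>R y) \<bullet> (r *\<^sub>R y)) integrable_on unit_cube"
          "(\<lambda>y. (r * sqrt (real DIM('a))) * norm (G (x0 + (\<theta> * r) *\<^sub>R y))) integrable_on unit_cube"
          by (intro integrable_continuous continuous_intros Gc)+
        fix y :: 'a assume y: "y \<in> unit_cube"
        have "norm (G (x0 + (\<theta> * r) *\<^sub>R y) \<bullet> (r *\<^sub>R y)) \<le> norm (G (x0 + (\<theta> * r) *\<^sub>R y)) * norm (r *\<^sub>R y)"
          by (simp only: real_norm_def Cauchy_Schwarz_ineq2)
        also have "\<dots> \<le> norm (G (x0 + (\<theta> * r) *\<^sub>R y)) * (r * sqrt (real DIM('a)))"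
          using norm_unit_cube[OF y] r by (intro mult_left_mono) auto
        finally show "norm (G (x0 + (\<theta> * r) *\<^sub>R y) \<bullet> (r *\<^sub>R y)) \<le> (r * sqrt (real DIM('a))) * norm (G (x0 + (\<theta> * r) *\<^sub>R y))"
          by (simp add: mult.commute)
      qed
      also have "\<dots> = (r * sqrt (real DIM('a))) * integral unit_cube (\<lambda>y. norm (G (x0 + (\<theta> * r) *\<^sub>R y)))" by simp
      also have "\<dots> \<le> (r * sqrt (real DIM('a))) * (K * (\<theta> * r) powr (- \<alpha>))"
        using K[OF \<rho>] r by (intro mult_left_mono) auto
      also have "\<dots> = sqrt (real DIM('a)) * K * (r powr 1 * r powr (- \<alpha>)) * \<theta> powr (- \<alpha>)"
        using \<theta> r by (simp add: powr_mult mult_ac)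
      also have "r powr 1 * r powr (- \<alpha>) = r powr (1 - \<alpha>)" by (simp only: powr_add[symmetric]) simp
      finally show ?thesis .
    qed
  qed (use \<phi>_deriv in auto)
  moreover have "\<psi> 1 - \<psi> 0 = sqrt (real DIM('a)) * K / (1 - \<alpha>) * r powr (1 - \<alpha>)" using \<alpha> by (simp add: \<psi>_def)
  moreover have "\<phi> 0 = 2 ^ DIM('a) * h x0" using integral_const_unit_cube[where 'a='a, of "h x0"] by (simp add: \<phi>_def del: integral_const)
  moreover have "\<bar>\<phi> 1\<bar> \<le> integral unit_cube (\<lambda>y. \<bar>h (x0 + r *\<^sub>R y)\<bar>)"
  proof -
    have c: "continuous_on unit_cube (\<lambda>y. h (x0 + r *\<^sub>R y))"
      by (intro continuous_on_compose2[OF hc] continuous_intros) auto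
    have "norm (\<phi> 1) \<le> integral unit_cube (\<lambda>y. \<bar>h (x0 + r *\<^sub>R y)\<bar>)"
      unfolding \<phi>_def mult_1
      by (rule integral_norm_bound_integral) (auto intro!: integrable_continuous continuous_intros c)
    then show ?thesis by simp
  qed
  ultimately have "\<bar>2 ^ DIM('a) * h x0\<bar> \<le> integral unit_cube (\<lambda>y. \<bar>h (x0 + r *\<^sub>R y)\<bar>) + sqrt (real DIM('a)) * K / (1 - \<alpha>) * r powr (1 - \<alpha>)"
    by (simp add: abs_le_iff) 
  then show ?thesis by (simp add: abs_mult)
qed

text \<open>Lower bound of the squared weight on the unit cube around its centre: the square of the
  bound in \<open>cutoff_lower_bound\<close> for radius sqrt d.\<close>

definition cube_weight :: "'a::euclidean_space itself \<Rightarrow> real"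
  where "cube_weight _ = exp (- 4 * (2 + sqrt (real DIM('a))))"

lemma cube_weight_pos [simp]: "0 < cube_weight TYPE('a::euclidean_space)" "cube_weight TYPE('a) \<noteq> 0"
  by (simp_all add: cube_weight_def)

lemma integral_unit_cube_le:
  fixes k :: "'a::euclidean_space \<Rightarrow> real"
  assumes k: "continuous_on UNIV k" "\<And>x. 0 \<le> k x" and \<rho>: "0 < \<rho>" "\<rho> \<le> 1"
    and R: "2 + sqrt (real DIM('a)) \<le> R"
  shows "integral unit_cube (\<lambda>y. k (x0 + \<rho> *\<^sub>R y))
    \<le> (LINT x|lborel. (cutoff x0 R x)\<^sup>2 * k x) / (cube_weight TYPE('a) * \<rho> ^ DIM('a))"
proof -
  define f where "f x = (cutoff x0 R x)\<^sup>2 * k x" for x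
  have fc: "continuous_on UNIV f" unfolding f_def by (intro continuous_intros k)
  have fz: "f x = 0" if "R + norm x0 < norm x" for x using that by (simp add: f_def cutoff_zero)
  have f0: "0 \<le> f x" for x using k by (simp add: f_def)
  have kc: "continuous_on unit_cube (\<lambda>y. k (x0 + \<rho> *\<^sub>R y))"
    by (intro continuous_on_compose2[OF k(1)] continuous_intros) auto
  have fc2: "continuous_on UNIV (\<lambda>y. f (x0 + \<rho> *\<^sub>R y))"
    by (intro continuous_on_compose2[OF fc] continuous_intros) auto
  have int: "integrable lborel (\<lambda>y. f (x0 + \<rho> *\<^sub>R y))"
  proof (rule integrable_bounded_support[OF fc2])
    fix y :: 'a assume "(R + norm x0 + norm x0) / \<rho> < norm y"
    then have "R + norm x0 + norm x0 < norm (\<rho> *\<^sub>R y)" using \<rho> by (simp add: field_simps)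
    then show "f (x0 + \<rho> *\<^sub>R y) = 0" using norm_triangle_ineq2[of "\<rho> *\<^sub>R y" "- x0"] by (intro fz) (simp add: add.commute)
  qed
  have "integral unit_cube (\<lambda>y. cube_weight TYPE('a) * k (x0 + \<rho> *\<^sub>R y)) \<le> integral unit_cube (\<lambda>y. f (x0 + \<rho> *\<^sub>R y))"
  proof (rule integral_le)
    fix y :: 'a assume y: "y \<in> unit_cube"
    have "norm (\<rho> *\<^sub>R y) \<le> 1 * sqrt (real DIM('a))"
      using norm_unit_cube[OF y] \<rho> by (simp only: norm_scaleR) (intro mult_mono, auto)
    then have "exp (- 2 * (2 + sqrt (real DIM('a)))) \<le> cutoff x0 R (x0 + \<rho> *\<^sub>R y)"
      using R by (intro cutoff_lower_bound) auto
    then have "(exp (- 2 * (2 + sqrt (real DIM('a)))))\<^sup>2 \<le> (cutoff x0 R (x0 + \<rho> *\<^sub>R y))\<^sup>2" by (intro power_mono) auto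
    then have "cube_weight TYPE('a) \<le> (cutoff x0 R (x0 + \<rho> *\<^sub>R y))\<^sup>2"
      by (simp add: cube_weight_def power2_eq_square flip: exp_add)
    then show "cube_weight TYPE('a) * k (x0 + \<rho> *\<^sub>R y) \<le> f (x0 + \<rho> *\<^sub>R y)"
      unfolding f_def using k by (intro mult_right_mono) auto
  qed (auto intro!: integrable_continuous continuous_intros kc continuous_on_subset[OF fc2])
  also have "\<dots> \<le> (LINT y|lborel. f (x0 + \<rho> *\<^sub>R y))"
  proof -
    have si: "set_integrable lborel unit_cube (\<lambda>y. f (x0 + \<rho> *\<^sub>R y))"
      unfolding set_integrable_def by (rule borel_integrable_compact) (auto intro: continuous_on_subset[OF fc2])
    have "integral unit_cube (\<lambda>y. f (x0 + \<rho> *\<^sub>R y)) = (LINT y:unit_cube|lborel. f (x0 + \<rho> *\<^sub>R y))"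
      using set_borel_integral_eq_integral(2)[OF si] by simp
    also have "\<dots> \<le> (LINT y|lborel. f (x0 + \<rho> *\<^sub>R y))"
      unfolding set_lebesgue_integral_def
      by (rule integral_mono[OF si[unfolded set_integrable_def] int]) (simp add: indicator_def f0)
    finally show ?thesis .
  qed
  also have "\<dots> = (LINT x|lborel. f x) / \<rho> ^ DIM('a)"
    using LINT_affine[of f \<rho> x0] \<rho> borel_measurable_continuous_onI[OF fc] by simp
  finally have "cube_weight TYPE('a) * integral unit_cube (\<lambda>y. k (x0 + \<rho> *\<^sub>R y)) \<le> (LINT x|lborel. f x) / \<rho> ^ DIM('a)"
    by simp
  then show ?thesis using \<rho> by (simp add: f_def field_simps)
qed

text \<open>Replaces Hoelder's inequality by a threshold: where |G| exceeds \<open>a\<close> it is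
  at most a^(1-q) times the integrand of order q. The rescaled integral of that integrand is of
  order \<rho>^(-d), and a = \<rho>^(-d/q) gives both contributions the same size.\<close>

lemma gradient_integral_unit_cube:
  fixes G :: "'a::euclidean_space \<Rightarrow> 'a"
  assumes G: "continuous_on UNIV G" and q: "1 < q" and \<rho>: "0 < \<rho>" "\<rho> \<le> 1"
    and R: "2 + sqrt (real DIM('a)) \<le> R"
    and B: "(LINT x|lborel. (cutoff x0 R x)\<^sup>2 * (1 + G x \<bullet> G x) powr (q / 2)) \<le> B"
  shows "integral unit_cube (\<lambda>y. norm (G (x0 + \<rho> *\<^sub>R y))) \<le> (B / cube_weight TYPE('a) + 2 ^ DIM('a)) * \<rho> powr (- (real DIM('a) / q))"
proof -
  define d where "d = real DIM('a)"
  define a where "a = \<rho> powr (- (d / q))"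
  define \<Psi> where "\<Psi> x = (1 + G x \<bullet> G x) powr (q / 2)" for x
  have a: "0 < a" using \<rho> by (simp add: a_def)
  have pos: "0 < 1 + G x \<bullet> G x" for x by (simp add: add_pos_nonneg)
  have \<Psi>c: "continuous_on UNIV \<Psi>" unfolding \<Psi>_def
    by (intro continuous_intros G) (use pos in \<open>auto simp: less_imp_neq[symmetric] dest: less_imp_neq\<close>)
  have le: "norm (G x) \<le> a powr (1 - q) * \<Psi> x + a" for x
  proof (cases "norm (G x) \<le> a")
    case True
    then show ?thesis by (simp add: \<Psi>_def add_increasing)
  next
    case False
    define n where "n = norm (G x)"
    have n: "a < n" "0 < n" using False a by (auto simp: n_def)
    have "n = n powr (1 - q) * n powr q" using n by (simp flip: powr_add)
    also have "\<dots> \<le> a powr (1 - q) * \<Psi> x"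
    proof (rule mult_mono)
      show "n powr (1 - q) \<le> a powr (1 - q)" using n a q by (intro powr_mono2') auto
      have "n powr q = (n\<^sup>2) powr (q / 2)" using n by (simp add: powr_powr flip: powr_numeral)
      also have "\<dots> \<le> \<Psi> x" unfolding \<Psi>_def using q by (intro powr_mono2) (auto simp: n_def power2_norm_eq_inner)
      finally show "n powr q \<le> \<Psi> x" .
    qed auto
    finally show ?thesis using a by (simp add: n_def)
  qed
  have c: "continuous_on unit_cube (\<lambda>y. G (x0 + \<rho> *\<^sub>R y))" "continuous_on unit_cube (\<lambda>y. \<Psi> (x0 + \<rho> *\<^sub>R y))"
    by (intro continuous_on_compose2[OF G] continuous_on_compose2[OF \<Psi>c] continuous_intros; simp)+
  have "integral unit_cube (\<lambda>y. norm (G (x0 + \<rho> *\<^sub>R y))) \<le> integral unit_cube (\<lambda>y. a powr (1 - q) * \<Psi> (x0 + \<rho> *\<^sub>R y) + a)"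
    by (rule integral_le) (auto intro!: integrable_continuous continuous_intros c le)
  also have "\<dots> = a powr (1 - q) * integral unit_cube (\<lambda>y. \<Psi> (x0 + \<rho> *\<^sub>R y)) + 2 ^ DIM('a) * a"
    by (subst Henstock_Kurzweil_Integration.integral_add)
      (auto intro!: integrable_continuous continuous_intros c simp: integral_const_unit_cube simp del: integral_const)
  also have "\<dots> \<le> a powr (1 - q) * (B / (cube_weight TYPE('a) * \<rho> ^ DIM('a))) + 2 ^ DIM('a) * a"
  proof (intro add_mono mult_left_mono order_refl)
    have "integral unit_cube (\<lambda>y. \<Psi> (x0 + \<rho> *\<^sub>R y)) \<le> (LINT x|lborel. (cutoff x0 R x)\<^sup>2 * \<Psi> x) / (cube_weight TYPE('a) * \<rho> ^ DIM('a))"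
      by (rule integral_unit_cube_le[OF \<Psi>c _ \<rho> R]) (simp add: \<Psi>_def)
    also have "\<dots> \<le> B / (cube_weight TYPE('a) * \<rho> ^ DIM('a))"
      using B \<rho> by (intro divide_right_mono) (auto simp: \<Psi>_def less_imp_le)
    finally show "integral unit_cube (\<lambda>y. \<Psi> (x0 + \<rho> *\<^sub>R y)) \<le> B / (cube_weight TYPE('a) * \<rho> ^ DIM('a))" .
  qed auto
  also have "a powr (1 - q) * (B / (cube_weight TYPE('a) * \<rho> ^ DIM('a))) = B / cube_weight TYPE('a) * a"
  proof -
    have "a powr (1 - q) = a * \<rho> powr d"
    proof -
      have "- (d / q) * (1 - q) = - (d / q) + d" using q by (simp add: field_simps)
      then show ?thesis using \<rho> by (simp add: a_def powr_powr flip: powr_add)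
    qed
    also have "\<rho> powr d = \<rho> ^ DIM('a)" using \<rho> by (simp add: d_def powr_realpow)
    finally show ?thesis using \<rho> by simp
  qed
  finally show ?thesis by (simp add: a_def d_def algebra_simps)
qed

text \<open>|h| \<le> \<kappa> + h^2 / \<kappa> trades the local mean in \<open>morrey\<close> for
  the weighted L^2 norm. The parameters \<kappa> and \<open>r\<close> stay free until
  \<open>small_of_small_L2\<close>.\<close>

lemma pointwise_bound:
  fixes h :: "'a::euclidean_space \<Rightarrow> real"
  assumes h: "\<And>x. (h has_derivative (\<lambda>v. G x \<bullet> v)) (at x)" and G: "continuous_on UNIV G"
    and \<alpha>: "0 < \<alpha>" "\<alpha> < 1" and r: "0 < r" "r \<le> 1" and \<kappa>: "0 < \<kappa>"
    and K: "\<And>\<rho>. 0 < \<rho> \<Longrightarrow> \<rho> \<le> 1 \<Longrightarrow> integral unit_cube (\<lambda>y. norm (G (x0 + \<rho> *\<^sub>R y))) \<le> K * \<rho> powr (- \<alpha>)"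
    and R: "2 + sqrt (real DIM('a)) \<le> R"
    and B: "(LINT x|lborel. (cutoff x0 R x * h x)\<^sup>2) \<le> B"
  shows "2 ^ DIM('a) * \<bar>h x0\<bar> \<le> 2 ^ DIM('a) * \<kappa> + B / (\<kappa> * cube_weight TYPE('a) * r ^ DIM('a))
    + sqrt (real DIM('a)) * K / (1 - \<alpha>) * r powr (1 - \<alpha>)"
proof -
  have hc: "continuous_on UNIV h" by (rule has_derivative_continuous_on_UNIV[OF h])
  have c: "continuous_on unit_cube (\<lambda>y. h (x0 + r *\<^sub>R y))"
    by (intro continuous_on_compose2[OF hc] continuous_intros) auto
  have "integral unit_cube (\<lambda>y. \<bar>h (x0 + r *\<^sub>R y)\<bar>) \<le> integral unit_cube (\<lambda>y. \<kappa> + (1 / \<kappa>) * (h (x0 + r *\<^sub>R y))\<^sup>2)"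
  proof (rule integral_le)
    fix y
    show "\<bar>h (x0 + r *\<^sub>R y)\<bar> \<le> \<kappa> + (1 / \<kappa>) * (h (x0 + r *\<^sub>R y))\<^sup>2"
      using young[OF \<kappa>, of 1 "\<bar>h (x0 + r *\<^sub>R y)\<bar>"] \<kappa> by simp
  qed (use \<kappa> in \<open>auto intro!: integrable_continuous continuous_intros c\<close>)
  also have "\<dots> = 2 ^ DIM('a) * \<kappa> + (1 / \<kappa>) * integral unit_cube (\<lambda>y. (h (x0 + r *\<^sub>R y))\<^sup>2)"
    using \<kappa> by (subst Henstock_Kurzweil_Integration.integral_add)
      (auto intro!: integrable_continuous continuous_intros c simp: integral_const_unit_cube simp del: integral_const)
  also have "\<dots> \<le> 2 ^ DIM('a) * \<kappa> + (1 / \<kappa>) * (B / (cube_weight TYPE('a) * r ^ DIM('a)))"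
  proof (intro add_mono mult_left_mono order_refl)
    have "integral unit_cube (\<lambda>y. (h (x0 + r *\<^sub>R y))\<^sup>2) \<le> (LINT x|lborel. (cutoff x0 R x)\<^sup>2 * (h x)\<^sup>2) / (cube_weight TYPE('a) * r ^ DIM('a))"
      by (rule integral_unit_cube_le[OF _ _ r R]) (auto intro!: continuous_intros hc)
    also have "\<dots> \<le> B / (cube_weight TYPE('a) * r ^ DIM('a))"
      using B r by (intro divide_right_mono) (auto simp: power_mult_distrib less_imp_le)
    finally show "integral unit_cube (\<lambda>y. (h (x0 + r *\<^sub>R y))\<^sup>2) \<le> B / (cube_weight TYPE('a) * r ^ DIM('a))" .
  qed (use \<kappa> in auto)
  finally show ?thesis using morrey[OF h G \<alpha> r K] by (simp add: mult_ac)
qed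

subsection \<open>Uniform convergence for data of compact support\<close>

lemma cutoff_mono: "R \<le> R' \<Longrightarrow> cutoff x0 R x \<le> cutoff x0 R' x"
  unfolding cutoff_def by (intro power_mono max.mono) auto

text \<open>Lets a radius \<open>R\<close> beyond an arbitrary constant \<open>X\<close> neutralise
  that constant.\<close>

lemma exp_error_le_1:
  fixes X R :: real
  shows "X \<le> R \<Longrightarrow> 0 \<le> X \<Longrightarrow> X * exp (- 2 * R) \<le> 1"
proof -
  assume "X \<le> R" "0 \<le> X"
  have "X * exp (- 2 * R) \<le> exp (2 * R) * exp (- 2 * R)"
    using exp_ge_add_one_self[of "2 * R"] \<open>X \<le> R\<close> \<open>0 \<le> X\<close> by (intro mult_right_mono) (linarith, simp)
  then show ?thesis by (simp flip: exp_add)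
qed

lemma LINT_cutoff_mono:
  fixes k :: "'a::euclidean_space \<Rightarrow> real"
  assumes "continuous_on UNIV k" "\<And>x. 0 \<le> k x" "R \<le> R'"
  shows "(LINT x|lborel. (cutoff x0 R x)\<^sup>2 * k x) \<le> (LINT x|lborel. (cutoff x0 R' x)\<^sup>2 * k x)"
proof (rule integral_mono)
  have "integrable lborel (\<lambda>x. (cutoff x0 R x)\<^sup>2 * k x)" for R
    by (rule integrable_bounded_support[where R = "R + norm x0"]) (auto simp: cutoff_zero intro!: continuous_intros assms)
  then show "integrable lborel (\<lambda>x. (cutoff x0 R x)\<^sup>2 * k x)" "integrable lborel (\<lambda>x. (cutoff x0 R' x)\<^sup>2 * k x)" by auto
  show "(cutoff x0 R x)\<^sup>2 * k x \<le> (cutoff x0 R' x)\<^sup>2 * k x" for x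
    by (intro mult_right_mono power_mono cutoff_mono assms cutoff_bounds)
qed

lemma LINT_cutoff_le:
  fixes k :: "'a::euclidean_space \<Rightarrow> real"
  assumes "continuous_on UNIV k" "\<And>x. k x \<le> C" "0 \<le> C"
  shows "(LINT x|lborel. (cutoff x0 R x)\<^sup>2 * k x) \<le> C * rho_mass TYPE('a)"
proof -
  have "(LINT x|lborel. (cutoff x0 R x)\<^sup>2 * k x) \<le> (LINT x|lborel. C * rho x0 x)"
  proof (rule integral_mono)
    show "integrable lborel (\<lambda>x. (cutoff x0 R x)\<^sup>2 * k x)"
      by (rule integrable_bounded_support[where R = "R + norm x0"]) (auto simp: cutoff_zero intro!: continuous_intros assms)
    show "integrable lborel (\<lambda>x. C * rho x0 x)" by (intro integrable_mult_right rho_integrable)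
    fix x
    have "(cutoff x0 R x)\<^sup>2 \<le> 1 * rho x0 x"
      unfolding power2_eq_square using cutoff_bounds(1-3)[of x0 R x] by (intro mult_mono) auto
    then have "(cutoff x0 R x)\<^sup>2 * C \<le> rho x0 x * C" using assms(3) by (intro mult_right_mono) auto
    moreover have "(cutoff x0 R x)\<^sup>2 * k x \<le> (cutoff x0 R x)\<^sup>2 * C" by (intro mult_left_mono assms) auto
    ultimately show "(cutoff x0 R x)\<^sup>2 * k x \<le> C * rho x0 x" by (simp add: mult.commute)
  qed
  then show ?thesis by (simp add: rho_integrable)
qed

text \<open>The bound of the drift influences only the constant \<open>c\<close>, hence
  \<open>W\<close> and the starting time \<open>t1\<close>. Enlarging the radius of the weight
  removes the former, starting early enough the latter, and neither is visible in the
  conclusion.\<close>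

lemma gradient_bound:
  fixes b :: "real \<times> 'a::euclidean_space \<Rightarrow> 'a" and x0 :: 'a
  assumes sol: "parabolic b (\<lambda>t x. 0) s u ut w H" and form: "form_inequality T b \<delta> g"
    and bc: "continuous_on UNIV b" and bB: "\<And>z. norm (b z) \<le> Bb"
    and \<delta>: "0 < \<delta>" and q: "2 < q" "sqrt \<delta> * q / 2 < 1"
    and s: "0 \<le> s" and g: "set_integrable lborel {0..T} g" "\<And>t. 0 \<le> g t"
    and M: "\<And>t x. s \<le> t \<Longrightarrow> t \<le> T \<Longrightarrow> \<bar>u t x\<bar> \<le> M"
    and L: "\<And>x y. \<bar>u s x - u s y\<bar> \<le> L * norm (x - y)" "L > 0"
    and n: "8 * q * gr_rate \<delta> q (real DIM('a)) * T + q * gr_gain \<delta> q (real DIM('a)) * integral {0..T} g \<le> real n / 2"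
    and t: "s < t" "t \<le> T"
  shows "(LINT x|lborel. (cutoff x0 R x)\<^sup>2 * (1 + w t x \<bullet> w t x) powr (q / 2))
    \<le> 2 ^ n * ((1 + 16 * L\<^sup>2) powr (q / 2) * rho_mass TYPE('a) + 3)"
proof -
  interpret parabolic b "\<lambda>t x. 0" s u ut w H by (rule sol)
  have \<delta>1: "\<delta> < 1"
  proof -
    have "sqrt \<delta> * 1 \<le> sqrt \<delta> * (q / 2)" using q \<delta> by (intro mult_left_mono) auto
    then have "sqrt \<delta> < 1" using q(2) by linarith
    then show ?thesis by simp
  qed
  have gf: "gradient_form b s u ut w H T \<delta> g q"
    by (intro gradient_form.intro gradient_form_axioms.intro parabolic_form.intro parabolic_form_axioms.intro sol
        form bc \<delta> \<delta>1 s g q continuous_intros) simp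
  obtain c where c: "\<And>t x. s < t \<Longrightarrow> t \<le> T \<Longrightarrow> norm (w t x) \<le> 2 * L * exp (c * (t - s))"
    using gradient_bound_near_initial_time[where B = Bb and T = T and M = M and L = L] bB M L by blast
  define W where "W = (1 + (2 * L * exp (\<bar>c\<bar> * T))\<^sup>2) powr (q / 2)"
  define X where "X = \<bar>8 * q * gr_rate \<delta> q (real DIM('a)) * T * W * rho_mass TYPE('a)\<bar>"
  \<comment> \<open>The weighted integral increases with the radius, and beyond \<open>X\<close> the
    truncation error is at most 1.\<close>
  define R' where "R' = max R X"
  \<comment> \<open>So close to \<open>s\<close> that exp (c (t1 - s)) \<le> exp (1 / 2) \<le> 2,
    hence the gradient at \<open>t1\<close> is at most 4 L. The 1 added to the absolute value of
    \<open>c\<close> avoids division by zero.\<close>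
  define t1 where "t1 = min t (s + 1 / (2 * (\<bar>c\<bar> + 1)))"
  have t1: "s < t1" "t1 \<le> t" using t by (auto simp: t1_def)
  have W: "(1 + w t x \<bullet> w t x) powr (q / 2) \<le> W" if "s < t" "t \<le> T" for t x
  proof -
    have "c * (t - s) \<le> \<bar>c\<bar> * T"
      using that s by (intro mult_mono) auto
    then have "2 * L * exp (c * (t - s)) \<le> 2 * L * exp (\<bar>c\<bar> * T)" using L by simp
    then have "(norm (w t x))\<^sup>2 \<le> (2 * L * exp (\<bar>c\<bar> * T))\<^sup>2" using c[OF that, of x] by (intro power_mono) auto
    then show ?thesis unfolding W_def using q by (intro powr_mono2) (auto simp: power2_norm_eq_inner add_nonneg_nonneg)
  qed
  have w1: "(1 + w t1 x \<bullet> w t1 x) powr (q / 2) \<le> (1 + 16 * L\<^sup>2) powr (q / 2)" for x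
  proof -
    have "c * (t1 - s) \<le> (\<bar>c\<bar> + 1) * (1 / (2 * (\<bar>c\<bar> + 1)))"
      using t1 by (intro mult_mono) (auto simp: t1_def)
    also have "\<dots> = 1 / 2" by (simp add: field_simps)
    finally have "exp (c * (t1 - s)) \<le> exp (1 / 2)" by simp
    also have "\<dots> \<le> 2"
    proof (rule power2_le_imp_le)
      have "(exp (1 / 2 :: real))\<^sup>2 = exp 1" by (simp add: power2_eq_square flip: exp_add)
      also have "\<dots> \<le> 2\<^sup>2" using exp_le by simp
      finally show "(exp (1 / 2 :: real))\<^sup>2 \<le> 2\<^sup>2" .
    qed simp
    finally have "2 * L * exp (c * (t1 - s)) \<le> 4 * L" using L by simp
    then have "norm (w t1 x) \<le> 4 * L" using c[of t1 x] t1 t by linarith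
    then have "(norm (w t1 x))\<^sup>2 \<le> (4 * L)\<^sup>2" by (intro power_mono) auto
    then show ?thesis using q by (intro powr_mono2) (auto simp: power2_norm_eq_inner power_mult_distrib add_nonneg_nonneg)
  qed
  have pos: "0 < 1 + w t x \<bullet> w t x" for t x by (simp add: add_pos_nonneg)
  have cw: "continuous_on UNIV (\<lambda>x. (1 + w t x \<bullet> w t x) powr (q / 2))" if "s < t" for t
    by (intro continuous_intros cont_slice that) (use pos in \<open>auto dest: less_imp_neq[THEN not_sym]\<close>)
  have "(LINT x|lborel. (cutoff x0 R x)\<^sup>2 * (1 + w t x \<bullet> w t x) powr (q / 2))
     \<le> (LINT x|lborel. (cutoff x0 R' x)\<^sup>2 * (1 + w t x \<bullet> w t x) powr (q / 2))"
    by (rule LINT_cutoff_mono[OF cw[OF t(1)]]) (auto simp: R'_def)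
  also have "\<dots> \<le> 2 ^ n * ((LINT x|lborel. (cutoff x0 R' x)\<^sup>2 * (1 + w t1 x \<bullet> w t1 x) powr (q / 2))
      + 3 * (8 * q * gr_rate \<delta> q (real DIM('a)) * T * W * exp (- 2 * R') * rho_mass TYPE('a)))"
    using gradient_form.gradient_growth[OF gf, of W t1 t n x0 R'] W t1 t n
    unfolding gradient_form.E3_def[OF gf] gradient_form.\<Psi>_def[OF gf] gradient_form.N_def[OF gf] by simp
  also have "\<dots> \<le> 2 ^ n * ((1 + 16 * L\<^sup>2) powr (q / 2) * rho_mass TYPE('a) + 3)"
  proof (intro mult_left_mono add_mono)
    show "(LINT x|lborel. (cutoff x0 R' x)\<^sup>2 * (1 + w t1 x \<bullet> w t1 x) powr (q / 2)) \<le> (1 + 16 * L\<^sup>2) powr (q / 2) * rho_mass TYPE('a)"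
      by (rule LINT_cutoff_le[OF cw[OF t1(1)] w1]) simp
    have "8 * q * gr_rate \<delta> q (real DIM('a)) * T * W * exp (- 2 * R') * rho_mass TYPE('a)
        = (8 * q * gr_rate \<delta> q (real DIM('a)) * T * W * rho_mass TYPE('a)) * exp (- 2 * R')" by (simp only: mult_ac)
    also have "\<dots> \<le> X * exp (- 2 * R')" by (intro mult_right_mono) (auto simp: X_def)
    also have "\<dots> \<le> 1" by (rule exp_error_le_1) (auto simp: R'_def X_def)
    finally show "3 * (8 * q * gr_rate \<delta> q (real DIM('a)) * T * W * exp (- 2 * R') * rho_mass TYPE('a)) \<le> 3" by linarith
  qed simp
  finally show ?thesis .
qed

text \<open>The truncation error of \<open>L2_growth\<close> is a constant times exp (- 2 R).
  Raising the radius makes it smaller than any given number, so it vanishes from the bound together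
  with \<open>M\<close>.\<close>

lemma L2_bound:
  fixes b :: "real \<times> 'a::euclidean_space \<Rightarrow> 'a" and x0 :: 'a
  assumes sol: "parabolic b (\<lambda>t x. 0) s u ut w H" and form: "form_inequality T b \<delta> g"
    and bc: "continuous_on UNIV b" and \<delta>: "0 < \<delta>" "\<delta> < 1"
    and s: "0 \<le> s" and g: "set_integrable lborel {0..T} g" "\<And>t. 0 \<le> g t"
    and M: "\<And>t x. s \<le> t \<Longrightarrow> t \<le> T \<Longrightarrow> \<bar>u t x\<bar> \<le> M"
    and F: "\<And>R. (LINT x|lborel. (cutoff x0 R x * u s x)\<^sup>2) \<le> F"
    and n: "8 * L2_rate (sqrt \<delta>) * T + integral {0..T} g / sqrt \<delta> \<le> real n / 2"
    and t: "s \<le> t" "t \<le> T"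
  shows "(LINT x|lborel. (cutoff x0 R x * u t x)\<^sup>2) \<le> 2 ^ n * F"
proof (rule field_le_epsilon)
  fix \<epsilon> :: real assume \<epsilon>: "\<epsilon> > 0"
  interpret parabolic b "\<lambda>t x. 0" s u ut w H by (rule sol)
  have pf: "parabolic_form b (\<lambda>t x. 0) s u ut w H T \<delta> g"
    by (intro parabolic_form.intro parabolic_form_axioms.intro sol form bc \<delta> s g continuous_intros) simp
  define C where "C = 3 * 2 ^ n * (8 * L2_rate (sqrt \<delta>) * T * M\<^sup>2 * rho_mass TYPE('a))"
  define X where "X = \<bar>C\<bar> / \<epsilon>"
  define R' where "R' = max R X"
  have uc: "continuous_on UNIV (u t)"
  proof -
    have "continuous_on ({t} \<times> UNIV) (\<lambda>p. u (fst p) (snd p))" by (rule u_cont_on) (use t in auto)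
    then show ?thesis by (rule continuous_on_slice)
  qed
  have "(LINT x|lborel. (cutoff x0 R x * u t x)\<^sup>2) \<le> (LINT x|lborel. (cutoff x0 R' x * u t x)\<^sup>2)"
    unfolding power_mult_distrib by (rule LINT_cutoff_mono) (auto simp: R'_def intro!: continuous_intros uc)
  also have "\<dots> \<le> 2 ^ n * ((LINT x|lborel. (cutoff x0 R' x * u s x)\<^sup>2)
     + 3 * (8 * L2_rate (sqrt \<delta>) * T * M\<^sup>2 * exp (- 2 * R') * rho_mass TYPE('a) + 0))"
    using parabolic_form.L2_growth[OF pf M _ _ n t, where \<sigma> = 0 and ?x0.0 = x0 and R = R']
    unfolding parabolic_form.E2_def[OF pf] by (simp add: spacetime_integral_def)
  also have "\<dots> = 2 ^ n * (LINT x|lborel. (cutoff x0 R' x * u s x)\<^sup>2) + C * exp (- 2 * R')"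
    by (simp add: C_def algebra_simps)
  also have "\<dots> \<le> 2 ^ n * F + \<epsilon>"
  proof (intro add_mono mult_left_mono F)
    have "C * exp (- 2 * R') \<le> (\<epsilon> * X) * exp (- 2 * R')" using \<epsilon> by (intro mult_right_mono) (auto simp: X_def)
    also have "\<dots> = \<epsilon> * (X * exp (- 2 * R'))" by simp
    also have "\<dots> \<le> \<epsilon> * 1" using \<epsilon> by (intro mult_left_mono exp_error_le_1) (auto simp: R'_def X_def)
    finally show "C * exp (- 2 * R') \<le> \<epsilon>" by simp
  qed simp
  finally show "(LINT x|lborel. (cutoff x0 R x * u t x)\<^sup>2) \<le> 2 ^ n * F + \<epsilon>" .
qed

text \<open>Points of the support have distance at least norm x0 - r from the centre
  \<open>x0\<close>, so a datum seen from a remote centre is exponentially small.\<close>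

lemma LINT_cutoff_compact_support:
  fixes f :: "'a::euclidean_space \<Rightarrow> real"
  assumes f: "continuous_on UNIV f" "\<And>x. \<bar>f x\<bar> \<le> M" "\<And>x. r < norm x \<Longrightarrow> f x = 0"
  shows "(LINT x|lborel. (cutoff x0 R x * f x)\<^sup>2) \<le> M\<^sup>2 * exp (- 2 * (norm x0 - r)) * measure lborel (cball (0::'a) r)"
proof -
  have fin: "emeasure lborel (cball (0::'a) r) < \<infinity>" using emeasure_bounded_finite[OF bounded_cball[of "0::'a" r]] by simp
  have "(LINT x|lborel. (cutoff x0 R x * f x)\<^sup>2) \<le> (LINT x::'a|lborel. (M\<^sup>2 * exp (- 2 * (norm x0 - r))) * indicator (cball 0 r) x)"
  proof (rule integral_mono)
    show "integrable lborel (\<lambda>x. (cutoff x0 R x * f x)\<^sup>2)"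
      by (rule integrable_bounded_support[where R = r]) (auto simp: f(3) intro!: continuous_intros f(1))
    show "integrable lborel (\<lambda>x. (M\<^sup>2 * exp (- 2 * (norm x0 - r))) * indicator (cball (0::'a) r) x)"
      by (intro integrable_mult_right integrable_real_indicator fin) simp
    fix x :: 'a
    show "(cutoff x0 R x * f x)\<^sup>2 \<le> (M\<^sup>2 * exp (- 2 * (norm x0 - r))) * indicator (cball 0 r) x"
    proof (cases "norm x \<le> r")
      case True
      have "(cutoff x0 R x)\<^sup>2 \<le> 1 * rho x0 x"
        unfolding power2_eq_square using cutoff_bounds(1-3)[of x0 R x] by (intro mult_mono) auto
      also have "\<dots> \<le> exp (- 2 * (norm x0 - r))"
        using japanese_ge(2)[of "x - x0"] norm_triangle_ineq2[of x0 x] True by (simp add: rho_def norm_minus_commute)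
      finally have "(cutoff x0 R x)\<^sup>2 * (f x)\<^sup>2 \<le> exp (- 2 * (norm x0 - r)) * M\<^sup>2"
        using f(2)[of x] by (intro mult_mono) (auto simp: abs_le_square_iff[symmetric])
      then show ?thesis using True by (simp add: power_mult_distrib mult.commute)
    next
      case False
      then show ?thesis using f(3)[of x] by simp
    qed
  qed
  then show ?thesis by simp
qed

lemma spacetime_integral_nn_integral:
  fixes f :: "real \<Rightarrow> 'a::euclidean_space \<Rightarrow> real"
  assumes f: "cont_supported {t1..t2} r f" "\<And>t x. 0 \<le> f t x"
  shows "ennreal (spacetime_integral t1 t2 f) = (\<integral>\<^sup>+p. ennreal (f (fst p) (snd p)) * indicator ({t1..t2} \<times> UNIV) p \<partial>lborel)"
proof -
  have c: "continuous_on {t1..t2} (\<lambda>t. LINT x|lborel. f t x)" by (rule cont_supported_continuous_LINT[OF f(1)])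
  have si: "set_integrable lborel {t1..t2} (\<lambda>t. LINT x|lborel. f t x)"
    unfolding set_integrable_def by (rule borel_integrable_compact[OF _ c]) simp
  have pos: "0 \<le> (LINT x|lborel. f t x)" for t by (rule integral_nonneg_AE) (simp add: f(2))
  have "closed ({t1..t2} \<times> (UNIV :: 'a set))" by (intro closed_Times) auto
  then have m: "(\<lambda>p. indicator ({t1..t2} \<times> UNIV) p *\<^sub>R f (fst p) (snd p)) \<in> borel_measurable borel"
    using f(1) by (intro borel_measurable_continuous_on_indicator) (auto simp: cont_supported_def split_def)
  have "ennreal (spacetime_integral t1 t2 f) = ennreal (LINT t:{t1..t2}|lborel. LINT x|lborel. f t x)"
    unfolding spacetime_integral_def using set_borel_integral_eq_integral(2)[OF si] by simp
  also have "\<dots> = (\<integral>\<^sup>+t. ennreal (indicator {t1..t2} t *\<^sub>R (LINT x|lborel. f t x)) \<partial>lborel)"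
    unfolding set_lebesgue_integral_def
    by (rule nn_integral_eq_integral[symmetric]) (use si pos in \<open>auto simp: set_integrable_def\<close>)
  also have "\<dots> = (\<integral>\<^sup>+t. (\<integral>\<^sup>+x. ennreal (indicator ({t1..t2} \<times> UNIV) (t, x) *\<^sub>R f t x) \<partial>lborel) \<partial>lborel)"
  proof (rule nn_integral_cong)
    fix t
    show "ennreal (indicator {t1..t2} t *\<^sub>R (LINT x|lborel. f t x)) = (\<integral>\<^sup>+x. ennreal (indicator ({t1..t2} \<times> UNIV) (t, x) *\<^sub>R f t x) \<partial>lborel)"
      using nn_integral_eq_integral[OF cont_supported_integrable[OF f(1), of t]] f(2) by (cases "t \<in> {t1..t2}") (auto simp: indicator_def)
  qed
  also have "\<dots> = (\<integral>\<^sup>+p. ennreal (indicator ({t1..t2} \<times> UNIV) p *\<^sub>R f (fst p) (snd p)) \<partial>lborel)"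
    using nn_integral_lborel_fst(1)[of "\<lambda>p. ennreal (indicator ({t1..t2} \<times> UNIV) p *\<^sub>R f (fst p) (snd p))"] m by simp
  also have "\<dots> = (\<integral>\<^sup>+p. ennreal (f (fst p) (snd p)) * indicator ({t1..t2} \<times> UNIV) p \<partial>lborel)"
    by (intro nn_integral_cong) (simp add: indicator_def)
  finally show ?thesis .
qed

lemma parabolic_diff:
  assumes "parabolic b (\<lambda>t x. 0) s u ut w H" "parabolic c (\<lambda>t x. 0) s v vt z J"
  shows "parabolic b (\<lambda>t x. - ((b (t, x) - c (t, x)) \<bullet> z t x)) s (\<lambda>t x. u t x - v t x) (\<lambda>t x. ut t x - vt t x)
    (\<lambda>t x. w t x - z t x) (\<lambda>t x y. H t x y - J t x y)"
proof -
  interpret p: parabolic b "\<lambda>t x. 0" s u ut w H by fact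
  interpret q: parabolic c "\<lambda>t x. 0" s v vt z J by fact
  show ?thesis
  proof
    show "((\<lambda>r. u r x - v r x) has_real_derivative ut t x - vt t x) (at t)" if "s < t" for t x
      by (intro DERIV_diff p.u_t q.u_t that)
    show "((\<lambda>x. u t x - v t x) has_derivative (\<lambda>y. (w t x - z t x) \<bullet> y)) (at x)" if "s < t" for t x
      using has_derivative_diff[OF p.u_x[OF that] q.u_x[OF that]] by (simp add: inner_simps)
    show "((\<lambda>x. w t x - z t x) has_derivative (\<lambda>y. H t x y - J t x y)) (at x)" if "s < t" for t x
      by (intro has_derivative_diff p.w_x q.w_x that)
    show "ut t x - vt t x = (\<Sum>i\<in>Basis. (H t x i - J t x i) \<bullet> i) - b (t, x) \<bullet> (w t x - z t x) + - ((b (t, x) - c (t, x)) \<bullet> z t x)"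
      if "s < t" for t x
      using p.eq[OF that, of x] q.eq[OF that, of x] by (simp add: inner_simps sum_subtractf)
  qed (use p.u_cont q.u_cont p.ut_cont q.ut_cont p.w_cont q.w_cont p.H_cont q.H_cont in
      \<open>auto simp: split_def intro!: continuous_intros\<close>)
qed

lemma gr_gain_nonneg: "0 \<le> gr_gain \<delta> q d" if "1 \<le> q" "0 \<le> \<delta>" "sqrt \<delta> * q / 2 < 1" "0 \<le> d"
proof -
  have "0 \<le> sqrt \<delta> * q / 2" using that by simp
  then have "0 < gr_beta \<delta> q" unfolding gr_beta_def by (intro divide_pos_pos add_pos_nonneg) simp_all
  moreover have "gr_beta \<delta> q < 1" using that by (simp add: gr_beta_def)
  ultimately show ?thesis unfolding gr_gain_def gr_eta_def using that by (intro add_nonneg_nonneg divide_nonneg_nonneg) auto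
qed

text \<open>The threshold \<open>B\<close> precedes the function and the point. First
  \<open>r\<close> makes the gradient contribution less than \<epsilon> / 3, then \<kappa> =
  \<epsilon> / 3, and \<open>B\<close> is what the remaining third permits.\<close>

lemma small_of_small_L2:
  fixes K \<alpha> \<epsilon> :: real
  assumes \<alpha>: "0 < \<alpha>" "\<alpha> < 1" and \<epsilon>: "0 < \<epsilon>"
  obtains B where "0 < B" "\<And>(h :: 'a::euclidean_space \<Rightarrow> real) G x0. (\<And>x. (h has_derivative (\<lambda>v. G x \<bullet> v)) (at x)) \<Longrightarrow>
    continuous_on UNIV G \<Longrightarrow>
    (\<And>\<rho>. 0 < \<rho> \<Longrightarrow> \<rho> \<le> 1 \<Longrightarrow> integral unit_cube (\<lambda>y. norm (G (x0 + \<rho> *\<^sub>R y))) \<le> K * \<rho> powr (- \<alpha>)) \<Longrightarrow>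
    (LINT x|lborel. (cutoff x0 (2 + sqrt (real DIM('a))) x * h x)\<^sup>2) \<le> B \<Longrightarrow> \<bar>h x0\<bar> \<le> \<epsilon>"
proof -
  define D where "D = sqrt (real DIM('a)) * K / (1 - \<alpha>)"
  have "((\<lambda>r. D * r powr (1 - \<alpha>)) \<longlongrightarrow> D * 0 powr (1 - \<alpha>)) (at_right 0)"
    by (intro tendsto_intros) (use \<alpha> in \<open>auto simp: eventually_at_right_less[THEN eventually_mono]\<close>)
  then have "\<forall>\<^sub>F r in at_right 0. D * r powr (1 - \<alpha>) < \<epsilon> / 3 \<and> r \<in> {0<..<1}"
    using \<epsilon> by (intro eventually_conj order_tendstoD(2) eventually_at_right_real) auto
  then obtain r where r: "D * r powr (1 - \<alpha>) < \<epsilon> / 3" "0 < r" "r < 1"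
    by (auto dest!: eventually_happens simp: trivial_limit_at_right_real)
  define B where "B = \<epsilon> / 3 * (\<epsilon> / 3 * cube_weight TYPE('a) * r ^ DIM('a))"
  have p: "0 < \<epsilon> / 3 * cube_weight TYPE('a) * r ^ DIM('a)" using \<epsilon> r by (intro mult_pos_pos zero_less_power) auto
  show thesis
  proof (rule that)
    show "0 < B" unfolding B_def using \<epsilon> by (intro mult_pos_pos[OF _ p]) auto
    fix h :: "'a \<Rightarrow> real" and G x0
    assume h: "\<And>x. (h has_derivative (\<lambda>v. G x \<bullet> v)) (at x)" "continuous_on UNIV G"
      "\<And>\<rho>. 0 < \<rho> \<Longrightarrow> \<rho> \<le> 1 \<Longrightarrow> integral unit_cube (\<lambda>y. norm (G (x0 + \<rho> *\<^sub>R y))) \<le> K * \<rho> powr (- \<alpha>)"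
      "(LINT x|lborel. (cutoff x0 (2 + sqrt (real DIM('a))) x * h x)\<^sup>2) \<le> B"
    have "2 ^ DIM('a) * \<bar>h x0\<bar> \<le> 2 ^ DIM('a) * (\<epsilon> / 3) + B / (\<epsilon> / 3 * cube_weight TYPE('a) * r ^ DIM('a)) + D * r powr (1 - \<alpha>)"
      unfolding D_def by (rule pointwise_bound[OF h(1,2) \<alpha> _ _ _ h(3) _ h(4)]) (use r \<epsilon> in auto)
    also have "B / (\<epsilon> / 3 * cube_weight TYPE('a) * r ^ DIM('a)) = \<epsilon> / 3" using p less_imp_neq[OF p] unfolding B_def by (simp del: mult_eq_0_iff power_eq_0_iff)
    finally have "2 ^ DIM('a) * \<bar>h x0\<bar> \<le> 2 ^ DIM('a) * (\<epsilon> / 3) + 2 * (\<epsilon> / 3)" using r by linarith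
    moreover have "1 * (2 * (\<epsilon> / 3)) \<le> 2 ^ DIM('a) * (2 * (\<epsilon> / 3))" using \<epsilon> by (intro mult_right_mono) auto
    ultimately have "2 ^ DIM('a) * \<bar>h x0\<bar> \<le> 2 ^ DIM('a) * \<epsilon>" by linarith
    then show "\<bar>h x0\<bar> \<le> \<epsilon>" by simp
  qed
qed

text \<open>One time horizon and one datum are fixed. All constants are obtained from these
  parameters before an index, an initial time or a solution is named.\<close>

locale approximation =
  fixes \<delta> q T cg :: real and bn :: "nat \<Rightarrow> real \<times> 'a::euclidean_space \<Rightarrow> 'a" and gn :: "nat \<Rightarrow> real \<Rightarrow> real"
    and b :: "real \<times> 'a \<Rightarrow> 'a" and f :: "'a \<Rightarrow> real" and M L r :: real
  assumes T: "0 < T" and \<delta>: "0 < \<delta>" and q: "2 < q" "real DIM('a) < q" "sqrt \<delta> * q / 2 < 1"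
    and bn_form: "\<And>n. form_inequality T (bn n) \<delta> (gn n)" and bn_cont: "\<And>n. continuous_on UNIV (bn n)"
    and bn_bounded: "\<And>n. bounded (range (bn n))"
    and gn: "\<And>n. set_integrable lborel {0..T} (gn n)" "\<And>n t. 0 \<le> gn n t" "\<And>n. integral {0..T} (gn n) \<le> cg"
    and b_meas: "b \<in> borel_measurable borel"
    and bn_lim: "\<And>R. (\<lambda>n. \<integral>\<^sup>+z\<in>{0..T} \<times> cball 0 R. ennreal ((norm (bn n z - b z))\<^sup>2) \<partial>lborel) \<longlonglongrightarrow> 0"
    and f_lipschitz: "\<And>x y. \<bar>f x - f y\<bar> \<le> L * norm (x - y)" "0 < L"
    and f_support: "\<And>x. r < norm x \<Longrightarrow> f x = 0" and f_bound: "\<And>x. \<bar>f x\<bar> \<le> M"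
begin

text \<open>The gradient \<open>w\<close> is exposed because the estimates speak of it; the other
  derivatives stay hidden. For the operators the bound by \<open>M\<close> comes from
  contractivity.\<close>

definition solves :: "nat \<Rightarrow> real \<Rightarrow> (real \<Rightarrow> 'a \<Rightarrow> real) \<Rightarrow> (real \<Rightarrow> 'a \<Rightarrow> 'a) \<Rightarrow> bool"
  where "solves n s u w \<longleftrightarrow> 0 \<le> s \<and> (\<exists>ut H. parabolic (bn n) (\<lambda>t x. 0) s u ut w H) \<and> u s = f \<and>
    (\<forall>t x. s \<le> t \<longrightarrow> \<bar>u t x\<bar> \<le> M)"

lemma \<delta>_less_1: "\<delta> < 1"
proof -
  have "sqrt \<delta> * 1 \<le> sqrt \<delta> * (q / 2)" using q \<delta> by (intro mult_left_mono) auto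
  then have "sqrt \<delta> < 1" using q(3) by linarith
  then show ?thesis by simp
qed

lemma f_cont: "continuous_on UNIV f"
  by (rule lipschitz_on_continuous_on[OF lipschitz_onI]) (use f_lipschitz in \<open>auto simp: dist_norm\<close>)

lemma M_nonneg: "0 \<le> M" using f_bound[of 0] by linarith

lemma gradient_bound_uniform:
  obtains Bg where "0 \<le> Bg" "\<And>n s u w t x0 R. solves n s u w \<Longrightarrow> s < t \<Longrightarrow> t \<le> T \<Longrightarrow>
    (LINT x|lborel. (cutoff x0 R x)\<^sup>2 * (1 + w t x \<bullet> w t x) powr (q / 2)) \<le> Bg"
proof -
  obtain N where N: "8 * q * gr_rate \<delta> q (real DIM('a)) * T + q * gr_gain \<delta> q (real DIM('a)) * cg \<le> real N / 2"
    using real_arch_simple[of "2 * (8 * q * gr_rate \<delta> q (real DIM('a)) * T + q * gr_gain \<delta> q (real DIM('a)) * cg)"]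
    by (auto simp: mult.commute)
  show thesis
  proof (rule that)
    show "0 \<le> 2 ^ N * ((1 + 16 * L\<^sup>2) powr (q / 2) * rho_mass TYPE('a) + 3)"
      using rho_mass_nonneg[where 'a='a] by (intro mult_nonneg_nonneg add_nonneg_nonneg) auto
    fix n s u w t x0 R
    assume u: "solves n s u w" "s < t" "t \<le> T"
    obtain ut H where p: "parabolic (bn n) (\<lambda>t x. 0) s u ut w H" using u by (auto simp: solves_def)
    obtain Bb where Bb: "\<And>z. norm (bn n z) \<le> Bb" using bn_bounded[of n] by (auto simp: bounded_iff)
    have "q * gr_gain \<delta> q (real DIM('a)) * integral {0..T} (gn n) \<le> q * gr_gain \<delta> q (real DIM('a)) * cg"
      using q \<delta> gn(3) by (intro mult_left_mono mult_nonneg_nonneg gr_gain_nonneg) auto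
    then have n: "8 * q * gr_rate \<delta> q (real DIM('a)) * T + q * gr_gain \<delta> q (real DIM('a)) * integral {0..T} (gn n) \<le> real N / 2"
      using N by linarith
    show "(LINT x|lborel. (cutoff x0 R x)\<^sup>2 * (1 + w t x \<bullet> w t x) powr (q / 2)) \<le> 2 ^ N * ((1 + 16 * L\<^sup>2) powr (q / 2) * rho_mass TYPE('a) + 3)"
    proof (rule gradient_bound[OF p bn_form bn_cont Bb \<delta> q(1,3) _ gn(1,2) _ _ _ n])
      show "\<bar>u s x - u s y\<bar> \<le> L * norm (x - y)" for x y using u f_lipschitz by (simp add: solves_def)
    qed (use u f_lipschitz in \<open>auto simp: solves_def\<close>)
  qed
qed

lemma solves_slice:
  assumes "solves n s u w" "s < t"
  shows "(u t has_derivative (\<lambda>v. w t x \<bullet> v)) (at x)" "continuous_on UNIV (w t)"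
proof -
  obtain ut H where "parabolic (bn n) (\<lambda>t x. 0) s u ut w H" using assms by (auto simp: solves_def)
  then interpret parabolic "bn n" "\<lambda>t x. 0" s u ut w H .
  show "(u t has_derivative (\<lambda>v. w t x \<bullet> v)) (at x)" by (rule u_x[OF assms(2)])
  show "continuous_on UNIV (w t)" by (rule has_derivative_continuous_on_UNIV[OF w_x[OF assms(2)]])
qed

lemma L2_steps:
  obtains N where "\<And>n. 8 * L2_rate (sqrt \<delta>) * T + integral {0..T} (gn n) / sqrt \<delta> \<le> real N / 2"
proof -
  obtain N where N: "8 * L2_rate (sqrt \<delta>) * T + cg / sqrt \<delta> \<le> real N / 2"
    using real_arch_simple[of "2 * (8 * L2_rate (sqrt \<delta>) * T + cg / sqrt \<delta>)"] by (auto simp: mult.commute)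
  show thesis
  proof (rule that)
    fix n
    have "integral {0..T} (gn n) / sqrt \<delta> \<le> cg / sqrt \<delta>" using gn(3) \<delta> by (intro divide_right_mono) auto
    then show "8 * L2_rate (sqrt \<delta>) * T + integral {0..T} (gn n) / sqrt \<delta> \<le> real N / 2" using N by linarith
  qed
qed

lemma exponent: "0 < real DIM('a) / q" "real DIM('a) / q < 1"
  using q by auto

lemma uniform_tails:
  assumes \<epsilon>: "0 < \<epsilon>"
  obtains \<rho> where "\<And>n s u w t x. solves n s u w \<Longrightarrow> s \<le> t \<Longrightarrow> t \<le> T \<Longrightarrow> \<rho> \<le> norm x \<Longrightarrow> \<bar>u t x\<bar> \<le> \<epsilon>"
proof -
  obtain Bg where Bg: "0 \<le> Bg" "\<And>n s u w t x0 R. solves n s u w \<Longrightarrow> s < t \<Longrightarrow> t \<le> T \<Longrightarrow>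
      (LINT x|lborel. (cutoff x0 R x)\<^sup>2 * (1 + w t x \<bullet> w t x) powr (q / 2)) \<le> Bg"
    using gradient_bound_uniform by blast
  obtain N where N: "\<And>n. 8 * L2_rate (sqrt \<delta>) * T + integral {0..T} (gn n) / sqrt \<delta> \<le> real N / 2"
    using L2_steps by blast
  define K where "K = Bg / cube_weight TYPE('a) + 2 ^ DIM('a)"
  obtain B where B: "0 < B" "\<And>(h :: 'a \<Rightarrow> real) G x0. (\<And>x. (h has_derivative (\<lambda>v. G x \<bullet> v)) (at x)) \<Longrightarrow>
    continuous_on UNIV G \<Longrightarrow>
    (\<And>\<rho>. 0 < \<rho> \<Longrightarrow> \<rho> \<le> 1 \<Longrightarrow> integral unit_cube (\<lambda>y. norm (G (x0 + \<rho> *\<^sub>R y))) \<le> K * \<rho> powr (- (real DIM('a) / q))) \<Longrightarrow>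
    (LINT x|lborel. (cutoff x0 (2 + sqrt (real DIM('a))) x * h x)\<^sup>2) \<le> B \<Longrightarrow> \<bar>h x0\<bar> \<le> \<epsilon>"
    using small_of_small_L2[OF exponent \<epsilon>] by blast
  define C where "C = 2 ^ N * (M\<^sup>2 * measure lborel (cball (0::'a) r))"
  \<comment> \<open>The first entry puts \<open>x\<close> outside the support of the datum, the
    second makes C / B \<le> norm x - r, so that \<open>exp_error_le_1\<close> applies.\<close>
  define \<rho> where "\<rho> = max (r + 1) (r + C / B)"
  show thesis
  proof (rule that)
    fix n s u w t and x :: 'a
    assume u: "solves n s u w" "s \<le> t" "t \<le> T" and x: "\<rho> \<le> norm x"
    show "\<bar>u t x\<bar> \<le> \<epsilon>"
    proof (cases "t = s")
      case True
      then show ?thesis using u x \<epsilon> f_support[of x] by (simp add: solves_def \<rho>_def)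
    next
      case False
      then have st: "s < t" using u by simp
      obtain ut H where p: "parabolic (bn n) (\<lambda>t x. 0) s u ut w H" using u by (auto simp: solves_def)
      show ?thesis
      proof (rule B(2)[OF solves_slice[OF u(1) st]])
        show "integral unit_cube (\<lambda>y. norm (w t (x + \<rho> *\<^sub>R y))) \<le> K * \<rho> powr (- (real DIM('a) / q))" if "0 < \<rho>" "\<rho> \<le> 1" for \<rho>
          unfolding K_def
          by (rule gradient_integral_unit_cube[OF solves_slice(2)[OF u(1) st] _ that order_refl Bg(2)[OF u(1) st u(3)]]) (use q in simp)
        have "(LINT y|lborel. (cutoff x R y * u t y)\<^sup>2) \<le> 2 ^ N * (M\<^sup>2 * exp (- 2 * (norm x - r)) * measure lborel (cball (0::'a) r))" for R
        proof (rule L2_bound[OF p bn_form bn_cont \<delta> \<delta>_less_1 _ gn(1,2) _ _ N u(2,3)])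
          show "(LINT y|lborel. (cutoff x R y * u s y)\<^sup>2) \<le> M\<^sup>2 * exp (- 2 * (norm x - r)) * measure lborel (cball (0::'a) r)" for R
          proof -
            have "u s = f" using u by (simp add: solves_def)
            then show ?thesis using LINT_cutoff_compact_support[OF f_cont f_bound f_support] by simp
          qed
        qed (use u in \<open>auto simp: solves_def\<close>)
        also have "2 ^ N * (M\<^sup>2 * exp (- 2 * (norm x - r)) * measure lborel (cball (0::'a) r)) = C * exp (- 2 * (norm x - r))"
          by (simp add: C_def mult_ac)
        also have "C * exp (- 2 * (norm x - r)) = B * (C / B * exp (- 2 * (norm x - r)))" using B(1) by simp
        also have "\<dots> \<le> B * 1"
          using B(1) x by (intro mult_left_mono exp_error_le_1) (auto simp: \<rho>_def C_def)
        finally show "(LINT y|lborel. (cutoff x (2 + sqrt (real DIM('a))) y * u t y)\<^sup>2) \<le> B" by simp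
      qed
    qed
  qed
qed

end

text \<open>First the Young weight \<open>k\<close> makes the part with \<open>C\<close> small; the
  tolerance \<eta> for the drifts may then depend on \<open>k\<close>.\<close>

lemma real_small_parameters:
  fixes Q C B :: real
  assumes "0 \<le> Q" "0 \<le> C" "0 < B"
  obtains k \<eta> where "0 < k" "0 < \<eta>" "Q * (k * C + 4 * \<eta> / k) \<le> B"
proof
  define k where "k = B / (2 * (Q * C + 1))"
  define \<eta> where "\<eta> = B * k / (8 * (Q + 1))"
  have p: "0 < 2 * (Q * C + 1)" "0 < 8 * (Q + 1)" using assms by (auto intro: add_nonneg_pos)
  show k: "0 < k" unfolding k_def using p assms by (intro divide_pos_pos) auto
  show "0 < \<eta>" unfolding \<eta>_def using p k assms by (intro divide_pos_pos mult_pos_pos) auto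
  have 1: "k * (2 * (Q * C + 1)) = B" using p by (simp add: k_def)
  define e where "e = 4 * \<eta> / k"
  have "e * (8 * (Q + 1)) = 4 * B" using p k by (simp add: e_def \<eta>_def)
  then have 2: "2 * (Q * e) + 2 * e = B" by (simp add: algebra_simps)
  have 3: "2 * (Q * (k * C)) + 2 * k = B" using 1 by (simp add: algebra_simps)
  have "0 \<le> e" using \<open>0 < \<eta>\<close> k by (simp add: e_def)
  then show "Q * (k * C + 4 * \<eta> / k) \<le> B"
    using 2 3 k unfolding e_def[symmetric] distrib_left by linarith
qed

context approximation
begin

text \<open>A weight centred at 0 is supported in \<open>cball 0 R\<close>, where the drifts
  converge to \<open>b\<close>; the triangle inequality passes through \<open>b\<close>.\<close>

lemma drift_difference_bound:
  assumes "0 \<le> t1" "t2 \<le> T"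
  shows "ennreal (spacetime_integral t1 t2 (\<lambda>t x. (cutoff 0 R x)\<^sup>2 * (norm (bn n (t, x) - bn m (t, x)))\<^sup>2))
    \<le> 2 * (\<integral>\<^sup>+z\<in>{0..T} \<times> cball 0 R. ennreal ((norm (bn n z - b z))\<^sup>2) \<partial>lborel)
      + 2 * (\<integral>\<^sup>+z\<in>{0..T} \<times> cball 0 R. ennreal ((norm (bn m z - b z))\<^sup>2) \<partial>lborel)"
proof -
  let ?A = "{0..T} \<times> cball (0::'a) R"
  have A: "?A \<in> sets borel" by (intro borel_closed closed_Times) auto
  have bm: "(\<lambda>z. ennreal ((norm (bn n z - b z))\<^sup>2) * indicator ?A z) \<in> borel_measurable borel" for n
    using b_meas borel_measurable_continuous_onI[OF bn_cont, of n] A by measurable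
  have "cont_supported {t1..t2} R (\<lambda>t x. (cutoff 0 R x)\<^sup>2 * (norm (bn n (t, x) - bn m (t, x)))\<^sup>2)"
    by (rule cont_supportedI) (auto simp: cutoff_zero intro!: continuous_intros continuous_on_subset[OF bn_cont])
  then have "ennreal (spacetime_integral t1 t2 (\<lambda>t x. (cutoff 0 R x)\<^sup>2 * (norm (bn n (t, x) - bn m (t, x)))\<^sup>2))
    = (\<integral>\<^sup>+p. ennreal ((cutoff 0 R (snd p))\<^sup>2 * (norm (bn n (fst p, snd p) - bn m (fst p, snd p)))\<^sup>2) * indicator ({t1..t2} \<times> UNIV) p \<partial>lborel)"
    by (rule spacetime_integral_nn_integral) simp
  also have "\<dots> \<le> (\<integral>\<^sup>+z. 2 * (ennreal ((norm (bn n z - b z))\<^sup>2) * indicator ?A z) + 2 * (ennreal ((norm (bn m z - b z))\<^sup>2) * indicator ?A z) \<partial>lborel)"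
  proof (rule nn_integral_mono)
    fix z :: "real \<times> 'a"
    obtain t x where z: "z = (t, x)" by (cases z)
    show "ennreal ((cutoff 0 R (snd z))\<^sup>2 * (norm (bn n (fst z, snd z) - bn m (fst z, snd z)))\<^sup>2) * indicator ({t1..t2} \<times> UNIV) z
      \<le> 2 * (ennreal ((norm (bn n z - b z))\<^sup>2) * indicator ?A z) + 2 * (ennreal ((norm (bn m z - b z))\<^sup>2) * indicator ?A z)"
    proof (cases "t \<in> {t1..t2} \<and> norm x \<le> R")
      case True
      have 1: "(cutoff 0 R x)\<^sup>2 \<le> 1" using cutoff_bounds(1,3)[of 0 R x] by (simp add: power_le_one)
      have "norm (bn n z - bn m z) \<le> norm (bn n z - b z) + norm (bn m z - b z)"
        using norm_triangle_ineq4[of "bn n z - b z" "bn m z - b z"] by simp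
      then have "(norm (bn n z - bn m z))\<^sup>2 \<le> (norm (bn n z - b z) + norm (bn m z - b z))\<^sup>2" by (intro power_mono) auto
      also have "\<dots> \<le> 2 * (norm (bn n z - b z))\<^sup>2 + 2 * (norm (bn m z - b z))\<^sup>2" using sum_squares_bound[of "norm (bn n z - b z)" "norm (bn m z - b z)"] by (simp add: power2_sum)
      finally have "(norm (bn n z - bn m z))\<^sup>2 \<le> 2 * (norm (bn n z - b z))\<^sup>2 + 2 * (norm (bn m z - b z))\<^sup>2" .
      then have "(cutoff 0 R x)\<^sup>2 * (norm (bn n z - bn m z))\<^sup>2 \<le> 1 * (2 * (norm (bn n z - b z))\<^sup>2 + 2 * (norm (bn m z - b z))\<^sup>2)"
        using 1 by (intro mult_mono) auto
      then have "ennreal ((cutoff 0 R x)\<^sup>2 * (norm (bn n z - bn m z))\<^sup>2)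
          \<le> ennreal (2 * (norm (bn n z - b z))\<^sup>2 + 2 * (norm (bn m z - b z))\<^sup>2)" by (intro ennreal_leI) simp
      then show ?thesis using True assms by (simp add: z ennreal_plus ennreal_mult)
    next
      case False
      then show ?thesis using cutoff_zero[of R 0 x] by (auto simp: z)
    qed
  qed
  also have "\<dots> = 2 * (\<integral>\<^sup>+z\<in>?A. ennreal ((norm (bn n z - b z))\<^sup>2) \<partial>lborel) + 2 * (\<integral>\<^sup>+z\<in>?A. ennreal ((norm (bn m z - b z))\<^sup>2) \<partial>lborel)"
    using bm by (subst nn_integral_add) (auto simp: nn_integral_cmult)
  finally show ?thesis .
qed

text \<open>The gradient \<open>z\<close> is bounded only in a weighted integral, and the difference
  of the drifts is small only in local L^2. Young's inequality with a free weight \<open>k\<close>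
  separates them, and q > 2 gives |z|^2 \<le> (1 + |z|^2)^(q/2).\<close>

lemma source_bound:
  assumes v: "solves m s v z" and t: "s < t1" "t1 \<le> t2" "t2 \<le> T" and k: "0 < k"
    and h: "continuous_on ({s<..} \<times> UNIV) (\<lambda>(t, x). h t x)" "\<And>t x. s < t \<Longrightarrow> \<bar>h t x\<bar> \<le> 2 * M"
    and Bg: "\<And>t. s < t \<Longrightarrow> t \<le> T \<Longrightarrow> (LINT x|lborel. (cutoff 0 R x)\<^sup>2 * (1 + z t x \<bullet> z t x) powr (q / 2)) \<le> Bg" "0 \<le> Bg"
    and D: "spacetime_integral t1 t2 (\<lambda>t x. (cutoff 0 R x)\<^sup>2 * (norm (bn n (t, x) - bn m (t, x)))\<^sup>2) \<le> D"
  shows "spacetime_integral t1 t2 (\<lambda>t x. 2 * (cutoff 0 R x)\<^sup>2 * (\<bar>h t x\<bar> * \<bar>- ((bn n (t, x) - bn m (t, x)) \<bullet> z t x)\<bar>)) \<le> 4 * M * (k * (T * Bg) + D / k)"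
proof -
  let ?I = "{t1..t2}"
  obtain vt J where "parabolic (bn m) (\<lambda>t x. 0) s v vt z J" using v by (auto simp: solves_def)
  then interpret parabolic "bn m" "\<lambda>t x. 0" s v vt z J .
  have s: "0 \<le> s" using v by (simp add: solves_def)
  have sub: "?I \<times> (UNIV :: 'a set) \<subseteq> {s<..} \<times> UNIV" using t by auto
  have zc: "continuous_on (?I \<times> UNIV) (\<lambda>p. z (fst p) (snd p))"
    using continuous_on_subset[OF w_cont sub] by (simp add: split_def)
  have hc: "continuous_on (?I \<times> UNIV) (\<lambda>p. h (fst p) (snd p))"
    using continuous_on_subset[OF h(1) sub] by (simp add: split_def)
  have bc: "continuous_on X (bn i)" for X i using continuous_on_subset[OF bn_cont] by blast
  have pos: "0 < 1 + z t x \<bullet> z t x" for t x by (simp add: add_pos_nonneg)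
  then have nz: "1 + z t x \<bullet> z t x \<noteq> 0" for t x by (metis less_irrefl)
  define F where "F t x = (cutoff 0 R x)\<^sup>2 * (1 + z t x \<bullet> z t x) powr (q / 2)" for t x
  define G where "G t x = (cutoff 0 R x)\<^sup>2 * (norm (bn n (t, x) - bn m (t, x)))\<^sup>2" for t x
  have Fa: "cont_supported ?I R F" unfolding F_def
    by (rule cont_supportedI) (auto simp: cutoff_zero nz intro!: continuous_intros zc)
  have Ga: "cont_supported ?I R G" unfolding G_def
    by (rule cont_supportedI) (auto simp: cutoff_zero intro!: continuous_intros bc)
  note FGa = cont_supported_cmult[OF cont_supported_add[OF cont_supported_cmult[OF Fa, of k] cont_supported_cmult[OF Ga, of "1 / k"]], of "4 * M"]
  have "spacetime_integral t1 t2 (\<lambda>t x. 2 * (cutoff 0 R x)\<^sup>2 * (\<bar>h t x\<bar> * \<bar>- ((bn n (t, x) - bn m (t, x)) \<bullet> z t x)\<bar>))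
     \<le> spacetime_integral t1 t2 (\<lambda>t x. 4 * M * (k * F t x + 1 / k * G t x))"
  proof (rule spacetime_integral_mono[OF _ FGa])
    show "cont_supported ?I R (\<lambda>t x. 2 * (cutoff 0 R x)\<^sup>2 * (\<bar>h t x\<bar> * \<bar>- ((bn n (t, x) - bn m (t, x)) \<bullet> z t x)\<bar>))"
      by (rule cont_supportedI) (auto simp: cutoff_zero intro!: continuous_intros zc hc bc)
    fix t x assume t': "t \<in> ?I"
    let ?\<beta> = "bn n (t, x) - bn m (t, x)"
    have "(norm (z t x))\<^sup>2 \<le> 1 + z t x \<bullet> z t x" by (simp add: power2_norm_eq_inner)
    also have "\<dots> \<le> (1 + z t x \<bullet> z t x) powr (q / 2)"
      using powr_mono[of 1 "q / 2" "1 + z t x \<bullet> z t x"] q pos[of t x] by simp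
    finally have z2: "(norm (z t x))\<^sup>2 \<le> (1 + z t x \<bullet> z t x) powr (q / 2)" .
    have "\<bar>?\<beta> \<bullet> z t x\<bar> \<le> norm (z t x) * norm ?\<beta>" using Cauchy_Schwarz_ineq2[of ?\<beta> "z t x"] by (simp add: mult.commute)
    also have "\<dots> \<le> k * (norm (z t x))\<^sup>2 + (norm ?\<beta>)\<^sup>2 / k" using young[OF k, of "norm (z t x)" "norm ?\<beta>"] mult_nonneg_nonneg[OF norm_ge_zero[of "z t x"] norm_ge_zero[of ?\<beta>]] by linarith
    also have "\<dots> \<le> k * (1 + z t x \<bullet> z t x) powr (q / 2) + (norm ?\<beta>)\<^sup>2 / k" using z2 k by simp
    finally have 1: "\<bar>?\<beta> \<bullet> z t x\<bar> \<le> k * (1 + z t x \<bullet> z t x) powr (q / 2) + (norm ?\<beta>)\<^sup>2 / k" .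
    have "\<bar>h t x\<bar> * \<bar>?\<beta> \<bullet> z t x\<bar> \<le> 2 * M * (k * (1 + z t x \<bullet> z t x) powr (q / 2) + (norm ?\<beta>)\<^sup>2 / k)"
      using h(2)[of t x] t' t 1 M_nonneg by (intro mult_mono) auto
    then have "2 * (cutoff 0 R x)\<^sup>2 * (\<bar>h t x\<bar> * \<bar>?\<beta> \<bullet> z t x\<bar>)
        \<le> 2 * (cutoff 0 R x)\<^sup>2 * (2 * M * (k * (1 + z t x \<bullet> z t x) powr (q / 2) + (norm ?\<beta>)\<^sup>2 / k))"
      by (intro mult_left_mono) auto
    then show "2 * (cutoff 0 R x)\<^sup>2 * (\<bar>h t x\<bar> * \<bar>- (?\<beta> \<bullet> z t x)\<bar>) \<le> 4 * M * (k * F t x + 1 / k * G t x)"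
      unfolding abs_minus_cancel F_def G_def by (simp add: algebra_simps)
  qed
  also have "\<dots> = 4 * M * (k * spacetime_integral t1 t2 F + 1 / k * spacetime_integral t1 t2 G)"
    by (simp only: spacetime_integral_cmult spacetime_integral_add[OF cont_supported_cmult[OF Fa, of k] cont_supported_cmult[OF Ga, of "1 / k"]])
  also have "\<dots> \<le> 4 * M * (k * (T * Bg) + D / k)"
  proof (intro mult_left_mono add_mono)
    have "spacetime_integral t1 t2 F \<le> integral ?I (\<lambda>t. Bg)" unfolding spacetime_integral_def
    proof (rule integral_le)
      show "(\<lambda>t. LINT x|lborel. F t x) integrable_on ?I"
        by (intro integrable_continuous_interval cont_supported_continuous_LINT[OF Fa])
      show "(LINT x|lborel. F t x) \<le> Bg" if "t \<in> ?I" for t unfolding F_def using Bg(1)[of t] that t by auto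
    qed auto
    also have "\<dots> = (t2 - t1) * Bg" using t by simp
    also have "\<dots> \<le> T * Bg" using t s Bg by (intro mult_right_mono) auto
    finally show "spacetime_integral t1 t2 F \<le> T * Bg" .
    have "1 / k * spacetime_integral t1 t2 G \<le> 1 / k * D" using D k unfolding G_def by (intro mult_left_mono) auto
    then show "1 / k * spacetime_integral t1 t2 G \<le> D / k" by simp
  qed (use M_nonneg k in auto)
  finally show ?thesis .
qed

text \<open>Outside a large ball both solutions are small by \<open>uniform_tails\<close>. Inside it
  a single weight centred at 0 is used in the energy inequality, because the drifts converge only
  locally; it is compared with the weights centred at the points of the ball, as Morrey's inequality
  requires.\<close>

theorem uniformly_Cauchy:
  assumes \<epsilon>: "0 < \<epsilon>"
  obtains N where "\<And>n m s u w v z t x. N \<le> n \<Longrightarrow> N \<le> m \<Longrightarrow> solves n s u w \<Longrightarrow> solves m s v z \<Longrightarrow>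
    s \<le> t \<Longrightarrow> t \<le> T \<Longrightarrow> \<bar>u t x - v t x\<bar> \<le> \<epsilon>"
proof -
  obtain Bg where Bg: "0 \<le> Bg" "\<And>n s u w t x0 R. solves n s u w \<Longrightarrow> s < t \<Longrightarrow> t \<le> T \<Longrightarrow>
      (LINT x|lborel. (cutoff x0 R x)\<^sup>2 * (1 + w t x \<bullet> w t x) powr (q / 2)) \<le> Bg"
    using gradient_bound_uniform by blast
  obtain N2 where N2: "\<And>n. 8 * L2_rate (sqrt \<delta>) * T + integral {0..T} (gn n) / sqrt \<delta> \<le> real N2 / 2"
    using L2_steps by blast
  obtain \<rho>' where \<rho>': "\<And>n s u w t x. solves n s u w \<Longrightarrow> s \<le> t \<Longrightarrow> t \<le> T \<Longrightarrow> \<rho>' \<le> norm x \<Longrightarrow> \<bar>u t x\<bar> \<le> \<epsilon> / 2"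
    using uniform_tails[of "\<epsilon> / 2"] \<epsilon> by auto
  define \<rho>0 where "\<rho>0 = max 0 \<rho>'"
  define K where "K = 2 * (Bg / cube_weight TYPE('a) + 2 ^ DIM('a))"
  obtain B where B: "0 < B" "\<And>(h :: 'a \<Rightarrow> real) G x0. (\<And>x. (h has_derivative (\<lambda>v. G x \<bullet> v)) (at x)) \<Longrightarrow>
    continuous_on UNIV G \<Longrightarrow>
    (\<And>\<rho>. 0 < \<rho> \<Longrightarrow> \<rho> \<le> 1 \<Longrightarrow> integral unit_cube (\<lambda>y. norm (G (x0 + \<rho> *\<^sub>R y))) \<le> K * \<rho> powr (- (real DIM('a) / q))) \<Longrightarrow>
    (LINT x|lborel. (cutoff x0 (2 + sqrt (real DIM('a))) x * h x)\<^sup>2) \<le> B \<Longrightarrow> \<bar>h x0\<bar> \<le> \<epsilon>"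
    using small_of_small_L2[OF exponent \<epsilon>] by blast
  define R1 where "R1 = 2 + sqrt (real DIM('a))"
  \<comment> \<open>A lower bound of \<open>cutoff 0 R\<close> on the ball that contains the support
    of \<open>cutoff x R1\<close> for every \<open>x\<close> of norm at most \<open>\<rho>0\<close>.
    Dividing the factor of \<open>L2_growth\<close> by its square gives \<open>Q\<close>.\<close>
  define a where "a = exp (- 2 * (2 + (R1 + \<rho>0)))"
  define Q where "Q = 3 * 2 ^ N2 / a\<^sup>2"
  have a: "0 < a" by (simp add: a_def)
  have Q: "0 \<le> Q" by (simp add: Q_def)
  define X where "X = \<bar>Q * (8 * L2_rate (sqrt \<delta>) * T * (2 * M)\<^sup>2 * rho_mass TYPE('a))\<bar> / (B / 2)"
  \<comment> \<open>Large enough for the lower bound \<open>a\<close> to hold and for the truncation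
    error to take at most half of \<open>B\<close>.\<close>
  define R where "R = max (2 + (R1 + \<rho>0)) X"
  have R: "Q * (8 * L2_rate (sqrt \<delta>) * T * (2 * M)\<^sup>2 * exp (- 2 * R) * rho_mass TYPE('a)) \<le> B / 2"
  proof -
    have "Q * (8 * L2_rate (sqrt \<delta>) * T * (2 * M)\<^sup>2 * exp (- 2 * R) * rho_mass TYPE('a))
        = (Q * (8 * L2_rate (sqrt \<delta>) * T * (2 * M)\<^sup>2 * rho_mass TYPE('a))) * exp (- 2 * R)" by (simp only: mult_ac)
    also have "\<dots> \<le> (B / 2 * X) * exp (- 2 * R)" using B(1) by (intro mult_right_mono) (auto simp: X_def)
    also have "\<dots> = B / 2 * (X * exp (- 2 * R))" by simp
    also have "\<dots> \<le> B / 2 * 1" using B(1) by (intro mult_left_mono exp_error_le_1) (auto simp: R_def X_def)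
    finally show ?thesis by simp
  qed
  \<comment> \<open>With \<open>R\<close> fixed, the drifts need to be close on one compact set
    only. The bound \<open>T * Bg\<close> of the gradient term does not depend on
    \<open>R\<close>.\<close>
  obtain k \<eta> where k: "0 < k" "0 < \<eta>" "Q * (4 * M) * (k * (T * Bg) + 4 * \<eta> / k) \<le> B / 2"
    using real_small_parameters[of "Q * (4 * M)" "T * Bg" "B / 2"] Q M_nonneg T Bg(1) B(1) by (metis half_gt_zero less_imp_le mult_nonneg_nonneg zero_le_numeral)
  have "\<forall>\<^sub>F n in sequentially. (\<integral>\<^sup>+z\<in>{0..T} \<times> cball 0 R. ennreal ((norm (bn n z - b z))\<^sup>2) \<partial>lborel) < ennreal \<eta>"
    by (rule order_tendstoD(2)[OF bn_lim]) (use k in simp)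
  then obtain N where N: "\<And>n. N \<le> n \<Longrightarrow> (\<integral>\<^sup>+z\<in>{0..T} \<times> cball 0 R. ennreal ((norm (bn n z - b z))\<^sup>2) \<partial>lborel) < ennreal \<eta>"
    by (auto simp: eventually_sequentially)
  show thesis
  proof (rule that)
    fix n m s u w v z t and x :: 'a
    assume nm: "N \<le> n" "N \<le> m" and u: "solves n s u w" and v: "solves m s v z" and t: "s \<le> t" "t \<le> T"
    have eq: "u s = v s" using u v by (simp add: solves_def)
    consider "t = s" | "\<rho>' \<le> norm x" | "s < t" "norm x \<le> \<rho>0" using t by (fastforce simp: \<rho>0_def)
    then show "\<bar>u t x - v t x\<bar> \<le> \<epsilon>"
    proof cases
      case 1
      then show ?thesis using eq \<epsilon> by simp
    next
      case 2
      then show ?thesis using \<rho>'[OF u t 2] \<rho>'[OF v t 2] by linarith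
    next
      case 3
      have s: "0 \<le> s" using u by (simp add: solves_def)
      obtain ut H vt J where p: "parabolic (bn n) (\<lambda>t x. 0) s u ut w H" and p': "parabolic (bn m) (\<lambda>t x. 0) s v vt z J"
        using u v by (auto simp: solves_def)
      let ?h = "\<lambda>t x. u t x - v t x" and ?S = "\<lambda>t x. - ((bn n (t, x) - bn m (t, x)) \<bullet> z t x)"
      have pd: "parabolic (bn n) ?S s ?h (\<lambda>t x. ut t x - vt t x) (\<lambda>t x. w t x - z t x) (\<lambda>t x y. H t x y - J t x y)"
        by (rule parabolic_diff[OF p p'])
      have hM: "\<bar>?h t x\<bar> \<le> 2 * M" if "s \<le> t" for t x
      proof -
        have "\<bar>u t x\<bar> \<le> M" "\<bar>v t x\<bar> \<le> M" using u v that by (auto simp: solves_def)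
        then show ?thesis by linarith
      qed
      interpret pd: parabolic "bn n" ?S s ?h "\<lambda>t x. ut t x - vt t x" "\<lambda>t x. w t x - z t x" "\<lambda>t x y. H t x y - J t x y" by (rule pd)
      interpret p': parabolic "bn m" "\<lambda>t x. 0" s v vt z J by (rule p')
      have Sc: "continuous_on ({s<..} \<times> UNIV) (\<lambda>(t, x). ?S t x)"
        using p'.w_cont unfolding split_def by (auto intro!: continuous_intros continuous_on_subset[OF bn_cont])
      have pf: "parabolic_form (bn n) ?S s ?h (\<lambda>t x. ut t x - vt t x) (\<lambda>t x. w t x - z t x) (\<lambda>t x y. H t x y - J t x y) T \<delta> (gn n)"
        by (intro parabolic_form.intro parabolic_form_axioms.intro pd bn_form bn_cont \<delta> \<delta>_less_1 s gn Sc)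
      define \<sigma> where "\<sigma> = 4 * M * (k * (T * Bg) + 4 * \<eta> / k)"
      have \<sigma>0: "0 \<le> \<sigma>" unfolding \<sigma>_def using M_nonneg k T Bg(1) by (intro mult_nonneg_nonneg add_nonneg_nonneg) auto
      have \<sigma>: "spacetime_integral t1 t2 (\<lambda>t x. 2 * (cutoff 0 R x)\<^sup>2 * (\<bar>?h t x\<bar> * \<bar>?S t x\<bar>)) \<le> \<sigma>" if t12: "s < t1" "t1 \<le> t2" "t2 \<le> T" for t1 t2
        unfolding \<sigma>_def
      proof (rule source_bound[OF v t12 k(1) _ hM])
        show "continuous_on ({s<..} \<times> UNIV) (\<lambda>(t, x). ?h t x)"
          by (rule continuous_on_subset[OF pd.u_cont]) auto
        have "ennreal (spacetime_integral t1 t2 (\<lambda>t x. (cutoff 0 R x)\<^sup>2 * (norm (bn n (t, x) - bn m (t, x)))\<^sup>2)) \<le> 2 * ennreal \<eta> + 2 * ennreal \<eta>"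
          by (rule order_trans[OF drift_difference_bound]) (use s t12 in simp, use t12 in simp,
              intro add_mono mult_left_mono less_imp_le[OF N] nm, simp_all)
        also have "\<dots> = ennreal (4 * \<eta>)" using k by (simp add: ennreal_mult'[symmetric] ennreal_plus[symmetric] del: ennreal_plus flip: ennreal_numeral)
        finally show "spacetime_integral t1 t2 (\<lambda>t x. (cutoff 0 R x)\<^sup>2 * (norm (bn n (t, x) - bn m (t, x)))\<^sup>2) \<le> 4 * \<eta>"
          using k by (simp add: ennreal_le_iff)
      qed (use Bg v in auto)
      have hc: "continuous_on UNIV (?h t)" by (rule has_derivative_continuous_on_UNIV[OF pd.u_x[OF 3(1)]])
      have E2: "(LINT y|lborel. (cutoff 0 R y * ?h t y)\<^sup>2)
          \<le> 2 ^ N2 * (0 + 3 * (8 * L2_rate (sqrt \<delta>) * T * (2 * M)\<^sup>2 * exp (- 2 * R) * rho_mass TYPE('a) + \<sigma>))"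
        using parabolic_form.L2_growth[OF pf hM \<sigma> \<sigma>0 N2 t] eq
        unfolding parabolic_form.E2_def[OF pf] by simp
      show ?thesis
      proof (rule B(2)[of "?h t" "\<lambda>x. w t x - z t x"])
        show "(?h t has_derivative (\<lambda>y. (w t x - z t x) \<bullet> y)) (at x)" for x by (rule pd.u_x[OF 3(1)])
        show "continuous_on UNIV (\<lambda>x. w t x - z t x)"
          by (intro continuous_intros solves_slice(2)[OF u 3(1)] solves_slice(2)[OF v 3(1)])
        show "integral unit_cube (\<lambda>y. norm (w t (x + \<rho> *\<^sub>R y) - z t (x + \<rho> *\<^sub>R y))) \<le> K * \<rho> powr (- (real DIM('a) / q))" if "0 < \<rho>" "\<rho> \<le> 1" for \<rho>
        proof -
          have c: "continuous_on unit_cube (\<lambda>y. w t (x + \<rho> *\<^sub>R y))" "continuous_on unit_cube (\<lambda>y. z t (x + \<rho> *\<^sub>R y))"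
            by (intro continuous_on_compose2[OF solves_slice(2)[OF u 3(1)]] continuous_on_compose2[OF solves_slice(2)[OF v 3(1)]]
                continuous_intros subset_UNIV)+
          have "integral unit_cube (\<lambda>y. norm (w t (x + \<rho> *\<^sub>R y) - z t (x + \<rho> *\<^sub>R y)))
              \<le> integral unit_cube (\<lambda>y. norm (w t (x + \<rho> *\<^sub>R y)) + norm (z t (x + \<rho> *\<^sub>R y)))"
            by (intro integral_le integrable_continuous continuous_intros c norm_triangle_ineq4)
          also have "\<dots> = integral unit_cube (\<lambda>y. norm (w t (x + \<rho> *\<^sub>R y))) + integral unit_cube (\<lambda>y. norm (z t (x + \<rho> *\<^sub>R y)))"
            by (intro Henstock_Kurzweil_Integration.integral_add integrable_continuous continuous_intros c)
          also have "\<dots> \<le> (Bg / cube_weight TYPE('a) + 2 ^ DIM('a)) * \<rho> powr (- (real DIM('a) / q))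
              + (Bg / cube_weight TYPE('a) + 2 ^ DIM('a)) * \<rho> powr (- (real DIM('a) / q))"
            using q by (intro add_mono
              gradient_integral_unit_cube[OF solves_slice(2)[OF u 3(1)] _ that order_refl Bg(2)[OF u 3(1) t(2)]]
              gradient_integral_unit_cube[OF solves_slice(2)[OF v 3(1)] _ that order_refl Bg(2)[OF v 3(1) t(2)]]) auto
          finally show ?thesis unfolding K_def by linarith
        qed
        have le: "a\<^sup>2 * (cutoff x R1 y * ?h t y)\<^sup>2 \<le> (cutoff 0 R y * ?h t y)\<^sup>2" for y
        proof (cases "norm y \<le> R1 + \<rho>0")
          case True
          have "a \<le> cutoff 0 R y" unfolding a_def by (rule cutoff_lower_bound) (use True in \<open>auto simp: R_def\<close>)
          moreover have "cutoff x R1 y \<le> 1" "0 \<le> cutoff x R1 y" by (rule cutoff_bounds)+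
          ultimately have "a * cutoff x R1 y \<le> cutoff 0 R y * 1" using a by (intro mult_mono) auto
          then have "(a * cutoff x R1 y)\<^sup>2 \<le> (cutoff 0 R y)\<^sup>2" using a \<open>0 \<le> cutoff x R1 y\<close> by (intro power_mono) auto
          then have "(a * cutoff x R1 y)\<^sup>2 * (?h t y)\<^sup>2 \<le> (cutoff 0 R y)\<^sup>2 * (?h t y)\<^sup>2" by (intro mult_right_mono) auto
          then show ?thesis by (simp add: power_mult_distrib mult_ac)
        next
          case False
          then show ?thesis using 3 cutoff_zero[of R1 x y] by simp
        qed
        have "a\<^sup>2 * (LINT y|lborel. (cutoff x R1 y * ?h t y)\<^sup>2) = (LINT y|lborel. a\<^sup>2 * (cutoff x R1 y * ?h t y)\<^sup>2)" by simp
        also have "\<dots> \<le> (LINT y|lborel. (cutoff 0 R y * ?h t y)\<^sup>2)"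
        proof (rule integral_mono[OF _ _ le])
          show "integrable lborel (\<lambda>y. a\<^sup>2 * (cutoff x R1 y * ?h t y)\<^sup>2)"
            by (rule integrable_bounded_support[where R = "R1 + norm x"]) (auto simp: cutoff_zero intro!: continuous_intros hc)
          show "integrable lborel (\<lambda>y. (cutoff 0 R y * ?h t y)\<^sup>2)"
            by (rule integrable_bounded_support[where R = "R"]) (auto simp: cutoff_zero intro!: continuous_intros hc)
        qed
        also note E2
        also have "2 ^ N2 * (0 + 3 * (8 * L2_rate (sqrt \<delta>) * T * (2 * M)\<^sup>2 * exp (- 2 * R) * rho_mass TYPE('a) + \<sigma>))
            = a\<^sup>2 * (Q * (8 * L2_rate (sqrt \<delta>) * T * (2 * M)\<^sup>2 * exp (- 2 * R) * rho_mass TYPE('a)) + Q * \<sigma>)"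
          using a by (simp add: Q_def field_simps)
        also have "\<dots> \<le> a\<^sup>2 * B"
        proof (rule mult_left_mono)
          have "Q * \<sigma> \<le> B / 2" using k(3) by (simp add: \<sigma>_def mult.assoc)
          then show "Q * (8 * L2_rate (sqrt \<delta>) * T * (2 * M)\<^sup>2 * exp (- 2 * R) * rho_mass TYPE('a)) + Q * \<sigma> \<le> B"
            using R by linarith
        qed simp
        finally show "(LINT y|lborel. (cutoff x (2 + sqrt (real DIM('a))) y * ?h t y)\<^sup>2) \<le> B"
          using a by (simp add: R1_def)
      qed
    qed
  qed
qed

end

subsection \<open>Density and completeness\<close>

lemma abs_ev_le_norm: "\<bar>ev f x\<bar> \<le> norm f"
  using norm_bounded[of "bcontfun_of f" x] by (simp add: ev_def norm_C_infty_def)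

lemma norm_C_infty_le: "(\<And>x. \<bar>ev f x\<bar> \<le> c) \<Longrightarrow> norm f \<le> c"
  using norm_bound[of "bcontfun_of f" c] by (simp add: ev_def norm_C_infty_def)

lemma ev_eqI: "ev f = ev g \<Longrightarrow> f = g"
  by (simp add: ev_def bcontfun_of_inject apply_bcontfun_inject)

lemma ev_continuous: "continuous_on S (ev f)"
  by (simp add: ev_def)

text \<open>Vanishing at infinity survives uniform limits. Completeness later turns the uniform
  Cauchy property of the operators into a limit.\<close>

instance C_infty :: (euclidean_space) banach
proof
  fix X :: "nat \<Rightarrow> 'a C_infty" assume X: "Cauchy X"
  then have "Cauchy (\<lambda>n. bcontfun_of (X n))" by (simp add: Cauchy_def dist_C_infty_def)
  then obtain h where h: "(\<lambda>n. bcontfun_of (X n)) \<longlonglongrightarrow> h"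
    using Cauchy_convergent by (auto simp: convergent_def)
  have "(apply_bcontfun h \<longlongrightarrow> 0) at_infinity"
  proof (rule tendstoI)
    fix e :: real assume "0 < e"
    then have "\<forall>\<^sub>F n in sequentially. dist (bcontfun_of (X n)) h < e / 2" by (intro tendstoD[OF h]) simp
    then obtain n where n: "dist (bcontfun_of (X n)) h < e / 2" by (auto simp: eventually_sequentially)
    have "\<forall>\<^sub>F x in at_infinity. dist (ev (X n) x) 0 < e / 2" using \<open>0 < e\<close> by (intro tendstoD[OF ev_tendsto_0]) simp
    then show "\<forall>\<^sub>F x in at_infinity. dist (apply_bcontfun h x) 0 < e"
    proof eventually_elim
      case (elim x)
      have "dist (ev (X n) x) (apply_bcontfun h x) \<le> dist (bcontfun_of (X n)) h" unfolding ev_def by (rule dist_bounded)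
      then show ?case using elim n by (simp add: dist_real_def)
    qed
  qed
  then have "X \<longlonglongrightarrow> Abs_C_infty h" using h by (simp add: tendsto_iff dist_C_infty_def bcontfun_of_Abs)
  then show "convergent X" by (auto simp: convergent_def)
qed

text \<open>A predicate stable under sums and products, as the Stone-Weierstrass theorem asks
  for.\<close>

definition has_cont_gradient :: "('a::euclidean_space \<Rightarrow> real) \<Rightarrow> bool"
  where "has_cont_gradient p \<longleftrightarrow> (\<exists>G. continuous_on UNIV G \<and> (\<forall>x. (p has_derivative (\<lambda>v. G x \<bullet> v)) (at x)))"

lemma has_cont_gradient_ring:
  "has_cont_gradient (\<lambda>x. c)" "has_cont_gradient (\<lambda>x. x \<bullet> a)" "has_cont_gradient (cutoff x0 R)"
  "has_cont_gradient p \<Longrightarrow> has_cont_gradient p' \<Longrightarrow> has_cont_gradient (\<lambda>x. p x + p' x)"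
  "has_cont_gradient p \<Longrightarrow> has_cont_gradient p' \<Longrightarrow> has_cont_gradient (\<lambda>x. p x * p' x)"
  "has_cont_gradient p \<Longrightarrow> continuous_on S p"
proof -
  show "has_cont_gradient (\<lambda>x. c)" unfolding has_cont_gradient_def
    by (intro exI[of _ "\<lambda>x. 0"]) (auto intro!: has_derivative_eq_rhs[OF has_derivative_const])
  show "has_cont_gradient (\<lambda>x. x \<bullet> a)" unfolding has_cont_gradient_def
    by (intro exI[of _ "\<lambda>x. a"]) (auto intro!: derivative_eq_intros simp: inner_commute)
  show "has_cont_gradient (cutoff x0 R)" unfolding has_cont_gradient_def
    using cutoff_has_derivative by (intro exI[of _ "cutoff_grad x0 R"]) (auto intro!: continuous_intros)
  show "continuous_on S p" if hp: "has_cont_gradient p"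
  proof -
    obtain G where "\<And>x. (p has_derivative (\<lambda>v. G x \<bullet> v)) (at x)" using hp unfolding has_cont_gradient_def by blast
    from has_derivative_continuous_on_UNIV[OF this] show ?thesis by (rule continuous_on_subset) simp
  qed
  assume p: "has_cont_gradient p" "has_cont_gradient p'"
  then obtain G G' where G: "continuous_on UNIV G" "\<And>x. (p has_derivative (\<lambda>v. G x \<bullet> v)) (at x)"
    and G': "continuous_on UNIV G'" "\<And>x. (p' has_derivative (\<lambda>v. G' x \<bullet> v)) (at x)"
    unfolding has_cont_gradient_def by blast
  note c = has_derivative_continuous_on_UNIV[OF G(2)] has_derivative_continuous_on_UNIV[OF G'(2)]
  have "((\<lambda>x. p x + p' x) has_derivative (\<lambda>v. (G x + G' x) \<bullet> v)) (at x)" for x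
    using has_derivative_add[OF G(2) G'(2)] by (simp add: inner_add_left)
  then show "has_cont_gradient (\<lambda>x. p x + p' x)" unfolding has_cont_gradient_def
    by (intro exI[of _ "\<lambda>x. G x + G' x"]) (auto intro!: continuous_intros G G')
  have "((\<lambda>x. p x * p' x) has_derivative (\<lambda>v. (p x *\<^sub>R G' x + p' x *\<^sub>R G x) \<bullet> v)) (at x)" for x
    using has_derivative_mult[OF G(2) G'(2)] by (simp add: inner_add_left mult.commute)
  then show "has_cont_gradient (\<lambda>x. p x * p' x)" unfolding has_cont_gradient_def
    by (intro exI[of _ "\<lambda>x. p x *\<^sub>R G' x + p' x *\<^sub>R G x"]) (auto intro!: continuous_intros G G' c)
qed

lemma C1_compact_supportI:
  assumes p: "has_cont_gradient p" and R: "\<And>x. R < norm x \<Longrightarrow> p x = 0"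
  shows "C1_compact_support p"
proof -
  obtain G where G: "continuous_on UNIV G" "\<And>x. (p has_derivative (\<lambda>v. G x \<bullet> v)) (at x)"
    using p unfolding has_cont_gradient_def by blast
  have "dderiv i p = (\<lambda>x. G x \<bullet> i)" for i
    unfolding dderiv_def by (intro ext) (simp add: frechet_derivative_at[OF G(2), symmetric])
  moreover have "bounded {x. p x \<noteq> 0}"
    by (rule bounded_subset[OF bounded_cball[of 0 R]]) (use R in force)
  ultimately show ?thesis
    unfolding C1_compact_support_def using G by (auto simp: differentiable_def intro!: continuous_intros)
qed

text \<open>Approximating \<open>f\<close> divided by a weight on a ball and multiplying the
  approximant by the weight yields compact support; the weight is at most 1, so the error does not
  grow.\<close>

lemma C1_compact_support_dense:
  fixes f :: "'a::euclidean_space C_infty"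
  assumes e: "0 < e"
  obtains g where "C1_compact_support (ev g)" "norm (f - g) \<le> e"
proof -
  have "\<forall>\<^sub>F x in at_infinity. dist (ev f x) 0 < e / 3" using e by (intro tendstoD[OF ev_tendsto_0]) simp
  then obtain r where r: "\<And>x. r \<le> norm x \<Longrightarrow> \<bar>ev f x\<bar> < e / 3" by (auto simp: eventually_at_infinity)
  define R where "R = 2 + r"
  define cf where "cf = (cutoff 0 R :: 'a \<Rightarrow> real)"
  define c where "c = exp (- 2 * (2 + r))"
  \<comment> \<open>The maximum with \<open>c\<close> prevents division by zero at the edge of the
    ball. For norm x \<le> r it changes nothing, and beyond \<open>r\<close> the product of
    \<open>cf\<close> and \<open>G\<close> is at most |f|, which is small there.\<close>
  define G where "G x = ev f x / max (cf x) c" for x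
  have c: "0 < c" by (simp add: c_def)
  have cf: "0 \<le> cf x" "cf x \<le> 1" for x using cutoff_bounds(1,3)[of 0 R x] by (auto simp: cf_def)
  have "continuous_on (cball 0 R) G"
    unfolding G_def cf_def using c by (intro continuous_intros ev_continuous) (auto simp: max_def)
  then have "\<exists>p. has_cont_gradient p \<and> (\<forall>x\<in>cball 0 R. \<bar>G x - p x\<bar> < e / 3)"
  proof (rule Stone_Weierstrass_HOL[where P = has_cont_gradient and S = "cball 0 R", rotated -2])
    show "\<exists>p. has_cont_gradient p \<and> p x \<noteq> p y" if "x \<in> cball 0 R \<and> y \<in> cball 0 R \<and> x \<noteq> y" for x y :: 'a
    proof -
      obtain i where "x \<bullet> i \<noteq> y \<bullet> i" using \<open>_ \<and> _ \<and> x \<noteq> y\<close> euclidean_eq_iff[of x y] by blast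
      then show ?thesis by (intro exI[of _ "\<lambda>x. x \<bullet> i"]) (simp add: has_cont_gradient_ring)
    qed
  qed (use e in \<open>auto intro: has_cont_gradient_ring\<close>)
  then obtain p where p: "has_cont_gradient p" "\<And>x. x \<in> cball 0 R \<Longrightarrow> \<bar>G x - p x\<bar> < e / 3" by blast
  define g where "g x = cf x * p x" for x
  have g: "has_cont_gradient g" unfolding g_def cf_def by (intro has_cont_gradient_ring p)
  have g0: "g x = 0" if "R < norm x" for x using cutoff_zero[of R 0 x] that by (simp add: g_def cf_def)
  have "(g \<longlongrightarrow> 0) at_infinity"
    by (rule tendsto_eventually) (use g0 in \<open>auto simp: eventually_at_infinity intro!: exI[of _ "R + 1"]\<close>)
  then obtain F where F: "ev F = g" using ex_C_infty has_cont_gradient_ring(6)[OF g] by blast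
  show thesis
  proof (rule that)
    show "C1_compact_support (ev F)" unfolding F by (rule C1_compact_supportI[OF g g0])
    show "norm (f - F) \<le> e"
    proof (rule norm_C_infty_le)
      fix x
      have *: "\<bar>cf x * G x - g x\<bar> \<le> e / 3" if "norm x \<le> R"
      proof -
        have "cf x * \<bar>G x - p x\<bar> \<le> 1 * (e / 3)" using p(2)[of x] cf[of x] that by (intro mult_mono) auto
        moreover have "cf x * G x - g x = cf x * (G x - p x)" by (simp add: g_def algebra_simps)
        ultimately show ?thesis using cf[of x] by (simp add: abs_mult)
      qed
      consider "norm x \<le> r" | "r \<le> norm x" "norm x \<le> R" | "r \<le> norm x" "R < norm x" by linarith
      then have "\<bar>ev f x - g x\<bar> \<le> e"
      proof cases
        case 1
        then have "c \<le> cf x" unfolding c_def cf_def R_def by (intro cutoff_lower_bound) auto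
        then have "cf x * G x = ev f x" using c by (simp add: G_def)
        then show ?thesis using * 1 e by (simp add: R_def)
      next
        case 2
        have "cf x * \<bar>ev f x\<bar> \<le> max (cf x) c * \<bar>ev f x\<bar>" by (intro mult_right_mono) auto
        then have "\<bar>cf x * G x\<bar> \<le> \<bar>ev f x\<bar>" using c cf[of x] by (simp add: G_def abs_mult field_simps)
        then show ?thesis using *[OF 2(2)] r[OF 2(1)] by linarith
      next
        case 3
        then show ?thesis using g0[of x] r[of x] e by simp
      qed
      then show "\<bar>ev (f - F) x\<bar> \<le> e" by (simp add: F)
    qed
  qed
qed

lemma C1_compact_support_Lipschitz:
  fixes f :: "'a::euclidean_space \<Rightarrow> real"
  assumes "C1_compact_support f"
  obtains L r where "0 < L" "\<And>x y. \<bar>f x - f y\<bar> \<le> L * norm (x - y)" "\<And>x. r < norm x \<Longrightarrow> f x = 0"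
proof -
  have d: "f differentiable at x" for x using assms by (simp add: C1_compact_support_def)
  have D: "(f has_derivative (\<lambda>v. gradient f x \<bullet> v)) (at x)" for x by (rule differentiable_gradient[OF d])
  have gc: "continuous_on UNIV (gradient f)"
    using assms unfolding gradient_def C1_compact_support_def by (auto intro!: continuous_intros)
  have "bounded (closure {x. f x \<noteq> 0})" using assms compact_imp_bounded by (auto simp: C1_compact_support_def)
  then obtain r where r: "\<And>x. x \<in> closure {x. f x \<noteq> 0} \<Longrightarrow> norm x \<le> r" by (auto simp: bounded_iff)
  have f0: "f x = 0" if "r < norm x" for x
  proof (rule ccontr)
    assume "f x \<noteq> 0"
    then have "x \<in> closure {x. f x \<noteq> 0}" by (intro closure_subset[THEN subsetD]) simp
    then show False using r[of x] that by simp
  qed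
  have g0: "gradient f x = 0" if "r < norm x" for x by (rule zero_gradient_outside_support[OF D f0 that])
  have "bounded (gradient f ` cball 0 r)"
    by (intro compact_imp_bounded compact_continuous_image continuous_on_subset[OF gc]) auto
  then obtain B where B: "\<And>x. x \<in> cball 0 r \<Longrightarrow> norm (gradient f x) \<le> B"
    by (force simp: bounded_iff)
  define L where "L = max 1 B"
  have gL: "norm (gradient f x) \<le> L" for x
    using B[of x] g0[of x] by (cases "norm x \<le> r") (auto simp: L_def)
  have on: "onorm (\<lambda>v. gradient f x \<bullet> v) \<le> L" for x
  proof (rule onorm_le)
    show "norm (gradient f x \<bullet> v) \<le> L * norm v" for v
      using Cauchy_Schwarz_ineq2[of "gradient f x" v] mult_right_mono[OF gL[of x] norm_ge_zero[of v]] by simp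
  qed
  show thesis
  proof (rule that)
    show "0 < L" by (simp add: L_def)
    show "\<bar>f x - f y\<bar> \<le> L * norm (x - y)" for x y
      using differentiable_bound[of UNIV f "\<lambda>x v. gradient f x \<bullet> v" L x y] D on by simp
  qed (rule f0)
qed

text \<open>Comparison with the barrier \<open>a e\<^bsup>t-s\<^esup> |x - x0|\<^sup>2 + C (t - s)\<close>; the exponential absorbs the drift term
  \<open>2 a |b| |x - x0|\<close>.\<close>

lemma (in parabolic) initial_time_bound:
  assumes b: "\<And>t x. norm (b (t, x)) \<le> B"
    and M: "\<And>t x. s \<le> t \<Longrightarrow> t \<le> T \<Longrightarrow> u t x \<le> M"
    and S: "\<And>t x. S t x = 0"
    and L: "\<And>x y. \<bar>u s x - u s y\<bar> \<le> L * norm (x - y)" and a: "0 < a" and t: "s \<le> t" "t \<le> T"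
  shows "u t x0 \<le> u s x0 + L\<^sup>2 / (4 * a) + a * exp (T - s) * (2 * real DIM('a) + B\<^sup>2) * (t - s)"
proof -
  define C where "C = a * exp (T - s) * (2 * real DIM('a) + B\<^sup>2)"
  define e where "e t = a * exp (t - s)" for t
  define S' where "S' t x = 2 * e t * real DIM('a) - 2 * e t * (b (t, x) \<bullet> (x - x0)) - e t * ((x - x0) \<bullet> (x - x0)) - C" for t x
  have e: "0 < e t" for t using a by (simp add: e_def)
  have C: "0 \<le> C" using a by (simp add: C_def)
  have ec: "continuous_on X (\<lambda>p::real \<times> 'a. e (fst p))" for X unfolding e_def by (intro continuous_intros)
  interpret h: parabolic b S' s "\<lambda>t x. u t x - (e t * ((x - x0) \<bullet> (x - x0)) + C * (t - s))"
    "\<lambda>t x. ut t x - (e t * ((x - x0) \<bullet> (x - x0)) + C)" "\<lambda>t x. w t x - (2 * e t) *\<^sub>R (x - x0)" "\<lambda>t x v. H t x v - (2 * e t) *\<^sub>R v"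
  proof
    show "((\<lambda>r. u r x - (e r * ((x - x0) \<bullet> (x - x0)) + C * (r - s))) has_real_derivative ut t x - (e t * ((x - x0) \<bullet> (x - x0)) + C)) (at t)"
      if "s < t" for t x
      unfolding e_def by (rule derivative_eq_intros u_t[OF that] refl | simp)+
    show "((\<lambda>x. u t x - (e t * ((x - x0) \<bullet> (x - x0)) + C * (t - s))) has_derivative (\<lambda>v. (w t x - (2 * e t) *\<^sub>R (x - x0)) \<bullet> v)) (at x)"
      if "s < t" for t x
      by (rule derivative_eq_intros u_x[OF that] refl)+ (auto simp: fun_eq_iff inner_simps inner_commute algebra_simps)
    show "((\<lambda>x. w t x - (2 * e t) *\<^sub>R (x - x0)) has_derivative (\<lambda>v. H t x v - (2 * e t) *\<^sub>R v)) (at x)" if "s < t" for t x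
      by (rule derivative_eq_intros w_x[OF that] refl)+ auto
    show "ut t x - (e t * ((x - x0) \<bullet> (x - x0)) + C) = (\<Sum>i\<in>Basis. (H t x i - (2 * e t) *\<^sub>R i) \<bullet> i)
        - b (t, x) \<bullet> (w t x - (2 * e t) *\<^sub>R (x - x0)) + S' t x" if "s < t" for t x
      using eq[OF that, of x] S by (simp add: S'_def inner_diff_left inner_diff_right sum_subtractf algebra_simps)
    show "continuous_on ({s..} \<times> UNIV) (\<lambda>(t, x). u t x - (e t * ((x - x0) \<bullet> (x - x0)) + C * (t - s)))"
      using u_cont by (auto simp: split_def intro!: continuous_intros ec)
    show "continuous_on ({s<..} \<times> UNIV) (\<lambda>(t, x). ut t x - (e t * ((x - x0) \<bullet> (x - x0)) + C))"
      using ut_cont by (auto simp: split_def intro!: continuous_intros ec)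
    show "continuous_on ({s<..} \<times> UNIV) (\<lambda>(t, x). w t x - (2 * e t) *\<^sub>R (x - x0))"
      using w_cont by (auto simp: split_def intro!: continuous_intros ec)
    show "continuous_on ({s<..} \<times> UNIV) (\<lambda>(t, x). H t x v - (2 * e t) *\<^sub>R v)" for v
      using H_cont[of v] by (auto simp: split_def intro!: continuous_intros ec)
  qed
  have "u t x0 - (e t * ((x0 - x0) \<bullet> (x0 - x0)) + C * (t - s)) \<le> u s x0 + L\<^sup>2 / (4 * a)"
  proof (rule h.max_principle[OF b _ _ _ t])
    fix t x assume t: "s \<le> t" "t \<le> T"
    have "0 \<le> e t * ((x - x0) \<bullet> (x - x0)) + C * (t - s)" using e[of t] C t by (intro add_nonneg_nonneg mult_nonneg_nonneg) auto
    then show "u t x - (e t * ((x - x0) \<bullet> (x - x0)) + C * (t - s)) \<le> M" using M[OF t, of x] by linarith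
  next
    fix t x assume t: "s < t" "t \<le> T"
    have "0 \<le> (b (t, x) + (x - x0)) \<bullet> (b (t, x) + (x - x0))" by simp
    also have "\<dots> = (norm (b (t, x)))\<^sup>2 + 2 * (b (t, x) \<bullet> (x - x0)) + (x - x0) \<bullet> (x - x0)"
      by (simp only: power2_norm_eq_inner inner_add_left inner_add_right inner_commute[of "x - x0" "b (t, x)"])
    also have "(norm (b (t, x)))\<^sup>2 \<le> B\<^sup>2" using b by (intro power_mono) auto
    finally have "e t * (2 * real DIM('a) - 2 * (b (t, x) \<bullet> (x - x0)) - (x - x0) \<bullet> (x - x0)) \<le> e t * (2 * real DIM('a) + B\<^sup>2)"
      using e[of t] by (intro mult_left_mono) auto
    also have "\<dots> \<le> C" unfolding C_def e_def using a t by (intro mult_right_mono mult_left_mono) auto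
    finally show "S' t x \<le> 0" by (simp add: S'_def algebra_simps)
  next
    fix x
    have "0 \<le> (2 * a * norm (x - x0) - L)\<^sup>2 / (4 * a)" using a by simp
    also have "\<dots> = a * (norm (x - x0))\<^sup>2 - L * norm (x - x0) + L\<^sup>2 / (4 * a)"
      using a by (simp add: power2_eq_square field_simps)
    finally show "u s x - (e s * ((x - x0) \<bullet> (x - x0)) + C * (s - s)) \<le> u s x0 + L\<^sup>2 / (4 * a)"
      using L[of x x0] by (simp add: e_def power2_norm_eq_inner)
  qed
  then show ?thesis by (simp add: C_def)
qed

subsection \<open>Evolution families\<close>

text \<open>No datum is recorded: the class is stable under differences and under later initial
  times, which is what the uniqueness argument for the evolution law uses.\<close>

definition bounded_solution :: "(real \<times> 'a::euclidean_space \<Rightarrow> 'a) \<Rightarrow> real \<Rightarrow> (real \<Rightarrow> 'a \<Rightarrow> real) \<Rightarrow> bool"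
  where "bounded_solution b s u \<longleftrightarrow> (\<exists>ut w H. parabolic b (\<lambda>t x. 0) s u ut w H) \<and> (\<exists>M. \<forall>t x. s \<le> t \<longrightarrow> \<bar>u t x\<bar> \<le> M)"

lemma bounded_solution_classical: "classical_solution b s f u \<Longrightarrow> bounded_solution b s u"
  using classical_solution_parabolic[of b s f u]
  by (fastforce simp: bounded_solution_def classical_solution_def bounded_iff)

lemma bounded_solution_zero: "bounded_solution b s (\<lambda>t x. 0)"
proof -
  have "parabolic b (\<lambda>t x. 0) s (\<lambda>t x. 0) (\<lambda>t x. 0) (\<lambda>t x. 0) (\<lambda>t x v. 0)"
    by unfold_locales (auto simp: split_def)
  then show ?thesis by (auto simp: bounded_solution_def)
qed

lemma bounded_solution_diff:
  assumes "bounded_solution b s u" "bounded_solution b s v"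
  shows "bounded_solution b s (\<lambda>t x. u t x - v t x)"
proof -
  obtain ut w H vt z J M N where p: "parabolic b (\<lambda>t x. 0) s u ut w H" "parabolic b (\<lambda>t x. 0) s v vt z J"
    and M: "\<And>t x. s \<le> t \<Longrightarrow> \<bar>u t x\<bar> \<le> M" "\<And>t x. s \<le> t \<Longrightarrow> \<bar>v t x\<bar> \<le> N"
    using assms unfolding bounded_solution_def by blast
  have "\<bar>u t x - v t x\<bar> \<le> M + N" if "s \<le> t" for t x using M(1)[OF that, of x] M(2)[OF that, of x] by linarith
  then show ?thesis using parabolic_diff[OF p] unfolding bounded_solution_def by auto
qed

lemma bounded_solution_restrict:
  assumes "bounded_solution b s u" "s \<le> r"
  shows "bounded_solution b r u"
proof -
  obtain ut w H M where "parabolic b (\<lambda>t x. 0) s u ut w H" and M: "\<And>t x. s \<le> t \<Longrightarrow> \<bar>u t x\<bar> \<le> M"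
    using assms unfolding bounded_solution_def by blast
  then interpret parabolic b "\<lambda>t x. 0" s u ut w H by simp
  have sub: "{r..} \<times> (UNIV :: 'a set) \<subseteq> {s..} \<times> UNIV" "{r<..} \<times> (UNIV :: 'a set) \<subseteq> {s<..} \<times> UNIV" using assms(2) by auto
  have "parabolic b (\<lambda>t x. 0) r u ut w H"
    by unfold_locales (use assms(2) u_t u_x w_x eq in
      \<open>auto intro: continuous_on_subset[OF u_cont sub(1)] continuous_on_subset[OF ut_cont sub(2)]
        continuous_on_subset[OF w_cont sub(2)] continuous_on_subset[OF H_cont sub(2)]\<close>)
  moreover have "\<forall>t x. r \<le> t \<longrightarrow> \<bar>u t x\<bar> \<le> M" using M assms(2) by auto
  ultimately show ?thesis unfolding bounded_solution_def by blast
qed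

lemma bounded_solution_le:
  assumes "bounded_solution b s u" "bounded (range b)" "\<And>x. u s x \<le> m" "s \<le> t"
  shows "u t x \<le> m"
proof -
  obtain ut w H M where "parabolic b (\<lambda>t x. 0) s u ut w H" and M: "\<And>t x. s \<le> t \<Longrightarrow> \<bar>u t x\<bar> \<le> M"
    using assms(1) unfolding bounded_solution_def by blast
  then interpret parabolic b "\<lambda>t x. 0" s u ut w H by simp
  obtain B where "\<And>z. norm (b z) \<le> B" using assms(2) by (auto simp: bounded_iff)
  then show ?thesis using max_principle[where B = B and M = M and T = t] M assms(3,4) abs_le_D1 by blast
qed

lemma bounded_solution_uminus: "bounded_solution b s u \<Longrightarrow> bounded_solution b s (\<lambda>t x. - u t x)"
  using bounded_solution_diff[OF bounded_solution_zero] by simp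

lemma bounded_solution_ge:
  assumes "bounded_solution b s u" "bounded (range b)" "\<And>x. m \<le> u s x" "s \<le> t"
  shows "m \<le> u t x"
  using bounded_solution_le[OF bounded_solution_uminus[OF assms(1)] assms(2), of "- m" t x] assms(3,4) by simp

lemma bounded_solution_abs_le:
  assumes "bounded_solution b s u" "bounded (range b)" "\<And>x. \<bar>u s x\<bar> \<le> m" "s \<le> t"
  shows "\<bar>u t x\<bar> \<le> m"
proof -
  have "u t x \<le> m" "- m \<le> u t x"
    by (rule bounded_solution_le[OF assms(1,2) _ assms(4)] bounded_solution_ge[OF assms(1,2) _ assms(4)],
        use assms(3) in \<open>simp add: abs_le_iff minus_le_iff\<close>)+
  then show ?thesis by linarith
qed

lemma bounded_solution_Lipschitz:
  assumes u: "bounded_solution b s u" and b: "bounded (range b)"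
    and L: "\<And>x y. \<bar>u s x - u s y\<bar> \<le> L * norm (x - y)" "0 < L"
  obtains L' where "\<And>t x y. s \<le> t \<Longrightarrow> t \<le> T \<Longrightarrow> \<bar>u t x - u t y\<bar> \<le> L' * norm (x - y)"
proof -
  obtain ut w H M where "parabolic b (\<lambda>t x. 0) s u ut w H" and M: "\<And>t x. s \<le> t \<Longrightarrow> \<bar>u t x\<bar> \<le> M"
    using u unfolding bounded_solution_def by blast
  then interpret parabolic b "\<lambda>t x. 0" s u ut w H by simp
  obtain B where B: "\<And>z. norm (b z) \<le> B" using b by (auto simp: bounded_iff)
  obtain c where c: "\<And>t x. s < t \<Longrightarrow> t \<le> T \<Longrightarrow> norm (w t x) \<le> 2 * L * exp (c * (t - s))"
    using gradient_bound_near_initial_time[where B = B and T = T and M = M and L = L] B M L by blast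
  define L' where "L' = 2 * L * exp (\<bar>c\<bar> * \<bar>T - s\<bar>)"
  show thesis
  proof (rule that)
    fix t x y assume t: "s \<le> t" "t \<le> T"
    show "\<bar>u t x - u t y\<bar> \<le> L' * norm (x - y)"
    proof (cases "t = s")
      case True
      have "1 * L \<le> L' " unfolding L'_def using L by (simp add: mult.commute[of L] mult_le_cancel_right order_trans[of 1 2])
      then have "L * norm (x - y) \<le> L' * norm (x - y)" by (intro mult_right_mono) auto
      then show ?thesis using L(1)[of x y] True by simp
    next
      case False
      then have st: "s < t" using t by simp
      have wL: "norm (w t x) \<le> L'" for x
      proof -
        have "c * (t - s) \<le> \<bar>c\<bar> * \<bar>T - s\<bar>" using t by (intro mult_mono) auto
        then have "2 * L * exp (c * (t - s)) \<le> L'" using L by (simp add: L'_def)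
        then show ?thesis using c[OF st t(2), of x] by linarith
      qed
      have "onorm (\<lambda>v. w t x \<bullet> v) \<le> L'" for x
      proof (rule onorm_le)
        show "norm (w t x \<bullet> v) \<le> L' * norm v" for v
          using Cauchy_Schwarz_ineq2[of "w t x" v] mult_right_mono[OF wL[of x] norm_ge_zero[of v]] by simp
      qed
      then show ?thesis
        using differentiable_bound[of UNIV "u t" "\<lambda>x v. w t x \<bullet> v" L' x y] u_x[OF st] by simp
    qed
  qed
qed

text \<open>The slope a = 1 / sqrt (t - s) balances the two terms of
  \<open>initial_time_bound\<close>. The constant depends on the bound of the drift, so it serves
  the continuity of one family at a time.\<close>

lemma bounded_solution_time_modulus:
  fixes b :: "real \<times> 'a::euclidean_space \<Rightarrow> 'a"
  assumes u: "bounded_solution b s u" and b: "\<And>z. norm (b z) \<le> B" and s: "0 \<le> s"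
    and L: "\<And>x y. \<bar>u s x - u s y\<bar> \<le> L * norm (x - y)" and t: "s \<le> t" "t \<le> T"
  shows "\<bar>u t x - u s x\<bar> \<le> (L\<^sup>2 / 4 + exp T * (2 * real DIM('a) + B\<^sup>2)) * sqrt (t - s)"
proof (cases "t = s")
  case False
  have *: "v t x - v s x \<le> (L\<^sup>2 / 4 + exp T * (2 * real DIM('a) + B\<^sup>2)) * sqrt (t - s)"
    if v: "bounded_solution b s v" "\<And>x y. \<bar>v s x - v s y\<bar> \<le> L * norm (x - y)" for v
  proof -
    obtain vt w H M where "parabolic b (\<lambda>t x. 0) s v vt w H" and M: "\<And>t x. s \<le> t \<Longrightarrow> \<bar>v t x\<bar> \<le> M"
      using v unfolding bounded_solution_def by blast
    then interpret parabolic b "\<lambda>t x. 0" s v vt w H by simp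
    define r where "r = sqrt (t - s)"
    define C where "C = exp (T - s) * (2 * real DIM('a) + B\<^sup>2)"
    have r: "0 < r" "t - s = r * r" using t False by (auto simp: r_def)
    have "v t x \<le> v s x + L\<^sup>2 / (4 * (1 / r)) + 1 / r * exp (T - s) * (2 * real DIM('a) + B\<^sup>2) * (t - s)"
      by (rule initial_time_bound[OF b _ _ v(2) _ t]) (use M r in \<open>auto dest: abs_le_D1\<close>)
    also have "\<dots> = v s x + L\<^sup>2 / (4 * (1 / r)) + 1 / r * C * (r * r)" unfolding r(2) by (simp add: C_def mult.assoc)
    also have "\<dots> = v s x + (L\<^sup>2 / 4 + C) * r" using r by (simp add: field_simps)
    also have "\<dots> \<le> v s x + (L\<^sup>2 / 4 + exp T * (2 * real DIM('a) + B\<^sup>2)) * r"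
      unfolding C_def using r s by (intro add_left_mono mult_right_mono) auto
    finally show ?thesis by (simp add: r_def)
  qed
  have "\<bar>- u s x - - u s y\<bar> \<le> L * norm (x - y)" for x y using L[of x y] by linarith
  from *[OF u L] *[OF bounded_solution_uminus[OF u] this] show ?thesis by linarith
qed simp

section \<open>The operators of one bounded drift form a Feller evolution family\<close>

locale solution_family =
  fixes b :: "real \<times> 'a::euclidean_space \<Rightarrow> 'a" and V :: "real \<Rightarrow> real \<Rightarrow> 'a C_infty \<Rightarrow>\<^sub>L 'a C_infty"
  assumes ops: "solution_operators b V" and b_bounded: "bounded (range b)"
begin

lemma solution:
  assumes "0 \<le> s" "C1_compact_support (ev f)"
  obtains u where "bounded_solution b s u" "u s = ev f" "\<And>t. s \<le> t \<Longrightarrow> ev (V t s f) = u t"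
proof -
  obtain u where u: "classical_solution b s (ev f) u" "\<And>t. s \<le> t \<Longrightarrow> ev (V t s f) = u t"
    using ops assms unfolding solution_operators_def by blast
  moreover have "u s = ev f" using u(1) by (auto simp: classical_solution_def)
  ultimately show thesis using that bounded_solution_classical by blast
qed

text \<open>Density in the form in which it is applied: a norm identity or inequality is written as
  nonpositivity of a continuous function of the datum.\<close>

lemma dense_le:
  fixes P :: "'a C_infty \<Rightarrow> real"
  assumes P: "continuous_on UNIV P" and le: "\<And>f. C1_compact_support (ev f) \<Longrightarrow> P f \<le> 0"
  shows "P f \<le> 0"
proof -
  have "closed {f. P f \<le> 0}" by (intro closed_Collect_le P continuous_intros)
  moreover have "f \<in> closure {f. C1_compact_support (ev f)}"
    unfolding closure_approachable
  proof (intro allI impI)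
    fix e :: real assume "0 < e"
    then obtain g where "C1_compact_support (ev g)" "norm (f - g) \<le> e / 2"
      using C1_compact_support_dense[of "e / 2" f] by auto
    then show "\<exists>y\<in>{f. C1_compact_support (ev f)}. dist y f < e"
      using \<open>0 < e\<close> by (intro bexI[of _ g]) (auto simp: dist_norm norm_minus_commute)
  qed
  moreover have "closure {f. C1_compact_support (ev f)} \<subseteq> closure {f. P f \<le> 0}" using le by (intro closure_mono) auto
  ultimately show ?thesis by auto
qed

lemma contraction:
  assumes "0 \<le> s" "s \<le> t"
  shows "norm (V t s f) \<le> norm f"
proof -
  have "norm (V t s f) - norm f \<le> 0"
  proof (rule dense_le[where P = "\<lambda>f. norm (V t s f) - norm f" and f = f])
    show "norm (V t s f) - norm f \<le> 0" if f: "C1_compact_support (ev f)" for f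
    proof -
      obtain u where u: "bounded_solution b s u" "u s = ev f" "\<And>t. s \<le> t \<Longrightarrow> ev (V t s f) = u t"
        using solution[OF assms(1) f] by blast
      have "\<bar>u t x\<bar> \<le> norm f" for x
        by (rule bounded_solution_abs_le[OF u(1) b_bounded _ assms(2)]) (simp add: u(2) abs_ev_le_norm)
      then show ?thesis using norm_C_infty_le[of "V t s f" "norm f"] u(3)[OF assms(2)] by simp
    qed
  qed (intro continuous_intros)
  then show ?thesis by simp
qed

text \<open>An approximant of a nonnegative function need not be nonnegative. It is at least - e /
  2, a bound that the maximum principle propagates, and contractivity costs another e / 2.\<close>

lemma positivity:
  assumes st: "0 \<le> s" "s \<le> t" and f: "\<And>x. 0 \<le> ev f x"
  shows "0 \<le> ev (V t s f) x"
proof (rule field_le_epsilon)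
  fix e :: real assume e: "0 < e"
  obtain g where g: "C1_compact_support (ev g)" "norm (f - g) \<le> e / 2"
    using C1_compact_support_dense[of "e / 2" f] e by auto
  obtain u where u: "bounded_solution b s u" "u s = ev g" "\<And>t. s \<le> t \<Longrightarrow> ev (V t s g) = u t"
    using solution[OF st(1) g(1)] by blast
  have "- (e / 2) \<le> u t x"
  proof (rule bounded_solution_ge[OF u(1) b_bounded _ st(2)])
    show "- (e / 2) \<le> u s x" for x using abs_ev_le_norm[of "f - g" x] g(2) f[of x] by (simp add: u(2))
  qed
  moreover have "norm (V t s (f - g)) \<le> e / 2" using contraction[OF st, of "f - g"] g(2) by simp
  ultimately show "0 \<le> ev (V t s f) x + e"
    using abs_ev_le_norm[of "V t s (f - g)" x] u(3)[OF st(2)] by (simp add: blinfun.diff_right)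
qed

lemma identity:
  assumes "0 \<le> s"
  shows "V s s f = f"
proof -
  have "norm (V s s f - f) \<le> 0"
  proof (rule dense_le[where P = "\<lambda>f. norm (V s s f - f)" and f = f])
    show "norm (V s s f - f) \<le> 0" if "C1_compact_support (ev f)" for f
      using solution[OF assms that] ev_eqI[of "V s s f" f] by (metis norm_zero order_refl right_minus_eq)
  qed (intro continuous_intros)
  then show ?thesis by simp
qed

text \<open>The value \<open>V r s f\<close> need not be an admissible datum of class C^1 with
  compact support. It is approximated by such a \<open>g\<close> at time \<open>r\<close>, and the
  maximum principle compares the old solution, restarted at \<open>r\<close>, with the one issued
  from \<open>g\<close>.\<close>

lemma cocycle:
  assumes "0 \<le> s" "s \<le> r" "r \<le> t"
  shows "V t s f = V t r (V r s f)"
proof -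
  have st: "s \<le> t" and r: "0 \<le> r" using assms by auto
  have "norm (V t s f - V t r (V r s f)) \<le> 0"
  proof (rule dense_le[where P = "\<lambda>f. norm (V t s f - V t r (V r s f))" and f = f])
    fix f :: "'a C_infty" assume "C1_compact_support (ev f)"
    then obtain u where u: "bounded_solution b s u" "u s = ev f" "\<And>t. s \<le> t \<Longrightarrow> ev (V t s f) = u t"
      using solution[OF assms(1)] by blast
    have "norm (V t s f - V t r (V r s f)) \<le> 0 + e" if e: "0 < e" for e
    proof -
      obtain g where g: "C1_compact_support (ev g)" "norm (V r s f - g) \<le> e / 2"
        using C1_compact_support_dense[of "e / 2" "V r s f"] e by auto
      obtain v where v: "bounded_solution b r v" "v r = ev g" "\<And>t. r \<le> t \<Longrightarrow> ev (V t r g) = v t"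
        using solution[OF r g(1)] by blast
      have "\<bar>u t x - v t x\<bar> \<le> e / 2" for x
      proof (rule bounded_solution_abs_le[OF bounded_solution_diff[OF bounded_solution_restrict[OF u(1) assms(2)] v(1)] b_bounded _ assms(3)])
        show "\<bar>u r x - v r x\<bar> \<le> e / 2" for x
          using abs_ev_le_norm[of "V r s f - g" x] g(2) by (simp add: u(3)[OF assms(2)] v(2))
      qed
      then have "norm (V t s f - V t r g) \<le> e / 2" by (intro norm_C_infty_le) (simp add: u(3)[OF st] v(3)[OF assms(3)])
      moreover have "norm (V t r (V r s f - g)) \<le> e / 2" using contraction[OF r assms(3), of "V r s f - g"] g(2) by simp
      then have "norm (V t r (V r s f) - V t r g) \<le> e / 2" by (simp add: blinfun.diff_right)
      ultimately show ?thesis using norm_triangle_ineq4[of "V t s f - V t r g" "V t r (V r s f) - V t r g"] by simp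
    qed
    then show "norm (V t s f - V t r (V r s f)) \<le> 0" by (rule field_le_epsilon)
  qed (intro continuous_intros)
  then show ?thesis by simp
qed

text \<open>For smooth data, a change of the final time is controlled by the Lipschitz constant of
  the solution, and a change of the initial time by the closeness of the operators to the identity,
  through the evolution law and contractivity. Both moduli are square roots.\<close>

lemma joint_continuity:
  "continuous_on {(t, s). 0 \<le> s \<and> s \<le> t} (\<lambda>(t, s). V t s f)"
proof -
  obtain B where B: "\<And>z. norm (b z) \<le> B" using b_bounded by (auto simp: bounded_iff)
  let ?A = "{(t::real, s::real). 0 \<le> s \<and> s \<le> t}"
  have C1: "continuous_on ?A (\<lambda>(t, s). V t s f)" if f: "C1_compact_support (ev f)" for f
    unfolding continuous_on_eq_continuous_within
  proof (intro ballI)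
    fix p0 assume "p0 \<in> ?A"
    then obtain t0 s0 where p0: "p0 = (t0, s0)" and t0: "0 \<le> s0" "s0 \<le> t0" by auto
    obtain L r where L: "0 < L" "\<And>x y. \<bar>ev f x - ev f y\<bar> \<le> L * norm (x - y)"
      and "\<And>x. r < norm x \<Longrightarrow> ev f x = 0"
      by (rule C1_compact_support_Lipschitz[OF f]) (rule that)
    obtain u where u: "bounded_solution b s0 u" "u s0 = ev f" "\<And>t. s0 \<le> t \<Longrightarrow> ev (V t s0 f) = u t"
      using solution[OF t0(1) f] by blast
    have Lu: "\<bar>u s0 x - u s0 y\<bar> \<le> L * norm (x - y)" for x y by (simp add: u(2) L(2))
    obtain L' where L': "\<And>t x y. s0 \<le> t \<Longrightarrow> t \<le> t0 + 1 \<Longrightarrow> \<bar>u t x - u t y\<bar> \<le> L' * norm (x - y)"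
      using bounded_solution_Lipschitz[OF u(1) b_bounded Lu L(1), where T = "t0 + 1"] by blast
    define K where "K L = L\<^sup>2 / 4 + exp (t0 + 1) * (2 * real DIM('a) + B\<^sup>2)" for L
    have K: "0 \<le> K L" for L by (simp add: K_def)
    have start: "norm (V t s f - f) \<le> K L * sqrt (t - s)" if st: "0 \<le> s" "s \<le> t" "t \<le> t0 + 1" for t s
    proof -
      obtain v where v: "bounded_solution b s v" "v s = ev f" "\<And>t. s \<le> t \<Longrightarrow> ev (V t s f) = v t"
        using solution[OF st(1) f] by blast
      have "\<bar>v t x - v s x\<bar> \<le> K L * sqrt (t - s)" for x
        unfolding K_def by (rule bounded_solution_time_modulus[OF v(1) B st(1) _ st(2,3)]) (simp add: v(2) L(2))
      then show ?thesis by (intro norm_C_infty_le) (simp add: v(3)[OF st(2)] v(2)[symmetric])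
    qed
    \<comment> \<open>The solution is restarted at time \<open>t\<close>. Its value there has no
      compact support in general, but it is Lipschitz with a constant uniform in
      \<open>t\<close>.\<close>
    have time1: "norm (V t' s0 f - V t s0 f) \<le> K L' * sqrt (t' - t)" if "s0 \<le> t" "t \<le> t'" "t' \<le> t0 + 1" for t t'
    proof -
      have "\<bar>u t' x - u t x\<bar> \<le> K L' * sqrt (t' - t)" for x
        unfolding K_def
        by (rule bounded_solution_time_modulus[OF bounded_solution_restrict[OF u(1) that(1)] B _ L' that(2,3)])
          (use that t0 in auto)
      then show ?thesis using that by (intro norm_C_infty_le) (simp add: u(3))
    qed
    have time: "norm (V t s0 f - V t0 s0 f) \<le> K L' * sqrt \<bar>t - t0\<bar>" if "s0 \<le> t" "t \<le> t0 + 1" for t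
      using time1[of t t0] time1[of t0 t] t0 that by (cases "t \<le> t0") (simp_all add: norm_minus_commute)
    have bound: "norm (V t s f - V t0 s0 f) \<le> K L * sqrt \<bar>s - s0\<bar> + (K L + K L') * sqrt \<bar>t - t0\<bar>"
      if ts: "0 \<le> s" "s \<le> t" "t \<le> t0 + 1" for t s
    proof (cases "s0 \<le> t")
      case True
      have "norm (V t s f - V t s0 f) \<le> K L * sqrt \<bar>s - s0\<bar>"
      proof (cases "s \<le> s0")
        case s: True
        have "V t s f - V t s0 f = V t s0 (V s0 s f - f)" using cocycle[OF ts(1) s True] by (simp add: blinfun.diff_right)
        then have "norm (V t s f - V t s0 f) \<le> norm (V s0 s f - f)" using contraction[OF t0(1) True] by simp
        also have "\<dots> \<le> K L * sqrt (s0 - s)" by (rule start[OF ts(1) s]) (use t0 in simp)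
        finally show ?thesis using s by simp
      next
        case s: False
        have "V t s0 f - V t s f = V t s (V s s0 f - f)" using cocycle[of s0 s t] t0 s ts by (simp add: blinfun.diff_right)
        then have "norm (V t s f - V t s0 f) \<le> norm (V s s0 f - f)"
          using contraction[OF ts(1,2), of "V s s0 f - f"] by (simp add: norm_minus_commute)
        also have "\<dots> \<le> K L * sqrt (s - s0)" by (rule start) (use s ts t0 in auto)
        finally show ?thesis using s by simp
      qed
      moreover have "0 \<le> K L * sqrt \<bar>t - t0\<bar>" using K by simp
      ultimately show ?thesis
        using time[OF True ts(3)] norm_triangle_ineq[of "V t s f - V t s0 f" "V t s0 f - V t0 s0 f"] by (simp add: distrib_right)
    next
      case False
      \<comment> \<open>Here s \<le> t < s0 \<le> t0, so \<open>V t s0\<close> has no meaning. But t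
        - s is at most |s - s0| and t0 - s0 at most |t - t0|, and both values are compared with
        \<open>f\<close>.\<close>
      have "norm (V t s f - f) \<le> K L * sqrt (t - s)" "norm (V t0 s0 f - f) \<le> K L * sqrt (t0 - s0)"
        using start[OF ts] start[OF t0] by auto
      moreover have "K L * sqrt (t - s) \<le> K L * sqrt \<bar>s - s0\<bar>" "K L * sqrt (t0 - s0) \<le> K L * sqrt \<bar>t - t0\<bar>"
        using K False ts t0 by (auto intro!: mult_left_mono)
      moreover have "0 \<le> K L' * sqrt \<bar>t - t0\<bar>" using K by simp
      ultimately show ?thesis using norm_triangle_ineq4[of "V t s f - f" "V t0 s0 f - f"] by (simp add: distrib_right)
    qed
    have "((\<lambda>p. (case p of (t, s) \<Rightarrow> V t s f) - V t0 s0 f) \<longlongrightarrow> 0) (at (t0, s0) within ?A)"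
    proof (rule Lim_null_comparison)
      have "((\<lambda>p::real \<times> real. fst p) \<longlongrightarrow> t0) (at (t0, s0) within ?A)" by (rule tendsto_eq_intros tendsto_ident_at | simp)+
      then have "\<forall>\<^sub>F p in at (t0, s0) within ?A. fst p < t0 + 1" by (rule order_tendstoD) simp
      moreover have "\<forall>\<^sub>F p in at (t0, s0) within ?A. p \<in> ?A" by (simp add: eventually_at_topological) blast
      ultimately show "\<forall>\<^sub>F p in at (t0, s0) within ?A. norm ((case p of (t, s) \<Rightarrow> V t s f) - V t0 s0 f)
          \<le> K L * sqrt \<bar>snd p - s0\<bar> + (K L + K L') * sqrt \<bar>fst p - t0\<bar>"
        by eventually_elim (use bound in \<open>auto simp: split_def\<close>)
    next
      have "((\<lambda>p::real \<times> real. K L * sqrt \<bar>snd p - s0\<bar> + (K L + K L') * sqrt \<bar>fst p - t0\<bar>)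
        \<longlongrightarrow> K L * sqrt \<bar>snd (t0, s0) - s0\<bar> + (K L + K L') * sqrt \<bar>fst (t0, s0) - t0\<bar>) (at (t0, s0) within ?A)"
        by (intro tendsto_intros)
      then show "((\<lambda>p::real \<times> real. K L * sqrt \<bar>snd p - s0\<bar> + (K L + K L') * sqrt \<bar>fst p - t0\<bar>) \<longlongrightarrow> 0) (at (t0, s0) within ?A)"
        by simp
    qed
    then show "continuous (at p0 within ?A) (\<lambda>(t, s). V t s f)"
      by (simp add: continuous_within p0 Lim_null[of "\<lambda>(t, s). V t s f" "V t0 s0 f"])
  qed
  have "\<exists>g. C1_compact_support (ev g) \<and> norm (f - g) \<le> inverse (real (Suc k))" for k
    using C1_compact_support_dense[of "inverse (real (Suc k))" f] by auto
  then obtain g where g: "\<And>k. C1_compact_support (ev (g k))" "\<And>k. norm (f - g k) \<le> inverse (real (Suc k))" by metis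
  \<comment> \<open>Contractivity makes the approximation by smooth data uniform over all pairs of
    times.\<close>
  have "uniform_limit ?A (\<lambda>k (t, s). V t s (g k)) (\<lambda>(t, s). V t s f) sequentially"
  proof (rule uniform_limitI)
    fix e :: real assume "0 < e"
    then have "\<forall>\<^sub>F k in sequentially. inverse (real (Suc k)) < e"
      by (intro order_tendstoD(2)[OF LIMSEQ_inverse_real_of_nat])
    then show "\<forall>\<^sub>F k in sequentially. \<forall>p\<in>?A. dist (case p of (t, s) \<Rightarrow> V t s (g k)) (case p of (t, s) \<Rightarrow> V t s f) < e"
    proof eventually_elim
      case (elim k)
      have "norm (V t s (f - g k)) < e" if "0 \<le> s" "s \<le> t" for t s
        using contraction[OF that, of "f - g k"] g(2)[of k] elim by linarith
      then show ?case by (auto simp: dist_norm blinfun.diff_right norm_minus_commute)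
    qed
  qed
  then show ?thesis
    by (rule uniform_limit_theorem[rotated]) (auto intro!: always_eventually C1 g)
qed

end

section \<open>Convergence of the families and passage to the limit\<close>

lemma uniformly_Cauchy_C1:
  fixes b :: "real \<times> 'a::euclidean_space \<Rightarrow> 'a" and f :: "'a C_infty"
  assumes \<delta>: "0 < \<delta>" and q: "2 < q" "real DIM('a) < q" "sqrt \<delta> * q / 2 < 1"
    and b: "b \<in> form_bounded \<delta> g" and bn: "bn \<in> regularizing_sequences \<delta> b"
    and fam: "\<And>n. solution_family (bn n) (V n)"
    and T: "0 < T" and f: "C1_compact_support (ev f)" and \<epsilon>: "0 < \<epsilon>"
  shows "\<exists>N. \<forall>n\<ge>N. \<forall>m\<ge>N. \<forall>t s. 0 \<le> s \<longrightarrow> s \<le> t \<longrightarrow> t \<le> T \<longrightarrow> norm (V n t s f - V m t s f) \<le> \<epsilon>"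
proof -
  have bT: "(\<forall>K. compact K \<longrightarrow> (\<lambda>n. \<integral>\<^sup>+z\<in>{0..T} \<times> K. ennreal ((norm (bn n z - b z))\<^sup>2) \<partial>lborel) \<longlonglongrightarrow> 0) \<and>
      (\<exists>gn :: nat \<Rightarrow> real \<Rightarrow> real. (\<forall>n. locally_integrable (gn n) \<and> (\<forall>\<tau>. 0 \<le> gn n \<tau>)) \<and>
        (SUP n. \<integral>\<^sup>+\<tau>\<in>{0..T}. ennreal (gn n \<tau>) \<partial>lborel) < \<infinity> \<and> (\<forall>n. form_inequality T (bn n) \<delta> (gn n)))"
    using bn T unfolding regularizing_sequences_def mem_Collect_eq by blast
  then obtain gn :: "nat \<Rightarrow> real \<Rightarrow> real" where gn: "\<And>n. locally_integrable (gn n)" "\<And>n \<tau>. 0 \<le> gn n \<tau>"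
    "(SUP n. \<integral>\<^sup>+\<tau>\<in>{0..T}. ennreal (gn n \<tau>) \<partial>lborel) < \<infinity>" "\<And>n. form_inequality T (bn n) \<delta> (gn n)"
    by blast
  obtain cg where cg: "(SUP n. \<integral>\<^sup>+\<tau>\<in>{0..T}. ennreal (gn n \<tau>) \<partial>lborel) = ennreal cg" "0 \<le> cg"
    using gn(3) by (cases "SUP n. \<integral>\<^sup>+\<tau>\<in>{0..T}. ennreal (gn n \<tau>) \<partial>lborel") auto
  have gi: "set_integrable lborel {0..T} (gn n)" for n using gn(1) unfolding locally_integrable_def by simp
  have gle: "integral {0..T} (gn n) \<le> cg" for n
  proof -
    have "ennreal (integral {0..T} (gn n)) = ennreal (LINT t:{0..T}|lborel. gn n t)"
      using set_borel_integral_eq_integral(2)[OF gi] by simp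
    also have "\<dots> = (\<integral>\<^sup>+\<tau>. ennreal (indicator {0..T} \<tau> *\<^sub>R gn n \<tau>) \<partial>lborel)"
      unfolding set_lebesgue_integral_def
      by (rule nn_integral_eq_integral[symmetric]) (use gi gn(2) in \<open>auto simp: set_integrable_def\<close>)
    also have "\<dots> = (\<integral>\<^sup>+\<tau>\<in>{0..T}. ennreal (gn n \<tau>) \<partial>lborel)" by (intro nn_integral_cong) (simp add: indicator_def)
    also have "\<dots> \<le> ennreal cg" unfolding cg(1)[symmetric] by (rule SUP_upper) simp
    finally show ?thesis using cg(2) by (simp add: ennreal_le_iff)
  qed
  have bb: "smooth (bn n)" "bounded (range (bn n))" for n
    using bn unfolding regularizing_sequences_def by auto
  have bc: "continuous_on UNIV (bn n)" for n
  proof -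
    have "foldr dderiv [] (bn n) differentiable (at z)" for z
      using bb(1)[of n] unfolding smooth_def by (metis empty_set empty_subsetI)
    then show ?thesis
      by (auto simp: continuous_on_eq_continuous_at dest!: differentiable_imp_continuous_within)
  qed
  obtain L r where L: "0 < L" "\<And>x y. \<bar>ev f x - ev f y\<bar> \<le> L * norm (x - y)" "\<And>x. r < norm x \<Longrightarrow> ev f x = 0"
    by (rule C1_compact_support_Lipschitz[OF f]) (rule that)
  interpret approximation \<delta> q T cg bn gn b "ev f" "norm f" L r
  proof
    show "b \<in> borel_measurable borel" using b unfolding form_bounded_def by blast
    show "(\<lambda>n. \<integral>\<^sup>+z\<in>{0..T} \<times> cball 0 R. ennreal ((norm (bn n z - b z))\<^sup>2) \<partial>lborel) \<longlonglongrightarrow> 0" for R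
      using bT compact_cball by blast
  qed (fact T \<delta> q gn gi gle bb bc L abs_ev_le_norm)+
  obtain N where N: "\<And>n m s u w v z t x. N \<le> n \<Longrightarrow> N \<le> m \<Longrightarrow> solves n s u w \<Longrightarrow> solves m s v z \<Longrightarrow>
    s \<le> t \<Longrightarrow> t \<le> T \<Longrightarrow> \<bar>u t x - v t x\<bar> \<le> \<epsilon>"
    by (rule uniformly_Cauchy[OF \<epsilon>]) (rule that)
  have ex: "\<exists>u w. solves n s u w \<and> (\<forall>t\<ge>s. ev (V n t s f) = u t)" if s: "0 \<le> s" for n s
  proof -
    interpret fam: solution_family "bn n" "V n" by (rule fam)
    obtain u where u: "bounded_solution (bn n) s u" "u s = ev f" "\<And>t. s \<le> t \<Longrightarrow> ev (V n t s f) = u t"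
      by (rule fam.solution[OF s f]) (rule that)
    \<comment> \<open>This is the sup bound required by \<open>solves\<close>, valid for all later
      times.\<close>
    have "\<bar>u t x\<bar> \<le> norm f" if "s \<le> t" for t x
      using abs_ev_le_norm[of "V n t s f" x] fam.contraction[OF s that, of f] u(3)[OF that] by simp
    then show ?thesis using u s unfolding bounded_solution_def solves_def by blast
  qed
  show ?thesis
  proof (intro exI[of _ N] allI impI)
    fix n m t s assume h: "N \<le> n" "N \<le> m" "0 \<le> s" "s \<le> t" "t \<le> T"
    obtain u w v z where u: "solves n s u w" "\<And>t. s \<le> t \<Longrightarrow> ev (V n t s f) = u t"
      and v: "solves m s v z" "\<And>t. s \<le> t \<Longrightarrow> ev (V m t s f) = v t" using ex[OF h(3)] by metis
    show "norm (V n t s f - V m t s f) \<le> \<epsilon>"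
      using N[OF h(1,2) u(1) v(1) h(4,5)] by (intro norm_C_infty_le) (simp add: u(2)[OF h(4)] v(2)[OF h(4)])
  qed
qed

lemma uniformly_Cauchy_all:
  fixes V :: "nat \<Rightarrow> real \<Rightarrow> real \<Rightarrow> 'a::euclidean_space C_infty \<Rightarrow>\<^sub>L 'a C_infty"
  assumes fam: "\<And>n. solution_family (bn n) (V n)"
    and C1: "\<And>f \<epsilon>. C1_compact_support (ev f) \<Longrightarrow> 0 < \<epsilon> \<Longrightarrow>
      \<exists>N. \<forall>n\<ge>N. \<forall>m\<ge>N. \<forall>t s. 0 \<le> s \<longrightarrow> s \<le> t \<longrightarrow> t \<le> T \<longrightarrow> norm (V n t s f - V m t s f) \<le> \<epsilon>"
  shows "uniformly_Cauchy_on {(t, s). 0 \<le> s \<and> s \<le> t \<and> t \<le> T} (\<lambda>n (t, s). V n t s f)"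
proof (rule uniformly_Cauchy_onI)
  fix e :: real assume e: "0 < e"
  obtain g where g: "C1_compact_support (ev g)" "norm (f - g) \<le> e / 4"
    using C1_compact_support_dense[of "e / 4" f] e by auto
  obtain N where N: "\<And>n m t s. N \<le> n \<Longrightarrow> N \<le> m \<Longrightarrow> 0 \<le> s \<Longrightarrow> s \<le> t \<Longrightarrow> t \<le> T \<Longrightarrow> norm (V n t s g - V m t s g) \<le> e / 4"
    using C1[OF g(1) divide_pos_pos[OF e]] by (meson zero_less_numeral)
  have "norm (V n t s f - V m t s f) < e" if h: "N \<le> n" "N \<le> m" "0 \<le> s" "s \<le> t" "t \<le> T" for n m t s
  proof -
    have "norm (V n t s f - V n t s g) \<le> e / 4" for n
      using solution_family.contraction[OF fam h(3,4), of n "f - g"] g(2) by (simp add: blinfun.diff_right)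
    from this[of n] this[of m] N[OF h] show ?thesis
      using norm_triangle_ineq[of "V n t s f - V n t s g" "V n t s g - V m t s g"]
        norm_triangle_ineq4[of "V n t s f - V m t s g" "V m t s f - V m t s g"] e by simp
  qed
  then show "\<exists>N. \<forall>p\<in>{(t, s). 0 \<le> s \<and> s \<le> t \<and> t \<le> T}. \<forall>m\<ge>N. \<forall>n\<ge>N.
      dist (case p of (t, s) \<Rightarrow> V m t s f) (case p of (t, s) \<Rightarrow> V n t s f) < e"
    by (intro exI[of _ N]) (auto simp: dist_norm)
qed

theorem solution_family_limit:
  fixes V :: "nat \<Rightarrow> real \<Rightarrow> real \<Rightarrow> 'a::euclidean_space C_infty \<Rightarrow>\<^sub>L 'a C_infty"
  assumes fam: "\<And>n. solution_family (bn n) (V n)"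
    and Cauchy: "\<And>T f. 0 < T \<Longrightarrow> uniformly_Cauchy_on {(t, s). 0 \<le> s \<and> s \<le> t \<and> t \<le> T} (\<lambda>n (t, s). V n t s f)"
  obtains U where "\<And>T f. 0 < T \<Longrightarrow> uniform_limit {(t, s). 0 \<le> s \<and> s \<le> t \<and> t \<le> T} (\<lambda>n (t, s). V n t s f) (\<lambda>(t, s). blinfun_apply (U t s) f) sequentially"
    and "\<And>s t f. 0 \<le> s \<Longrightarrow> s \<le> t \<Longrightarrow> (\<lambda>n. V n t s f) \<longlonglongrightarrow> blinfun_apply (U t s) f"
    and "feller_evolution_family U"
proof -
  interpret fam: solution_family "bn n" "V n" for n by (rule fam)
  let ?A = "\<lambda>T. {(t::real, s::real). 0 \<le> s \<and> s \<le> t \<and> t \<le> T}"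
  define l where "l t s f = lim (\<lambda>n. V n t s f)" for t s f
  have lim: "(\<lambda>n. V n t s f) \<longlonglongrightarrow> l t s f" and ulim: "uniform_limit (?A (t + 1)) (\<lambda>n (t, s). V n t s f) (\<lambda>(t, s). l t s f) sequentially"
    if "0 \<le> s" "s \<le> t" for t s f
  proof -
    \<comment> \<open>The Cauchy hypothesis asks for a positive horizon, and \<open>t\<close> may be
      0; hence t + 1.\<close>
    have "uniformly_convergent_on (?A (t + 1)) (\<lambda>n (t, s). V n t s f)"
      using Cauchy[of "t + 1" f] that by (simp add: uniformly_convergent_eq_Cauchy)
    then have *: "uniform_limit (?A (t + 1)) (\<lambda>n (t, s). V n t s f) (\<lambda>p. lim (\<lambda>n. case p of (t, s) \<Rightarrow> V n t s f)) sequentially"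
      by (simp add: uniformly_convergent_uniform_limit_iff)
    also have "(\<lambda>p. lim (\<lambda>n. case p of (t, s) \<Rightarrow> V n t s f)) = (\<lambda>(t, s). l t s f)" by (auto simp: l_def fun_eq_iff)
    finally show u: "uniform_limit (?A (t + 1)) (\<lambda>n (t, s). V n t s f) (\<lambda>(t, s). l t s f) sequentially" .
    show "(\<lambda>n. V n t s f) \<longlonglongrightarrow> l t s f"
      using tendsto_uniform_limitI[OF u, of "(t, s)"] that by simp
  qed
  have bl: "bounded_linear (l t s)" if "0 \<le> s" "s \<le> t" for t s
  proof (rule bounded_linear_intro[where K = 1])
    note lim = lim[OF that]
    show "l t s (f + g) = l t s f + l t s g" for f g
      using LIMSEQ_unique[OF lim[of "f + g"]] tendsto_add[OF lim[of f] lim[of g]] by (simp add: blinfun.add_right)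
    show "l t s (c *\<^sub>R f) = c *\<^sub>R l t s f" for c f
      using LIMSEQ_unique[OF lim[of "c *\<^sub>R f"]] tendsto_scaleR[OF tendsto_const lim[of f]] by (simp add: blinfun.scaleR_right)
    show "norm (l t s f) \<le> norm f * 1" for f
      using LIMSEQ_le_const2[OF tendsto_norm[OF lim[of f]], of "norm f"] fam.contraction[OF that] by auto
  qed
  \<comment> \<open>Meaningful for 0 \<le> s \<le> t only; at other pairs of times
    \<open>Blinfun\<close> is applied to a function about which nothing is known.\<close>
  define U where "U t s = Blinfun (l t s)" for t s
  have U: "blinfun_apply (U t s) = l t s" if "0 \<le> s" "s \<le> t" for t s
    unfolding U_def by (rule bounded_linear_Blinfun_apply[OF bl[OF that]])
  have limU: "(\<lambda>n. V n t s f) \<longlonglongrightarrow> U t s f" if "0 \<le> s" "s \<le> t" for t s f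
    using lim[OF that] U[OF that] by simp
  have ulimU: "uniform_limit (?A T) (\<lambda>n (t, s). V n t s f) (\<lambda>(t, s). U t s f) sequentially" if "0 < T" for T f
  proof -
    have "uniform_limit (?A T) (\<lambda>n (t, s). V n t s f) (\<lambda>(t, s). l t s f) sequentially"
      by (rule uniform_limit_on_subset[OF ulim[of 0 T]]) (use that in auto)
    then show ?thesis by (rule uniform_limit_cong'[THEN iffD1, rotated -1]) (auto simp: U)
  qed
  show thesis
  proof (rule that[OF ulimU limU])
    show "feller_evolution_family U"
      unfolding feller_evolution_family_def
    proof (intro conjI allI impI; (elim conjE)?)
      fix s :: real assume "0 \<le> s"
      then have "U s s f = f" for f
        using LIMSEQ_unique[OF limU[of s s f]] fam.identity by simp
      then show "U s s = id_blinfun" by (intro blinfun_eqI) simp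
    next
      fix s r t :: real assume h: "0 \<le> s" "s \<le> r" "r \<le> t"
      then have st: "s \<le> t" and r: "0 \<le> r" by auto
      have "U t s f = U t r (U r s f)" for f
      proof (rule LIMSEQ_unique[OF limU[OF h(1) st]])
        \<comment> \<open>The operator and its argument both vary with \<open>n\<close>; uniform
          contractivity allows the argument to be replaced by its limit.\<close>
        have "(\<lambda>n. V n t r (V n r s f) - V n t r (U r s f)) \<longlonglongrightarrow> 0"
        proof (rule Lim_null_comparison)
          show "\<forall>\<^sub>F n in sequentially. norm (V n t r (V n r s f) - V n t r (U r s f)) \<le> norm (V n r s f - U r s f)"
            using fam.contraction[OF r h(3)] by (intro always_eventually allI) (simp flip: blinfun.diff_right)
          show "(\<lambda>n. norm (V n r s f - U r s f)) \<longlonglongrightarrow> 0"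
            using limU[OF h(1,2), of f] by (simp add: LIM_zero_iff tendsto_norm_zero)
        qed
        from tendsto_add[OF this limU[OF r h(3), of "U r s f"]]
        show "(\<lambda>n. V n t s f) \<longlonglongrightarrow> U t r (U r s f)" using fam.cocycle[OF h] by simp
      qed
      then show "U t s = U t r o\<^sub>L U r s" by (intro blinfun_eqI) simp
    next
      fix f :: "'a C_infty"
      show "continuous_on {(t, s). 0 \<le> s \<and> s \<le> t} (\<lambda>(t, s). U t s f)"
        unfolding continuous_on_eq_continuous_within
      proof (intro ballI)
        fix p :: "real \<times> real" assume p: "p \<in> {(t, s). 0 \<le> s \<and> s \<le> t}"
        \<comment> \<open>The times below \<open>T\<close> form a neighbourhood of \<open>p\<close>,
          so the uniform limit on a bounded horizon decides continuity at \<open>p\<close>.\<close>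
        define T where "T = fst p + 1"
        have T: "0 < T" using p by (auto simp: T_def)
        have "continuous_on (?A T) (\<lambda>(t, s). V n t s f)" for n
          by (rule continuous_on_subset[OF fam.joint_continuity]) auto
        then have "continuous_on (?A T) (\<lambda>(t, s). U t s f)"
          by (intro uniform_limit_theorem[OF _ ulimU[OF T]]) auto
        moreover have "p \<in> ?A T" using p by (auto simp: T_def)
        ultimately have "continuous (at p within ?A T) (\<lambda>(t, s). U t s f)"
          by (auto simp only: continuous_on_eq_continuous_within)
        moreover have "at p within {(t, s). 0 \<le> s \<and> s \<le> t} = at p within ?A T"
        proof (rule at_within_nhd)
          show "open ({..<T} \<times> UNIV)" by (intro open_Times) auto
          show "p \<in> {..<T} \<times> UNIV" by (cases p) (simp add: T_def)
        qed auto
        ultimately show "continuous (at p within {(t, s). 0 \<le> s \<and> s \<le> t}) (\<lambda>(t, s). U t s f)" by simp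
      qed
    next
      fix s t :: real and f :: "'a C_infty" and x assume h: "0 \<le> s" "s \<le> t" and f: "\<forall>x. 0 \<le> ev f x"
      have "0 \<le> ev (V n t s f) x" for n by (rule fam.positivity[OF h]) (use f in auto)
      moreover have "(\<lambda>n. ev (V n t s f) x) \<longlonglongrightarrow> ev (U t s f) x"
      proof (rule LIM_zero_cancel, rule Lim_null_comparison)
        show "\<forall>\<^sub>F n in sequentially. norm (ev (V n t s f) x - ev (U t s f) x) \<le> norm (V n t s f - U t s f)"
          using abs_ev_le_norm[of "V _ t s f - U t s f" x] by (intro always_eventually allI) simp
        show "(\<lambda>n. norm (V n t s f - U t s f)) \<longlonglongrightarrow> 0"
          using limU[OF h, of f] by (simp add: LIM_zero_iff tendsto_norm_zero)
      qed
      ultimately show "0 \<le> ev (U t s f) x" by (intro LIMSEQ_le_const) auto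
    next
      fix s t :: real and f :: "'a C_infty" assume h: "0 \<le> s" "s \<le> t"
      show "norm (U t s f) \<le> norm f"
        using LIMSEQ_le_const2[OF tendsto_norm[OF limU[OF h, of f]], of "norm f"] fam.contraction[OF h] by auto
    qed
  qed
qed

text \<open>Both regimes give sqrt \<delta> < 2 / q. For d = 3, 4 the inequality (q - 2)^2 \<ge> 0
  yields sqrt (q - 1) \<le> q / 2, so the bracket is at most 1; for d \<ge> 5 the quotient (q - 1) /
  (q - 2) is at most 2.\<close>

lemma form_bound_less:
  fixes q \<delta> :: real and d :: nat
  assumes "3 \<le> d" "real d < q"
    and "d \<in> {3, 4} \<Longrightarrow> sqrt \<delta> < (sqrt (q - 1) - (q - 2) / 2) * (2 / q)"
    and "5 \<le> d \<Longrightarrow> \<exists>\<mu>>0. \<mu> < 1 \<and> sqrt \<delta> < (1 - \<mu>) * ((q - 1) / (q - 2)) * (1 / q)"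
  shows "sqrt \<delta> * q / 2 < 1"
proof -
  have q: "3 < q" using assms(1,2) by linarith
  have "sqrt \<delta> < 2 / q"
  proof (cases "5 \<le> d")
    case True
    then obtain \<mu> where \<mu>: "0 < \<mu>" "\<mu> < 1" "sqrt \<delta> < (1 - \<mu>) * ((q - 1) / (q - 2)) * (1 / q)" using assms(4) by blast
    have "(1 - \<mu>) * ((q - 1) / (q - 2)) \<le> 1 * 2" using \<mu> q by (intro mult_mono) (auto simp: field_simps)
    then have "(1 - \<mu>) * ((q - 1) / (q - 2)) * (1 / q) \<le> 1 * 2 * (1 / q)" using q by (intro mult_right_mono) auto
    then show ?thesis using \<mu> by simp
  next
    case False
    then have "d = 3 \<or> d = 4" using assms(1) by linarith
    then have s: "sqrt \<delta> < (sqrt (q - 1) - (q - 2) / 2) * (2 / q)" using assms(3) by blast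
    have "0 \<le> (q - 2)\<^sup>2" by simp
    then have "sqrt (q - 1) \<le> q / 2" using q by (intro real_le_lsqrt) (auto simp: power2_eq_square algebra_simps)
    then have "(sqrt (q - 1) - (q - 2) / 2) * (2 / q) \<le> 1 * (2 / q)" using q by (intro mult_right_mono) (auto simp: field_simps)
    then show ?thesis using s by simp
  qed
  then show ?thesis using q by (simp add: field_simps)
qed

theorem theorem2:
  fixes b :: "real \<times> 'a::euclidean_space \<Rightarrow> 'a"
    and bseq :: "nat \<Rightarrow> real \<times> 'a \<Rightarrow> 'a"
    and g :: "real \<Rightarrow> real"
    and \<delta> q :: real
    and Useq :: "nat \<Rightarrow> real \<Rightarrow> real \<Rightarrow> 'a C_infty \<Rightarrow>\<^sub>L 'a C_infty"
  assumes "DIM('a) \<ge> 3"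
    and "\<delta> > 0"
    and "q > real DIM('a)"
    and "b \<in> form_bounded \<delta> g"
    and "bseq \<in> regularizing_sequences \<delta> b"
    and "DIM('a) \<in> {3, 4} \<Longrightarrow>
      (\<exists>\<epsilon>::real. q = real DIM('a) + \<epsilon> \<and> 0 < \<epsilon> \<and> \<epsilon> \<le> 2 * (sqrt 2 - 1)) \<and>
      sqrt \<delta> < (sqrt (q - 1) - (q - 2) / 2) * (2 / q)"
    and "DIM('a) \<ge> 5 \<Longrightarrow>
      (\<exists>\<epsilon>::real. q = real DIM('a) + \<epsilon> \<and> 0 < \<epsilon> \<and> \<epsilon> \<le> 1) \<and>
      (\<exists>\<mu>. 0 < \<mu> \<and> \<mu> < 1 \<and>
        16 * \<mu> > (1 - \<mu>) ^ 4 * ((q - 1)\<^sup>2 / (q - 2) ^ 4) \<and>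
        sqrt \<delta> < (1 - \<mu>) * ((q - 1) / (q - 2)) * (1 / q))"
    and "\<And>n. solution_operators (bseq n) (Useq n)"
  shows "\<exists>U :: real \<Rightarrow> real \<Rightarrow> 'a C_infty \<Rightarrow>\<^sub>L 'a C_infty.
    (\<forall>f s t. 0 \<le> s \<and> s \<le> t \<longrightarrow>
      (\<lambda>n. blinfun_apply (Useq n t s) f) \<longlonglongrightarrow> blinfun_apply (U t s) f) \<and>
    (\<forall>f. uniform_limit {(t, s). 0 \<le> s \<and> s < t \<and> t \<le> 1}
      (\<lambda>n (t, s). blinfun_apply (Useq n t s) f) (\<lambda>(t, s). blinfun_apply (U t s) f) sequentially) \<and>
    feller_evolution_family U"
proof -
  have q: "3 < q" using assms(1,3) by linarith
  have sq: "sqrt \<delta> * q / 2 < 1"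
  proof (rule form_bound_less[OF assms(1,3)])
    show "sqrt \<delta> < (sqrt (q - 1) - (q - 2) / 2) * (2 / q)" if "DIM('a) \<in> {3, 4}"
      using assms(6)[OF that] by blast
    show "\<exists>\<mu>>0. \<mu> < 1 \<and> sqrt \<delta> < (1 - \<mu>) * ((q - 1) / (q - 2)) * (1 / q)" if "5 \<le> DIM('a)"
      using assms(7)[OF that] by blast
  qed
  have fam: "solution_family (bseq n) (Useq n)" for n
    using assms(5,8) by unfold_locales (auto simp: regularizing_sequences_def)
  obtain U where U: "\<And>T f. 0 < T \<Longrightarrow> uniform_limit {(t, s). 0 \<le> s \<and> s \<le> t \<and> t \<le> T}
      (\<lambda>n (t, s). Useq n t s f) (\<lambda>(t, s). blinfun_apply (U t s) f) sequentially"
    "\<And>s t f. 0 \<le> s \<Longrightarrow> s \<le> t \<Longrightarrow> (\<lambda>n. Useq n t s f) \<longlonglongrightarrow> blinfun_apply (U t s) f"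
    "feller_evolution_family U"
  proof (rule solution_family_limit[OF fam])
    show "uniformly_Cauchy_on {(t, s). 0 \<le> s \<and> s \<le> t \<and> t \<le> T} (\<lambda>n (t, s). Useq n t s f)" if "0 < T" for T f
      by (rule uniformly_Cauchy_all[OF fam uniformly_Cauchy_C1[OF assms(2) _ assms(3) sq assms(4,5) fam that]])
        (use q in auto)
  qed (rule that)
  have "uniform_limit {(t, s). 0 \<le> s \<and> s < t \<and> t \<le> 1} (\<lambda>n (t, s). Useq n t s f) (\<lambda>(t, s). U t s f) sequentially" for f
    by (rule uniform_limit_on_subset[OF U(1)[OF zero_less_one]]) auto
  then show ?thesis using U(2,3) by blast
qed

end
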